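(* Let $K$ be a formally real differential field, $\mathscr U$ a saturated model of CODF of cardinality $\kappa>|K|$ containing $K$, and let $L\subseteq\mathscr U$ be a differential field extension of $K$ such that $L/K$ is strongly normal. Then $\mathrm{Gal}(L/K)$ is isomorphic to a group $G$ which is definable (with parameters) in the field $C_{\mathscr U}$.
   Context: Differential fields have characteristic $0$ and one derivation $'$. For a differential field $F$, $C_F=\{f\in F:f'=0\}$. For a subset $A$ of a differential field, $\langle A\rangle$ denotes the differential subfield generated by $A$. CODF is the model completion of the theory of ordered differential fields; models of CODF are real closed and $M(i)$ is differentially closed for $M\models$ CODF; for $\mathscr U$ as in the claim, $\mathscr U(i)$ is a saturated differentially closed field and $C_{\mathscr U(i)}=C_{\mathscr U}(i)$. For differential fields $E\subseteq F$, $\mathrm{gal}(F/E)$ is the group of differential field automorphisms of $F$ fixing $E$ pointwise, and $\mathrm{Gal}(L/K):=\mathrm{gal}(\langle L,C_{\mathscr U}\rangle/\langle K,C_{\mathscr U}\rangle)$. An extension $L/K$ with $L\subseteq\mathscr U(i)$ is strongly normal iff (1) $C_K=C_L$ and this field is real closed; (2) $L$ is finitely generated over $K$ as a differential field; (3) for every $\sigma\in\mathrm{gal}(\mathscr U(i)/K)$, $\langle L,C_{\mathscr U}(i)\rangle=\langle\sigma(L),C_{\mathscr U}(i)\rangle$. Definability in $C_{\mathscr U}$ refers to the pure field $C_{\mathscr U}$ (a real closed field). *)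

theory Defs
  imports
    "HOL-Library.Equipollence"
    "HOL-Computational_Algebra.Polynomial"
    "HOL-Algebra.Group"
begin

section \<open>First-order logic\<close>

text \<open>A language assigns an arity to each of its symbols; \<^term>\<open>None\<close> marks symbols that do not
  belong to the language.\<close>

record ('f, 'p) language =
  farity :: "'f \<Rightarrow> nat option"
  rarity :: "'p \<Rightarrow> nat option"

datatype 'f fterm = TVar nat | TFun 'f "'f fterm list"

datatype ('f, 'p) form =
    FEq "'f fterm" "'f fterm"
  | FRel 'p "'f fterm list"
  | FNot "('f, 'p) form"
  | FAnd "('f, 'p) form" "('f, 'p) form"
  | FEx nat "('f, 'p) form"

definition FImp :: "('f, 'p) form \<Rightarrow> ('f, 'p) form \<Rightarrow> ('f, 'p) form" where
  "FImp \<phi> \<psi> = FNot (FAnd \<phi> (FNot \<psi>))"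

definition FOr :: "('f, 'p) form \<Rightarrow> ('f, 'p) form \<Rightarrow> ('f, 'p) form" where
  "FOr \<phi> \<psi> = FNot (FAnd (FNot \<phi>) (FNot \<psi>))"

definition FAll :: "nat \<Rightarrow> ('f, 'p) form \<Rightarrow> ('f, 'p) form" where
  "FAll n \<phi> = FNot (FEx n (FNot \<phi>))"

primrec wf_term :: "('f, 'p) language \<Rightarrow> 'f fterm \<Rightarrow> bool" where
  "wf_term \<L> (TVar n) = True"
| "wf_term \<L> (TFun f ts) = (farity \<L> f = Some (length ts) \<and> list_all id (map (wf_term \<L>) ts))"

primrec wf_form :: "('f, 'p) language \<Rightarrow> ('f, 'p) form \<Rightarrow> bool" where
  "wf_form \<L> (FEq s t) = (wf_term \<L> s \<and> wf_term \<L> t)"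
| "wf_form \<L> (FRel p ts) = (rarity \<L> p = Some (length ts) \<and> list_all (wf_term \<L>) ts)"
| "wf_form \<L> (FNot \<phi>) = wf_form \<L> \<phi>"
| "wf_form \<L> (FAnd \<phi> \<psi>) = (wf_form \<L> \<phi> \<and> wf_form \<L> \<psi>)"
| "wf_form \<L> (FEx n \<phi>) = wf_form \<L> \<phi>"

primrec fv_term :: "'f fterm \<Rightarrow> nat set" where
  "fv_term (TVar n) = {n}"
| "fv_term (TFun f ts) = \<Union> (set (map fv_term ts))"

primrec fv :: "('f, 'p) form \<Rightarrow> nat set" where
  "fv (FEq s t) = fv_term s \<union> fv_term t"
| "fv (FRel p ts) = \<Union> (set (map fv_term ts))"
| "fv (FNot \<phi>) = fv \<phi>"
| "fv (FAnd \<phi> \<psi>) = fv \<phi> \<union> fv \<psi>"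
| "fv (FEx n \<phi>) = fv \<phi> - {n}"

definition sentences :: "('f, 'p) language \<Rightarrow> ('f, 'p) form set" where
  "sentences \<L> = {\<phi>. wf_form \<L> \<phi> \<and> fv \<phi> = {}}"

record ('f, 'p, 'm) struct =
  dom :: "'m set"
  fint :: "'f \<Rightarrow> 'm list \<Rightarrow> 'm"
  rint :: "'p \<Rightarrow> 'm list \<Rightarrow> bool"

hide_const (open) Map.dom

definition is_struct :: "('f, 'p) language \<Rightarrow> ('f, 'p, 'm) struct \<Rightarrow> bool" where
  "is_struct \<L> M \<longleftrightarrow> dom M \<noteq> {} \<and>
    (\<forall>f xs. farity \<L> f = Some (length xs) \<and> set xs \<subseteq> dom M \<longrightarrow> fint M f xs \<in> dom M)"

primrec teval :: "('f, 'p, 'm) struct \<Rightarrow> (nat \<Rightarrow> 'm) \<Rightarrow> 'f fterm \<Rightarrow> 'm" where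
  "teval M v (TVar n) = v n"
| "teval M v (TFun f ts) = fint M f (map (teval M v) ts)"

primrec sat :: "('f, 'p, 'm) struct \<Rightarrow> (nat \<Rightarrow> 'm) \<Rightarrow> ('f, 'p) form \<Rightarrow> bool" where
  "sat M v (FEq s t) = (teval M v s = teval M v t)"
| "sat M v (FRel p ts) = rint M p (map (teval M v) ts)"
| "sat M v (FNot \<phi>) = (\<not> sat M v \<phi>)"
| "sat M v (FAnd \<phi> \<psi>) = (sat M v \<phi> \<and> sat M v \<psi>)"
| "sat M v (FEx n \<phi>) = (\<exists>x \<in> dom M. sat M (v(n := x)) \<phi>)"

definition is_model :: "('f, 'p) language \<Rightarrow> ('f, 'p, 'm) struct \<Rightarrow> ('f, 'p) form set \<Rightarrow> bool" where
  "is_model \<L> M T \<longleftrightarrow> is_struct \<L> M \<and> (\<forall>\<phi>\<in>T. \<forall>v. range v \<subseteq> dom M \<longrightarrow> sat M v \<phi>)"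

definition embedding ::
  "('f, 'p) language \<Rightarrow> ('f, 'p, 'm) struct \<Rightarrow> ('f, 'p, 'n) struct \<Rightarrow> ('m \<Rightarrow> 'n) \<Rightarrow> bool" where
  "embedding \<L> M N e \<longleftrightarrow> inj_on e (dom M) \<and> e ` dom M \<subseteq> dom N \<and>
    (\<forall>f xs. farity \<L> f = Some (length xs) \<and> set xs \<subseteq> dom M \<longrightarrow>
       e (fint M f xs) = fint N f (map e xs)) \<and>
    (\<forall>p xs. rarity \<L> p = Some (length xs) \<and> set xs \<subseteq> dom M \<longrightarrow>
       rint M p xs = rint N p (map e xs))"

text \<open>\<open>Ts\<close> is a model completion of \<open>T\<close>: it extends \<open>T\<close>, every model of \<open>T\<close> embeds into a model
  of \<open>Ts\<close>, and for every model \<open>M\<close> of \<open>T\<close> the union of \<open>Ts\<close> with the diagram of \<open>M\<close> is complete,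
  i.e. any two models of \<open>Ts\<close> into which \<open>M\<close> is embedded satisfy the same formulas with parameters
  from \<open>M\<close>. Models range over structures whose domain is a subset of the type \<open>'m\<close>, because HOL has
  no quantification over types. For a countable language and infinite \<open>'m\<close> this is no restriction,
  by the Loewenheim-Skolem theorem.\<close>

definition model_completion ::
  "'m itself \<Rightarrow> ('f, 'p) language \<Rightarrow> ('f, 'p) form set \<Rightarrow> ('f, 'p) form set \<Rightarrow> bool" where
  "model_completion (_ :: 'm itself) \<L> Ts T \<longleftrightarrow>
     Ts \<subseteq> sentences \<L> \<and>
     (\<forall>M :: ('f, 'p, 'm) struct. is_model \<L> M Ts \<longrightarrow> is_model \<L> M T) \<and>
     (\<forall>M :: ('f, 'p, 'm) struct. is_model \<L> M T \<longrightarrow>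
        (\<exists>(N :: ('f, 'p, 'm) struct) e. is_model \<L> N Ts \<and> embedding \<L> M N e)) \<and>
     (\<forall>(M :: ('f, 'p, 'm) struct) (N\<^sub>1 :: ('f, 'p, 'm) struct) (N\<^sub>2 :: ('f, 'p, 'm) struct) e\<^sub>1 e\<^sub>2 \<phi> v.
        is_model \<L> M T \<and> is_model \<L> N\<^sub>1 Ts \<and> is_model \<L> N\<^sub>2 Ts \<and>
        embedding \<L> M N\<^sub>1 e\<^sub>1 \<and> embedding \<L> M N\<^sub>2 e\<^sub>2 \<and>
        wf_form \<L> \<phi> \<and> range v \<subseteq> dom M \<longrightarrow>
        (sat N\<^sub>1 (e\<^sub>1 \<circ> v) \<phi> \<longleftrightarrow> sat N\<^sub>2 (e\<^sub>2 \<circ> v) \<phi>))"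

text \<open>Every partial 1-type over fewer than \<open>|M|\<close> parameters is realised. A formula with parameters
  is a pair \<open>(\<phi>, v)\<close>: variable 0 is the type variable, and \<open>v\<close> gives the parameters that replace the
  other free variables.\<close>

definition saturated :: "('f, 'p) language \<Rightarrow> ('f, 'p, 'm) struct \<Rightarrow> bool" where
  "saturated \<L> M \<longleftrightarrow>
     (\<forall>A \<Gamma>. A \<subseteq> dom M \<and> A \<prec> dom M \<and>
        (\<forall>(\<phi>, v)\<in>\<Gamma>. wf_form \<L> \<phi> \<and> v ` (fv \<phi> - {0}) \<subseteq> A) \<and>
        (\<forall>\<Delta>\<subseteq>\<Gamma>. finite \<Delta> \<longrightarrow> (\<exists>x\<in>dom M. \<forall>(\<phi>, v)\<in>\<Delta>. sat M (v(0 := x)) \<phi>)) \<longrightarrow>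
        (\<exists>x\<in>dom M. \<forall>(\<phi>, v)\<in>\<Gamma>. sat M (v(0 := x)) \<phi>))"

text \<open>Subsets of \<open>M\<^sup>n\<close> are sets of lists of length \<open>n\<close>. The variables below \<open>n\<close> are the coordinates,
  the remaining ones are parameters from \<open>M\<close>.\<close>

definition definable_set ::
  "('f, 'p) language \<Rightarrow> ('f, 'p, 'm) struct \<Rightarrow> nat \<Rightarrow> 'm list set \<Rightarrow> bool" where
  "definable_set \<L> M n X \<longleftrightarrow>
     (\<exists>\<phi> v. wf_form \<L> \<phi> \<and> range v \<subseteq> dom M \<and>
        X = {xs. length xs = n \<and> set xs \<subseteq> dom M \<and> sat M (\<lambda>i. if i < n then xs ! i else v i) \<phi>})"

definition definable_group ::
  "('f, 'p) language \<Rightarrow> ('f, 'p, 'm) struct \<Rightarrow> nat \<Rightarrow> 'm list monoid \<Rightarrow> bool" where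
  "definable_group \<L> M n G \<longleftrightarrow> group G \<and>
     definable_set \<L> M n (carrier G) \<and>
     definable_set \<L> M (3 * n)
       {x @ y @ (x \<otimes>\<^bsub>G\<^esub> y) | x y. x \<in> carrier G \<and> y \<in> carrier G}"


section \<open>Ordered differential fields\<close>

datatype fsym = Zero | One | Add | Neg | Mul | Der
datatype rsym = Less

fun fsym_arity :: "fsym \<Rightarrow> nat" where
  "fsym_arity Zero = 0"
| "fsym_arity One = 0"
| "fsym_arity Add = 2"
| "fsym_arity Neg = 1"
| "fsym_arity Mul = 2"
| "fsym_arity Der = 1"

definition ord_diff_ring_lang :: "(fsym, rsym) language" where
  "ord_diff_ring_lang = \<lparr>farity = (\<lambda>f. Some (fsym_arity f)), rarity = (\<lambda>_. Some 2)\<rparr>"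

definition ring_lang :: "(fsym, rsym) language" where
  "ring_lang = \<lparr>farity = (\<lambda>f. if f = Der then None else Some (fsym_arity f)), rarity = (\<lambda>_. None)\<rparr>"

definition ODF :: "(fsym, rsym) form set" where
  "ODF = (let x = TVar 0; y = TVar 1; z = TVar 2;
              zero = TFun Zero []; one = TFun One [];
              add = (\<lambda>s t. TFun Add [s, t]); neg = (\<lambda>t. TFun Neg [t]);
              mul = (\<lambda>s t. TFun Mul [s, t]); der = (\<lambda>t. TFun Der [t]);
              less = (\<lambda>s t. FRel Less [s, t]);
              all3 = (\<lambda>\<phi>. FAll 0 (FAll 1 (FAll 2 \<phi>)))
    in all3 `
     {FEq (add (add x y) z) (add x (add y z)),
      FEq (add x y) (add y x),
      FEq (add x zero) x,
      FEq (add x (neg x)) zero,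
      FEq (mul (mul x y) z) (mul x (mul y z)),
      FEq (mul x y) (mul y x),
      FEq (mul x one) x,
      FEq (mul x (add y z)) (add (mul x y) (mul x z)),
      FNot (FEq zero one),
      FImp (FNot (FEq x zero)) (FEx 1 (FEq (mul x y) one)),
      FNot (less x x),
      FImp (FAnd (less x y) (less y z)) (less x z),
      FOr (less x y) (FOr (FEq x y) (less y x)),
      FImp (less x y) (less (add x z) (add y z)),
      FImp (FAnd (less zero x) (less zero y)) (less zero (mul x y)),
      FEq (der (add x y)) (add (der x) (der y)),
      FEq (der (mul x y)) (add (mul (der x) y) (mul x (der y)))})"

fun ord_diff_field_fint :: "('a::linordered_field \<Rightarrow> 'a) \<Rightarrow> fsym \<Rightarrow> 'a list \<Rightarrow> 'a" where
  "ord_diff_field_fint D Zero [] = 0"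
| "ord_diff_field_fint D One [] = 1"
| "ord_diff_field_fint D Add [x, y] = x + y"
| "ord_diff_field_fint D Neg [x] = - x"
| "ord_diff_field_fint D Mul [x, y] = x * y"
| "ord_diff_field_fint D Der [x] = D x"
| "ord_diff_field_fint D _ _ = undefined"

fun ord_diff_field_rint :: "rsym \<Rightarrow> 'a::linordered_field list \<Rightarrow> bool" where
  "ord_diff_field_rint Less [x, y] = (x < y)"
| "ord_diff_field_rint Less _ = undefined"

definition ord_diff_field_struct ::
  "('a::linordered_field \<Rightarrow> 'a) \<Rightarrow> 'a set \<Rightarrow> (fsym, rsym, 'a) struct" where
  "ord_diff_field_struct D F =
     \<lparr>dom = F, fint = ord_diff_field_fint D, rint = ord_diff_field_rint\<rparr>"


section \<open>Differential fields\<close>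

definition derivation :: "('a::field \<Rightarrow> 'a) \<Rightarrow> bool" where
  "derivation D \<longleftrightarrow> (\<forall>x y. D (x + y) = D x + D y) \<and> (\<forall>x y. D (x * y) = D x * y + x * D y)"

lemma ODF_sentences: "ODF \<subseteq> sentences ord_diff_ring_lang"
  by (auto simp: ODF_def Let_def sentences_def FImp_def FOr_def FAll_def ord_diff_ring_lang_def)

lemma is_model_ODF:
  assumes "derivation (D :: 'a::linordered_field \<Rightarrow> 'a)"
  shows "is_model ord_diff_ring_lang (ord_diff_field_struct D UNIV) ODF"
proof -
  have inv: "\<exists>y. x * y = 1" if "x \<noteq> 0" for x :: 'a
    using that by (intro exI[of _ "inverse x"]) simp
  show ?thesis
    using assms inv
    by (auto simp: is_model_def is_struct_def ODF_def Let_def FImp_def FOr_def FAll_def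
        ord_diff_field_struct_def derivation_def algebra_simps)
qed

definition diff_subfield :: "('a::field \<Rightarrow> 'a) \<Rightarrow> 'a set \<Rightarrow> bool" where
  "diff_subfield D F \<longleftrightarrow> 0 \<in> F \<and> 1 \<in> F \<and>
     (\<forall>x\<in>F. \<forall>y\<in>F. x + y \<in> F \<and> x * y \<in> F) \<and>
     (\<forall>x\<in>F. - x \<in> F \<and> inverse x \<in> F \<and> D x \<in> F)"

definition diff_gen :: "('a::field \<Rightarrow> 'a) \<Rightarrow> 'a set \<Rightarrow> 'a set" where
  "diff_gen D A = \<Inter> {F. diff_subfield D F \<and> A \<subseteq> F}"

definition constants :: "('a::field \<Rightarrow> 'a) \<Rightarrow> 'a set \<Rightarrow> 'a set" where
  "constants D F = {x \<in> F. D x = 0}"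

definition formally_real :: "'a::field set \<Rightarrow> bool" where
  "formally_real F \<longleftrightarrow> (\<forall>xs. set xs \<subseteq> F \<longrightarrow> (\<Sum>x\<leftarrow>xs. x\<^sup>2) \<noteq> - 1)"

definition real_closed :: "'a::field set \<Rightarrow> bool" where
  "real_closed F \<longleftrightarrow> formally_real F \<and>
     (\<forall>x\<in>F. \<exists>y\<in>F. x = y\<^sup>2 \<or> x = - y\<^sup>2) \<and>
     (\<forall>p. (\<forall>i. coeff p i \<in> F) \<and> odd (degree p) \<longrightarrow> (\<exists>x\<in>F. poly p x = 0))"

text \<open>\<open>gal D F E\<close> is \<open>gal(F/E)\<close>; automorphisms of \<open>F\<close> are represented by functions that are
  \<^term>\<open>undefined\<close> outside \<open>F\<close>, so that equal automorphisms are equal functions.\<close>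

definition gal :: "('a::field \<Rightarrow> 'a) \<Rightarrow> 'a set \<Rightarrow> 'a set \<Rightarrow> ('a \<Rightarrow> 'a) monoid" where
  "gal D F E =
     \<lparr>carrier = {\<sigma> \<in> extensional F. bij_betw \<sigma> F F \<and>
        (\<forall>x\<in>F. \<forall>y\<in>F. \<sigma> (x + y) = \<sigma> x + \<sigma> y \<and> \<sigma> (x * y) = \<sigma> x * \<sigma> y) \<and>
        (\<forall>x\<in>F. \<sigma> (D x) = D (\<sigma> x)) \<and>
        (\<forall>x\<in>E. \<sigma> x = x)},
      monoid.mult = (\<lambda>\<sigma> \<tau>. compose F \<sigma> \<tau>),
      one = (\<lambda>x\<in>F. x)\<rparr>"

definition Gal :: "('u::linordered_field \<Rightarrow> 'u) \<Rightarrow> 'u set \<Rightarrow> 'u set \<Rightarrow> ('u \<Rightarrow> 'u) monoid" where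
  "Gal \<delta> L K = gal \<delta> (diff_gen \<delta> (L \<union> constants \<delta> UNIV)) (diff_gen \<delta> (K \<union> constants \<delta> UNIV))"


section \<open>The field \<open>U(i)\<close>\<close>

datatype 'a adj_i = Adj (re: 'a) (im: 'a)

instantiation adj_i :: (linordered_field) field
begin

definition "0 = Adj 0 0"
definition "1 = Adj 1 0"
definition "z + w = Adj (re z + re w) (im z + im w)"
definition "z - w = Adj (re z - re w) (im z - im w)"
definition "- z = Adj (- re z) (- im z)"
definition "z * w = Adj (re z * re w - im z * im w) (re z * im w + im z * re w)"
definition "inverse z = Adj (re z / ((re z)\<^sup>2 + (im z)\<^sup>2)) (- im z / ((re z)\<^sup>2 + (im z)\<^sup>2))"
definition "z div w = z * inverse (w :: 'a adj_i)"

instance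
proof
  fix a b c :: "'a adj_i"
  show "inverse a * a = 1" if "a \<noteq> 0"
  proof -
    have "(re a)\<^sup>2 + (im a)\<^sup>2 \<noteq> 0"
      using that by (cases a) (simp add: zero_adj_i_def sum_power2_eq_zero_iff)
    then show ?thesis
      by (simp add: inverse_adj_i_def times_adj_i_def one_adj_i_def
          flip: power2_eq_square add_divide_distrib)
  qed
qed (auto simp: zero_adj_i_def one_adj_i_def plus_adj_i_def minus_adj_i_def uminus_adj_i_def
    times_adj_i_def inverse_adj_i_def divide_adj_i_def algebra_simps adj_i.expand)

end

definition of_base :: "'a::linordered_field \<Rightarrow> 'a adj_i" where
  "of_base x = Adj x 0"

definition ext_deriv :: "('a \<Rightarrow> 'a) \<Rightarrow> 'a adj_i \<Rightarrow> 'a adj_i" where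
  "ext_deriv \<delta> z = Adj (\<delta> (re z)) (\<delta> (im z))"

definition adj_i_set :: "'a set \<Rightarrow> 'a adj_i set" where
  "adj_i_set F = {Adj x y | x y. x \<in> F \<and> y \<in> F}"

text \<open>\<open>\<delta>\<close> is the derivation of \<open>U\<close>, while \<open>K\<close> and \<open>L\<close> are differential subfields of \<open>U(i)\<close>.\<close>

definition strongly_normal ::
  "('u::linordered_field \<Rightarrow> 'u) \<Rightarrow> 'u adj_i set \<Rightarrow> 'u adj_i set \<Rightarrow> bool" where
  "strongly_normal \<delta> K L \<longleftrightarrow>
     (let D = ext_deriv \<delta>; C = adj_i_set (constants \<delta> UNIV) in
       constants D K = constants D L \<and> real_closed (constants D K) \<and>
       (\<exists>S. finite S \<and> L = diff_gen D (K \<union> S)) \<and>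
       (\<forall>\<sigma>\<in>carrier (gal D UNIV K). diff_gen D (L \<union> C) = diff_gen D (\<sigma> ` L \<union> C)))"

end

theory Submission
  imports Defs "HOL-Computational_Algebra.Formal_Laurent_Series" "HOL-Library.Function_Algebras"
begin

text \<open>
  Let \<open>C\<close> be the constants of \<open>U\<close>, \<open>L = K\<langle>a\<rangle>\<close>, \<open>F = \<langle>L, C\<rangle>\<close> and \<open>E = \<langle>K, C\<rangle>\<close>. An element \<open>\<sigma>\<close> of the
  Galois group is determined by the tuple \<open>\<sigma>(a)\<close> in \<open>F\<close>, whose entries are quotients of \<open>C\<close>-linear
  combinations of elements of \<open>L\<close>.

  The main point is that finitely many elements of \<open>L\<close> suffice for all \<open>\<sigma>\<close> simultaneously. If not,
  saturation gives a tuple \<open>b\<close> which is not of this form for any finite subset of \<open>L\<close>, although each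
  formula over \<open>L\<close> that holds at \<open>b\<close> holds at some \<open>\<sigma>(a)\<close>. Strong normality, applied to automorphisms
  of \<open>U\<close> over \<open>K\<close>, and compactness give finitely many polynomial inequalities satisfied by \<open>\<sigma>(a)\<close>
  that force a tuple with the same differential ideal over \<open>K\<close> to be such a quotient over a fixed
  finite set. The field \<open>L\<langle>b\<rangle>\<close> embeds over \<open>L\<close> into the Laurent series over \<open>U\<close> so that \<open>b\<close> is
  infinitesimally close to \<open>\<sigma>(a)\<close>; the order of the Laurent series, pulled back to \<open>L\<langle>b\<rangle>\<close>, is an
  ordering for which \<open>b\<close> satisfies those inequalities. As CODF is the model completion of ordered
  differential fields, a tuple of \<open>U\<close> with the field type of \<open>b\<close> over \<open>L\<close> satisfies them too, and linear
  disjointness from the constants carries the quotient representation back to \<open>b\<close>, a contradiction.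

  Consequently the automorphisms are coded by tuples of constants of a fixed length. Being a code of
  an automorphism amounts to polynomial conditions with coefficients in \<open>U\<close>, infinitely many of
  them, which Hilbert's basis theorem and a basis over \<open>C\<close> of the coefficients reduce to finitely
  many with coefficients in \<open>C\<close>. A canonical choice among the codes of one automorphism turns the
  set of codes into the required definable group.
\<close>

hide_const (open) Map.dom
unbundle cardinal_syntax

section \<open>Definability and saturation\<close>

text \<open>Elements of \<open>Gal \<delta> L K\<close> need not preserve signs. So strong normality
  only controls tuples with the same signs over \<open>K\<close> as one given
  \<open>\<sigma>(a)\<close>, and the finitely many inequalities obtained from compactness depend on
  \<open>\<sigma>\<close>. The limit tuple \<open>b\<close> inherits from the conjugates of
  \<open>a\<close> the equations over \<open>K\<close>, but its full sign type need not be that of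
  any conjugate. This is why \<open>L\<langle>b\<rangle>\<close> gets a new order. Strict
  inequalities survive infinitesimal perturbation, so closeness to a single conjugate suffices; and
  being a quotient of constant combinations depends on the differential field structure alone, so
  the new order can be forgotten afterwards. On the side of the constants, no description of the
  structure that \<open>U\<close> induces on \<open>C\<close> is needed: the equations descend to
  the pure field by linear algebra over \<open>C\<close>.\<close>

primrec tren :: "(nat \<Rightarrow> nat) \<Rightarrow> 'f fterm \<Rightarrow> 'f fterm" where
  "tren \<rho> (TVar n) = TVar (\<rho> n)"
| "tren \<rho> (TFun f ts) = TFun f (map (tren \<rho>) ts)"

text \<open>Bound variables are renamed as well, so an injective \<open>\<rho>\<close> cannot cause
  capture and no fresh names have to be found.\<close>

primrec fren :: "(nat \<Rightarrow> nat) \<Rightarrow> ('f, 'p) form \<Rightarrow> ('f, 'p) form" where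
  "fren \<rho> (FEq s t) = FEq (tren \<rho> s) (tren \<rho> t)"
| "fren \<rho> (FRel p ts) = FRel p (map (tren \<rho>) ts)"
| "fren \<rho> (FNot \<phi>) = FNot (fren \<rho> \<phi>)"
| "fren \<rho> (FAnd \<phi> \<psi>) = FAnd (fren \<rho> \<phi>) (fren \<rho> \<psi>)"
| "fren \<rho> (FEx n \<phi>) = FEx (\<rho> n) (fren \<rho> \<phi>)"

lemma teval_tren: "teval M v (tren \<rho> t) = teval M (v \<circ> \<rho>) t"
  by (induction t) (auto simp: comp_def intro!: arg_cong[where f = "fint M _"])

lemma sat_fren: "inj \<rho> \<Longrightarrow> sat M v (fren \<rho> \<phi>) = sat M (v \<circ> \<rho>) \<phi>"
proof (induction \<phi> arbitrary: v)
  case (FEx n \<phi>)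
  have "(v(\<rho> n := x)) \<circ> \<rho> = (v \<circ> \<rho>)(n := x)" for x
    using FEx.prems by (auto simp: fun_eq_iff inj_def)
  then show ?case by (simp only: fren.simps sat.simps FEx.IH[OF FEx.prems])
qed (auto simp: teval_tren comp_def)

lemma wf_tren: "wf_term \<L> (tren \<rho> t) = wf_term \<L> t"
  by (induction t) (auto simp: list_all_iff)

lemma wf_fren: "wf_form \<L> (fren \<rho> \<phi>) = wf_form \<L> \<phi>"
  by (induction \<phi>) (auto simp: wf_tren list_all_iff)

lemma finite_fv_term: "finite (fv_term t)"
  by (induction t) auto

lemma finite_fv: "finite (fv \<phi>)"
  by (induction \<phi>) (auto simp: finite_fv_term)

lemma teval_cong: "(\<And>i. i \<in> fv_term t \<Longrightarrow> v i = w i) \<Longrightarrow> teval M v t = teval M w t"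
proof (induction t)
  case (TFun f ts)
  then have "map (teval M v) ts = map (teval M w) ts" by (auto intro!: map_cong)
  then show ?case by (simp only: teval.simps)
qed simp

lemma sat_cong: "(\<And>i. i \<in> fv \<phi> \<Longrightarrow> v i = w i) \<Longrightarrow> sat M v \<phi> = sat M w \<phi>"
proof (induction \<phi> arbitrary: v w)
  case (FEq s t)
  then show ?case using teval_cong[of s v w M] teval_cong[of t v w M] by simp
next
  case (FRel p ts)
  then have "map (teval M v) ts = map (teval M w) ts" by (auto intro!: map_cong teval_cong)
  then show ?case by (simp only: sat.simps)
next
  case (FAnd \<phi>1 \<phi>2)
  then show ?case by (metis UnI1 UnI2 fv.simps(4) sat.simps(4))
next
  case (FEx n \<phi>)
  have "sat M (v(n := x)) \<phi> = sat M (w(n := x)) \<phi>" for x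
    using FEx.prems by (intro FEx.IH) auto
  then show ?case by simp
next
  case (FNot \<phi>)
  have "sat M v \<phi> = sat M w \<phi>" using FNot.prems by (intro FNot.IH) simp
  then show ?case by simp
qed

text \<open>Even variables are coordinates and odd variables are parameters, so that parameters of two
  formulas can be joined without touching the coordinates.\<close>

definition mrg :: "(nat \<Rightarrow> 'm) \<Rightarrow> (nat \<Rightarrow> 'm) \<Rightarrow> nat \<Rightarrow> 'm" where
  "mrg x w = (\<lambda>i. if even i then x (i div 2) else w (i div 2))"

text \<open>Parameter \<open>k\<close> moves to parameter \<open>2 * k + e\<close>, which is where
  \<open>mrg w\<^sub>1 w\<^sub>2\<close> stores entry \<open>k\<close> of \<open>w\<^sub>1\<close>
  (for \<open>e = 0\<close>) or of \<open>w\<^sub>2\<close> (for \<open>e = 1\<close>).\<close>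

definition pren :: "nat \<Rightarrow> nat \<Rightarrow> nat" where
  "pren e = (\<lambda>i. if even i then i else 2 * (2 * (i div 2) + e) + 1)"

lemma inj_pren: "inj (pren e)"
  by (auto simp: inj_def pren_def elim!: evenE oddE split: if_splits) presburger+

lemma mrg_pren_0: "mrg x (mrg w\<^sub>1 w\<^sub>2) \<circ> pren 0 = mrg x w\<^sub>1"
  by (auto simp: mrg_def pren_def fun_eq_iff elim: oddE)

lemma mrg_pren_1: "mrg x (mrg w\<^sub>1 w\<^sub>2) \<circ> pren 1 = mrg x w\<^sub>2"
  by (auto simp: mrg_def pren_def fun_eq_iff elim: oddE)

lemma range_mrg: "range x \<subseteq> A \<Longrightarrow> range w \<subseteq> A \<Longrightarrow> range (mrg x w) \<subseteq> A"
  by (auto simp: mrg_def)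

lemma mrg_upd: "(mrg x w)(2 * i := u) = mrg (x(i := u)) w"
  by (auto simp: mrg_def fun_eq_iff)

definition tfun :: "('f, 'p) language \<Rightarrow> ('f, 'p, 'm) struct \<Rightarrow> 'm set \<Rightarrow> ((nat \<Rightarrow> 'm) \<Rightarrow> 'm) \<Rightarrow> bool" where
  "tfun \<L> M A f \<longleftrightarrow> (\<exists>t w. wf_term \<L> t \<and> range w \<subseteq> A \<and>
     (\<forall>x. range x \<subseteq> dom M \<longrightarrow> f x = teval M (mrg x w) t))"

text \<open>Definability is stated for predicates on assignments, so that formulas are produced by
  closure rules and hardly ever written down. Nothing is claimed about \<open>P\<close> on
  assignments that leave \<open>dom M\<close>.\<close>

definition defbl :: "('f, 'p) language \<Rightarrow> ('f, 'p, 'm) struct \<Rightarrow> 'm set \<Rightarrow> ((nat \<Rightarrow> 'm) \<Rightarrow> bool) \<Rightarrow> bool" where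
  "defbl \<L> M A P \<longleftrightarrow> (\<exists>\<phi> w. wf_form \<L> \<phi> \<and> range w \<subseteq> A \<and>
     (\<forall>x. range x \<subseteq> dom M \<longrightarrow> P x = sat M (mrg x w) \<phi>))"

lemma tfun_var: "A \<noteq> {} \<Longrightarrow> tfun \<L> M A (\<lambda>x. x i)"
  unfolding tfun_def by (intro exI[of _ "TVar (2 * i)"] exI[of _ "\<lambda>_. SOME a. a \<in> A"])
    (auto simp: mrg_def some_in_eq)

lemma tfun_const: "a \<in> A \<Longrightarrow> tfun \<L> M A (\<lambda>x. a)"
  unfolding tfun_def by (intro exI[of _ "TVar 1"] exI[of _ "\<lambda>_. a"]) (auto simp: mrg_def)

lemma tfun_1:
  assumes "tfun \<L> M A f" "farity \<L> s = Some 1"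
  shows "tfun \<L> M A (\<lambda>x. fint M s [f x])"
proof -
  obtain t w where "wf_term \<L> t" "range w \<subseteq> A" "\<forall>x. range x \<subseteq> dom M \<longrightarrow> f x = teval M (mrg x w) t"
    using assms(1) unfolding tfun_def by blast
  then show ?thesis unfolding tfun_def using assms(2)
    by (intro exI[of _ "TFun s [t]"] exI[of _ w]) auto
qed

lemma tfun_2:
  assumes "tfun \<L> M A f" "tfun \<L> M A g" "farity \<L> s = Some 2"
  shows "tfun \<L> M A (\<lambda>x. fint M s [f x, g x])"
proof -
  obtain t w where t: "wf_term \<L> t" "range w \<subseteq> A" "\<forall>x. range x \<subseteq> dom M \<longrightarrow> f x = teval M (mrg x w) t"
    using assms(1) unfolding tfun_def by blast
  obtain t' w' where t': "wf_term \<L> t'" "range w' \<subseteq> A" "\<forall>x. range x \<subseteq> dom M \<longrightarrow> g x = teval M (mrg x w') t'"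
    using assms(2) unfolding tfun_def by blast
  show ?thesis unfolding tfun_def using assms(3) t t'
    by (intro exI[of _ "TFun s [tren (pren 0) t, tren (pren 1) t']"] exI[of _ "mrg w w'"])
      (auto simp: wf_tren teval_tren mrg_pren_0 mrg_pren_1 range_mrg[THEN subsetD] mrg_pren_1[simplified])
qed

lemma defbl_eq:
  assumes "tfun \<L> M A f" "tfun \<L> M A g"
  shows "defbl \<L> M A (\<lambda>x. f x = g x)"
proof -
  obtain t w where t: "wf_term \<L> t" "range w \<subseteq> A" "\<forall>x. range x \<subseteq> dom M \<longrightarrow> f x = teval M (mrg x w) t"
    using assms(1) unfolding tfun_def by blast
  obtain t' w' where t': "wf_term \<L> t'" "range w' \<subseteq> A" "\<forall>x. range x \<subseteq> dom M \<longrightarrow> g x = teval M (mrg x w') t'"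
    using assms(2) unfolding tfun_def by blast
  show ?thesis unfolding defbl_def using t t'
    by (intro exI[of _ "FEq (tren (pren 0) t) (tren (pren 1) t')"] exI[of _ "mrg w w'"])
      (auto simp: wf_tren teval_tren mrg_pren_0 mrg_pren_1 range_mrg[THEN subsetD] mrg_pren_1[simplified])
qed

lemma defbl_rel2:
  assumes "tfun \<L> M A f" "tfun \<L> M A g" "rarity \<L> p = Some 2"
  shows "defbl \<L> M A (\<lambda>x. rint M p [f x, g x])"
proof -
  obtain t w where t: "wf_term \<L> t" "range w \<subseteq> A" "\<forall>x. range x \<subseteq> dom M \<longrightarrow> f x = teval M (mrg x w) t"
    using assms(1) unfolding tfun_def by blast
  obtain t' w' where t': "wf_term \<L> t'" "range w' \<subseteq> A" "\<forall>x. range x \<subseteq> dom M \<longrightarrow> g x = teval M (mrg x w') t'"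
    using assms(2) unfolding tfun_def by blast
  show ?thesis unfolding defbl_def using assms(3) t t'
    by (intro exI[of _ "FRel p [tren (pren 0) t, tren (pren 1) t']"] exI[of _ "mrg w w'"])
      (auto simp: wf_tren teval_tren mrg_pren_0 mrg_pren_1 range_mrg[THEN subsetD] mrg_pren_1[simplified])
qed

lemma defbl_not: "defbl \<L> M A P \<Longrightarrow> defbl \<L> M A (\<lambda>x. \<not> P x)"
  unfolding defbl_def by (metis sat.simps(3) wf_form.simps(3))

lemma defbl_conj:
  assumes "defbl \<L> M A P" "defbl \<L> M A Q"
  shows "defbl \<L> M A (\<lambda>x. P x \<and> Q x)"
proof -
  obtain \<phi> w where t: "wf_form \<L> \<phi>" "range w \<subseteq> A" "\<forall>x. range x \<subseteq> dom M \<longrightarrow> P x = sat M (mrg x w) \<phi>"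
    using assms(1) unfolding defbl_def by blast
  obtain \<phi>' w' where t': "wf_form \<L> \<phi>'" "range w' \<subseteq> A" "\<forall>x. range x \<subseteq> dom M \<longrightarrow> Q x = sat M (mrg x w') \<phi>'"
    using assms(2) unfolding defbl_def by blast
  show ?thesis unfolding defbl_def using t t'
    by (intro exI[of _ "FAnd (fren (pren 0) \<phi>) (fren (pren 1) \<phi>')"] exI[of _ "mrg w w'"])
      (auto simp: wf_fren sat_fren inj_pren mrg_pren_0 mrg_pren_1 range_mrg[THEN subsetD] inj_pren[of 1, simplified] mrg_pren_1[simplified])
qed

lemma defbl_cong:
  assumes "defbl \<L> M A P" "\<And>x. range x \<subseteq> dom M \<Longrightarrow> P x = Q x"
  shows "defbl \<L> M A Q"
  using assms unfolding defbl_def by metis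

lemma defbl_True: "A \<noteq> {} \<Longrightarrow> defbl \<L> M A (\<lambda>x. True)"
  using defbl_eq[OF tfun_var[of A \<L> M 0] tfun_var[of A \<L> M 0]] by simp

lemma defbl_ball:
  assumes "A \<noteq> {}" "finite I" "\<And>i. i \<in> I \<Longrightarrow> defbl \<L> M A (P i)"
  shows "defbl \<L> M A (\<lambda>x. \<forall>i\<in>I. P i x)"
  using assms(2,3) by (induction I) (simp_all add: defbl_True assms(1) defbl_conj)

lemma defbl_bex:
  assumes "A \<noteq> {}" "finite I" "\<And>i. i \<in> I \<Longrightarrow> defbl \<L> M A (P i)"
  shows "defbl \<L> M A (\<lambda>x. \<exists>i\<in>I. P i x)"
  using defbl_not[OF defbl_ball[OF assms(1,2), of \<L> M "\<lambda>i x. \<not> P i x", OF defbl_not[OF assms(3)]]]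
  by simp

lemma defbl_mono: "defbl \<L> M A P \<Longrightarrow> A \<subseteq> B \<Longrightarrow> defbl \<L> M B P"
  unfolding defbl_def by (meson subset_trans)

lemma defbl_ex:
  assumes "defbl \<L> M A P"
  shows "defbl \<L> M A (\<lambda>x. \<exists>u\<in>dom M. P (x(i := u)))"
proof -
  obtain \<phi> w where t: "wf_form \<L> \<phi>" "range w \<subseteq> A" "\<forall>x. range x \<subseteq> dom M \<longrightarrow> P x = sat M (mrg x w) \<phi>"
    using assms(1) unfolding defbl_def by blast
  have "P (x(i := u)) = sat M ((mrg x w)(2 * i := u)) \<phi>" if "range x \<subseteq> dom M" "u \<in> dom M" for x u
  proof -
    have "range (x(i := u)) \<subseteq> dom M" using that by (auto simp: fun_upd_def)
    then show ?thesis using t(3) by (simp add: mrg_upd)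
  qed
  then show ?thesis unfolding defbl_def using t(1,2)
    by (intro exI[of _ "FEx (2 * i) \<phi>"] exI[of _ w]) simp
qed

lemma defbl_exblock:
  fixes M :: "('f, 'p, 'b) struct"
  assumes "defbl \<L> M A P" "finite I"
  shows "defbl \<L> M A (\<lambda>x. \<exists>y. range y \<subseteq> dom M \<and> (\<forall>i. i \<notin> I \<longrightarrow> y i = x i) \<and> P y)"
  using assms(2)
proof (induction I)
  case empty
  show ?case using assms(1) by (rule defbl_cong) (metis ext empty_iff)
next
  case (insert i I)
  show ?case
  proof (rule defbl_cong[OF defbl_ex[OF insert.IH, of i]])
    fix x :: "nat \<Rightarrow> 'b"
    show "(\<exists>u\<in>dom M. \<exists>y. range y \<subseteq> dom M \<and> (\<forall>j. j \<notin> I \<longrightarrow> y j = (x(i := u)) j) \<and> P y) =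
      (\<exists>y. range y \<subseteq> dom M \<and> (\<forall>j. j \<notin> insert i I \<longrightarrow> y j = x j) \<and> P y)" (is "?l = ?r")
    proof
      assume ?l
      then obtain u y where "range y \<subseteq> dom M" "\<forall>j. j \<notin> I \<longrightarrow> y j = (x(i := u)) j" "P y" by blast
      then show ?r by (intro exI[of _ y]) auto
    next
      assume ?r
      then obtain y where "range y \<subseteq> dom M" "\<forall>j. j \<notin> insert i I \<longrightarrow> y j = x j" "P y" by blast
      then show ?l by (intro bexI[of _ "y i"] exI[of _ y]) auto
    qed
  qed
qed

lemma defbl_reindex:
  assumes "defbl \<L> M A P" "inj \<rho>"
  shows "defbl \<L> M A (\<lambda>x. P (\<lambda>i. x (\<rho> i)))"
proof -
  obtain \<phi> w where t: "wf_form \<L> \<phi>" "range w \<subseteq> A" "\<forall>x. range x \<subseteq> dom M \<longrightarrow> P x = sat M (mrg x w) \<phi>"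
    using assms(1) unfolding defbl_def by blast
  define \<theta> where "\<theta> i = (if even i then 2 * \<rho> (i div 2) else i)" for i
  have "inj \<theta>"
  proof (rule injI)
    fix i j assume *: "\<theta> i = \<theta> j"
    have "even (\<theta> i) = even i" for i by (simp add: \<theta>_def)
    with * have "even i = even j" by metis
    with * show "i = j" using injD[OF assms(2), of "i div 2" "j div 2"]
      by (cases "even i") (auto simp: \<theta>_def)
  qed
  moreover have "mrg x w \<circ> \<theta> = mrg (\<lambda>i. x (\<rho> i)) w" for x
    by (auto simp: mrg_def \<theta>_def fun_eq_iff)
  moreover have "range (\<lambda>i. x (\<rho> i)) \<subseteq> dom M" if "range x \<subseteq> dom M" for x using that by auto
  ultimately show ?thesis unfolding defbl_def using t
    by (intro exI[of _ "fren \<theta> \<phi>"] exI[of _ w]) (simp add: wf_fren sat_fren)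
qed

lemma defbl_definable_set:
  assumes "defbl \<L> M (dom M) P" "z \<in> dom M"
  shows "definable_set \<L> M n {xs. length xs = n \<and> set xs \<subseteq> dom M \<and> P (\<lambda>i. if i < n then xs ! i else z)}"
proof -
  obtain \<phi> w where t: "wf_form \<L> \<phi>" "range w \<subseteq> dom M" "\<forall>x. range x \<subseteq> dom M \<longrightarrow> P x = sat M (mrg x w) \<phi>"
    using assms(1) unfolding defbl_def by blast
  \<comment> \<open>\<open>definable_set\<close> expects coordinate \<open>i\<close> in variable
    \<open>i\<close>, below \<open>n\<close>; all other variables are moved above \<open>n\<close>
    by the shift \<open>n + j\<close>, which cannot collide with them.\<close>
  define \<theta> where "\<theta> j = (if even j \<and> j div 2 < n then j div 2 else n + j)" for j
  define v where "v i = (if i < n then z else mrg (\<lambda>_. z) w (i - n))" for i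
  have inj: "inj \<theta>"
    by (auto simp: inj_def \<theta>_def elim!: evenE split: if_splits)
  have eq: "(\<lambda>i. if i < n then xs ! i else v i) \<circ> \<theta> = mrg (\<lambda>i. if i < n then xs ! i else z) w" for xs
    by (auto simp: mrg_def \<theta>_def v_def fun_eq_iff)
  have "range (\<lambda>i. if i < n then xs ! i else z) \<subseteq> dom M" if "length xs = n" "set xs \<subseteq> dom M" for xs
    using that assms(2) by (auto simp: subset_iff)
  then have "{xs. length xs = n \<and> set xs \<subseteq> dom M \<and> P (\<lambda>i. if i < n then xs ! i else z)} =
    {xs. length xs = n \<and> set xs \<subseteq> dom M \<and> sat M (\<lambda>i. if i < n then xs ! i else v i) (fren \<theta> \<phi>)}"
    using t(3) by (auto simp: sat_fren inj eq)
  moreover have "range v \<subseteq> dom M" using assms(2) t(2) by (auto simp: v_def mrg_def)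
  ultimately show ?thesis unfolding definable_set_def using t(1) wf_fren by blast
qed

lemma lesspoll_iff_ordLess: "A \<prec> B \<longleftrightarrow> |A| <o |B|"
proof -
  have "A \<prec> B \<longleftrightarrow> \<not> B \<lesssim> A"
    by (metis eqpoll_imp_lepoll eqpoll_sym lepoll_antisym lepoll_def lesspoll_def card_of_ordLeq
        card_of_ordLess ordLess_imp_ordLeq)
  then show ?thesis by (simp add: lepoll_def flip: card_of_ordLess)
qed

lemma insert_lesspoll: "A \<prec> B \<Longrightarrow> infinite B \<Longrightarrow> insert a A \<prec> B"
  by (metis finite_insert finite_lesspoll_infinite infinite_insert_eqpoll eq_lesspoll_trans)

lemma saturated_realise_coord:
  assumes "saturated \<L> M" "A \<subseteq> dom M" "A \<prec> dom M" "range x\<^sub>0 \<subseteq> A"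
    and "\<And>P. P \<in> \<P> \<Longrightarrow> defbl \<L> M A P"
    and fin: "\<And>\<D>. \<D> \<subseteq> \<P> \<Longrightarrow> finite \<D> \<Longrightarrow> \<exists>u\<in>dom M. \<forall>P\<in>\<D>. P (x\<^sub>0(r := u))"
  shows "\<exists>u\<in>dom M. \<forall>P\<in>\<P>. P (x\<^sub>0(r := u))"
proof -
  have "\<forall>P\<in>\<P>. \<exists>\<phi> w. wf_form \<L> \<phi> \<and> range w \<subseteq> A \<and> (\<forall>x. range x \<subseteq> dom M \<longrightarrow> P x = sat M (mrg x w) \<phi>)"
    using assms(5) unfolding defbl_def by blast
  then obtain \<phi> w where *: "\<And>P. P \<in> \<P> \<Longrightarrow> wf_form \<L> (\<phi> P) \<and> range (w P) \<subseteq> A \<and>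
      (\<forall>x. range x \<subseteq> dom M \<longrightarrow> P x = sat M (mrg x (w P)) (\<phi> P))"
    by metis
  \<comment> \<open>\<open>saturated\<close> reserves variable 0 for the element to be realised,
    whereas coordinate \<open>r\<close> is coded by variable \<open>2 * r\<close>; the two are
    swapped.\<close>
  define \<tau> where "\<tau> i = (if i = 2 * r then 0 else if i = 0 then 2 * r else i)" for i
  have inj: "inj \<tau>" by (auto simp: inj_def \<tau>_def split: if_splits)
  define F where "F P = (fren \<tau> (\<phi> P), mrg x\<^sub>0 (w P) \<circ> \<tau>)" for P
  have eq: "((mrg x\<^sub>0 v \<circ> \<tau>)(0 := u)) \<circ> \<tau> = mrg (x\<^sub>0(r := u)) v" for v u
    unfolding mrg_upd[symmetric] by (auto simp: \<tau>_def fun_eq_iff)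
  have F: "(case F P of (\<phi>, v) \<Rightarrow> sat M (v(0 := u)) \<phi>) = P (x\<^sub>0(r := u))" if "P \<in> \<P>" "u \<in> dom M" for P u
  proof -
    have "range (x\<^sub>0(r := u)) \<subseteq> dom M" using that assms(2,4) by auto
    then show ?thesis using *[OF that(1)] by (simp add: F_def sat_fren inj eq)
  qed
  have "\<exists>u\<in>dom M. \<forall>(\<phi>, v)\<in>F ` \<P>. sat M (v(0 := u)) \<phi>"
  proof (rule assms(1)[unfolded saturated_def, rule_format, of A], intro conjI assms(2,3) allI impI)
    show "\<forall>(\<phi>, v)\<in>F ` \<P>. wf_form \<L> \<phi> \<and> v ` (fv \<phi> - {0}) \<subseteq> A"
    proof (clarsimp simp: F_def, intro conjI)
      fix P assume P: "P \<in> \<P>"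
      show "wf_form \<L> (fren \<tau> (\<phi> P))" using *[OF P] by (simp add: wf_fren)
      show "(\<lambda>x. mrg x\<^sub>0 (w P) (\<tau> x)) ` (fv (fren \<tau> (\<phi> P)) - {0}) \<subseteq> A"
        using range_mrg[OF assms(4)] *[OF P] by blast
    qed
  next
    fix \<Delta> assume "\<Delta> \<subseteq> F ` \<P>" "finite \<Delta>"
    then obtain \<D> where D: "\<D> \<subseteq> \<P>" "finite \<D>" "\<Delta> = F ` \<D>" by (meson finite_subset_image)
    then obtain u where u: "u \<in> dom M" "\<forall>P\<in>\<D>. P (x\<^sub>0(r := u))" using fin by blast
    have "case F P of (\<phi>, v) \<Rightarrow> sat M (v(0 := u)) \<phi>" if "P \<in> \<D>" for P
      unfolding F[OF subsetD[OF D(1) that] u(1)] using u(2) that by (rule bspec)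
    then have "\<forall>(\<phi>, v)\<in>\<Delta>. sat M (v(0 := u)) \<phi>" unfolding D(3) by (simp only: ball_simps) (rule ballI)
    then show "\<exists>u\<in>dom M. \<forall>(\<phi>, v)\<in>\<Delta>. sat M (v(0 := u)) \<phi>" using u(1) by (rule bexI[where x = u])
  qed
  then obtain u where u: "u \<in> dom M" "\<forall>d\<in>F ` \<P>. case d of (\<phi>, v) \<Rightarrow> sat M (v(0 := u)) \<phi>" by (rule bexE)
  have "P (x\<^sub>0(r := u))" if "P \<in> \<P>" for P
    using bspec[OF u(2) imageI[OF that]] unfolding F[OF that u(1)] .
  then show ?thesis using u(1) by (intro bexI[of _ u] ballI)
qed

text \<open>From 1-types to types of tuples: the last coordinate is realised first, by the 1-type
  which says, for each finite set of conditions, that the earlier coordinates can still be filled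
  in. The element found joins the parameters, which remain fewer than the elements of
  \<open>dom M\<close>.\<close>

lemma saturated_realise:
  assumes "saturated \<L> M" "A \<subseteq> dom M" "A \<prec> dom M" "range x\<^sub>0 \<subseteq> A" "infinite (dom M)"
    and "\<And>P. P \<in> \<P> \<Longrightarrow> defbl \<L> M A P"
    and "\<And>\<D>. \<D> \<subseteq> \<P> \<Longrightarrow> finite \<D> \<Longrightarrow> \<exists>y. range y \<subseteq> dom M \<and> (\<forall>i\<ge>r. y i = x\<^sub>0 i) \<and> (\<forall>P\<in>\<D>. P y)"
  shows "\<exists>y. range y \<subseteq> dom M \<and> (\<forall>i\<ge>r. y i = x\<^sub>0 i) \<and> (\<forall>P\<in>\<P>. P y)"
  using assms
proof (induction r arbitrary: A x\<^sub>0)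
  case 0
  have "\<forall>P\<in>\<P>. P x\<^sub>0"
  proof
    fix P assume "P \<in> \<P>"
    then have "\<exists>y. range y \<subseteq> dom M \<and> (\<forall>i\<ge>0. y i = x\<^sub>0 i) \<and> (\<forall>P\<in>{P}. P y)" by (intro 0(7)) simp_all
    then obtain y where "\<forall>i. y i = x\<^sub>0 i" "P y" by (elim exE conjE) simp
    then have "y = x\<^sub>0" by auto
    with \<open>P y\<close> show "P x\<^sub>0" by simp
  qed
  moreover have "range x\<^sub>0 \<subseteq> dom M" using 0(2,4) by simp
  ultimately show ?case by (intro exI[of _ x\<^sub>0] conjI) simp_all
next
  case (Suc r)
  define Q where "Q \<D> = (\<lambda>x. \<exists>y. range y \<subseteq> dom M \<and> (\<forall>i. i \<notin> {..<r} \<longrightarrow> y i = x i) \<and> (\<forall>P\<in>\<D>. P y))" for \<D>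
  have "\<exists>u\<in>dom M. \<forall>P\<in>Q ` {\<D>. \<D> \<subseteq> \<P> \<and> finite \<D>}. P (x\<^sub>0(r := u))"
  proof (rule saturated_realise_coord[OF Suc.prems(1-4)])
    fix P assume "P \<in> Q ` {\<D>. \<D> \<subseteq> \<P> \<and> finite \<D>}"
    then obtain \<D> where D: "\<D> \<subseteq> \<P>" "finite \<D>" "P = Q \<D>" by blast
    have "A \<noteq> {}" using Suc.prems(4) by auto
    then have "defbl \<L> M A (\<lambda>x. \<forall>P\<in>\<D>. P x)"
      by (rule defbl_ball[OF _ D(2)]) (rule Suc.prems(6)[OF subsetD[OF D(1)]])
    from defbl_exblock[OF this, of "{..<r}"] show "defbl \<L> M A P" unfolding D(3) Q_def by simp
  next
    fix \<Q> assume "\<Q> \<subseteq> Q ` {\<D>. \<D> \<subseteq> \<P> \<and> finite \<D>}" "finite \<Q>"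
    then obtain \<DD> where D: "\<DD> \<subseteq> {\<D>. \<D> \<subseteq> \<P> \<and> finite \<D>}" "finite \<DD>" "\<Q> = Q ` \<DD>"
      by (meson finite_subset_image)
    then obtain y where y: "range y \<subseteq> dom M" "\<forall>i\<ge>Suc r. y i = x\<^sub>0 i" "\<forall>P\<in>\<Union>\<DD>. P y"
    proof -
      have "\<Union>\<DD> \<subseteq> \<P>" "finite (\<Union>\<DD>)" using D(1,2) by auto
      from Suc.prems(7)[OF this] show ?thesis using that by (elim exE conjE)
    qed
    have "y i = (x\<^sub>0(r := y r)) i" if "i \<notin> {..<r}" for i
      using y(2) that by (cases "i = r") auto
    then have "Q \<D> (x\<^sub>0(r := y r))" if "\<D> \<in> \<DD>" for \<D>
      unfolding Q_def using y(1,3) that by (intro exI[of _ y]) (simp only: Union_iff, blast)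
    then have "\<forall>P\<in>\<Q>. P (x\<^sub>0(r := y r))" unfolding D(3) by (simp only: ball_simps) (rule ballI)
    moreover have "y r \<in> dom M" using y(1) by blast
    ultimately show "\<exists>u\<in>dom M. \<forall>P\<in>\<Q>. P (x\<^sub>0(r := u))" by (rule bexI[where x = "y r"])
  qed
  then obtain u where u: "u \<in> dom M" "\<forall>P\<in>Q ` {\<D>. \<D> \<subseteq> \<P> \<and> finite \<D>}. P (x\<^sub>0(r := u))" by (rule bexE)
  have uQ: "Q \<D> (x\<^sub>0(r := u))" if "\<D> \<subseteq> \<P>" "finite \<D>" for \<D>
    by (rule bspec[OF u(2) imageI]) (simp add: that)
  have "\<exists>y. range y \<subseteq> dom M \<and> (\<forall>i\<ge>r. y i = (x\<^sub>0(r := u)) i) \<and> (\<forall>P\<in>\<P>. P y)"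
  proof (rule Suc.IH[of "insert u A"])
    show "insert u A \<prec> dom M" by (rule insert_lesspoll[OF Suc.prems(3,5)])
    show "range (x\<^sub>0(r := u)) \<subseteq> insert u A" using Suc.prems(4) by auto
    show "defbl \<L> M (insert u A) P" if "P \<in> \<P>" for P by (rule defbl_mono[OF Suc.prems(6)[OF that]]) blast
    show "\<exists>y. range y \<subseteq> dom M \<and> (\<forall>i\<ge>r. y i = (x\<^sub>0(r := u)) i) \<and> (\<forall>P\<in>\<D>. P y)"
      if "\<D> \<subseteq> \<P>" "finite \<D>" for \<D> using uQ[OF that] unfolding Q_def lessThan_iff not_less .
  qed (use Suc.prems(1,2,5) u(1) in simp_all)
  then obtain y where y: "range y \<subseteq> dom M" "\<forall>i\<ge>r. y i = (x\<^sub>0(r := u)) i" "\<forall>P\<in>\<P>. P y" by (elim exE conjE)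
  have "\<forall>i\<ge>Suc r. y i = x\<^sub>0 i" using y(2) by auto
  then show ?case using y(1,3) by (intro exI[of _ y] conjI)
qed

subsection \<open>Homogeneity\<close>

text \<open>A partial elementary map, given by its graph: the backward step of a back-and-forth
  construction is then the forward step for the converse relation. That the relation is
  single-valued and injective follows by testing it on an equation.\<close>

definition elemrel :: "('f, 'p) language \<Rightarrow> ('f, 'p, 'm) struct \<Rightarrow> ('m \<times> 'm) set \<Rightarrow> bool" where
  "elemrel \<L> M S \<longleftrightarrow> (\<forall>\<phi> v w. wf_form \<L> \<phi> \<longrightarrow> (\<forall>i. (v i, w i) \<in> S) \<longrightarrow> sat M v \<phi> = sat M w \<phi>)"

text \<open>Forces each variable \<open>Suc i\<close> with \<open>i\<close> in the list to take the
  value of variable 0. A new point may occur at several places of a formula, while a 1-type has only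
  one variable for it.\<close>

primrec dupl :: "nat list \<Rightarrow> ('f, 'p) form \<Rightarrow> ('f, 'p) form" where
  "dupl [] \<phi> = \<phi>"
| "dupl (i # is) \<phi> = FEx (Suc i) (FAnd (FEq (TVar (Suc i)) (TVar 0)) (dupl is \<phi>))"

lemma wf_dupl: "wf_form \<L> (dupl is \<phi>) = wf_form \<L> \<phi>"
  by (induction "is") auto

lemma sat_dupl: "v 0 \<in> dom M \<Longrightarrow> sat M v (dupl is \<phi>) = sat M (\<lambda>j. if \<exists>i\<in>set is. j = Suc i then v 0 else v j) \<phi>"
proof (induction "is" arbitrary: v)
  case (Cons i "is")
  have "sat M v (dupl (i # is) \<phi>) = sat M (v(Suc i := v 0)) (dupl is \<phi>)" using Cons.prems by auto
  also have "\<dots> = sat M (\<lambda>j. if \<exists>i\<in>set is. j = Suc i then v 0 else (v(Suc i := v 0)) j) \<phi>"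
    using Cons by (simp cong: if_cong)
  also have "(\<lambda>j. if \<exists>i\<in>set is. j = Suc i then v 0 else (v(Suc i := v 0)) j) =
      (\<lambda>j. if \<exists>i\<in>set (i # is). j = Suc i then v 0 else v j)" by auto
  finally show ?case .
qed auto

lemma elemrel_converse: "elemrel \<L> M S \<Longrightarrow> elemrel \<L> M (S\<inverse>)"
  unfolding elemrel_def by auto

text \<open>The image of \<open>x\<close> has to realise the type of \<open>x\<close> transported
  along \<open>S\<close>. A finite part of that type amounts to one formula, and the statement that
  it has a solution is again a formula with parameters in the domain of \<open>S\<close>, hence
  preserved by \<open>S\<close>.\<close>

lemma elemrel_forth:
  assumes sat: "saturated \<L> M" and UNIV: "dom M = UNIV" "infinite (UNIV :: 'm set)"
    and S: "elemrel \<L> (M :: ('f, 'p, 'm) struct) S" "S \<noteq> {}" "S \<prec> (UNIV :: 'm set)"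
  shows "\<exists>y. elemrel \<L> M (insert (x, y) S)"
proof -
  define \<Gamma> where "\<Gamma> = {(\<phi>, w). wf_form \<L> \<phi> \<and> (\<exists>v. (\<forall>i. (v i, w i) \<in> S) \<and> sat M (v(0 := x)) \<phi>)}"
  have join: "\<exists>\<phi> v w. wf_form \<L> \<phi> \<and> (\<forall>i. (v i, w i) \<in> S) \<and> sat M (v(0 := x)) \<phi> \<and>
      (\<forall>u. sat M (w(0 := u)) \<phi> \<longrightarrow> (\<forall>(\<phi>', w')\<in>\<Delta>. sat M (w'(0 := u)) \<phi>'))"
    if "finite \<Delta>" "\<Delta> \<subseteq> \<Gamma>" for \<Delta>
    using that
  proof (induction \<Delta>)
    case empty
    obtain a b where "(a, b) \<in> S" using S(2) by auto
    then show ?case by (intro exI[of _ "FEq (TVar 0) (TVar 0)"] exI[of _ "\<lambda>_. a"] exI[of _ "\<lambda>_. b"]) auto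
  next
    case (insert d \<Delta>)
    obtain \<phi>\<^sub>1 v\<^sub>1 w\<^sub>1 where 1: "wf_form \<L> \<phi>\<^sub>1" "\<forall>i. (v\<^sub>1 i, w\<^sub>1 i) \<in> S" "sat M (v\<^sub>1(0 := x)) \<phi>\<^sub>1"
       "\<forall>u. sat M (w\<^sub>1(0 := u)) \<phi>\<^sub>1 \<longrightarrow> (\<forall>(\<phi>', w')\<in>\<Delta>. sat M (w'(0 := u)) \<phi>')"
    proof -
      have "\<Delta> \<subseteq> \<Gamma>" using insert.prems by simp
      from insert.IH[OF this] show ?thesis using that by blast
    qed
    obtain \<phi>\<^sub>2 v\<^sub>2 w\<^sub>2 where 2: "d = (\<phi>\<^sub>2, w\<^sub>2)" "wf_form \<L> \<phi>\<^sub>2" "\<forall>i. (v\<^sub>2 i, w\<^sub>2 i) \<in> S" "sat M (v\<^sub>2(0 := x)) \<phi>\<^sub>2"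
      using insert.prems unfolding \<Gamma>_def by auto
    \<comment> \<open>The parameters of the two formulas are interleaved, but both renamings fix 0,
      since the type variable must stay common to them.\<close>
    define jn where "jn v v' = (\<lambda>j. if even j then v (j div 2) else v' (Suc j div 2))" for v v' :: "nat \<Rightarrow> 'm"
    define \<rho>\<^sub>1 where "\<rho>\<^sub>1 = (\<lambda>i::nat. 2 * i)"
    define \<rho>\<^sub>2 where "\<rho>\<^sub>2 = (\<lambda>i::nat. if i = 0 then 0 else 2 * i - 1)"
    have inj: "inj \<rho>\<^sub>1" "inj \<rho>\<^sub>2" unfolding \<rho>\<^sub>1_def \<rho>\<^sub>2_def by (auto simp: inj_def) 
    have e1: "((jn v v')(0 := u)) \<circ> \<rho>\<^sub>1 = v(0 := u)" for v v' u
      by (auto simp: jn_def \<rho>\<^sub>1_def fun_eq_iff)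
    have e2: "((jn v v')(0 := u)) \<circ> \<rho>\<^sub>2 = v'(0 := u)" for v v' u
      by (auto simp: jn_def \<rho>\<^sub>2_def fun_eq_iff)
    have jS: "(jn v\<^sub>1 v\<^sub>2 i, jn w\<^sub>1 w\<^sub>2 i) \<in> S" for i using 1(2) 2(3) by (simp add: jn_def)
    let ?\<phi> = "FAnd (fren \<rho>\<^sub>1 \<phi>\<^sub>1) (fren \<rho>\<^sub>2 \<phi>\<^sub>2)"
    have a1: "wf_form \<L> ?\<phi>" using 1(1) 2(2) by (simp add: wf_fren)
    have a2: "\<forall>i. (jn v\<^sub>1 v\<^sub>2 i, jn w\<^sub>1 w\<^sub>2 i) \<in> S" using jS ..
    have a3: "sat M ((jn v\<^sub>1 v\<^sub>2)(0 := x)) ?\<phi>"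
      using 1(3) 2(4) by (simp only: sat.simps sat_fren inj e1 e2)
    have a4: "\<forall>u. sat M ((jn w\<^sub>1 w\<^sub>2)(0 := u)) ?\<phi> \<longrightarrow> (\<forall>(\<phi>', w')\<in>insert d \<Delta>. sat M (w'(0 := u)) \<phi>')"
    proof (intro allI impI)
      fix u assume "sat M ((jn w\<^sub>1 w\<^sub>2)(0 := u)) ?\<phi>"
      then have "sat M (w\<^sub>1(0 := u)) \<phi>\<^sub>1" "sat M (w\<^sub>2(0 := u)) \<phi>\<^sub>2" by (simp_all only: sat.simps sat_fren inj e1 e2)
      then show "\<forall>(\<phi>', w')\<in>insert d \<Delta>. sat M (w'(0 := u)) \<phi>'" using 1(4) 2(1) by simp
    qed
    show ?case
      by (rule exI[of _ ?\<phi>], rule exI[of _ "jn v\<^sub>1 v\<^sub>2"], rule exI[of _ "jn w\<^sub>1 w\<^sub>2"]) (intro conjI a1 a2 a3 a4)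
  qed
  have "\<exists>y\<in>dom M. \<forall>(\<phi>, w)\<in>\<Gamma>. sat M (w(0 := y)) \<phi>"
  proof (rule sat[unfolded saturated_def, rule_format, of "Range S"], intro conjI allI impI)
    show "Range S \<prec> dom M" using S(3)
      by (metis UNIV(1) Range_snd image_lepoll lesspoll_trans1)
    show "\<forall>(\<phi>, v)\<in>\<Gamma>. wf_form \<L> \<phi> \<and> v ` (fv \<phi> - {0}) \<subseteq> Range S"
      unfolding \<Gamma>_def by auto
    fix \<Delta> assume "\<Delta> \<subseteq> \<Gamma>" "finite \<Delta>"
    then obtain \<phi> v w where *: "wf_form \<L> \<phi>" "\<forall>i. (v i, w i) \<in> S" "sat M (v(0 := x)) \<phi>"
      "\<And>u. sat M (w(0 := u)) \<phi> \<Longrightarrow> (\<forall>(\<phi>', w')\<in>\<Delta>. sat M (w'(0 := u)) \<phi>')" using join by metis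
    have "sat M v (FEx 0 \<phi>)" using *(3) UNIV by auto
    then have "sat M w (FEx 0 \<phi>)" using S(1) *(1,2) unfolding elemrel_def by (metis wf_form.simps(5))
    then obtain u where u: "u \<in> dom M" "sat M (w(0 := u)) \<phi>" unfolding sat.simps by (rule bexE)
    show "\<exists>u\<in>dom M. \<forall>(\<phi>', w')\<in>\<Delta>. sat M (w'(0 := u)) \<phi>'" using *(4)[OF u(2)] u(1) by (rule bexI[where x = u])
  qed (use UNIV in auto)
  then obtain y where y: "\<And>\<phi> w. (\<phi>, w) \<in> \<Gamma> \<Longrightarrow> sat M (w(0 := y)) \<phi>" by auto
  obtain a b where ab: "(a, b) \<in> S" using S(2) by auto
  have imp: "sat M w \<phi>" if \<phi>: "wf_form \<L> \<phi>" "\<forall>i. (v i, w i) \<in> insert (x, y) S" "sat M v \<phi>" for \<phi> v w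
  proof -
    \<comment> \<open>Positions at which the new pair is used; all of them are collapsed into
      variable 0 by \<open>dupl\<close>, after the remaining variables have been shifted by one to
      make room.\<close>
    define I where "I = {i \<in> fv \<phi>. (v i, w i) = (x, y)}"
    obtain "is" where I: "set is = I" using finite_fv[of \<phi>] finite_list I_def by (metis finite_Collect_conjI Collect_mem_eq)
    define v' where "v' j = (case j of 0 \<Rightarrow> a | Suc i \<Rightarrow> if (v i, w i) \<in> S then v i else a)" for j
    define w' where "w' j = (case j of 0 \<Rightarrow> b | Suc i \<Rightarrow> if (v i, w i) \<in> S then w i else b)" for j
    let ?\<phi> = "dupl is (fren Suc \<phi>)"
    have "sat M (v'(0 := x)) ?\<phi> = sat M ((\<lambda>j. if \<exists>i\<in>set is. j = Suc i then x else (v'(0 := x)) j) \<circ> Suc) \<phi>"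
      by (subst sat_dupl) (simp_all add: UNIV sat_fren cong: if_cong)
    also have "\<dots> = sat M v \<phi>" using that(2) by (intro sat_cong) (auto simp: I I_def v'_def)
    finally have "sat M (v'(0 := x)) ?\<phi>" using that(3) by simp
    moreover have "(v' i, w' i) \<in> S" for i using ab by (auto simp: v'_def w'_def split: nat.split)
    ultimately have "(?\<phi>, w') \<in> \<Gamma>" using \<phi>(1) unfolding \<Gamma>_def by (auto simp: wf_dupl wf_fren)
    then have "sat M (w'(0 := y)) ?\<phi>" by (rule y)
    also have "sat M (w'(0 := y)) ?\<phi> = sat M ((\<lambda>j. if \<exists>i\<in>set is. j = Suc i then y else (w'(0 := y)) j) \<circ> Suc) \<phi>"
      by (subst sat_dupl) (simp_all add: UNIV sat_fren cong: if_cong)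
    also have "\<dots> = sat M w \<phi>" using that(2) by (intro sat_cong) (auto simp: I I_def w'_def)
    finally show ?thesis .
  qed
  have "elemrel \<L> M (insert (x, y) S)" unfolding elemrel_def
  proof (intro allI impI iffI)
    fix \<phi> and v w :: "nat \<Rightarrow> 'm" assume *: "wf_form \<L> \<phi>" "\<forall>i. (v i, w i) \<in> insert (x, y) S"
    show "sat M w \<phi>" if "sat M v \<phi>" using imp * that by blast
    show "sat M v \<phi>" if "sat M w \<phi>" using imp[of "FNot \<phi>" v w] * that by auto
  qed
  then show ?thesis by blast
qed

lemma insert_ne_lesspoll: "S \<prec> (UNIV :: 'm set) \<Longrightarrow> infinite (UNIV :: 'm set) \<Longrightarrow> (insert p S)\<inverse> \<prec> (UNIV :: 'm set)"
proof -
  assume *: "S \<prec> (UNIV :: 'm set)" "infinite (UNIV :: 'm set)"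
  have "(insert p S)\<inverse> \<lesssim> insert p S" unfolding lepoll_def by (rule exI[of _ prod.swap]) (auto simp: inj_on_def)
  then show ?thesis using insert_lesspoll[OF *] lesspoll_trans1 by blast
qed

lemma elemrel_back_forth:
  assumes sat: "saturated \<L> M" and UNIV: "dom M = UNIV" "infinite (UNIV :: 'm set)"
    and S: "elemrel \<L> (M :: ('f, 'p, 'm) struct) S" "S \<noteq> {}" "S \<prec> (UNIV :: 'm set)"
  shows "\<exists>p. elemrel \<L> M (S \<union> {(x, fst p), (snd p, x)})"
proof -
  obtain y where y: "elemrel \<L> M (insert (x, y) S)" using elemrel_forth[OF assms] by blast
  obtain z where "elemrel \<L> M (insert (x, z) ((insert (x, y) S)\<inverse>))"
    using elemrel_forth[OF sat UNIV elemrel_converse[OF y] _ insert_ne_lesspoll[OF S(3) UNIV(2)]] by auto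
  then have "elemrel \<L> M ((insert (x, z) ((insert (x, y) S)\<inverse>))\<inverse>)" by (rule elemrel_converse)
  moreover have "(insert (x, z) ((insert (x, y) S)\<inverse>))\<inverse> = S \<union> {(x, y), (z, x)}" by auto
  ultimately show ?thesis by (intro exI[of _ "(y, z)"]) simp
qed

text \<open>A formula has finitely many free variables, so the pairs that matter lie in one member
  of the chain. The common pair \<open>p\<close> serves as value of the other variables.\<close>

lemma elemrel_Union_chain:
  fixes M :: "('f, 'p, 'm) struct"
  assumes "subset.chain UNIV \<C>" "\<C> \<noteq> {}" "\<And>S. S \<in> \<C> \<Longrightarrow> elemrel \<L> M S" "p \<in> \<Inter>\<C>"
  shows "elemrel \<L> M (\<Union>\<C>)"
  unfolding elemrel_def
proof (intro allI impI)
  fix \<phi> and v w :: "nat \<Rightarrow> 'm" assume *: "wf_form \<L> \<phi>" "\<forall>i. (v i, w i) \<in> \<Union>\<C>"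
  have "finite ((\<lambda>i. (v i, w i)) ` fv \<phi>)" by (simp add: finite_fv)
  moreover have "(\<lambda>i. (v i, w i)) ` fv \<phi> \<subseteq> \<Union>\<C>"
    by (rule image_subsetI) (rule spec[OF *(2)])
  ultimately obtain S where S: "S \<in> \<C>" "(\<lambda>i. (v i, w i)) ` fv \<phi> \<subseteq> S"
    by (rule finite_subset_Union_chain[OF _ _ assms(2,1)])
  define v' where "v' i = (if i \<in> fv \<phi> then v i else fst p)" for i
  define w' where "w' i = (if i \<in> fv \<phi> then w i else snd p)" for i
  have "p \<in> S" using S(1) assms(4) by (simp only: Inter_iff)
  then have "(v' i, w' i) \<in> S" for i
    using S(2) by (cases "i \<in> fv \<phi>") (simp_all add: v'_def w'_def image_subset_iff)
  then have "sat M v' \<phi> = sat M w' \<phi>" using assms(3)[OF S(1)] *(1) unfolding elemrel_def by blast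
  moreover have "sat M v' \<phi> = sat M v \<phi>" by (rule sat_cong) (simp add: v'_def)
  moreover have "sat M w' \<phi> = sat M w \<phi>" by (rule sat_cong) (simp add: w'_def)
  ultimately show "sat M v \<phi> = sat M w \<phi>" by simp
qed

text \<open>Transfinite back-and-forth along a well-order of the universe of least possible type.
  Proper initial segments then have smaller cardinality than the universe, so the relation reached
  at each stage is small enough for saturation to give both an image and a preimage of the current
  element.\<close>

lemma saturated_homogeneous:
  assumes sat: "saturated \<L> M" and UNIV: "dom M = UNIV" "infinite (UNIV :: 'm set)"
    and S\<^sub>0: "elemrel \<L> (M :: ('f, 'p, 'm) struct) S\<^sub>0" "S\<^sub>0 \<noteq> {}" "S\<^sub>0 \<prec> (UNIV :: 'm set)"
  shows "\<exists>g. bij g \<and> (\<forall>(x, y)\<in>S\<^sub>0. g x = y) \<and> (\<forall>\<phi> v. wf_form \<L> \<phi> \<longrightarrow> sat M (g \<circ> v) \<phi> = sat M v \<phi>)"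
proof -
  define r where "r = |UNIV :: 'm set|"
  have r: "Card_order r" "Field r = UNIV" "Well_order r" unfolding r_def
    by (rule card_of_Card_order Field_card_of card_of_Well_order)+
  have wf: "wf (r - Id)" using r(3) unfolding well_order_on_def by blast
  have lin: "trans r" "antisym r" "total_on UNIV r" using r(2,3)
    unfolding well_order_on_def linear_order_on_def partial_order_on_def preorder_on_def by auto
  define prs where "prs f \<beta> = {(\<beta>, fst (f \<beta>)), (snd (f \<beta>), \<beta>)}" for f :: "'m \<Rightarrow> 'm \<times> 'm" and \<beta>
  define H where "H f \<alpha> = (SOME p. elemrel \<L> M (S\<^sub>0 \<union> (\<Union>\<beta>\<in>underS r \<alpha>. prs f \<beta>) \<union> {(\<alpha>, fst p), (snd p, \<alpha>)}))" for f \<alpha>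
  define st where "st = wfrec (r - Id) H"
  have st: "st \<alpha> = H st \<alpha>" for \<alpha>
  proof -
    \<comment> \<open>\<open>H\<close> looks only at stages strictly before \<open>\<alpha>\<close>,
      so cutting the recursive function off there changes nothing.\<close>
    have "st \<alpha> = H (cut st (r - Id) \<alpha>) \<alpha>" unfolding st_def by (rule wfrec[OF wf])
    also have "prs (cut st (r - Id) \<alpha>) \<beta> = prs st \<beta>" if "\<beta> \<in> underS r \<alpha>" for \<beta>
      using that by (auto simp: prs_def cut_def underS_def)
    then have "H (cut st (r - Id) \<alpha>) \<alpha> = H st \<alpha>" unfolding H_def by (simp cong: SUP_cong)
    finally show ?thesis .
  qed
  define T where "T \<alpha> = S\<^sub>0 \<union> (\<Union>\<beta>\<in>underS r \<alpha>. prs st \<beta>)" for \<alpha>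
  define T' where "T' \<alpha> = T \<alpha> \<union> prs st \<alpha>" for \<alpha>
  have T'_mono: "T' \<beta> \<subseteq> T' \<gamma>" if "(\<beta>, \<gamma>) \<in> r" for \<beta> \<gamma>
  proof (cases "\<beta> = \<gamma>")
    case False
    have "\<beta>' \<in> underS r \<gamma>" if "\<beta>' \<in> underS r \<beta>" for \<beta>'
      using that \<open>(\<beta>, \<gamma>) \<in> r\<close> lin(1,2) False unfolding underS_def
      by (auto dest: transD antisymD)
    moreover have "\<beta> \<in> underS r \<gamma>" using that False by (auto simp: underS_def)
    ultimately show ?thesis unfolding T'_def T_def by auto
  qed simp
  have chain: "subset.chain UNIV (insert S\<^sub>0 (T' ` X))" for X
    unfolding subset.chain_def
  proof (intro conjI ballI)
    fix A B assume "A \<in> insert S\<^sub>0 (T' ` X)" "B \<in> insert S\<^sub>0 (T' ` X)"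
    moreover have "S\<^sub>0 \<subseteq> T' \<gamma>" for \<gamma> by (auto simp: T'_def T_def)
    moreover have "T' \<beta> \<subseteq> T' \<gamma> \<or> T' \<gamma> \<subseteq> T' \<beta>" for \<beta> \<gamma>
      using T'_mono lin(3) unfolding total_on_def by (metis UNIV_I subset_refl)
    ultimately have "A \<subseteq> B \<or> B \<subseteq> A" by (metis (no_types, lifting) imageE insertE subset_refl)
    then show "(\<subset>)\<^sup>=\<^sup>= A B \<or> (\<subset>)\<^sup>=\<^sup>= B A" by auto
  qed simp
  obtain p where p: "p \<in> S\<^sub>0" using S\<^sub>0(2) by auto
  have elT': "elemrel \<L> M (T' \<alpha>)" for \<alpha>
    using wf
  proof (induction \<alpha> rule: wf_induct_rule)
    case (less \<alpha>)
    have "elemrel \<L> M (\<Union>(insert S\<^sub>0 (T' ` underS r \<alpha>)))"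
    proof (rule elemrel_Union_chain[OF chain, where p = p])
      fix S assume "S \<in> insert S\<^sub>0 (T' ` underS r \<alpha>)"
      then show "elemrel \<L> M S" using S\<^sub>0(1) less by (auto simp: underS_def)
    qed (use p in \<open>auto simp: T'_def T_def\<close>)
    moreover have "\<Union>(insert S\<^sub>0 (T' ` underS r \<alpha>)) = T \<alpha>"
    proof
      show "\<Union>(insert S\<^sub>0 (T' ` underS r \<alpha>)) \<subseteq> T \<alpha>"
      proof -
        have "\<beta>' \<in> underS r \<alpha>" if "\<beta>' \<in> underS r \<beta>" "\<beta> \<in> underS r \<alpha>" for \<beta> \<beta>'
          using that lin(1,2) unfolding underS_def by (auto dest: transD antisymD)
        then show ?thesis unfolding T'_def T_def by auto
      qed
    qed (auto simp: T'_def T_def)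
    ultimately have T: "elemrel \<L> M (T \<alpha>)" by simp
    have "|underS r \<alpha>| <o |UNIV :: 'm set|" using card_of_underS[OF r(1), of \<alpha>] r by (simp add: r_def)
    moreover have "|(\<lambda>\<beta>. (\<beta>, fst (st \<beta>))) ` underS r \<alpha>| \<le>o |underS r \<alpha>|"
      "|(\<lambda>\<beta>. (snd (st \<beta>), \<beta>)) ` underS r \<alpha>| \<le>o |underS r \<alpha>|" by (auto intro: card_of_image)
    moreover have "|S\<^sub>0| <o |UNIV :: 'm set|" using S\<^sub>0(3) lesspoll_iff_ordLess by blast
    ultimately have "|S\<^sub>0 \<union> ((\<lambda>\<beta>. (\<beta>, fst (st \<beta>))) ` underS r \<alpha> \<union> (\<lambda>\<beta>. (snd (st \<beta>), \<beta>)) ` underS r \<alpha>)| <o |UNIV :: 'm set|"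
      using UNIV(2) by (intro card_of_Un_ordLess_infinite) (blast intro: ordLeq_ordLess_trans)+
    moreover have "T \<alpha> = S\<^sub>0 \<union> ((\<lambda>\<beta>. (\<beta>, fst (st \<beta>))) ` underS r \<alpha> \<union> (\<lambda>\<beta>. (snd (st \<beta>), \<beta>)) ` underS r \<alpha>)"
      unfolding T_def prs_def by auto
    ultimately have "T \<alpha> \<prec> (UNIV :: 'm set)" by (simp add: lesspoll_iff_ordLess)
    then have "\<exists>q. elemrel \<L> M (T \<alpha> \<union> {(\<alpha>, fst q), (snd q, \<alpha>)})"
      using elemrel_back_forth[OF sat UNIV T] p unfolding T_def by blast
    then have "elemrel \<L> M (T \<alpha> \<union> {(\<alpha>, fst (H st \<alpha>)), (snd (H st \<alpha>), \<alpha>)})"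
      unfolding H_def T_def by (rule someI_ex)
    then show ?case unfolding T'_def prs_def by (simp flip: st)
  qed
  have el: "elemrel \<L> M (\<Union>(insert S\<^sub>0 (range T')))" (is "elemrel \<L> M ?S")
  proof (rule elemrel_Union_chain[OF chain, where p = p])
    fix S assume "S \<in> insert S\<^sub>0 (range T')"
    then show "elemrel \<L> M S" using S\<^sub>0(1) elT' by auto
  qed (use p in \<open>auto simp: T'_def T_def\<close>)
  have fn: "(x = x') = (y = y')" if "(x, y) \<in> ?S" "(x', y') \<in> ?S" for x y x' y'
    using el[unfolded elemrel_def, rule_format, of "FEq (TVar 0) (TVar 1)"
        "\<lambda>i. if i = 0 then x else x'" "\<lambda>i. if i = 0 then y else y'"] that by auto
  define g where "g x = fst (st x)" for x
  have gS: "(x, g x) \<in> ?S" for x unfolding g_def T'_def prs_def by auto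
  have "inj g" using fn[OF gS gS] by (auto simp: inj_def)
  moreover have "surj g"
  proof (rule surjI)
    fix y have "(snd (st y), y) \<in> ?S" unfolding T'_def prs_def by auto
    from fn[OF gS[of "snd (st y)"] this] show "g (snd (st y)) = y" by simp
  qed
  moreover have "g x = y" if "(x, y) \<in> S\<^sub>0" for x y
  proof -
    have "(x, y) \<in> ?S" using that by (rule UnionI[OF insertI1])
    from fn[OF gS[of x] this] show ?thesis by simp
  qed
  moreover have "sat M (g \<circ> v) \<phi> = sat M v \<phi>" if "wf_form \<L> \<phi>" for \<phi> v
  proof -
    have "(v i, (g \<circ> v) i) \<in> ?S" for i unfolding comp_def by (rule gS)
    then show ?thesis using el that unfolding elemrel_def by metis
  qed
  ultimately show ?thesis by (intro exI[of _ g]) (auto simp: bij_def)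
qed

section \<open>Differential algebra\<close>

definition sfield :: "'a::field set \<Rightarrow> bool" where
  "sfield A \<longleftrightarrow> 0 \<in> A \<and> 1 \<in> A \<and> (\<forall>x\<in>A. \<forall>y\<in>A. x + y \<in> A \<and> x * y \<in> A) \<and> (\<forall>x\<in>A. - x \<in> A \<and> inverse x \<in> A)"

definition sring :: "'a::comm_ring_1 set \<Rightarrow> bool" where
  "sring A \<longleftrightarrow> 0 \<in> A \<and> 1 \<in> A \<and> (\<forall>x\<in>A. \<forall>y\<in>A. x + y \<in> A \<and> x * y \<in> A) \<and> (\<forall>x\<in>A. - x \<in> A)"

definition frac :: "'a::field set \<Rightarrow> 'a set" where
  "frac R = {x / y | x y. x \<in> R \<and> y \<in> R \<and> y \<noteq> 0}"

lemma diff_subfield_iff: "diff_subfield D F \<longleftrightarrow> sfield F \<and> (\<forall>x\<in>F. D x \<in> F)"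
  unfolding diff_subfield_def sfield_def by blast

lemma sfield_imp_sring: "sfield A \<Longrightarrow> sring A"
  unfolding sfield_def sring_def by blast

context
  fixes R :: "'a::comm_ring_1 set" assumes R: "sring R"
begin
lemma sring_0: "0 \<in> R" and sring_1: "1 \<in> R" using R by (auto simp: sring_def)
lemma sring_add: "x \<in> R \<Longrightarrow> y \<in> R \<Longrightarrow> x + y \<in> R" using R by (auto simp: sring_def)
lemma sring_mult: "x \<in> R \<Longrightarrow> y \<in> R \<Longrightarrow> x * y \<in> R" using R by (auto simp: sring_def)
lemma sring_neg: "x \<in> R \<Longrightarrow> - x \<in> R" using R by (auto simp: sring_def)
lemma sring_diff: "x \<in> R \<Longrightarrow> y \<in> R \<Longrightarrow> x - y \<in> R" using sring_add[of x "- y"] sring_neg by simp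
lemma sring_sum: "(\<And>i. i \<in> I \<Longrightarrow> f i \<in> R) \<Longrightarrow> sum f I \<in> R"
  by (induction I rule: infinite_finite_induct) (auto simp: sring_0 sring_add)
lemma sring_prod: "(\<And>i. i \<in> I \<Longrightarrow> f i \<in> R) \<Longrightarrow> prod f I \<in> R"
  by (induction I rule: infinite_finite_induct) (auto simp: sring_1 sring_mult)
lemma sring_power: "x \<in> R \<Longrightarrow> x ^ n \<in> R"
  by (induction n) (auto simp: sring_1 sring_mult)
lemma sring_of_nat: "of_nat n \<in> R"
  by (induction n) (auto simp: sring_0 sring_1 sring_add)
end

lemma sfield_inv: "sfield A \<Longrightarrow> x \<in> A \<Longrightarrow> inverse x \<in> A"
  by (auto simp: sfield_def)

lemma sfield_divide: "sfield A \<Longrightarrow> x \<in> A \<Longrightarrow> y \<in> A \<Longrightarrow> x / y \<in> A"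
  by (simp add: divide_inverse sfield_inv sring_mult sfield_imp_sring)

lemma fracI: "x \<in> R \<Longrightarrow> y \<in> R \<Longrightarrow> y \<noteq> 0 \<Longrightarrow> x / y \<in> frac R"
  unfolding frac_def by (intro CollectI exI[of _ x] exI[of _ y] conjI refl)

lemma sring_subset_frac:
  assumes "sring R" shows "R \<subseteq> frac R"
proof
  fix x assume "x \<in> R"
  from fracI[OF this sring_1[OF assms]] show "x \<in> frac R" by simp
qed

lemma frac_subset: "sfield A \<Longrightarrow> R \<subseteq> A \<Longrightarrow> frac R \<subseteq> A"
  unfolding frac_def by (auto intro!: sfield_divide)

lemma sfield_frac:
  assumes R: "sring R" shows "sfield (frac R)"
  unfolding sfield_def
proof (intro conjI ballI)
  show "0 \<in> frac R" "1 \<in> frac R" using sring_subset_frac[OF R] sring_0[OF R] sring_1[OF R] by auto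
  fix x y assume "x \<in> frac R" "y \<in> frac R"
  then obtain a b c d where *: "x = a / b" "y = c / d" "a \<in> R" "b \<in> R" "c \<in> R" "d \<in> R" "b \<noteq> 0" "d \<noteq> 0"
    unfolding frac_def by auto
  have "x + y = (a * d + c * b) / (b * d)" "x * y = (a * c) / (b * d)" "b * d \<noteq> 0"
    using * by (auto simp: field_simps)
  moreover have "a * d + c * b \<in> R" "a * c \<in> R" "b * d \<in> R" using * by (auto intro!: sring_add sring_mult R)
  ultimately show "x + y \<in> frac R" "x * y \<in> frac R" by (simp_all only: fracI not_False_eq_True)
next
  fix x assume "x \<in> frac R"
  then obtain a b where *: "x = a / b" "a \<in> R" "b \<in> R" "b \<noteq> 0"
    unfolding frac_def by auto
  have "- x = (- a) / b" using * by simp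
  then show "- x \<in> frac R" using fracI[OF sring_neg[OF R *(2)] *(3,4)] by (simp only:)
  show "inverse x \<in> frac R"
  proof (cases "a = 0")
    case True
    then show ?thesis using * sring_subset_frac[OF R] sring_0[OF R] by auto
  next
    case False
    then have "inverse x = b / a" using * by simp
    then show ?thesis using fracI[OF *(3,2) False] by (simp only:)
  qed
qed

section \<open>Linear independence over a subfield\<close>

definition indep :: "'a::field set \<Rightarrow> 'a set \<Rightarrow> bool" where
  "indep k B \<longleftrightarrow> (\<forall>c. (\<forall>e\<in>B. c e \<in> k) \<and> (\<Sum>e\<in>B. c e * e) = 0 \<longrightarrow> (\<forall>e\<in>B. c e = 0))"

lemma indepD: "indep k B \<Longrightarrow> (\<And>e. e \<in> B \<Longrightarrow> c e \<in> k) \<Longrightarrow> (\<Sum>e\<in>B. c e * e) = 0 \<Longrightarrow> e \<in> B \<Longrightarrow> c e = 0"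
  unfolding indep_def by blast

lemma basis_exists:
  fixes f :: "'i \<Rightarrow> 'a::field"
  assumes k: "sfield k" and "finite J"
  shows "\<exists>B \<kappa>. finite B \<and> B \<subseteq> f ` J \<and> indep k B \<and> (\<forall>j\<in>J. (\<forall>e\<in>B. \<kappa> j e \<in> k) \<and> f j = (\<Sum>e\<in>B. \<kappa> j e * e))"
  using assms(2)
proof induction
  case empty
  show ?case by (intro exI[of _ "{}"]) (auto simp: indep_def)
next
  case (insert i J)
  then obtain B \<kappa> where B: "finite B" "B \<subseteq> f ` J" "indep k B"
    "\<And>j e. j \<in> J \<Longrightarrow> e \<in> B \<Longrightarrow> \<kappa> j e \<in> k" "\<And>j. j \<in> J \<Longrightarrow> f j = (\<Sum>e\<in>B. \<kappa> j e * e)" by blast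
  note kr = sfield_imp_sring[OF k]
  show ?case
  proof (cases "\<exists>c. (\<forall>e\<in>B. c e \<in> k) \<and> f i = (\<Sum>e\<in>B. c e * e)")
    case True
    then obtain c where c: "\<forall>e\<in>B. c e \<in> k" "f i = (\<Sum>e\<in>B. c e * e)" by blast
    have "(\<forall>e\<in>B. (\<kappa>(i := c)) j e \<in> k) \<and> f j = (\<Sum>e\<in>B. (\<kappa>(i := c)) j e * e)" if "j \<in> insert i J" for j
    proof (cases "j = i")
      case True
      with c show ?thesis by simp
    next
      case False
      with that B(4,5) show ?thesis by simp
    qed
    then show ?thesis using B(1-3) by (intro exI[of _ B] exI[of _ "\<kappa>(i := c)"] conjI ballI) auto
  next
    case False
    have nB: "f i \<notin> B"
    proof
      assume *: "f i \<in> B"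
      have "f i = (\<Sum>e\<in>B. (if e = f i then 1 else 0) * e)" using * B(1) by (simp add: if_distrib[of "\<lambda>x. x * _"] sum.delta cong: if_cong)
      moreover have "\<forall>e\<in>B. (if e = f i then 1 else 0) \<in> k" using sring_0[OF kr] sring_1[OF kr] by simp
      ultimately have "\<exists>c. (\<forall>e\<in>B. c e \<in> k) \<and> f i = (\<Sum>e\<in>B. c e * e)"
        by (intro exI[of _ "\<lambda>e. if e = f i then 1 else 0"] conjI)
      with False show False ..
    qed
    have "indep k (insert (f i) B)" unfolding indep_def
    proof (intro allI impI)
      fix c assume c: "(\<forall>e\<in>insert (f i) B. c e \<in> k) \<and> (\<Sum>e\<in>insert (f i) B. c e * e) = 0"
      then have s: "c (f i) * f i + (\<Sum>e\<in>B. c e * e) = 0" using nB B(1) by simp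
      have "c (f i) = 0"
      proof (rule ccontr)
        assume n: "c (f i) \<noteq> 0"
        have "f i = - (inverse (c (f i)) * (\<Sum>e\<in>B. c e * e))" using s n by (simp add: field_simps eq_neg_iff_add_eq_0 add.commute)
        also have "\<dots> = (\<Sum>e\<in>B. (- (inverse (c (f i)) * c e)) * e)"
          by (simp add: sum_distrib_left sum_negf mult.assoc)
        finally have "f i = (\<Sum>e\<in>B. (- (inverse (c (f i)) * c e)) * e)" .
        moreover have "\<forall>e\<in>B. - (inverse (c (f i)) * c e) \<in> k"
          using c by (intro ballI sring_neg[OF kr] sring_mult[OF kr] sfield_inv[OF k]) auto
        ultimately have "\<exists>c. (\<forall>e\<in>B. c e \<in> k) \<and> f i = (\<Sum>e\<in>B. c e * e)"
          by (intro exI[of _ "\<lambda>e. - (inverse (c (f i)) * c e)"] conjI)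
        with False show False ..
      qed
      moreover from this have "(\<Sum>e\<in>B. c e * e) = 0" using s by simp
      then have "\<forall>e\<in>B. c e = 0" using indepD[OF B(3) _ \<open>(\<Sum>e\<in>B. c e * e) = 0\<close>] c by blast
      ultimately show "\<forall>e\<in>insert (f i) B. c e = 0" by simp
    qed
    moreover have "f i = (\<Sum>e\<in>insert (f i) B. (if e = f i then 1 else 0) * e)"
      using B(1) by (simp add: if_distrib[of "\<lambda>x. x * _"] sum.delta cong: if_cong)
    moreover have "f j = (\<Sum>e\<in>insert (f i) B. (if e = f i then 0 else \<kappa> j e) * e)" if "j \<in> J" for j
    proof -
      have "(\<Sum>e\<in>B. (if e = f i then 0 else \<kappa> j e) * e) = (\<Sum>e\<in>B. \<kappa> j e * e)" using nB by (intro sum.cong) auto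
      then show ?thesis using B(5)[OF that] nB B(1) by simp
    qed
    note * = calculation this
    define \<kappa>' where "\<kappa>' j e = (if j = i then if e = f i then 1 else 0 else if e = f i then 0 else \<kappa> j e)" for j e
    have k1: "\<kappa>' i = (\<lambda>e. if e = f i then 1 else 0)" by (simp add: \<kappa>'_def fun_eq_iff)
    have k2: "\<kappa>' j = (\<lambda>e. if e = f i then 0 else \<kappa> j e)" if "j \<in> J" for j
      using that insert.hyps by (auto simp: \<kappa>'_def fun_eq_iff)
    have k3: "\<forall>e\<in>insert (f i) B. \<kappa>' j e \<in> k" if "j \<in> insert i J" for j
      using that B(4) sring_0[OF kr] sring_1[OF kr] by (auto simp: \<kappa>'_def)
    have k4: "f j = (\<Sum>e\<in>insert (f i) B. \<kappa>' j e * e)" if "j \<in> insert i J" for j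
    proof (cases "j = i")
      case True
      show ?thesis unfolding True k1 by (rule *(2))
    next
      case False
      with that have "j \<in> J" by simp
      show ?thesis unfolding k2[OF \<open>j \<in> J\<close>] by (rule *(3)[OF \<open>j \<in> J\<close>])
    qed
    have "finite (insert (f i) B)" "insert (f i) B \<subseteq> f ` insert i J" using B(1,2) by auto
    then show ?thesis
      by (intro exI[of _ "insert (f i) B"] exI[of _ \<kappa>'] conjI ballI *(1) k3 k4)
  qed
qed

section \<open>Derivations and constants\<close>

locale diff_field =
  fixes \<delta> :: "'a::field_char_0 \<Rightarrow> 'a"
  assumes isder: "derivation \<delta>"
begin

lemma der_add: "\<delta> (x + y) = \<delta> x + \<delta> y" and der_mult: "\<delta> (x * y) = \<delta> x * y + x * \<delta> y"
  using isder by (auto simp: derivation_def)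

lemma der_0: "\<delta> 0 = 0" using der_add[of 0 0] by simp
lemma der_1: "\<delta> 1 = 0" using der_mult[of 1 1] by simp
lemma der_neg: "\<delta> (- x) = - \<delta> x"
  using der_add[of x "- x"] by (simp add: der_0 eq_neg_iff_add_eq_0 add.commute)
lemma der_sum: "\<delta> (sum f I) = (\<Sum>i\<in>I. \<delta> (f i))"
  by (induction I rule: infinite_finite_induct) (auto simp: der_0 der_add)
lemma der_inverse: "\<delta> (inverse x) = - (\<delta> x * inverse x * inverse x)"
proof (cases "x = 0")
  case False
  then have "\<delta> (x * inverse x) = 0" by (simp add: der_1)
  then have "x * \<delta> (inverse x) = - (\<delta> x * inverse x)" by (simp add: der_mult eq_neg_iff_add_eq_0 add.commute)
  then have "inverse x * (x * \<delta> (inverse x)) = inverse x * (- (\<delta> x * inverse x))" by simp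
  moreover have "inverse x * (x * \<delta> (inverse x)) = \<delta> (inverse x)" using False by (simp flip: mult.assoc)
  ultimately show ?thesis by (simp add: mult.commute)
qed (simp add: der_0)
lemma der_divide: "y \<noteq> 0 \<Longrightarrow> \<delta> (x / y) = (\<delta> x * y - x * \<delta> y) / (y * y)"
  by (simp add: divide_inverse der_mult der_inverse) (simp add: field_simps)
lemma der_power_Suc: "\<delta> (x ^ Suc n) = of_nat (Suc n) * x ^ n * \<delta> x"
  by (induction n) (simp_all add: der_mult algebra_simps)

lemma diff_subfield_frac:
  assumes R: "sring R" "\<And>x. x \<in> R \<Longrightarrow> \<delta> x \<in> R"
  shows "diff_subfield \<delta> (frac R)"
  unfolding diff_subfield_iff
proof (intro conjI ballI sfield_frac R(1))
  fix x assume "x \<in> frac R"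
  then obtain a b where *: "x = a / b" "a \<in> R" "b \<in> R" "b \<noteq> 0"
    unfolding frac_def by auto
  then have "\<delta> x = (\<delta> a * b - a * \<delta> b) / (b * b)" "b * b \<noteq> 0" by (simp_all add: der_divide)
  moreover have "\<delta> a * b - a * \<delta> b \<in> R" "b * b \<in> R"
    using * R(2) by (simp_all add: sring_mult[OF R(1)] sring_diff[OF R(1)])
  ultimately show "\<delta> x \<in> frac R" using fracI by (simp only:)
qed

lemma diff_subfield_diff_gen: "diff_subfield \<delta> (diff_gen \<delta> A)"
  unfolding diff_gen_def diff_subfield_def by blast

lemma diff_gen_least: "diff_subfield \<delta> F \<Longrightarrow> A \<subseteq> F \<Longrightarrow> diff_gen \<delta> A \<subseteq> F"
  unfolding diff_gen_def by blast

lemma subset_diff_gen: "A \<subseteq> diff_gen \<delta> A"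
  unfolding diff_gen_def by blast

lemma diff_gen_mono: "A \<subseteq> B \<Longrightarrow> diff_gen \<delta> A \<subseteq> diff_gen \<delta> B"
  by (meson diff_gen_least diff_subfield_diff_gen subset_diff_gen subset_trans)

lemma sfield_constants: "sfield F \<Longrightarrow> sfield (constants \<delta> F)"
  unfolding sfield_def constants_def by (auto simp: der_0 der_1 der_add der_mult der_neg der_inverse)

lemma sfield_UNIV: "sfield UNIV" by (simp add: sfield_def)

text \<open>Linear disjointness of \<open>W\<close> from the constants. In a relation with one
  coefficient normalised to 1, differentiation kills that coefficient and leaves a relation between
  fewer constants, which is trivial by induction. So all coefficients are constants of
  \<open>W\<close>, against independence over those.\<close>

lemma constants_independent:
  assumes W: "diff_subfield \<delta> W" and "finite B" "B \<subseteq> constants \<delta> UNIV" "indep (constants \<delta> W) B"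
  shows "indep W B"
  using assms(2-)
proof (induction B)
  case (insert e B)
  have Ws: "sfield W" and Wr: "sring W" using W diff_subfield_iff sfield_imp_sring by blast+
  have kr: "sring (constants \<delta> W)" using sfield_constants[OF Ws] sfield_imp_sring by blast
  have "indep (constants \<delta> W) B" unfolding indep_def
  proof (intro allI impI)
    fix c assume c: "(\<forall>e\<in>B. c e \<in> constants \<delta> W) \<and> (\<Sum>e\<in>B. c e * e) = 0"
    have "(\<Sum>x\<in>insert e B. (c(e := 0)) x * x) = (\<Sum>x\<in>B. c x * x)"
      using insert.hyps by (simp add: fun_upd_def) (intro sum.cong, auto)
    moreover have "(c(e := 0)) x \<in> constants \<delta> W" if "x \<in> insert e B" for x
      using c that sring_0[OF kr] by auto
    ultimately have "x \<in> insert e B \<Longrightarrow> (c(e := 0)) x = 0" for x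
      using indepD[OF insert.prems(2), of "c(e := 0)" x] c by presburger
    then show "\<forall>e\<in>B. c e = 0" using insert.hyps by (metis fun_upd_other insertI2)
  qed
  then have IH: "indep W B" using insert by blast
  show ?case unfolding indep_def
  proof (intro allI impI)
    fix w assume w: "(\<forall>x\<in>insert e B. w x \<in> W) \<and> (\<Sum>x\<in>insert e B. w x * x) = 0"
    then have s: "w e * e + (\<Sum>x\<in>B. w x * x) = 0" using insert.hyps by simp
    have "w e = 0"
    proof (rule ccontr)
      assume n: "w e \<noteq> 0"
      define u where "u x = inverse (w e) * w x" for x
      have uW: "u x \<in> W" if "x \<in> insert e B" for x
        using w that unfolding u_def by (intro sring_mult[OF Wr] sfield_inv[OF Ws]) auto
      have "inverse (w e) * (w e * e + (\<Sum>x\<in>B. w x * x)) = 0" using s by simp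
      then have s': "e + (\<Sum>x\<in>B. u x * x) = 0"
        using n by (simp add: u_def distrib_left sum_distrib_left mult.assoc flip: mult.assoc[of _ _ e])
      have "\<delta> x = 0" if "x \<in> insert e B" for x using insert.prems(1) that by (auto simp: constants_def)
      then have "(\<Sum>x\<in>B. \<delta> (u x) * x) = \<delta> (e + (\<Sum>x\<in>B. u x * x))"
        by (simp add: der_add der_sum der_mult)
      then have "(\<Sum>x\<in>B. \<delta> (u x) * x) = 0" using s' by (simp add: der_0)
      moreover have "\<delta> (u x) \<in> W" if "x \<in> B" for x using W uW that by (simp add: diff_subfield_def)
      ultimately have d: "\<delta> (u x) = 0" if "x \<in> B" for x using indepD[OF IH, of "\<lambda>x. \<delta> (u x)"] that by blast
      have "u e = 1" using n by (simp add: u_def)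
      then have "(\<Sum>x\<in>insert e B. u x * x) = 0" using s' insert.hyps by simp
      moreover have "u x \<in> constants \<delta> W" if "x \<in> insert e B" for x
        using uW[OF that] d that \<open>u e = 1\<close> by (auto simp: constants_def der_1)
      ultimately have "u e = 0" using indepD[OF insert.prems(2), of u] by blast
      with \<open>u e = 1\<close> show False by simp
    qed
    moreover from this have "(\<Sum>x\<in>B. w x * x) = 0" using s by simp
    then have "\<forall>x\<in>B. w x = 0" using indepD[OF IH _ \<open>(\<Sum>x\<in>B. w x * x) = 0\<close>] w by blast
    ultimately show "\<forall>x\<in>insert e B. w x = 0" by simp
  qed
qed (simp add: indep_def)

text \<open>The constants \<open>c j\<close> are expanded in a basis over the constants of
  \<open>W\<close>. By linear disjointness each coordinate of the solution solves the linear
  equations separately, and the inequation survives in at least one coordinate.\<close>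

lemma constant_solution_descends:
  fixes w :: "'r \<Rightarrow> 'j \<Rightarrow> 'a"
  assumes W: "diff_subfield \<delta> W" and "finite J" and c: "\<And>j. j \<in> J \<Longrightarrow> c j \<in> constants \<delta> UNIV"
    and w: "\<And>r j. r \<in> R \<Longrightarrow> j \<in> J \<Longrightarrow> w r j \<in> W" "\<And>j. j \<in> J \<Longrightarrow> u j \<in> W"
    and eq: "\<And>r. r \<in> R \<Longrightarrow> (\<Sum>j\<in>J. w r j * c j) = 0" "(\<Sum>j\<in>J. u j * c j) \<noteq> 0"
  shows "\<exists>c'. (\<forall>j\<in>J. c' j \<in> constants \<delta> W) \<and> (\<forall>r\<in>R. (\<Sum>j\<in>J. w r j * c' j) = 0) \<and> (\<Sum>j\<in>J. u j * c' j) \<noteq> 0"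
proof -
  have Ws: "sfield W" and Wr: "sring W" using W diff_subfield_iff sfield_imp_sring by blast+
  obtain B \<kappa> where B: "finite B" "B \<subseteq> c ` J" "indep (constants \<delta> W) B"
    "\<And>j e. j \<in> J \<Longrightarrow> e \<in> B \<Longrightarrow> \<kappa> j e \<in> constants \<delta> W" "\<And>j. j \<in> J \<Longrightarrow> c j = (\<Sum>e\<in>B. \<kappa> j e * e)"
    using basis_exists[OF sfield_constants[OF Ws] assms(2), of c] by blast
  have "B \<subseteq> constants \<delta> UNIV" using B(2) c by auto
  then have ind: "indep W B" by (rule constants_independent[OF W B(1) _ B(3)])
  have kW: "\<kappa> j e \<in> W" if "j \<in> J" "e \<in> B" for j e using B(4)[OF that] by (simp add: constants_def)
  have exp: "(\<Sum>j\<in>J. g j * c j) = (\<Sum>e\<in>B. (\<Sum>j\<in>J. g j * \<kappa> j e) * e)" for g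
  proof -
    have "(\<Sum>j\<in>J. g j * c j) = (\<Sum>j\<in>J. \<Sum>e\<in>B. g j * \<kappa> j e * e)"
      using B(5) by (intro sum.cong) (auto simp: sum_distrib_left mult.assoc)
    also have "\<dots> = (\<Sum>e\<in>B. \<Sum>j\<in>J. g j * \<kappa> j e * e)" by (rule sum.swap)
    finally show ?thesis by (simp add: sum_distrib_right)
  qed
  obtain e where e: "e \<in> B" "(\<Sum>j\<in>J. u j * \<kappa> j e) \<noteq> 0"
    using eq(2) exp[of u] by (metis (no_types, lifting) mult_zero_left sum.neutral)
  have "(\<Sum>j\<in>J. w r j * \<kappa> j e) = 0" if "r \<in> R" for r
    by (rule indepD[OF ind, of "\<lambda>e. \<Sum>j\<in>J. w r j * \<kappa> j e"])
      (use eq(1)[OF that] exp[of "w r"] e w kW that in \<open>auto intro!: sring_sum[OF Wr] sring_mult[OF Wr]\<close>)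
  then show ?thesis using e B(4) by (intro exI[of _ "\<lambda>j. \<kappa> j e"]) auto
qed

lemma card_diff_gen:
  assumes "infinite X"
  shows "|diff_gen \<delta> X| \<le>o |X|"
proof -
  \<comment> \<open>All field operations and the derivation are packed into one tagged map, so that
    one closure step is the image of a product and its cardinality is immediate.\<close>
  define opr where "opr p = (case p of (n::nat, x, y) \<Rightarrow>
     if n = 0 then x else if n = 1 then x + y else if n = 2 then x * y else if n = 3 then - x
     else if n = 4 then inverse x else if n = 5 then \<delta> x else if n = 6 then 0 else 1)" for p :: "nat \<times> 'a \<times> 'a"
  define C where "C = rec_nat X (\<lambda>_ Y. opr ` (UNIV \<times> Y \<times> Y))"
  have C0: "C 0 = X" and CS: "C (Suc n) = opr ` (UNIV \<times> C n \<times> C n)" for n by (simp_all add: C_def)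
  have card: "|C n| \<le>o |X|" for n
  proof (induction n)
    case 0
    show ?case by (simp add: C0 card_of_refl ordIso_imp_ordLeq)
  next
    case (Suc n)
    have X: "\<not> finite (Field |X| )" using assms by (simp add: Field_card_of)
    have "|UNIV :: nat set| \<le>o |X|" using assms infinite_iff_card_of_nat by blast
    then have "|(UNIV :: nat set) \<times> C n \<times> C n| \<le>o |X|"
      by (intro card_of_Times_ordLeq_infinite_Field[OF X] Suc card_of_Card_order)
    then show ?case unfolding CS using card_of_image ordLeq_transitive by blast
  qed
  have mono: "C n \<subseteq> C (Suc n)" for n
  proof
    fix x assume "x \<in> C n"
    then have "opr (0, x, x) \<in> C (Suc n)" unfolding CS by blast
    then show "x \<in> C (Suc n)" by (simp add: opr_def)
  qed
  then have mono': "n \<le> m \<Longrightarrow> C n \<subseteq> C m" for n m by (rule lift_Suc_mono_le)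
  have mem: "opr (i, x, y) \<in> (\<Union>n. C n)" if xy: "x \<in> (\<Union>n. C n)" "y \<in> (\<Union>n. C n)" for i x y
  proof -
    obtain n m where "x \<in> C n" "y \<in> C m" using xy by blast
    then have "x \<in> C (max n m)" "y \<in> C (max n m)" using mono' by (meson max.cobounded1 max.cobounded2 subsetD)+
    then have "opr (i, x, y) \<in> C (Suc (max n m))" unfolding CS by blast
    then show ?thesis by blast
  qed
  obtain x\<^sub>0 where "x\<^sub>0 \<in> X" using assms by (metis finite.emptyI ex_in_conv)
  then have x0: "x\<^sub>0 \<in> (\<Union>n. C n)" using C0 by blast
  have "diff_subfield \<delta> (\<Union>n. C n)"
    unfolding diff_subfield_def
  proof (intro conjI ballI)
    show "0 \<in> (\<Union>n. C n)" using mem[OF x0 x0, of 6] by (simp add: opr_def)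
    show "1 \<in> (\<Union>n. C n)" using mem[OF x0 x0, of 7] by (simp add: opr_def)
    fix x assume x: "x \<in> (\<Union>n. C n)"
    show "- x \<in> (\<Union>n. C n)" using mem[OF x x, of 3] by (simp add: opr_def)
    show "inverse x \<in> (\<Union>n. C n)" using mem[OF x x, of 4] by (simp add: opr_def)
    show "\<delta> x \<in> (\<Union>n. C n)" using mem[OF x x, of 5] by (simp add: opr_def)
    fix y assume y: "y \<in> (\<Union>n. C n)"
    show "x + y \<in> (\<Union>n. C n)" using mem[OF x y, of 1] by (simp add: opr_def)
    show "x * y \<in> (\<Union>n. C n)" using mem[OF x y, of 2] by (simp add: opr_def)
  qed
  moreover have "X \<subseteq> (\<Union>n. C n)" using C0 by blast
  ultimately have "diff_gen \<delta> X \<subseteq> (\<Union>n. C n)" by (rule diff_gen_least)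
  then have "|diff_gen \<delta> X| \<le>o |\<Union>n. C n|" by (rule card_of_mono1)
  moreover have "|\<Union>n. C n| \<le>o |X|"
    using assms card infinite_iff_card_of_nat[of X] by (intro card_of_UNION_ordLeq_infinite) auto
  ultimately show ?thesis by (rule ordLeq_transitive)
qed

lemma diff_gen_lesspoll:
  assumes "infinite X" "X \<prec> Y" shows "diff_gen \<delta> X \<prec> Y"
  using card_diff_gen[OF assms(1)] assms(2) unfolding lesspoll_iff_ordLess by (rule ordLeq_ordLess_trans)

subsection \<open>Differential polynomial functions\<close>

text \<open>Functions take the place of formal differential polynomials: only their values at tuples
  of the field ever matter.\<close>

inductive_set dpoly :: "'a set \<Rightarrow> nat \<Rightarrow> ((nat \<Rightarrow> 'a) \<Rightarrow> 'a) set" for A m where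
  const: "a \<in> A \<Longrightarrow> (\<lambda>_. a) \<in> dpoly A m"
| var: "i < m \<Longrightarrow> (\<lambda>x. x i) \<in> dpoly A m"
| add: "f \<in> dpoly A m \<Longrightarrow> g \<in> dpoly A m \<Longrightarrow> (\<lambda>x. f x + g x) \<in> dpoly A m"
| mult: "f \<in> dpoly A m \<Longrightarrow> g \<in> dpoly A m \<Longrightarrow> (\<lambda>x. f x * g x) \<in> dpoly A m"
| neg: "f \<in> dpoly A m \<Longrightarrow> (\<lambda>x. - f x) \<in> dpoly A m"
| der: "f \<in> dpoly A m \<Longrightarrow> (\<lambda>x. \<delta> (f x)) \<in> dpoly A m"

lemma dpoly_diff: "f \<in> dpoly A m \<Longrightarrow> g \<in> dpoly A m \<Longrightarrow> (\<lambda>x. f x - g x) \<in> dpoly A m"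
  using dpoly.add[OF _ dpoly.neg, of f A m g] by simp

lemma dpoly_sum: "0 \<in> A \<Longrightarrow> (\<And>i. i \<in> I \<Longrightarrow> f i \<in> dpoly A m) \<Longrightarrow> (\<lambda>x. \<Sum>i\<in>I. f i x) \<in> dpoly A m"
  by (induction I rule: infinite_finite_induct) (auto simp: dpoly.const dpoly.add)

lemma dpoly_prod: "1 \<in> A \<Longrightarrow> (\<And>i. i \<in> I \<Longrightarrow> f i \<in> dpoly A m) \<Longrightarrow> (\<lambda>x. \<Prod>i\<in>I. f i x) \<in> dpoly A m"
  by (induction I rule: infinite_finite_induct) (auto simp: dpoly.const dpoly.mult)

lemma dpoly_power: "1 \<in> A \<Longrightarrow> f \<in> dpoly A m \<Longrightarrow> (\<lambda>x. f x ^ n) \<in> dpoly A m"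
  by (induction n) (auto simp: dpoly.const dpoly.mult)

lemma dpoly_mono: "f \<in> dpoly A m \<Longrightarrow> A \<subseteq> B \<Longrightarrow> m \<le> n \<Longrightarrow> f \<in> dpoly B n"
  by (induction rule: dpoly.induct) (auto intro: dpoly.intros)

lemma dpoly_cong: "f \<in> dpoly A m \<Longrightarrow> (\<And>i. i < m \<Longrightarrow> x i = y i) \<Longrightarrow> f x = f y"
  by (induction rule: dpoly.induct) auto

lemma dpoly_in: "f \<in> dpoly A m \<Longrightarrow> diff_subfield \<delta> F \<Longrightarrow> A \<subseteq> F \<Longrightarrow> (\<And>i. i < m \<Longrightarrow> x i \<in> F) \<Longrightarrow> f x \<in> F"
  by (induction rule: dpoly.induct) (auto simp: diff_subfield_def)

lemma sring_dpoly_image: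
  assumes "0 \<in> A" "1 \<in> A"
  shows "sring ((\<lambda>f. f x) ` dpoly A m)"
  unfolding sring_def
proof (intro conjI ballI)
  have I: "f x \<in> (\<lambda>f. f x) ` dpoly A m" if "f \<in> dpoly A m" for f using that by (rule imageI)
  show "0 \<in> (\<lambda>f. f x) ` dpoly A m" "1 \<in> (\<lambda>f. f x) ` dpoly A m" using I[OF dpoly.const] assms by blast+
  fix y assume "y \<in> (\<lambda>f. f x) ` dpoly A m"
  then obtain f where f: "f \<in> dpoly A m" "y = f x" by (rule imageE) 
  show "- y \<in> (\<lambda>f. f x) ` dpoly A m" unfolding f(2) using I[OF dpoly.neg[OF f(1)]] .
  fix z assume "z \<in> (\<lambda>f. f x) ` dpoly A m"
  then obtain g where g: "g \<in> dpoly A m" "z = g x" by (rule imageE) 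
  show "y + z \<in> (\<lambda>f. f x) ` dpoly A m" unfolding f(2) g(2) using I[OF dpoly.add[OF f(1) g(1)]] .
  show "y * z \<in> (\<lambda>f. f x) ` dpoly A m" unfolding f(2) g(2) using I[OF dpoly.mult[OF f(1) g(1)]] .
qed

definition dgen :: "'a set \<Rightarrow> nat \<Rightarrow> (nat \<Rightarrow> 'a) \<Rightarrow> 'a set" where
  "dgen A m x = diff_gen \<delta> (A \<union> x ` {..<m})"

lemma dgen_eq:
  assumes "0 \<in> A" "1 \<in> A"
  shows "dgen A m x = {f x / g x | f g. f \<in> dpoly A m \<and> g \<in> dpoly A m \<and> g x \<noteq> 0}"
proof -
  let ?R = "(\<lambda>f. f x) ` dpoly A m"
  have R: "sring ?R" by (rule sring_dpoly_image[OF assms])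
  have I: "f x \<in> ?R" if "f \<in> dpoly A m" for f using that by (rule imageI)
  have "\<delta> z \<in> ?R" if z: "z \<in> ?R" for z
  proof -
    from z obtain f where f: "f \<in> dpoly A m" "z = f x" by (rule imageE)
    show ?thesis unfolding f(2) using I[OF dpoly.der[OF f(1)]] .
  qed
  then have 1: "diff_subfield \<delta> (frac ?R)" by (rule diff_subfield_frac[OF R])
  have "A \<union> x ` {..<m} \<subseteq> ?R"
    using I[OF dpoly.const] I[OF dpoly.var] by blast
  then have "A \<union> x ` {..<m} \<subseteq> frac ?R" using sring_subset_frac[OF R] by blast
  then have "dgen A m x \<subseteq> frac ?R" unfolding dgen_def by (rule diff_gen_least[OF 1])
  moreover have "frac ?R \<subseteq> dgen A m x"
  proof (rule frac_subset)
    show "sfield (dgen A m x)" unfolding dgen_def using diff_subfield_diff_gen diff_subfield_iff by blast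
    show "?R \<subseteq> dgen A m x" unfolding dgen_def
    proof (rule image_subsetI)
      fix f assume "f \<in> dpoly A m"
      then show "f x \<in> diff_gen \<delta> (A \<union> x ` {..<m})"
        by (rule dpoly_in[OF _ diff_subfield_diff_gen]) (insert subset_diff_gen[of "A \<union> x ` {..<m}"], blast+)
    qed
  qed
  ultimately have "dgen A m x = frac ?R" by (rule subset_antisym)
  then show ?thesis unfolding frac_def by (simp only: image_iff) blast
qed

lemma dgen_diff_subfield: "diff_subfield \<delta> (dgen A m x)"
  unfolding dgen_def by (rule diff_subfield_diff_gen)

lemma dgen_const: "a \<in> A \<Longrightarrow> a \<in> dgen A m x" and dgen_var: "i < m \<Longrightarrow> x i \<in> dgen A m x"
  unfolding dgen_def by (rule subsetD[OF subset_diff_gen], simp)+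

lemma dgen_dpoly: "f \<in> dpoly A m \<Longrightarrow> f x \<in> dgen A m x"
  by (rule dpoly_in[OF _ dgen_diff_subfield]) (auto simp: dgen_const dgen_var)

lemma dgenE:
  assumes "0 \<in> A" "1 \<in> A" "z \<in> dgen A m x"
  obtains f g where "f \<in> dpoly A m" "g \<in> dpoly A m" "g x \<noteq> 0" "z = f x / g x"
  using assms(3) unfolding dgen_eq[OF assms(1,2)] by (elim CollectE exE conjE)

lemma dgenI: "f \<in> dpoly A m \<Longrightarrow> g \<in> dpoly A m \<Longrightarrow> f x / g x \<in> dgen A m x"
  by (rule sfield_divide[OF _ dgen_dpoly dgen_dpoly]) (rule conjunct1[OF dgen_diff_subfield[unfolded diff_subfield_iff]])

text \<open>\<open>a\<close> and \<open>b\<close> are generic points of the same differential ideal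
  over \<open>A\<close>. Equality of two fractions is the vanishing of a cross difference, which is
  a differential polynomial function again; hence mapping fractions in \<open>a\<close> to fractions
  in \<open>b\<close> is well defined and injective.\<close>

lemma dgen_iso:
  assumes A: "0 \<in> A" "1 \<in> A" and eq\<^sub>0: "\<forall>f\<in>dpoly A m. f a = 0 \<longleftrightarrow> f b = 0"
  shows "\<exists>s. (\<forall>f\<in>dpoly A m. \<forall>g\<in>dpoly A m. g a \<noteq> 0 \<longrightarrow> s (f a / g a) = f b / g b) \<and> bij_betw s (dgen A m a) (dgen A m b) \<and>
    (\<forall>x\<in>dgen A m a. \<forall>y\<in>dgen A m a. s (x + y) = s x + s y \<and> s (x * y) = s x * s y) \<and>
    (\<forall>x\<in>dgen A m a. s (\<delta> x) = \<delta> (s x)) \<and> (\<forall>x\<in>A. s x = x) \<and> (\<forall>i<m. s (a i) = b i)"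
proof -
  note eq = eq\<^sub>0[rule_format]
  define s where "s x = (SOME z. \<exists>f\<in>dpoly A m. \<exists>g\<in>dpoly A m. g a \<noteq> 0 \<and> x = f a / g a \<and> z = f b / g b)" for x
  have frac_eq: "f a / g a = f' a / g' a \<longleftrightarrow> f b / g b = f' b / g' b"
    if "f \<in> dpoly A m" "g \<in> dpoly A m" "f' \<in> dpoly A m" "g' \<in> dpoly A m" "g a \<noteq> 0" "g' a \<noteq> 0" for f g f' g'
  proof -
    have "(\<lambda>x. f x * g' x - f' x * g x) \<in> dpoly A m" using that by (intro dpoly_diff dpoly.mult)
    from eq[OF this] have "f a * g' a - f' a * g a = 0 \<longleftrightarrow> f b * g' b - f' b * g b = 0" .
    moreover have "g b \<noteq> 0" "g' b \<noteq> 0" using eq[OF that(2)] eq[OF that(4)] that(5,6) by simp_all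
    ultimately show ?thesis using that(5,6) by (simp add: frac_eq_eq)
  qed
  have s: "s (f a / g a) = f b / g b" if fg: "f \<in> dpoly A m" "g \<in> dpoly A m" "g a \<noteq> 0" for f g
    unfolding s_def
  proof (rule some_equality)
    show "\<exists>f'\<in>dpoly A m. \<exists>g'\<in>dpoly A m. g' a \<noteq> 0 \<and> f a / g a = f' a / g' a \<and> f b / g b = f' b / g' b"
      by (intro bexI[of _ f] bexI[of _ g] conjI refl fg)
    fix z assume "\<exists>f'\<in>dpoly A m. \<exists>g'\<in>dpoly A m. g' a \<noteq> 0 \<and> f a / g a = f' a / g' a \<and> z = f' b / g' b"
    then obtain f' g' where fg': "f' \<in> dpoly A m" "g' \<in> dpoly A m" "g' a \<noteq> 0" "f a / g a = f' a / g' a" "z = f' b / g' b"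
      by (elim bexE conjE)
    show "z = f b / g b" using frac_eq[OF fg(1,2) fg'(1,2) fg(3) fg'(3)] fg'(4,5) by simp
  qed
  have s1: "s (f a) = f b" if "f \<in> dpoly A m" for f
    using s[OF that dpoly.const[OF A(2)]] by simp
  have nz: "g b \<noteq> 0" if "g \<in> dpoly A m" "g a \<noteq> 0" for g using eq[OF that(1)] that(2) by simp
  have bij: "bij_betw s (dgen A m a) (dgen A m b)"
    unfolding bij_betw_def
  proof
    show "inj_on s (dgen A m a)"
    proof (rule inj_onI)
      fix x y assume xy: "x \<in> dgen A m a" "y \<in> dgen A m a" "s x = s y"
      obtain f g where fg: "f \<in> dpoly A m" "g \<in> dpoly A m" "g a \<noteq> 0" "x = f a / g a" by (rule dgenE[OF A xy(1)])
      obtain f' g' where fg': "f' \<in> dpoly A m" "g' \<in> dpoly A m" "g' a \<noteq> 0" "y = f' a / g' a" by (rule dgenE[OF A xy(2)])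
      show "x = y" using xy(3) s[OF fg(1-3)] s[OF fg'(1-3)] frac_eq[OF fg(1,2) fg'(1,2) fg(3) fg'(3)] fg(4) fg'(4) by simp
    qed
    show "s ` dgen A m a = dgen A m b"
    proof
      show "s ` dgen A m a \<subseteq> dgen A m b"
      proof
        fix z assume "z \<in> s ` dgen A m a"
        then obtain x where x: "z = s x" "x \<in> dgen A m a" by (rule imageE)
        obtain f g where fg: "f \<in> dpoly A m" "g \<in> dpoly A m" "g a \<noteq> 0" "x = f a / g a" by (rule dgenE[OF A x(2)])
        show "z \<in> dgen A m b" unfolding x(1) fg(4) s[OF fg(1-3)] by (rule dgenI[OF fg(1,2)])
      qed
      show "dgen A m b \<subseteq> s ` dgen A m a"
      proof
        fix z assume "z \<in> dgen A m b"
        then obtain f g where fg: "f \<in> dpoly A m" "g \<in> dpoly A m" "g b \<noteq> 0" "z = f b / g b" by (rule dgenE[OF A])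
        then have "g a \<noteq> 0" using eq[OF fg(2)] by simp
        from s[OF fg(1,2) this] show "z \<in> s ` dgen A m a"
          unfolding fg(4) by (intro image_eqI[of _ _ "f a / g a"] dgenI fg(1,2)) simp
      qed
    qed
  qed
  have hom: "s (x + y) = s x + s y \<and> s (x * y) = s x * s y" if xy: "x \<in> dgen A m a" "y \<in> dgen A m a" for x y
  proof -
    obtain f g where fg: "f \<in> dpoly A m" "g \<in> dpoly A m" "g a \<noteq> 0" "x = f a / g a" by (rule dgenE[OF A xy(1)])
    obtain f' g' where fg': "f' \<in> dpoly A m" "g' \<in> dpoly A m" "g' a \<noteq> 0" "y = f' a / g' a" by (rule dgenE[OF A xy(2)])
    have 1: "(\<lambda>x. f x * g' x + f' x * g x) \<in> dpoly A m" "(\<lambda>x. g x * g' x) \<in> dpoly A m" "(\<lambda>x. f x * f' x) \<in> dpoly A m"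
      by (intro dpoly.intros fg(1,2) fg'(1,2))+
    have 2: "g b \<noteq> 0" "g' b \<noteq> 0" using nz[OF fg(2,3)] nz[OF fg'(2,3)] by auto
    have "x + y = (f a * g' a + f' a * g a) / (g a * g' a)" "x * y = (f a * f' a) / (g a * g' a)"
      unfolding fg(4) fg'(4) using fg(3) fg'(3) by (simp_all add: field_simps)
    moreover have "s ((f a * g' a + f' a * g a) / (g a * g' a)) = (f b * g' b + f' b * g b) / (g b * g' b)"
      using s[OF 1(1,2)] fg(3) fg'(3) by simp
    moreover have "s ((f a * f' a) / (g a * g' a)) = (f b * f' b) / (g b * g' b)"
      using s[OF 1(3,2)] fg(3) fg'(3) by simp
    moreover have "s x = f b / g b" "s y = f' b / g' b" unfolding fg(4) fg'(4) by (rule s[OF fg(1-3)], rule s[OF fg'(1-3)])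
    moreover have "(f b * g' b + f' b * g b) / (g b * g' b) = f b / g b + f' b / g' b"
      "(f b * f' b) / (g b * g' b) = f b / g b * (f' b / g' b)" using 2 by (simp_all add: field_simps)
    ultimately show ?thesis by (simp only: simp_thms)
  qed
  have dhom: "s (\<delta> x) = \<delta> (s x)" if x: "x \<in> dgen A m a" for x
  proof -
    obtain f g where fg: "f \<in> dpoly A m" "g \<in> dpoly A m" "g a \<noteq> 0" "x = f a / g a" by (rule dgenE[OF A x])
    have 1: "(\<lambda>x. \<delta> (f x) * g x - f x * \<delta> (g x)) \<in> dpoly A m" "(\<lambda>x. g x * g x) \<in> dpoly A m"
      by (intro dpoly.intros dpoly_diff fg(1,2))+
    have "\<delta> x = (\<delta> (f a) * g a - f a * \<delta> (g a)) / (g a * g a)" using fg(3,4) by (simp add: der_divide)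
    then have "s (\<delta> x) = (\<delta> (f b) * g b - f b * \<delta> (g b)) / (g b * g b)" using s[OF 1] fg(3) by simp
    also have "\<dots> = \<delta> (f b / g b)" using nz[OF fg(2,3)] by (simp add: der_divide)
    finally show ?thesis using s[OF fg(1-3)] fg(4) by simp
  qed
  show ?thesis
  proof (intro exI[of _ s] conjI ballI allI impI)
    show "s x = x" if "x \<in> A" for x using s1[OF dpoly.const[OF that]] .
    show "s (a i) = b i" if "i < m" for i using s1[OF dpoly.var[OF that]] .
  qed (use s bij hom dhom in \<open>simp_all only: simp_thms\<close>)
qed

end

section \<open>Model theory of closed ordered differential fields\<close>

text \<open>The order is a parameter, because subfields of \<open>U\<close> will carry orders other
  than the restriction of the given one.\<close>

definition dstruct :: "('a::linordered_field \<Rightarrow> 'a) \<Rightarrow> 'a set \<Rightarrow> ('a \<Rightarrow> 'a \<Rightarrow> bool) \<Rightarrow> (fsym, rsym, 'a) struct" where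
  "dstruct D W lt = \<lparr>dom = W, fint = ord_diff_field_fint D, rint = (\<lambda>_ xs. lt (xs ! 0) (xs ! 1))\<rparr>"

lemma dstruct_sel [simp]: "dom (dstruct D W lt) = W" "fint (dstruct D W lt) = ord_diff_field_fint D"
  "rint (dstruct D W lt) p xs = lt (xs ! 0) (xs ! 1)"
  by (simp_all add: dstruct_def)

lemma length_2E: "length xs = 2 \<Longrightarrow> (\<And>x y. xs = [x, y] \<Longrightarrow> P) \<Longrightarrow> P"
  by (metis length_0_conv length_Suc_conv numeral_2_eq_2)

lemma teval_fint_cong: "fint M = fint N \<Longrightarrow> teval M v t = teval N v t"
proof (induction t)
  case (TFun f ts)
  then have "map (teval M v) ts = map (teval N v) ts" by simp
  then show ?case using TFun.prems by (simp only: teval.simps)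
qed simp

lemma sat_dstruct_UNIV:
  "wf_form ord_diff_ring_lang \<phi> \<Longrightarrow> sat (ord_diff_field_struct D UNIV) v \<phi> = sat (dstruct D UNIV (<)) v \<phi>"
proof (induction \<phi> arbitrary: v)
  case (FEq s t)
  then show ?case using teval_fint_cong[of "ord_diff_field_struct D UNIV" "dstruct D UNIV (<)"]
    by (simp add: ord_diff_field_struct_def)
next
  case (FRel p ts)
  then have "length ts = 2" by (simp add: ord_diff_ring_lang_def)
  then obtain s t where ts: "ts = [s, t]" by (rule length_2E)
  show ?case using teval_fint_cong[of "ord_diff_field_struct D UNIV" "dstruct D UNIV (<)" v]
    by (cases p) (simp add: ts ord_diff_field_struct_def)
qed (simp_all add: ord_diff_field_struct_def)

definition order_on :: "'a::field set \<Rightarrow> ('a \<Rightarrow> 'a \<Rightarrow> bool) \<Rightarrow> bool" where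
  "order_on W lt \<longleftrightarrow> (\<forall>x\<in>W. \<not> lt x x) \<and> (\<forall>x\<in>W. \<forall>y\<in>W. \<forall>z\<in>W. lt x y \<longrightarrow> lt y z \<longrightarrow> lt x z) \<and>
     (\<forall>x\<in>W. \<forall>y\<in>W. lt x y \<or> x = y \<or> lt y x) \<and> (\<forall>x\<in>W. \<forall>y\<in>W. \<forall>z\<in>W. lt x y \<longrightarrow> lt (x + z) (y + z)) \<and>
     (\<forall>x\<in>W. \<forall>y\<in>W. lt 0 x \<longrightarrow> lt 0 y \<longrightarrow> lt 0 (x * y))"

lemma order_on_less: "order_on W ((<) :: 'a::linordered_field \<Rightarrow> 'a \<Rightarrow> bool)"
  unfolding order_on_def by auto

lemma is_model_dstruct:
  assumes D: "derivation (D :: 'a::linordered_field \<Rightarrow> 'a)" and W: "diff_subfield D W" and lt: "order_on W lt"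
  shows "is_model ord_diff_ring_lang (dstruct D W lt) ODF"
proof -
  have inv: "\<exists>y\<in>W. x * y = 1" if "x \<noteq> 0" "x \<in> W" for x
    using that W by (intro bexI[of _ "inverse x"]) (auto simp: diff_subfield_def)
  have inv': "x = 0 \<or> (\<exists>y\<in>W. x * y = 1)" if "x \<in> W" for x using inv that by blast
  have W': "0 \<in> W" "1 \<in> W" "\<And>x y. x \<in> W \<Longrightarrow> y \<in> W \<Longrightarrow> x + y \<in> W" "\<And>x y. x \<in> W \<Longrightarrow> y \<in> W \<Longrightarrow> x * y \<in> W"
    "\<And>x. x \<in> W \<Longrightarrow> - x \<in> W" "\<And>x. x \<in> W \<Longrightarrow> D x \<in> W" using W by (auto simp: diff_subfield_def)
  have str: "is_struct ord_diff_ring_lang (dstruct D W lt)"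
    unfolding is_struct_def
  proof (intro conjI allI impI)
    show "dom (dstruct D W lt) \<noteq> {}" using W'(1) by auto
    fix f xs assume a: "farity ord_diff_ring_lang f = Some (length xs) \<and> set xs \<subseteq> dom (dstruct D W lt)"
    have l: "length xs = 1 \<Longrightarrow> \<exists>x. xs = [x]" "length xs = 2 \<Longrightarrow> \<exists>x y. xs = [x, y]"
      by (auto simp: numeral_2_eq_2 length_Suc_conv)
    show "fint (dstruct D W lt) f xs \<in> dom (dstruct D W lt)"
      using a W' l by (cases f) (auto simp: ord_diff_ring_lang_def)
  qed
  have lt': "\<And>x. x \<in> W \<Longrightarrow> \<not> lt x x" "\<And>x y z. x \<in> W \<Longrightarrow> y \<in> W \<Longrightarrow> z \<in> W \<Longrightarrow> lt x y \<Longrightarrow> lt y z \<Longrightarrow> lt x z"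
     "\<And>x y. x \<in> W \<Longrightarrow> y \<in> W \<Longrightarrow> lt x y \<or> x = y \<or> lt y x" "\<And>x y z. x \<in> W \<Longrightarrow> y \<in> W \<Longrightarrow> z \<in> W \<Longrightarrow> lt x y \<Longrightarrow> lt (x + z) (y + z)"
     "\<And>x y. x \<in> W \<Longrightarrow> y \<in> W \<Longrightarrow> lt 0 x \<Longrightarrow> lt 0 y \<Longrightarrow> lt 0 (x * y)"
    using lt unfolding order_on_def by blast+
  have lt3: "lt y x" if "x \<in> W" "y \<in> W" "\<not> lt x y" "x \<noteq> y" for x y using lt'(3) that by blast
  have D': "D (x + y) = D x + D y" "D (x * y) = D x * y + x * D y" for x y using D by (auto simp: derivation_def)
  show ?thesis unfolding is_model_def
  proof (intro conjI str ballI allI impI, goal_cases)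
    case (1 \<phi> v)
    have S: "sat (dstruct D W lt) v (FAll 0 (FAll 1 (FAll 2 \<psi>))) \<longleftrightarrow>
        (\<forall>x\<in>W. \<forall>y\<in>W. \<forall>z\<in>W. sat (dstruct D W lt) (v(0 := x, 1 := y, 2 := z)) \<psi>)" for \<psi> by (simp add: FAll_def)
    from 1(1) show ?case unfolding ODF_def Let_def image_insert image_empty
      by (elim insertE emptyE; hypsubst; unfold S; intro ballI; simp add: FImp_def FOr_def D' lt'(1) add.assoc mult.assoc distrib_left inv';
        (blast intro: lt'(2,4,5) lt3 add.commute mult.commute)?)
  qed
qed

definition exn :: "nat \<Rightarrow> ('f, 'p) form \<Rightarrow> ('f, 'p) form" where
  "exn m \<phi> = foldr (\<lambda>i. FEx (2 * i)) [0..<m] \<phi>"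

lemma exn_0: "exn 0 \<phi> = \<phi>" and exn_Suc: "exn (Suc m) \<phi> = exn m (FEx (2 * m) \<phi>)"
  by (simp_all add: exn_def)

lemma wf_exn: "wf_form \<L> (exn m \<phi>) = wf_form \<L> \<phi>"
  by (induction m arbitrary: \<phi>) (simp_all add: exn_0 exn_Suc)

lemma sat_exn:
  "sat M (mrg x w) (exn m \<phi>) \<longleftrightarrow> (\<exists>y. (\<forall>i<m. y i \<in> dom M) \<and> (\<forall>i\<ge>m. y i = x i) \<and> sat M (mrg y w) \<phi>)"
proof (induction m arbitrary: \<phi>)
  case 0
  have "y = x" if "\<forall>i\<ge>0. y i = x i" for y using that by (intro ext) simp
  then show ?case by (auto simp: exn_0)
next
  case (Suc m)
  show ?case unfolding exn_Suc Suc
  proof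
    assume "\<exists>y. (\<forall>i<m. y i \<in> dom M) \<and> (\<forall>i\<ge>m. y i = x i) \<and> sat M (mrg y w) (FEx (2 * m) \<phi>)"
    then obtain y u where y: "\<forall>i<m. y i \<in> dom M" "\<forall>i\<ge>m. y i = x i" "u \<in> dom M" "sat M (mrg (y(m := u)) w) \<phi>"
      by (auto simp: mrg_upd)
    show "\<exists>y. (\<forall>i<Suc m. y i \<in> dom M) \<and> (\<forall>i\<ge>Suc m. y i = x i) \<and> sat M (mrg y w) \<phi>"
      by (rule exI[of _ "y(m := u)"]) (use y in \<open>auto simp: less_Suc_eq\<close>)
  next
    assume "\<exists>y. (\<forall>i<Suc m. y i \<in> dom M) \<and> (\<forall>i\<ge>Suc m. y i = x i) \<and> sat M (mrg y w) \<phi>"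
    then obtain y where y: "\<forall>i<Suc m. y i \<in> dom M" "\<forall>i\<ge>Suc m. y i = x i" "sat M (mrg y w) \<phi>" by blast
    have "(y(m := x m))(m := y m) = y" by simp
    then have "sat M ((mrg (y(m := x m)) w)(2 * m := y m)) \<phi>" unfolding mrg_upd using y(3) by (simp only:)
    then have "sat M (mrg (y(m := x m)) w) (FEx (2 * m) \<phi>)" using y(1) unfolding sat.simps by blast
    then show "\<exists>y. (\<forall>i<m. y i \<in> dom M) \<and> (\<forall>i\<ge>m. y i = x i) \<and> sat M (mrg y w) (FEx (2 * m) \<phi>)"
      using y(1,2) by (intro exI[of _ "y(m := x m)"] conjI) auto
  qed
qed

primrec qf :: "('f, 'p) form \<Rightarrow> bool" where
  "qf (FEq s t) = True" | "qf (FRel p ts) = True" | "qf (FNot \<phi>) = qf \<phi>"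
| "qf (FAnd \<phi> \<psi>) = (qf \<phi> \<and> qf \<psi>)" | "qf (FEx n \<phi>) = False"

lemma teval_dom: "is_struct \<L> M \<Longrightarrow> wf_term \<L> t \<Longrightarrow> range v \<subseteq> dom M \<Longrightarrow> teval M v t \<in> dom M"
proof (induction t)
  case (TFun f ts)
  have "set (map (teval M v) ts) \<subseteq> dom M" using TFun by (auto simp: list_all_iff)
  then show ?case using TFun.prems unfolding is_struct_def by simp
qed auto

lemma teval_embedding:
  assumes "embedding \<L> M N e" "is_struct \<L> M" "range v \<subseteq> dom M"
  shows "wf_term \<L> t \<Longrightarrow> teval N (\<lambda>i. e (v i)) t = e (teval M v t)"
proof (induction t)
  case (TFun f ts)
  have wf: "\<And>t. t \<in> set ts \<Longrightarrow> wf_term \<L> t" using TFun.prems by (auto simp: list_all_iff)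
  then have "map (teval N (\<lambda>i. e (v i))) ts = map e (map (teval M v) ts)" using TFun.IH by simp
  moreover have "set (map (teval M v) ts) \<subseteq> dom M" using teval_dom[OF assms(2) wf assms(3)] by auto
  moreover have "farity \<L> f = Some (length (map (teval M v) ts))" using TFun.prems by simp
  ultimately show ?case using assms(1) unfolding embedding_def by (metis teval.simps(2))
qed simp

lemma sat_qf_embedding:
  assumes "embedding \<L> M N e" "is_struct \<L> M" "range v \<subseteq> dom M"
  shows "wf_form \<L> \<phi> \<Longrightarrow> qf \<phi> \<Longrightarrow> sat N (\<lambda>i. e (v i)) \<phi> = sat M v \<phi>"
proof (induction \<phi>)
  case (FEq s t)
  have "teval M v s \<in> dom M" "teval M v t \<in> dom M" using FEq teval_dom[OF assms(2) _ assms(3)] by auto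
  moreover have "inj_on e (dom M)" using assms(1) by (simp add: embedding_def)
  ultimately show ?case using FEq by (simp add: teval_embedding[OF assms] inj_on_eq_iff)
next
  case (FRel p ts)
  have wf: "\<And>t. t \<in> set ts \<Longrightarrow> wf_term \<L> t" using FRel.prems by (auto simp: list_all_iff)
  then have "map (teval N (\<lambda>i. e (v i))) ts = map e (map (teval M v) ts)" by (simp add: teval_embedding[OF assms])
  moreover have "set (map (teval M v) ts) \<subseteq> dom M" using teval_dom[OF assms(2) wf assms(3)] by auto
  moreover have "rarity \<L> p = Some (length (map (teval M v) ts))" using FRel.prems by simp
  ultimately show ?case using assms(1) unfolding embedding_def by (metis sat.simps(2))
qed auto

text \<open>A literal is a pair of a tag (0 for \<open>f = 0\<close>, 1 for \<open>f \<noteq> 0\<close>, anything else for \<open>0 < f\<close>) and a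
  function \<open>f\<close>.\<close>

definition holds :: "('a::zero \<Rightarrow> 'a \<Rightarrow> bool) \<Rightarrow> nat \<times> ((nat \<Rightarrow> 'a) \<Rightarrow> 'a) \<Rightarrow> (nat \<Rightarrow> 'a) \<Rightarrow> bool" where
  "holds lt l x = (if fst l = 0 then snd l x = 0 else if fst l = 1 then snd l x \<noteq> 0 else lt 0 (snd l x))"

locale codf = diff_field \<delta> for \<delta> :: "'u::linordered_field \<Rightarrow> 'u" +
  fixes CODF :: "(fsym, rsym) form set"
  assumes mc: "model_completion TYPE('u) ord_diff_ring_lang CODF ODF"
    and model: "is_model ord_diff_ring_lang (ord_diff_field_struct \<delta> UNIV) CODF"
    and sat: "saturated ord_diff_ring_lang (ord_diff_field_struct \<delta> UNIV)"
begin

abbreviation "LL \<equiv> ord_diff_ring_lang"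
abbreviation "UU \<equiv> ord_diff_field_struct \<delta> UNIV"

lemma dom_UU [simp]: "dom UU = UNIV" by (simp add: ord_diff_field_struct_def)

lemma infinite_UNIV_u: "infinite (UNIV :: 'u set)" by (rule infinite_UNIV_char_0)

lemma tfun_dpoly:
  assumes "f \<in> dpoly A m" "A \<noteq> {}" shows "tfun LL UU A f"
  using assms(1)
proof induction
  case (add f g)
  from tfun_2[OF add.IH, of Add] show ?case by (simp add: ord_diff_field_struct_def ord_diff_ring_lang_def)
next
  case (mult f g)
  from tfun_2[OF mult.IH, of Mul] show ?case by (simp add: ord_diff_field_struct_def ord_diff_ring_lang_def)
next
  case (neg f)
  from tfun_1[OF neg.IH, of Neg] show ?case by (simp add: ord_diff_field_struct_def ord_diff_ring_lang_def)
next
  case (der f)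
  from tfun_1[OF der.IH, of Der] show ?case by (simp add: ord_diff_field_struct_def ord_diff_ring_lang_def)
qed (simp_all add: tfun_const tfun_var assms(2))

lemma defbl_dpoly_eq:
  assumes "f \<in> dpoly A m" "0 \<in> A" shows "defbl LL UU A (\<lambda>x. f x = 0)"
  by (rule defbl_eq[OF tfun_dpoly[OF assms(1)] tfun_const[OF assms(2)]]) (use assms(2) in auto)

lemma defbl_dpoly_pos:
  assumes "f \<in> dpoly A m" "0 \<in> A" shows "defbl LL UU A (\<lambda>x. 0 < f x)"
proof -
  have "A \<noteq> {}" using assms(2) by auto
  from defbl_rel2[OF tfun_const[OF assms(2)] tfun_dpoly[OF assms(1) this], of Less] show ?thesis
    by (simp add: ord_diff_field_struct_def ord_diff_ring_lang_def)
qed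

text \<open>The ordered differential field \<open>A\<close> embeds into \<open>U\<close> in two
  ways, by inclusion and by \<open>s\<close>. Completeness of the model completion over the diagram
  of \<open>A\<close> says that both embeddings satisfy the same formulas.\<close>

lemma elemrel_ordered_iso:
  assumes A: "diff_subfield \<delta> A" and inj: "inj_on s A"
    and hom: "\<And>x y. x \<in> A \<Longrightarrow> y \<in> A \<Longrightarrow> s (x + y) = s x + s y" "\<And>x y. x \<in> A \<Longrightarrow> y \<in> A \<Longrightarrow> s (x * y) = s x * s y"
      "\<And>x. x \<in> A \<Longrightarrow> s (\<delta> x) = \<delta> (s x)" and ord: "\<And>x y. x \<in> A \<Longrightarrow> y \<in> A \<Longrightarrow> x < y \<longleftrightarrow> s x < s y"
  shows "elemrel LL UU {(x, s x) | x. x \<in> A}"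
proof -
  let ?A = "dstruct \<delta> A (<)"
  have A': "0 \<in> A" "1 \<in> A" "\<And>x. x \<in> A \<Longrightarrow> - x \<in> A" using A by (auto simp: diff_subfield_def)
  have s0: "s 0 = 0" using hom(1)[of 0 0] A' by simp
  have "s 1 \<noteq> 0" using inj A' s0 by (metis inj_onD zero_neq_one)
  moreover have "s 1 = s 1 * s 1" using hom(2)[of 1 1] A' by simp
  ultimately have s1: "s 1 = 1" by simp
  have sneg: "s (- x) = - s x" if "x \<in> A" for x
    using hom(1)[of x "- x"] that A' s0 by (simp add: eq_neg_iff_add_eq_0 add.commute)
  have emb: "embedding LL ?A UU e" if e: "inj_on e A" "e 0 = 0" "e 1 = 1" "\<And>x. x \<in> A \<Longrightarrow> e (- x) = - e x"
    "\<And>x y. x \<in> A \<Longrightarrow> y \<in> A \<Longrightarrow> e (x + y) = e x + e y" "\<And>x y. x \<in> A \<Longrightarrow> y \<in> A \<Longrightarrow> e (x * y) = e x * e y"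
    "\<And>x. x \<in> A \<Longrightarrow> e (\<delta> x) = \<delta> (e x)" "\<And>x y. x \<in> A \<Longrightarrow> y \<in> A \<Longrightarrow> x < y \<longleftrightarrow> e x < e y" for e
    unfolding embedding_def
  proof (intro conjI allI impI)
    fix f xs assume a: "farity LL f = Some (length xs) \<and> set xs \<subseteq> dom ?A"
    have l: "length xs = 1 \<Longrightarrow> \<exists>x. xs = [x]" "length xs = 2 \<Longrightarrow> \<exists>x y. xs = [x, y]"
      by (auto simp: numeral_2_eq_2 length_Suc_conv)
    show "e (fint ?A f xs) = fint UU f (map e xs)"
      using a l e by (cases f) (auto simp: ord_diff_ring_lang_def ord_diff_field_struct_def)
  next
    fix p xs assume a: "rarity LL p = Some (length xs) \<and> set xs \<subseteq> dom ?A"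
    then have "length xs = 2" by (simp add: ord_diff_ring_lang_def)
    then obtain x y where "xs = [x, y]" by (rule length_2E)
    then show "rint ?A p xs = rint UU p (map e xs)" using a e(8)
      by (cases p) (simp add: ord_diff_field_struct_def)
  qed (use e(1) in auto)
  have m: "is_model LL ?A ODF" by (rule is_model_dstruct[OF isder A order_on_less])
  show ?thesis unfolding elemrel_def
  proof (intro allI impI)
    fix \<phi> and v w :: "nat \<Rightarrow> 'u" assume *: "wf_form LL \<phi>" "\<forall>i. (v i, w i) \<in> {(x, s x) | x. x \<in> A}"
    then have v: "range v \<subseteq> A" "w = s \<circ> v" by (auto simp: fun_eq_iff)
    have "sat UU (id \<circ> v) \<phi> = sat UU (s \<circ> v) \<phi>"
    proof (rule mc[unfolded model_completion_def, THEN conjunct2, THEN conjunct2, THEN conjunct2, rule_format])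
      show "is_model LL ?A ODF \<and> is_model LL UU CODF \<and> is_model LL UU CODF \<and> embedding LL ?A UU id \<and> embedding LL ?A UU s \<and>
        wf_form LL \<phi> \<and> range v \<subseteq> dom ?A"
        by (intro conjI m model emb *(1)) (use v(1) inj hom ord s0 s1 sneg in \<open>simp_all\<close>)
    qed
    then show "sat UU v \<phi> = sat UU w \<phi>" by (simp add: v(2))
  qed
qed

text \<open>Equal zeros give a differential isomorphism of the generated fields, equal signs make it
  order preserving and therefore elementary, and its small domain allows homogeneity to extend it to
  \<open>U\<close>.\<close>

lemma automorphism_extension:
  assumes K: "diff_subfield \<delta> K" "K \<prec> (UNIV :: 'u set)"
    and eq: "\<And>f. f \<in> dpoly K m \<Longrightarrow> f a = 0 \<longleftrightarrow> f b = 0" "\<And>f. f \<in> dpoly K m \<Longrightarrow> 0 < f a \<longleftrightarrow> 0 < f b"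
  shows "\<exists>\<beta>. bij \<beta> \<and> (\<forall>x y. \<beta> (x + y) = \<beta> x + \<beta> y \<and> \<beta> (x * y) = \<beta> x * \<beta> y) \<and> (\<forall>x. \<beta> (\<delta> x) = \<delta> (\<beta> x)) \<and>
     (\<forall>x\<in>K. \<beta> x = x) \<and> (\<forall>i<m. \<beta> (a i) = b i)"
proof -
  have K': "0 \<in> K" "1 \<in> K" using K by (auto simp: diff_subfield_def)
  have "\<forall>f\<in>dpoly K m. f a = 0 \<longleftrightarrow> f b = 0" using eq(1) by (rule ballI)
  from dgen_iso[OF K' this] obtain s where s\<^sub>0:
    "\<forall>f\<in>dpoly K m. \<forall>g\<in>dpoly K m. g a \<noteq> 0 \<longrightarrow> s (f a / g a) = f b / g b" "bij_betw s (dgen K m a) (dgen K m b)"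
    "\<forall>x\<in>dgen K m a. \<forall>y\<in>dgen K m a. s (x + y) = s x + s y \<and> s (x * y) = s x * s y"
    "\<forall>x\<in>dgen K m a. s (\<delta> x) = \<delta> (s x)" "\<forall>x\<in>K. s x = x" "\<forall>i<m. s (a i) = b i" by (elim exE conjE)
  note s = s\<^sub>0[rule_format]
  have A: "diff_subfield \<delta> (dgen K m a)" by (rule dgen_diff_subfield)
  have pos: "0 < x \<longleftrightarrow> 0 < s x" if x: "x \<in> dgen K m a" for x
  proof -
    obtain f g where fg: "f \<in> dpoly K m" "g \<in> dpoly K m" "g a \<noteq> 0" "x = f a / g a" by (rule dgenE[OF K' x])
    \<comment> \<open>The sign of a fraction is the sign of the product of numerator and
      denominator, so signs of differential polynomial functions determine all signs in the
      generated field.\<close>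
    have "(\<lambda>x. f x * g x) \<in> dpoly K m" using fg(1,2) by (rule dpoly.mult)
    from eq(2)[OF this] have "0 < f a * g a \<longleftrightarrow> 0 < f b * g b" .
    moreover have "s x = f b / g b" unfolding fg(4) by (rule s(1)[OF fg(1-3)])
    ultimately show ?thesis using fg(4) by (simp add: zero_less_divide_iff zero_less_mult_iff)
  qed
  have ord: "x < y \<longleftrightarrow> s x < s y" if xy: "x \<in> dgen K m a" "y \<in> dgen K m a" for x y
  proof -
    have y': "y - x \<in> dgen K m a" using sring_diff[OF sfield_imp_sring] A xy diff_subfield_iff by blast
    have "s y = s (y - x) + s x" using s(3)[OF y' xy(1)] by simp
    then show ?thesis using pos[OF y'] by auto
  qed
  let ?S = "{(x, s x) | x. x \<in> dgen K m a}"
  have el: "elemrel LL UU ?S"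
    using s(2) by (intro elemrel_ordered_iso[OF A]) (simp_all add: s(3,4) ord bij_betw_def)
  have infK: "infinite K"
  proof
    assume "finite K"
    moreover have "range of_nat \<subseteq> K"
      using sring_of_nat[OF sfield_imp_sring] K(1) diff_subfield_iff by blast
    ultimately have "finite (range (of_nat :: nat \<Rightarrow> 'u))" by (rule finite_subset[rotated])
    then show False using infinite_UNIV_nat finite_imageD[OF _ inj_of_nat] by blast
  qed
  have KU: "K \<union> a ` {..<m} \<prec> (UNIV :: 'u set)"
    using card_of_Un_ordLess_infinite[OF infinite_UNIV_u, of K "a ` {..<m}"] K(2)
      finite_lesspoll_infinite[OF infinite_UNIV_u, of "a ` {..<m}"] by (simp add: lesspoll_iff_ordLess)
  have "dgen K m a \<prec> (UNIV :: 'u set)" unfolding dgen_def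
    by (rule diff_gen_lesspoll[OF _ KU]) (use infK in auto)
  moreover have "?S \<lesssim> dgen K m a" unfolding Setcompr_eq_image by (rule image_lepoll)
  ultimately have small: "?S \<prec> (UNIV :: 'u set)" by (rule lesspoll_trans1[rotated])
  have "?S \<noteq> {}" using dgen_const[OF K'(1)] by blast
  from saturated_homogeneous[OF sat dom_UU infinite_UNIV_u el this small]
  obtain g where g: "bij g" "\<forall>(x, y)\<in>?S. g x = y" "\<And>\<phi> v. wf_form LL \<phi> \<Longrightarrow> sat UU (g \<circ> v) \<phi> = sat UU v \<phi>" by blast
  have gs: "g x = s x" if "x \<in> dgen K m a" for x using g(2) that by auto
  have g2: "g (x + y) = g x + g y" "g (x * y) = g x * g y" "g (\<delta> x) = \<delta> (g x)" for x y
    using g(3)[of "FEq (TFun Add [TVar 0, TVar 1]) (TVar 2)" "\<lambda>i. if i = 0 then x else if i = 1 then y else x + y"]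
      g(3)[of "FEq (TFun Mul [TVar 0, TVar 1]) (TVar 2)" "\<lambda>i. if i = 0 then x else if i = 1 then y else x * y"]
      g(3)[of "FEq (TFun Der [TVar 0]) (TVar 2)" "\<lambda>i. if i = 0 then x else \<delta> x"]
    by (simp_all add: ord_diff_field_struct_def ord_diff_ring_lang_def)
  show ?thesis
  proof (intro exI[of _ g] conjI allI ballI impI)
    show "g x = x" if "x \<in> K" for x using gs[OF dgen_const[OF that]] s(5)[OF that] by simp
    show "g (a i) = b i" if "i < m" for i using gs[OF dgen_var[of i m a K]] s(6) that by simp
  qed (simp_all add: g(1) g2)
qed

text \<open>The formula is chosen before \<open>W\<close> and \<open>lt\<close>: one and the same
  formula expresses the literals for every order, which is what allows a comparison of
  orders.\<close>

lemma literals_formula: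
  assumes "finite S" "S \<subseteq> UNIV \<times> dpoly A m" "0 \<in> A"
  shows "\<exists>\<phi> w. wf_form LL \<phi> \<and> qf \<phi> \<and> range w \<subseteq> A \<and>
    (\<forall>W lt x. sat (dstruct \<delta> W lt) (mrg x w) \<phi> = (\<forall>l\<in>S. holds lt l x))"
  using assms(1,2)
proof induction
  case empty
  show ?case by (intro exI[of _ "FEq (TVar 0) (TVar 0)"] exI[of _ "\<lambda>_. 0"]) (use assms(3) in auto)
next
  case (insert l S)
  then obtain \<phi> w where IH: "wf_form LL \<phi>" "qf \<phi>" "range w \<subseteq> A" "\<And>W lt x. sat (dstruct \<delta> W lt) (mrg x w) \<phi> = (\<forall>l\<in>S. holds lt l x)"
    by auto
  obtain k f where l: "l = (k, f)" "f \<in> dpoly A m" using insert.prems by auto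
  have "A \<noteq> {}" using assms(3) by auto
  from tfun_dpoly[OF l(2) this] obtain t w' where t: "wf_term LL t" "range w' \<subseteq> A" "\<And>x. f x = teval UU (mrg x w') t"
    unfolding tfun_def by auto
  have t': "teval (dstruct \<delta> W lt) (mrg x w') t = f x" for W lt x
    unfolding t(3) by (rule teval_fint_cong) (simp add: ord_diff_field_struct_def)
  define z where "z = (TFun Zero [] :: fsym fterm)"
  define \<chi> where "\<chi> = (if k = 0 then FEq t z else if k = 1 then FNot (FEq t z) else FRel Less [z, t])"
  have \<chi>: "wf_form LL \<chi>" "qf \<chi>" "\<And>W lt x. sat (dstruct \<delta> W lt) (mrg x w') \<chi> = holds lt l x"
    using t(1) by (auto simp: \<chi>_def z_def ord_diff_ring_lang_def holds_def l(1) t')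
  have qf_fren: "qf (fren \<rho> \<phi>) = qf \<phi>" for \<rho> and \<phi> :: "(fsym, rsym) form" by (induction \<phi>) auto
  show ?case
    by (intro exI[of _ "FAnd (fren (pren 0) \<phi>) (fren (pren 1) \<chi>)"] exI[of _ "mrg w w'"] conjI allI)
      (use IH(1,2,3) \<chi>(1,2) t(2) in \<open>simp_all add: wf_fren sat_fren inj_pren[of 0] inj_pren[of 1, simplified] inj_pren mrg_pren_0 mrg_pren_1 mrg_pren_1[simplified] range_mrg qf_fren IH(4) \<chi>(3) conj_commute\<close>)
qed

text \<open>\<open>W\<close> with the order \<open>lt\<close> embeds into some model of
  \<open>CODF\<close>, in which the literals have a solution. The solvability is a statement over
  \<open>A\<close>, where \<open>lt\<close> agrees with the order of \<open>U\<close>, so it passes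
  to \<open>U\<close> by completeness over the diagram of \<open>A\<close>. Outside
  \<open>A\<close>, \<open>lt\<close> is unrelated to the order of \<open>U\<close>.\<close>

lemma realise_literals:
  assumes A: "diff_subfield \<delta> A" and W: "diff_subfield \<delta> W" "A \<subseteq> W" "order_on W lt"
    and lt: "\<And>x y. x \<in> A \<Longrightarrow> y \<in> A \<Longrightarrow> lt x y \<longleftrightarrow> x < y"
    and S: "finite S" "S \<subseteq> UNIV \<times> dpoly A m" and b: "\<And>i. i < m \<Longrightarrow> b i \<in> W" "\<And>l. l \<in> S \<Longrightarrow> holds lt l b"
  shows "\<exists>x. (\<forall>i\<ge>m. x i = 0) \<and> (\<forall>l\<in>S. holds (<) l x)"
proof -
  have A0: "0 \<in> A" using A by (simp add: diff_subfield_def)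
  obtain \<phi> w where \<phi>: "wf_form LL \<phi>" "qf \<phi>" "range w \<subseteq> A"
    "\<And>W lt x. sat (dstruct \<delta> W lt) (mrg x w) \<phi> = (\<forall>l\<in>S. holds lt l x)"
    using literals_formula[OF S A0] by blast
  let ?W = "dstruct \<delta> W lt" and ?A = "dstruct \<delta> A (<)"
  have mW: "is_model LL ?W ODF" by (rule is_model_dstruct[OF isder W(1,3)])
  have mA: "is_model LL ?A ODF" by (rule is_model_dstruct[OF isder A order_on_less])
  from mc[unfolded model_completion_def, THEN conjunct2, THEN conjunct2, THEN conjunct1, rule_format, OF mW]
  obtain N :: "(fsym, rsym, 'u) struct" and e where N: "is_model LL N CODF" "embedding LL ?W N e" by blast
  have eA: "embedding LL ?A N e"
    using N(2) W(2) lt unfolding embedding_def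
  proof (intro conjI allI impI, goal_cases)
    case (4 p xs)
    then have "length xs = 2" by (simp add: ord_diff_ring_lang_def)
    then obtain x y where xy: "xs = [x, y]" by (rule length_2E)
    have "rint ?W p xs = rint N p (map e xs)" using 4 by (metis dstruct_sel(1) subset_trans)
    then show ?case using 4 lt[of x y] by (simp add: xy)
  next
    case (3 f xs)
    then show ?case by (metis dstruct_sel(1,2) subset_trans)
  next
    case 1
    then show ?case by (metis dstruct_sel(1) inj_on_subset)
  next
    case 2
    then show ?case by (metis dstruct_sel(1) image_mono subset_trans)
  qed
  have eU: "embedding LL ?A UU id" unfolding embedding_def
  proof (intro conjI allI impI)
    fix p xs assume a: "rarity LL p = Some (length xs) \<and> set xs \<subseteq> dom ?A"
    then have "length xs = 2" by (simp add: ord_diff_ring_lang_def)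
    then obtain x y where "xs = [x, y]" by (rule length_2E)
    then show "rint ?A p xs = rint UU p (map id xs)"
      by (cases p) (simp add: ord_diff_field_struct_def)
  qed (auto simp: ord_diff_field_struct_def)
  define b' where "b' i = (if i < m then b i else 0)" for i
  have rb: "range b' \<subseteq> W" using b(1) A0 W(2) by (auto simp: b'_def)
  have "holds lt l b'" if "l \<in> S" for l
  proof -
    have "snd l \<in> dpoly A m" using S(2) that by auto
    then have "snd l b' = snd l b" by (rule dpoly_cong) (simp add: b'_def)
    then show ?thesis using b(2)[OF that] by (simp add: holds_def)
  qed
  then have "sat ?W (mrg b' w) \<phi>" using \<phi>(4) by blast
  moreover have "range (mrg b' w) \<subseteq> dom ?W" using range_mrg[OF rb, of w] \<phi>(3) W(2) by simp
  moreover have "is_struct LL ?W" using mW by (simp add: is_model_def)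
  ultimately have "sat N (\<lambda>i. e (mrg b' w i)) \<phi>"
    using sat_qf_embedding[OF N(2) _ _ \<phi>(1,2), of "mrg b' w"] by simp
  then have sN: "sat N (e \<circ> mrg b' w) \<phi>" by (simp only: comp_def)
  have emrg: "e \<circ> mrg x w = mrg (e \<circ> x) (e \<circ> w)" for x by (rule ext) (simp add: mrg_def)
  from sN have "sat N (mrg (e \<circ> b') (e \<circ> w)) \<phi>" by (simp only: emrg)
  \<comment> \<open>Quantifying the \<open>m\<close> coordinates away leaves only parameters from
    \<open>A\<close>; beyond \<open>m\<close> both assignments are images of 0.\<close>
  then have "sat N (mrg (e \<circ> (\<lambda>_. 0)) (e \<circ> w)) (exn m \<phi>)"
    unfolding sat_exn using N(2) rb
    by (intro exI[of _ "e \<circ> b'"] conjI) (auto simp: b'_def embedding_def)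
  then have "sat N (e \<circ> mrg (\<lambda>_. 0) w) (exn m \<phi>)" by (simp only: emrg)
  moreover have "sat UU (id \<circ> mrg (\<lambda>_. 0) w) (exn m \<phi>) = sat N (e \<circ> mrg (\<lambda>_. 0) w) (exn m \<phi>)"
  proof (rule mc[unfolded model_completion_def, THEN conjunct2, THEN conjunct2, THEN conjunct2, rule_format])
    show "is_model LL ?A ODF \<and> is_model LL UU CODF \<and> is_model LL N CODF \<and> embedding LL ?A UU id \<and> embedding LL ?A N e \<and>
        wf_form LL (exn m \<phi>) \<and> range (mrg (\<lambda>_. 0) w) \<subseteq> dom ?A"
    proof (intro conjI mA model N(1) eU eA)
      have "range (\<lambda>_::nat. 0) \<subseteq> A" using A0 by auto
      from range_mrg[OF this \<phi>(3)] show "range (mrg (\<lambda>_. 0) w) \<subseteq> dom ?A" by (simp only: dstruct_sel)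
    qed (simp only: wf_exn \<phi>(1))
  qed
  ultimately have "sat UU (mrg (\<lambda>_. 0) w) (exn m \<phi>)" by (simp only: id_comp)
  then obtain y where y: "\<forall>i\<ge>m. y i = 0" "sat UU (mrg y w) \<phi>" unfolding sat_exn by auto
  have "\<forall>l\<in>S. holds (<) l y" using y(2) unfolding sat_dstruct_UNIV[OF \<phi>(1)] \<phi>(4) .
  with y(1) show ?thesis by blast
qed

end

section \<open>Embedding into Laurent series\<close>

subsection \<open>Simple extensions\<close>

definition polyA :: "'a::zero set \<Rightarrow> 'a poly \<Rightarrow> bool" where
  "polyA A p \<longleftrightarrow> (\<forall>i. coeff p i \<in> A)"

definition adj :: "'a::field set \<Rightarrow> 'a \<Rightarrow> 'a set" where
  "adj A x = frac {poly p x | p. polyA A p}"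

definition transc :: "'a::field set \<Rightarrow> 'a \<Rightarrow> bool" where
  "transc A x \<longleftrightarrow> (\<forall>p. polyA A p \<and> p \<noteq> 0 \<longrightarrow> poly p x \<noteq> 0)"

definition hom_on :: "'a::field set \<Rightarrow> ('a \<Rightarrow> 'b::field) \<Rightarrow> bool" where
  "hom_on A \<psi> \<longleftrightarrow> \<psi> 1 = 1 \<and> (\<forall>x\<in>A. \<forall>y\<in>A. \<psi> (x + y) = \<psi> x + \<psi> y \<and> \<psi> (x * y) = \<psi> x * \<psi> y)"

context
  fixes A :: "'a::comm_ring_1 set" assumes A: "sring A"
begin
lemma polyA_0: "polyA A 0" by (simp add: polyA_def sring_0[OF A])
lemma polyA_add: "polyA A p \<Longrightarrow> polyA A q \<Longrightarrow> polyA A (p + q)"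
  by (simp add: polyA_def sring_add[OF A])
lemma polyA_neg: "polyA A p \<Longrightarrow> polyA A (- p)" by (simp add: polyA_def sring_neg[OF A])
lemma polyA_diff: "polyA A p \<Longrightarrow> polyA A q \<Longrightarrow> polyA A (p - q)"
  by (simp add: polyA_def sring_diff[OF A])
lemma polyA_mult: "polyA A p \<Longrightarrow> polyA A q \<Longrightarrow> polyA A (p * q)"
  by (simp add: polyA_def coeff_mult sring_sum[OF A] sring_mult[OF A])
lemma polyA_const: "c \<in> A \<Longrightarrow> polyA A [:c:]"
  by (simp add: polyA_def coeff_pCons sring_0[OF A] split: nat.split)
lemma polyA_X: "polyA A [:0, 1:]"
  by (simp add: polyA_def coeff_pCons sring_0[OF A] sring_1[OF A] split: nat.split)
lemma polyA_smult: "c \<in> A \<Longrightarrow> polyA A p \<Longrightarrow> polyA A (smult c p)"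
  by (simp add: polyA_def sring_mult[OF A])
lemma polyA_monom: "c \<in> A \<Longrightarrow> polyA A (monom c n)"
  by (simp add: polyA_def sring_0[OF A])
lemma polyA_poly: "polyA A p \<Longrightarrow> x \<in> A \<Longrightarrow> poly p x \<in> A"
  by (simp add: poly_altdef polyA_def sring_sum[OF A] sring_mult[OF A] sring_power[OF A])
end

lemma polyA_pderiv:
  assumes A: "sring (A :: 'a::idom set)" and "polyA A p" shows "polyA A (pderiv p)"
  using assms(2) sring_of_nat[OF A, of "Suc _"] by (simp add: polyA_def coeff_pderiv sring_mult[OF A] del: of_nat_Suc)

lemma polyA_pCons: "polyA A (pCons a p) \<longleftrightarrow> a \<in> A \<and> polyA A p"
  unfolding polyA_def by (metis coeff_pCons_0 coeff_pCons_Suc not0_implies_Suc)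

lemma sring_poly_image:
  assumes A: "sring (A :: 'a::comm_ring_1 set)" shows "sring {poly p x | p. polyA A p}"
  unfolding sring_def
proof (intro conjI ballI)
  show "0 \<in> {poly p x | p. polyA A p}" using polyA_0[OF A] by (intro CollectI exI[of _ 0]) simp
  show "1 \<in> {poly p x | p. polyA A p}" using polyA_const[OF A sring_1[OF A]]
    by (intro CollectI exI[of _ "[:1:]"]) simp
  fix y assume "y \<in> {poly p x | p. polyA A p}"
  then obtain p where p: "y = poly p x" "polyA A p" by blast
  show "- y \<in> {poly p x | p. polyA A p}" using p polyA_neg[OF A p(2)] by (intro CollectI exI[of _ "- p"]) simp
  fix z assume "z \<in> {poly p x | p. polyA A p}"
  then obtain q where q: "z = poly q x" "polyA A q" by blast
  show "y + z \<in> {poly p x | p. polyA A p}" using p q polyA_add[OF A p(2) q(2)] by (intro CollectI exI[of _ "p + q"]) simp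
  show "y * z \<in> {poly p x | p. polyA A p}" using p q polyA_mult[OF A p(2) q(2)] by (intro CollectI exI[of _ "p * q"]) simp
qed

lemma sfield_adj: "sfield A \<Longrightarrow> sfield (adj A x)"
  unfolding adj_def by (intro sfield_frac sring_poly_image sfield_imp_sring)

lemma adj_mem:
  assumes A: "sfield A"
  shows "A \<subseteq> adj A x" "x \<in> adj A x"
proof -
  note Ar = sfield_imp_sring[OF A]
  have *: "poly p x \<in> adj A x" if "polyA A p" for p
    unfolding adj_def by (rule subsetD[OF sring_subset_frac[OF sring_poly_image[OF Ar]]]) (use that in blast)
  show "A \<subseteq> adj A x" using *[OF polyA_const[OF Ar]] by auto
  show "x \<in> adj A x" using *[OF polyA_X[OF Ar]] by simp
qed

lemma adj_least:
  assumes F: "sfield F" "A \<subseteq> F" "x \<in> F" shows "adj A x \<subseteq> F"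
  unfolding adj_def
proof (rule frac_subset[OF F(1)], safe)
  fix p assume "polyA A p"
  then have "polyA F p" using F(2) by (auto simp: polyA_def)
  then show "poly p x \<in> F" by (rule polyA_poly[OF sfield_imp_sring[OF F(1)] _ F(3)])
qed

context
  fixes A :: "'a::field set" and \<psi> :: "'a \<Rightarrow> 'b::field"
  assumes A: "sfield A" and \<psi>: "hom_on A \<psi>"
begin
lemma hom_add: "x \<in> A \<Longrightarrow> y \<in> A \<Longrightarrow> \<psi> (x + y) = \<psi> x + \<psi> y"
  and hom_mult: "x \<in> A \<Longrightarrow> y \<in> A \<Longrightarrow> \<psi> (x * y) = \<psi> x * \<psi> y" and hom_1: "\<psi> 1 = 1"
  using \<psi> by (auto simp: hom_on_def)
lemma hom_0: "\<psi> 0 = 0"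
proof -
  have "0 \<in> A" using A by (simp add: sfield_def)
  from hom_add[OF this this] have "\<psi> 0 + 0 = \<psi> 0 + \<psi> 0" by simp
  then show ?thesis by (simp only: add_left_cancel)
qed
lemma hom_neg: "x \<in> A \<Longrightarrow> \<psi> (- x) = - \<psi> x"
  using hom_add[of x "- x"] A hom_0 by (simp add: sfield_def eq_neg_iff_add_eq_0 add.commute)
lemma hom_diff: "x \<in> A \<Longrightarrow> y \<in> A \<Longrightarrow> \<psi> (x - y) = \<psi> x - \<psi> y"
  using hom_add[of x "- y"] hom_neg[of y] A by (simp add: sfield_def)
lemma hom_inverse: "x \<in> A \<Longrightarrow> \<psi> (inverse x) = inverse (\<psi> x)"
proof (cases "x = 0")
  case False
  assume x: "x \<in> A"
  then have "\<psi> x * \<psi> (inverse x) = 1" using hom_mult[of x "inverse x"] False hom_1 sfield_inv[OF A] by simp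
  then show ?thesis by (metis inverse_unique)
qed (simp add: hom_0)
lemma hom_eq_0: "x \<in> A \<Longrightarrow> \<psi> x = 0 \<longleftrightarrow> x = 0"
proof -
  assume x: "x \<in> A"
  have "\<psi> x \<noteq> 0" if "x \<noteq> 0"
    using hom_mult[OF x sfield_inv[OF A x]] hom_1 that by auto
  then show ?thesis using hom_0 by auto
qed
lemma hom_sum: "(\<And>i. i \<in> I \<Longrightarrow> f i \<in> A) \<Longrightarrow> \<psi> (sum f I) = (\<Sum>i\<in>I. \<psi> (f i))"
  by (induction I rule: infinite_finite_induct) (auto simp: hom_0 hom_add sring_sum[OF sfield_imp_sring[OF A]])
lemma coeff_hom: "coeff (map_poly \<psi> p) n = \<psi> (coeff p n)"
  by (rule coeff_map_poly) (rule hom_0)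
lemma map_poly_hom_add: "polyA A p \<Longrightarrow> polyA A q \<Longrightarrow> map_poly \<psi> (p + q) = map_poly \<psi> p + map_poly \<psi> q"
  by (rule poly_eqI) (simp add: coeff_hom hom_add polyA_def)
lemma map_poly_hom_mult: "polyA A p \<Longrightarrow> polyA A q \<Longrightarrow> map_poly \<psi> (p * q) = map_poly \<psi> p * map_poly \<psi> q"
  by (rule poly_eqI) (simp add: coeff_hom coeff_mult hom_sum hom_mult polyA_def sring_mult[OF sfield_imp_sring[OF A]])
lemma map_poly_hom_diff: "polyA A p \<Longrightarrow> polyA A q \<Longrightarrow> map_poly \<psi> (p - q) = map_poly \<psi> p - map_poly \<psi> q"
  by (rule poly_eqI) (simp add: coeff_hom hom_diff polyA_def)
lemma map_poly_hom_eq_0: "polyA A p \<Longrightarrow> map_poly \<psi> p = 0 \<longleftrightarrow> p = 0"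
  by (auto simp: poly_eq_iff coeff_hom hom_eq_0 polyA_def)

text \<open>One direction of \<open>eq\<close> makes the extension well defined on fractions, the
  other keeps denominators nonzero.\<close>

lemma hom_extend:
  assumes eq: "\<And>p. polyA A p \<Longrightarrow> poly p \<beta> = 0 \<longleftrightarrow> poly (map_poly \<psi> p) \<xi> = 0"
  shows "\<exists>\<psi>'. hom_on (adj A \<beta>) \<psi>' \<and> (\<forall>x\<in>A. \<psi>' x = \<psi> x) \<and> \<psi>' \<beta> = \<xi>"
proof -
  note Ar = sfield_imp_sring[OF A]
  define ev where "ev p = poly (map_poly \<psi> p) \<xi>" for p
  define s where "s x = (SOME z. \<exists>p q. polyA A p \<and> polyA A q \<and> poly q \<beta> \<noteq> 0 \<and> x = poly p \<beta> / poly q \<beta> \<and> z = ev p / ev q)" for x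
  have ev_add: "ev (p + q) = ev p + ev q" and ev_mult: "ev (p * q) = ev p * ev q" and ev_diff: "ev (p - q) = ev p - ev q"
    if "polyA A p" "polyA A q" for p q
    using that by (simp_all add: ev_def map_poly_hom_add map_poly_hom_mult map_poly_hom_diff)
  have nz: "ev q \<noteq> 0" if "polyA A q" "poly q \<beta> \<noteq> 0" for q using eq[OF that(1)] that(2) by (simp add: ev_def)
  have s: "s (poly p \<beta> / poly q \<beta>) = ev p / ev q" if pq: "polyA A p" "polyA A q" "poly q \<beta> \<noteq> 0" for p q
    unfolding s_def
  proof (rule some_equality)
    show "\<exists>p' q'. polyA A p' \<and> polyA A q' \<and> poly q' \<beta> \<noteq> 0 \<and> poly p \<beta> / poly q \<beta> = poly p' \<beta> / poly q' \<beta> \<and> ev p / ev q = ev p' / ev q'"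
      using pq by blast
    fix z assume "\<exists>p' q'. polyA A p' \<and> polyA A q' \<and> poly q' \<beta> \<noteq> 0 \<and> poly p \<beta> / poly q \<beta> = poly p' \<beta> / poly q' \<beta> \<and> z = ev p' / ev q'"
    then obtain p' q' where pq': "polyA A p'" "polyA A q'" "poly q' \<beta> \<noteq> 0" "poly p \<beta> / poly q \<beta> = poly p' \<beta> / poly q' \<beta>" "z = ev p' / ev q'" by blast
    have h1: "poly (p * q' - p' * q) \<beta> = 0" using pq'(3,4) pq(3) by (simp add: frac_eq_eq)
    have h2: "polyA A (p * q' - p' * q)" using pq pq' by (intro polyA_diff[OF Ar] polyA_mult[OF Ar])
    have "ev (p * q' - p' * q) = 0" using iffD1[OF eq[OF h2] h1] by (simp only: ev_def)
    then have "ev p * ev q' = ev p' * ev q" using pq pq' by (simp add: ev_diff ev_mult polyA_mult[OF Ar])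
    then show "z = ev p / ev q" using pq'(5) nz[OF pq(2,3)] nz[OF pq'(2,3)] by (simp add: frac_eq_eq)
  qed
  have c: "s x = \<psi> x" if "x \<in> A" for x
    using s[OF polyA_const[OF Ar that] polyA_const[OF Ar sring_1[OF Ar]]] by (simp add: ev_def map_poly_pCons hom_0 hom_1)
  have b: "s \<beta> = \<xi>"
    using s[OF polyA_X[OF Ar] polyA_const[OF Ar sring_1[OF Ar]]] by (simp add: ev_def map_poly_pCons hom_0 hom_1)
  have "hom_on (adj A \<beta>) s" unfolding hom_on_def
  proof (intro conjI ballI)
    show "s 1 = 1" using c[OF sring_1[OF Ar]] hom_1 by simp
    fix x y assume "x \<in> adj A \<beta>" "y \<in> adj A \<beta>"
    then obtain p q p' q' where x: "x = poly p \<beta> / poly q \<beta>" "polyA A p" "polyA A q" "poly q \<beta> \<noteq> 0"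
      and y: "y = poly p' \<beta> / poly q' \<beta>" "polyA A p'" "polyA A q'" "poly q' \<beta> \<noteq> 0"
      unfolding adj_def frac_def by blast
    note n = nz[OF x(3,4)] nz[OF y(3,4)]
    have "x + y = poly (p * q' + p' * q) \<beta> / poly (q * q') \<beta>" "x * y = poly (p * p') \<beta> / poly (q * q') \<beta>"
      unfolding x(1) y(1) using x(4) y(4) by (simp_all add: field_simps)
    moreover have "s (poly (p * q' + p' * q) \<beta> / poly (q * q') \<beta>) = (ev p * ev q' + ev p' * ev q) / (ev q * ev q')"
      using s[OF polyA_add[OF Ar polyA_mult[OF Ar x(2) y(3)] polyA_mult[OF Ar y(2) x(3)]] polyA_mult[OF Ar x(3) y(3)]] x y
      by (simp add: ev_add ev_mult polyA_mult[OF Ar])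
    moreover have "s (poly (p * p') \<beta> / poly (q * q') \<beta>) = (ev p * ev p') / (ev q * ev q')"
      using s[OF polyA_mult[OF Ar x(2) y(2)] polyA_mult[OF Ar x(3) y(3)]] x y by (simp add: ev_mult)
    moreover have "s x = ev p / ev q" "s y = ev p' / ev q'"
      unfolding x(1) y(1) by (rule s[OF x(2-4)], rule s[OF y(2-4)])
    moreover have "(ev p * ev q' + ev p' * ev q) / (ev q * ev q') = ev p / ev q + ev p' / ev q'"
      "(ev p * ev p') / (ev q * ev q') = ev p / ev q * (ev p' / ev q')" using n by (simp_all add: field_simps)
    ultimately show "s (x + y) = s x + s y" "s (x * y) = s x * s y" by (simp_all only:)
  qed
  then show ?thesis using b c by (intro exI[of _ s]) simp
qed

lemma polyA_division:
  assumes g: "polyA A g" "g \<noteq> 0"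
  shows "polyA A p \<Longrightarrow> \<exists>q r. polyA A q \<and> polyA A r \<and> p = q * g + r \<and> (r = 0 \<or> degree r < degree g)"
proof (induction "degree p" arbitrary: p rule: less_induct)
  case less
  note Ar = sfield_imp_sring[OF A]
  show ?case
  proof (cases "p = 0 \<or> degree p < degree g")
    case True
    then show ?thesis using less.prems polyA_0[OF Ar] by (intro exI[of _ 0] exI[of _ p]) auto
  next
    case False
    then have p: "p \<noteq> 0" "degree g \<le> degree p" by auto
    define c where "c = monom (lead_coeff p / lead_coeff g) (degree p - degree g)"
    have cA: "polyA A c" unfolding c_def using less.prems g(1)
      by (intro polyA_monom[OF Ar] sfield_divide[OF A]) (auto simp: polyA_def)
    have "lead_coeff c = lead_coeff p / lead_coeff g" "c \<noteq> 0" "degree c = degree p - degree g"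
      using p(1) g(2) by (simp_all add: c_def degree_monom_eq)
    then have cg: "degree (c * g) = degree p" "lead_coeff (c * g) = lead_coeff p"
      using p g(2) degree_mult_eq[of c g] lead_coeff_mult[of c g] by simp_all
    define p' where "p' = p - c * g"
    have p'A: "polyA A p'" unfolding p'_def by (intro polyA_diff[OF Ar] polyA_mult[OF Ar] less.prems cA g(1))
    show ?thesis
    proof (cases "p' = 0")
      case True
      then show ?thesis using cA polyA_0[OF Ar] by (intro exI[of _ c] exI[of _ 0]) (simp add: p'_def)
    next
      case False
      have "degree p' < degree p \<or> degree p = 0"
      proof -
        have "degree p' \<le> degree p" unfolding p'_def using cg(1) by (simp add: degree_diff_le)
        moreover have "coeff p' (degree p) = 0" unfolding p'_def using cg by simp
        ultimately show ?thesis using False by (metis le_neq_implies_less leading_coeff_0_iff)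
      qed
      moreover have "degree p \<noteq> 0"
      proof
        assume "degree p = 0"
        then have "coeff p' 0 = 0" "degree p' = 0" using cg degree_diff_le[of p 0 "c * g"] unfolding p'_def by auto
        then show False using False by (metis leading_coeff_0_iff)
      qed
      ultimately have "degree p' < degree p" by simp
      from less.hyps[OF this p'A] obtain q r where "polyA A q" "polyA A r" "p' = q * g + r" "r = 0 \<or> degree r < degree g" by blast
      then show ?thesis using cA
        by (intro exI[of _ "q + c"] exI[of _ r]) (auto simp: p'_def algebra_simps intro: polyA_add[OF Ar])
    qed
  qed
qed

lemma min_poly_divides:
  assumes J: "\<And>p. p \<in> J \<Longrightarrow> polyA A p" "\<And>p q. p \<in> J \<Longrightarrow> polyA A q \<Longrightarrow> q * p \<in> J" "\<And>p q. p \<in> J \<Longrightarrow> q \<in> J \<Longrightarrow> p - q \<in> J"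
    and g: "g \<in> J" "g \<noteq> 0" "\<And>p. p \<in> J \<Longrightarrow> p \<noteq> 0 \<Longrightarrow> degree g \<le> degree p" and p: "p \<in> J"
  shows "\<exists>q. polyA A q \<and> p = q * g"
proof -
  obtain q r where qr: "polyA A q" "polyA A r" "p = q * g + r" "r = 0 \<or> degree r < degree g"
    using polyA_division[OF J(1)[OF g(1)] g(2) J(1)[OF p]] by blast
  have "p - q * g \<in> J" by (rule J(3)[OF p J(2)[OF g(1) qr(1)]])
  then have "r \<in> J" using qr(3) by simp
  have "r = 0"
  proof (rule ccontr)
    assume "r \<noteq> 0"
    from g(3)[OF \<open>r \<in> J\<close> this] this qr(4) show False by simp
  qed
  then show ?thesis using qr by auto
qed

text \<open>Both annihilators are principal. The generator \<open>g\<close> of the annihilator of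
  \<open>\<xi>\<close> divides \<open>p\<^sub>0\<close>. If \<open>g\<close> did not vanish at
  \<open>\<beta>\<close>, the cofactor would, and minimality of \<open>p\<^sub>0\<close> would make
  \<open>g\<close> a nonzero constant, which \<open>\<psi>\<close> cannot send to 0. Irreducibility
  need not be discussed.\<close>

lemma algebraic_transfer:
  assumes p\<^sub>0: "polyA A p\<^sub>0" "p\<^sub>0 \<noteq> 0" "poly p\<^sub>0 \<beta> = 0" "\<And>p. polyA A p \<Longrightarrow> p \<noteq> 0 \<Longrightarrow> poly p \<beta> = 0 \<Longrightarrow> degree p\<^sub>0 \<le> degree p"
    and \<xi>: "poly (map_poly \<psi> p\<^sub>0) \<xi> = 0" and p: "polyA A p"
  shows "poly p \<beta> = 0 \<longleftrightarrow> poly (map_poly \<psi> p) \<xi> = 0"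
proof -
  note Ar = sfield_imp_sring[OF A]
  let ?I = "{p. polyA A p \<and> poly p \<beta> = 0}" and ?J = "{p. polyA A p \<and> poly (map_poly \<psi> p) \<xi> = 0}"
  have I: "\<exists>q. polyA A q \<and> p = q * p\<^sub>0" if "p \<in> ?I" for p
    by (rule min_poly_divides[of ?I]) (use p\<^sub>0 that in \<open>auto intro: polyA_mult[OF Ar] polyA_diff[OF Ar]\<close>)
  have IJ: "p \<in> ?J" if "p \<in> ?I" for p
    using I[OF that] that \<xi> p\<^sub>0(1) by (auto simp: map_poly_hom_mult)
  define g where "g = (ARG_MIN degree p. p \<in> ?J \<and> p \<noteq> 0)"
  have "p\<^sub>0 \<in> ?J \<and> p\<^sub>0 \<noteq> 0" using p\<^sub>0 \<xi> by simp
  from arg_min_natI[of "\<lambda>p. p \<in> ?J \<and> p \<noteq> 0", OF this, of degree]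
  have g: "g \<in> ?J" "g \<noteq> 0" unfolding g_def by blast+
  have gmin: "degree g \<le> degree p" if "p \<in> ?J" "p \<noteq> 0" for p
    unfolding g_def by (rule arg_min_nat_le) (use that in blast)
  have J: "\<exists>q. polyA A q \<and> p = q * g" if "p \<in> ?J" for p
    by (rule min_poly_divides[of ?J])
      (use g gmin that in \<open>auto intro: polyA_mult[OF Ar] polyA_diff[OF Ar] simp: map_poly_hom_mult map_poly_hom_diff\<close>)
  obtain q where q: "polyA A q" "p\<^sub>0 = q * g" using J[of p\<^sub>0] p\<^sub>0 \<xi> by auto
  have "poly g \<beta> = 0"
  proof (rule ccontr)
    assume "poly g \<beta> \<noteq> 0"
    then have "poly q \<beta> = 0" using p\<^sub>0(3) q(2) by simp
    moreover have "q \<noteq> 0" using q p\<^sub>0(2) by auto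
    ultimately have "degree p\<^sub>0 \<le> degree q" using p\<^sub>0(4) q(1) by blast
    then have "degree g = 0" using q(2) g(2) \<open>q \<noteq> 0\<close> by (simp add: degree_mult_eq)
    then obtain c where c: "g = [:c:]" by (metis degree_eq_zeroE)
    then have "\<psi> c = 0" "c \<in> A" using g(1) by (simp_all add: map_poly_pCons hom_0 polyA_pCons)
    then show False using g(2) c hom_eq_0 by simp
  qed
  then have "poly p \<beta> = 0" if "p \<in> ?J" for p using J[OF that] by auto
  then show ?thesis using IJ p by blast
qed

lemma transc_transfer:
  assumes "transc A \<beta>" "transc (\<psi> ` A) \<xi>" "polyA A p"
  shows "poly p \<beta> = 0 \<longleftrightarrow> poly (map_poly \<psi> p) \<xi> = 0"
proof (cases "p = 0")
  case False
  then have "map_poly \<psi> p \<noteq> 0" using map_poly_hom_eq_0[OF assms(3)] by simp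
  moreover have "polyA (\<psi> ` A) (map_poly \<psi> p)" using assms(3) by (auto simp: polyA_def coeff_hom)
  ultimately show ?thesis using assms False unfolding transc_def by blast
qed simp

end

lemma hom_on_subset: "hom_on A \<psi> \<Longrightarrow> B \<subseteq> A \<Longrightarrow> hom_on B \<psi>"
  unfolding hom_on_def by blast

subsection \<open>Hensel's lemma for power series\<close>

lemma poly_taylor1:
  fixes p :: "'a::idom poly"
  shows "\<exists>r. poly p (x + h) = poly p x + h * poly (pderiv p) x + h * h * r"
proof (induction p)
  case (pCons a p)
  then obtain r where r: "poly p (x + h) = poly p x + h * poly (pderiv p) x + h * h * r" by blast
  show ?case
    by (rule exI[of _ "x * r + poly (pderiv p) x + h * r"]) (simp only: poly_pCons pderiv_pCons poly_add r, simp add: algebra_simps)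
qed auto

lemma poly_diff_factor:
  fixes p :: "'a::comm_ring_1 poly"
  shows "\<exists>r. poly p x - poly p y = (x - y) * r"
proof (induction p)
  case (pCons a p)
  then obtain r where r: "poly p x - poly p y = (x - y) * r" by blast
  have "poly (pCons a p) x - poly (pCons a p) y = x * (poly p x - poly p y) + (x - y) * poly p y"
    by (simp add: algebra_simps)
  also have "\<dots> = (x - y) * (x * r + poly p y)" unfolding r by (simp add: algebra_simps)
  finally show ?case by blast
qed (rule exI[of _ 0], simp)

lemma fps_poly_nth_0: "fps_nth (poly p x) 0 = poly (map_poly (\<lambda>f. fps_nth f 0) p) (fps_nth x 0)"
  for p :: "'a::comm_ring_1 fps poly"
  by (induction p) (simp_all add: map_poly_pCons)

lemma fps_mult_X_power_nth: "n < k \<Longrightarrow> fps_nth (fps_X ^ k * f) n = 0" "fps_nth (fps_X ^ k * f) k = fps_nth f 0"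
  for f :: "'a::comm_ring_1 fps"
  by (simp_all add: fps_X_power_mult_nth)

text \<open>Newton iteration with the derivative frozen at its residue \<open>s\<close>: by the
  first-order Taylor formula a correction in degree \<open>Suc n\<close> changes that coefficient of
  the value of \<open>P\<close> by \<open>s\<close> times the correction, and no lower one.\<close>

lemma hensel_fps:
  fixes P :: "'a::field fps poly"
  assumes a: "poly (map_poly (\<lambda>f. fps_nth f 0) P) a = 0" "poly (pderiv (map_poly (\<lambda>f. fps_nth f 0) P)) a \<noteq> 0"
  shows "\<exists>\<xi>. poly P \<xi> = 0 \<and> fps_nth \<xi> 0 = a"
proof -
  define s where "s = poly (pderiv (map_poly (\<lambda>f. fps_nth f 0) P)) a"
  define x where "x = rec_nat (fps_const a) (\<lambda>n y. y + fps_X ^ Suc n * fps_const (- fps_nth (poly P y) (Suc n) / s))"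
  have x0: "x 0 = fps_const a" and xS: "x (Suc n) = x n + fps_X ^ Suc n * fps_const (- fps_nth (poly P (x n)) (Suc n) / s)" for n
    by (simp_all add: x_def)
  have s0: "s \<noteq> 0" using a by (simp add: s_def)
  have ct: "fps_nth (x n) 0 = a" for n
    by (induction n) (simp_all add: x0 xS fps_mult_X_power_nth)
  have pd: "pderiv (map_poly (\<lambda>f. fps_nth f 0) P) = map_poly (\<lambda>f. fps_nth f 0) (pderiv P)"
  proof -
    have N: "fps_nth (of_nat k :: 'a fps) 0 = of_nat k" for k by (simp flip: fps_of_nat)
    show ?thesis by (rule poly_eqI) (simp add: coeff_pderiv coeff_map_poly fps_mult_nth_0 N del: of_nat_Suc)
  qed
  have P: "\<forall>i\<le>n. fps_nth (poly P (x n)) i = 0" for n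
  proof (induction n)
    case 0
    show ?case using a(1) by (simp add: fps_poly_nth_0 x0)
  next
    case (Suc n)
    define h where "h = fps_X ^ Suc n * fps_const (- fps_nth (poly P (x n)) (Suc n) / s)"
    obtain r where r: "poly P (x n + h) = poly P (x n) + h * poly (pderiv P) (x n) + h * h * r"
      using poly_taylor1 by blast
    have h1: "fps_nth (h * f) i = 0" if "i \<le> n" for i f
      using fps_mult_X_power_nth(1)[of i "Suc n" "fps_const (- fps_nth (poly P (x n)) (Suc n) / s) * f"] that
      by (simp add: h_def mult.assoc del: power_Suc)
    have h2: "fps_nth (h * f) (Suc n) = - fps_nth (poly P (x n)) (Suc n) / s * fps_nth f 0" for f
      using fps_mult_X_power_nth(2)[of "Suc n" "fps_const (- fps_nth (poly P (x n)) (Suc n) / s) * f"]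
      by (simp add: h_def mult.assoc fps_mult_nth_0 del: power_Suc)
    have h0: "fps_nth h 0 = 0" using h1[of 0 1] by simp
    have d0: "fps_nth (poly (pderiv P) (x n)) 0 = s" by (simp add: fps_poly_nth_0 ct s_def pd)
    show ?case
    proof (intro allI impI)
      fix i assume i: "i \<le> Suc n"
      have "x (Suc n) = x n + h" by (simp add: xS h_def)
      then have "fps_nth (poly P (x (Suc n))) i = fps_nth (poly P (x n)) i + fps_nth (h * poly (pderiv P) (x n)) i + fps_nth (h * (h * r)) i"
        by (simp add: r mult.assoc)
      also have "\<dots> = 0"
      proof (cases "i = Suc n")
        case True
        then show ?thesis using s0 by (simp only: h2 True) (simp add: d0 h0 fps_mult_nth_0)
      next
        case False
        then have "i \<le> n" using i by simp
        then show ?thesis using Suc h1 by simp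
      qed
      finally show "fps_nth (poly P (x (Suc n))) i = 0" .
    qed
  qed
  \<comment> \<open>The approximations stabilise coefficientwise, so the limit is read off along the
    diagonal.\<close>
  define \<xi> where "\<xi> = Abs_fps (\<lambda>n. fps_nth (x n) n)"
  have stable: "fps_nth (x (n + k)) i = fps_nth (x n) i" if "i \<le> n" for n k i
  proof (induction k)
    case (Suc k)
    have "fps_nth (fps_X ^ Suc (n + k) * fps_const (- fps_nth (poly P (x (n + k))) (Suc (n + k)) / s)) i = 0"
      by (rule fps_mult_X_power_nth(1)) (use that in simp)
    then show ?case using Suc by (simp add: xS del: power_Suc)
  qed simp
  have agree: "fps_nth \<xi> i = fps_nth (x n) i" if "i \<le> n" for i n
    using stable[of i i "n - i"] that by (simp add: \<xi>_def)
  have "poly P \<xi> = 0"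
  proof (rule fps_ext)
    fix n
    obtain r where r: "poly P \<xi> - poly P (x n) = (\<xi> - x n) * r" using poly_diff_factor by blast
    have "fps_nth ((\<xi> - x n) * r) n = 0" by (simp add: fps_mult_nth agree)
    then have "fps_nth (poly P \<xi>) n = fps_nth (poly P (x n)) n" by (metis r fps_sub_nth right_minus_eq)
    then show "fps_nth (poly P \<xi>) n = fps_nth 0 n" using P[of n] by simp
  qed
  moreover have "fps_nth \<xi> 0 = a" using agree[of 0 0] ct by simp
  ultimately show ?thesis by blast
qed

subsection \<open>Residues\<close>

text \<open>A relation instead of a function: it also asserts that \<open>f\<close> lies in the
  valuation ring of power series.\<close>

definition res :: "'a::field fls \<Rightarrow> 'a \<Rightarrow> bool" where
  "res f u \<longleftrightarrow> (\<exists>g. f = fps_to_fls g \<and> fps_nth g 0 = u)"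

lemma res_const: "res (fls_const u) u"
  unfolding res_def by (rule exI[of _ "fps_const u"]) simp
lemma res_add: "res f u \<Longrightarrow> res g v \<Longrightarrow> res (f + g) (u + v)"
  unfolding res_def by (metis fps_to_fls_plus fps_add_nth)
lemma res_neg: "res f u \<Longrightarrow> res (- f) (- u)"
  unfolding res_def by (metis fps_to_fls_uminus fps_neg_nth)
lemma res_mult: "res f u \<Longrightarrow> res g v \<Longrightarrow> res (f * g) (u * v)"
  unfolding res_def by (metis fls_times_fps_to_fls fps_mult_nth_0)
lemma res_inverse: "res f u \<Longrightarrow> u \<noteq> 0 \<Longrightarrow> res (inverse f) (inverse u)"
  unfolding res_def
proof (elim exE conjE)
  fix g assume "f = fps_to_fls g" "g $ 0 = u" "u \<noteq> 0"
  then show "\<exists>g. inverse f = fps_to_fls g \<and> g $ 0 = inverse u"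
    by (intro exI[of _ "inverse g"]) (simp add: fls_inverse_fps_to_fls subdegree_eq_0 fps_inverse_nth_0)
qed

lemma hensel_fls:
  fixes p :: "'a::field fls poly" and q :: "'a poly"
  assumes r: "\<And>i. res (coeff p i) (coeff q i)" and a: "poly q a = 0" "poly (pderiv q) a \<noteq> 0"
  shows "\<exists>\<xi>. poly p \<xi> = 0 \<and> res \<xi> a"
proof -
  define P where "P = map_poly fls_regpart p"
  have P: "coeff p i = fps_to_fls (coeff P i)" for i
    using r[of i] unfolding res_def P_def by (auto simp: coeff_map_poly)
  have q: "map_poly (\<lambda>f. fps_nth f 0) P = q"
    by (rule poly_eqI) (use r P in \<open>auto simp: coeff_map_poly res_def\<close>)
  obtain \<xi> where \<xi>: "poly P \<xi> = 0" "fps_nth \<xi> 0 = a" using hensel_fps[of P a] a unfolding q by blast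
  have "p = map_poly fps_to_fls P" by (rule poly_eqI) (simp add: coeff_map_poly P)
  moreover have "poly (map_poly fps_to_fls P) (fps_to_fls \<xi>) = fps_to_fls (poly P \<xi>)"
    by (induction P) (simp_all add: map_poly_pCons fls_times_fps_to_fls)
  ultimately have "poly p (fps_to_fls \<xi>) = 0" using \<xi> by simp
  moreover have "res (fps_to_fls \<xi>) a" using \<xi>(2) by (auto simp: res_def)
  ultimately show ?thesis by blast
qed

lemma card_polys:
  assumes "infinite B" "0 \<in> B"
  shows "|{p :: 'b::zero poly. polyA B p}| \<le>o |B|"
proof -
  define Pn where "Pn = rec_nat {0 :: 'b poly} (\<lambda>_ Y. (\<lambda>(a, p). pCons a p) ` (B \<times> Y))"
  have P0: "Pn 0 = {0}" and PS: "Pn (Suc n) = (\<lambda>(a, p). pCons a p) ` (B \<times> Pn n)" for n by (simp_all add: Pn_def)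
  have inf: "\<not> finite (Field |B| )" using assms(1) by (simp add: Field_card_of)
  have card: "|Pn n| \<le>o |B|" for n
  proof (induction n)
    case 0
    show ?case unfolding P0 by (rule card_of_singl_ordLeq) (use assms(2) in auto)
  next
    case (Suc n)
    have "|B \<times> Pn n| \<le>o |B|"
      by (intro card_of_Times_ordLeq_infinite_Field[OF inf] Suc card_of_Card_order) (simp add: card_of_refl ordIso_imp_ordLeq)
    then show ?case unfolding PS using card_of_image ordLeq_transitive by blast
  qed
  have "\<exists>n. p \<in> Pn n" if "polyA B p" for p
    using that
  proof (induction p)
    case 0
    then show ?case using P0 by auto
  next
    case (pCons a p)
    then obtain n where "p \<in> Pn n" "a \<in> B" by (auto simp: polyA_pCons)
    then have "pCons a p \<in> Pn (Suc n)" unfolding PS by auto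
    then show ?case by blast
  qed
  then have "{p. polyA B p} \<subseteq> (\<Union>n. Pn n)" by blast
  then have "|{p. polyA B p}| \<le>o |\<Union>n. Pn n|" by (rule card_of_mono1)
  moreover have "|\<Union>n. Pn n| \<le>o |B|"
    using assms(1) card infinite_iff_card_of_nat[of B] by (intro card_of_UNION_ordLeq_infinite) auto
  ultimately show ?thesis by (rule ordLeq_transitive)
qed

text \<open>A counting argument. The series \<open>c + v * X\<close> have residue \<open>c\<close>
  and are as many as the elements of the field; each nonzero polynomial over \<open>B\<close>
  excludes finitely many of them, and there are too few polynomials to exclude all.\<close>

lemma exists_transc_shift:
  fixes B :: "'a::field fls set"
  assumes B: "|B| <o |UNIV :: 'a set|" "infinite B" "0 \<in> B"
  shows "\<exists>\<xi>. res \<xi> c \<and> transc B \<xi>"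
proof -
  define sh where "sh v = fls_const c + fls_const v * fls_X" for v :: 'a
  have sh: "res (sh v) c" for v unfolding res_def sh_def
    by (rule exI[of _ "fps_const c + fps_const v * fps_X"]) (simp add: fls_times_fps_to_fls)
  have inj: "inj sh"
  proof (rule injI)
    fix v w assume "sh v = sh w"
    then have "fls_const v * fls_X = fls_const w * (fls_X :: 'a fls)" by (simp add: sh_def)
    then have "fls_const v = fls_const w" by simp
    then show "v = w" by (metis fls_const_nth)
  qed
  define bad where "bad p = {v. poly p (sh v) = 0}" for p
  have fin: "finite (bad p)" if "p \<noteq> 0" for p
  proof -
    have "finite (sh -` {z. poly p z = 0})" by (rule finite_vimageI[OF poly_roots_finite[OF that] inj])
    then show ?thesis by (simp add: bad_def vimage_def)
  qed
  let ?P = "{p. polyA B p} - {0}"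
  have "|?P| \<le>o |{p. polyA B p}|" by (rule card_of_mono1) blast
  then have "|?P| \<le>o |B|" using card_polys[OF B(2,3)] by (rule ordLeq_transitive)
  moreover have "|bad p| \<le>o |B|" if "p \<in> ?P" for p
  proof -
    have "finite (bad p)" using fin[of p] that by simp
    from finite_lesspoll_infinite[OF B(2) this] show ?thesis unfolding lesspoll_iff_ordLess by (rule ordLess_imp_ordLeq)
  qed
  ultimately have "|\<Union>p\<in>?P. bad p| \<le>o |B|" using B(2) by (intro card_of_UNION_ordLeq_infinite) auto
  then have "|\<Union>p\<in>?P. bad p| <o |UNIV :: 'a set|" using B(1) by (rule ordLeq_ordLess_trans)
  then have "(\<Union>p\<in>?P. bad p) \<noteq> UNIV" using ordLess_irreflexive by force
  then obtain v where "v \<notin> (\<Union>p\<in>?P. bad p)" by blast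
  then have "transc B (sh v)" unfolding transc_def bad_def by blast
  then show ?thesis using sh by blast
qed

subsection \<open>Towers\<close>

primrec tow :: "'a::field set \<Rightarrow> (nat \<Rightarrow> 'a) \<Rightarrow> nat \<Rightarrow> 'a set" where
  "tow W \<beta> 0 = W"
| "tow W \<beta> (Suc n) = adj (tow W \<beta> n) (\<beta> n)"

lemma sfield_tow: "sfield W \<Longrightarrow> sfield (tow W \<beta> n)"
  by (induction n) (auto intro: sfield_adj)

lemma tow_Suc_mono: "sfield W \<Longrightarrow> tow W \<beta> n \<subseteq> tow W \<beta> (Suc n)"
  by (simp add: adj_mem sfield_tow)

lemma tow_mono:
  assumes "sfield W" "n \<le> m" shows "tow W \<beta> n \<subseteq> tow W \<beta> m"
  using tow_Suc_mono[OF assms(1)] assms(2) by (rule lift_Suc_mono_le)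

lemma tow_mem:
  assumes "sfield W" "i < n" shows "\<beta> i \<in> tow W \<beta> n"
proof -
  have "\<beta> i \<in> tow W \<beta> (Suc i)" by (simp add: adj_mem(2) sfield_tow assms(1))
  moreover have "Suc i \<le> n" using assms(2) by simp
  ultimately show ?thesis using tow_mono[OF assms(1)] by blast
qed

lemma tow_base: "sfield W \<Longrightarrow> W \<subseteq> tow W \<beta> n"
  using tow_mono[of W 0 n \<beta>] by simp

lemma tow_least: "sfield X \<Longrightarrow> W \<subseteq> X \<Longrightarrow> (\<And>i. i < n \<Longrightarrow> \<beta> i \<in> X) \<Longrightarrow> tow W \<beta> n \<subseteq> X"
proof (induction n)
  case (Suc n)
  have "tow W \<beta> n \<subseteq> X" by (rule Suc.IH[OF Suc.prems(1,2)]) (rule Suc.prems(3), simp)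
  from adj_least[OF Suc.prems(1) this Suc.prems(3)[of n]] show ?case by simp
qed simp

lemma sfield_infinite: "sfield (T :: 'a::field_char_0 set) \<Longrightarrow> infinite T"
proof
  assume T: "sfield T" "finite T"
  have "range of_nat \<subseteq> T" using sring_of_nat[OF sfield_imp_sring[OF T(1)]] by blast
  then have "finite (range (of_nat :: nat \<Rightarrow> 'a))" using T(2) by (rule finite_subset)
  then show False using infinite_UNIV_nat finite_imageD[OF _ inj_of_nat] by blast
qed

text \<open>A transcendental element can be sent to any element transcendental over the image, so
  its residue can be prescribed; smallness of \<open>T\<close> leaves a suitable element near every
  \<open>c\<close>.\<close>

lemma tower_step:
  fixes \<psi> :: "'a::field_char_0 \<Rightarrow> 'a fls"
  assumes T: "sfield T" "hom_on T \<psi>" "transc T x" "|T| <o |UNIV :: 'a set|"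
  shows "\<exists>\<psi>'. hom_on (adj T x) \<psi>' \<and> (\<forall>y\<in>T. \<psi>' y = \<psi> y) \<and> res (\<psi>' x) c"
proof -
  have inj: "inj_on \<psi> T"
  proof (rule inj_onI)
    fix y z assume yz: "y \<in> T" "z \<in> T" "\<psi> y = \<psi> z"
    then have "\<psi> (y - z) = 0" by (simp add: hom_diff[OF T(1,2)])
    then show "y = z" using hom_eq_0[OF T(1,2) sring_diff[OF sfield_imp_sring[OF T(1)] yz(1,2)]] by simp
  qed
  have "infinite (\<psi> ` T)" using sfield_infinite[OF T(1)] finite_imageD[OF _ inj] by blast
  moreover have "|\<psi> ` T| <o |UNIV :: 'a set|" using card_of_image T(4) by (rule ordLeq_ordLess_trans)
  moreover have "0 \<in> \<psi> ` T" using hom_0[OF T(1,2)] sring_0[OF sfield_imp_sring[OF T(1)]] by (metis image_eqI)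
  ultimately obtain \<xi> where \<xi>: "res \<xi> c" "transc (\<psi> ` T) \<xi>" using exists_transc_shift by blast
  obtain \<psi>' where "hom_on (adj T x) \<psi>'" "\<forall>y\<in>T. \<psi>' y = \<psi> y" "\<psi>' x = \<xi>"
    using hom_extend[OF T(1,2) transc_transfer[OF T(1,2,3) \<xi>(2)]] by blast
  then show ?thesis using \<xi>(1) by blast
qed

lemma tower_finite:
  fixes \<psi> :: "'a::field_char_0 \<Rightarrow> 'a fls"
  assumes W: "sfield W" "hom_on W \<psi>" and X: "\<And>i. |tow W \<beta> i| <o |UNIV :: 'a set|"
  shows "(\<And>i. i < n \<Longrightarrow> transc (tow W \<beta> i) (\<beta> i)) \<Longrightarrow>
    \<exists>\<psi>'. hom_on (tow W \<beta> n) \<psi>' \<and> (\<forall>y\<in>W. \<psi>' y = \<psi> y) \<and> (\<forall>i<n. res (\<psi>' (\<beta> i)) (\<alpha> i))"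
proof (induction n)
  case 0
  then show ?case using W by auto
next
  case (Suc n)
  then obtain \<psi>' where p: "hom_on (tow W \<beta> n) \<psi>'" "\<forall>y\<in>W. \<psi>' y = \<psi> y" "\<forall>i<n. res (\<psi>' (\<beta> i)) (\<alpha> i)" by auto
  obtain \<psi>'' where q: "hom_on (tow W \<beta> (Suc n)) \<psi>''" "\<forall>y\<in>tow W \<beta> n. \<psi>'' y = \<psi>' y" "res (\<psi>'' (\<beta> n)) (\<alpha> n)"
    using tower_step[OF sfield_tow[OF W(1)] p(1) Suc.prems[of n] X] by auto
  have "res (\<psi>'' (\<beta> i)) (\<alpha> i)" if "i < Suc n" for i
    using p(3) q(2,3) tow_mem[OF W(1), of i n \<beta>] that by (cases "i = n") auto
  then show ?case using q p(2) tow_base[OF W(1), of \<beta> n] by (intro exI[of _ \<psi>'']) auto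
qed

lemma tower_infinite:
  fixes \<psi> :: "'a::field_char_0 \<Rightarrow> 'a fls"
  assumes W: "sfield W" "hom_on W \<psi>" and X: "\<And>i. |tow W \<beta> i| <o |UNIV :: 'a set|"
    and tr: "\<And>i. transc (tow W \<beta> i) (\<beta> i)"
  shows "\<exists>\<psi>'. hom_on (\<Union>n. tow W \<beta> n) \<psi>' \<and> (\<forall>y\<in>W. \<psi>' y = \<psi> y) \<and> (\<forall>i. res (\<psi>' (\<beta> i)) (\<alpha> i))"
proof -
  define P where "P n \<psi>' \<longleftrightarrow> hom_on (tow W \<beta> n) \<psi>' \<and> (\<forall>y\<in>W. \<psi>' y = \<psi> y) \<and> (\<forall>i<n. res (\<psi>' (\<beta> i)) (\<alpha> i))" for n \<psi>'
  define Q where "Q n \<psi>' \<psi>'' \<longleftrightarrow> (\<forall>y\<in>tow W \<beta> n. \<psi>'' y = \<psi>' y)" for n and \<psi>' \<psi>'' :: "'a \<Rightarrow> 'a fls"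
  \<comment> \<open>The extension at each stage is far from unique, so the stages are chosen
    dependently, each extending the one before; \<open>\<Psi>\<close> glues them.\<close>
  have "\<exists>f. \<forall>n. P n (f n) \<and> Q n (f n) (f (Suc n))"
  proof (rule dependent_nat_choice)
    show "\<exists>f. P 0 f" using W by (auto simp: P_def)
    fix \<psi>' n assume "P n \<psi>'"
    then have p: "hom_on (tow W \<beta> n) \<psi>'" "\<forall>y\<in>W. \<psi>' y = \<psi> y" "\<forall>i<n. res (\<psi>' (\<beta> i)) (\<alpha> i)" by (auto simp: P_def)
    obtain \<psi>'' where q: "hom_on (tow W \<beta> (Suc n)) \<psi>''" "\<forall>y\<in>tow W \<beta> n. \<psi>'' y = \<psi>' y" "res (\<psi>'' (\<beta> n)) (\<alpha> n)"
      using tower_step[OF sfield_tow[OF W(1)] p(1) tr X] by auto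
    have "res (\<psi>'' (\<beta> i)) (\<alpha> i)" if "i < Suc n" for i
      using p(3) q(2,3) tow_mem[OF W(1), of i n \<beta>] that by (cases "i = n") auto
    then have "P (Suc n) \<psi>''" using q p(2) tow_base[OF W(1), of \<beta> n] unfolding P_def by auto
    then show "\<exists>\<psi>''. P (Suc n) \<psi>'' \<and> Q n \<psi>' \<psi>''" using q(2) unfolding Q_def by blast
  qed
  then obtain f where f: "\<And>n. P n (f n)" "\<And>n. Q n (f n) (f (Suc n))" by blast
  have step: "f (n + k) y = f n y" if "y \<in> tow W \<beta> n" for n k y
  proof (induction k)
    case (Suc k)
    have "y \<in> tow W \<beta> (n + k)" using that tow_mono[OF W(1), of n "n + k" \<beta>] by auto
    then show ?case using f(2)[of "n + k"] Suc unfolding Q_def by simp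
  qed simp
  define \<Psi> where "\<Psi> y = f (LEAST n. y \<in> tow W \<beta> n) y" for y
  have \<Psi>: "\<Psi> y = f n y" if "y \<in> tow W \<beta> n" for y n
  proof -
    let ?l = "LEAST n. y \<in> tow W \<beta> n"
    have "y \<in> tow W \<beta> ?l" "?l \<le> n" using that by (auto intro: LeastI Least_le)
    from step[OF this(1), of "n - ?l"] this(2) show ?thesis by (simp add: \<Psi>_def)
  qed
  have "hom_on (\<Union>n. tow W \<beta> n) \<Psi>" unfolding hom_on_def
  proof (intro conjI ballI)
    have W1: "1 \<in> tow W \<beta> 0" using W(1) by (simp add: sfield_def)
    show "\<Psi> 1 = 1" unfolding \<Psi>[OF W1] using f(1)[of 0] by (simp add: P_def hom_on_def)
    fix x y assume "x \<in> (\<Union>n. tow W \<beta> n)" "y \<in> (\<Union>n. tow W \<beta> n)"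
    then obtain n m where "x \<in> tow W \<beta> n" "y \<in> tow W \<beta> m" by blast
    then have xy: "x \<in> tow W \<beta> (max n m)" "y \<in> tow W \<beta> (max n m)"
      using tow_mono[OF W(1), of n "max n m" \<beta>] tow_mono[OF W(1), of m "max n m" \<beta>] by auto
    have r: "sring (tow W \<beta> (max n m))" by (intro sfield_imp_sring sfield_tow W(1))
    have h: "hom_on (tow W \<beta> (max n m)) (f (max n m))" using f(1) by (simp add: P_def)
    show "\<Psi> (x + y) = \<Psi> x + \<Psi> y" "\<Psi> (x * y) = \<Psi> x * \<Psi> y"
      unfolding \<Psi>[OF xy(1)] \<Psi>[OF xy(2)] \<Psi>[OF sring_add[OF r xy]] \<Psi>[OF sring_mult[OF r xy]]
      using h xy unfolding hom_on_def by blast+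
  qed
  moreover have "\<Psi> y = \<psi> y" if "y \<in> W" for y using \<Psi>[of y 0] f(1)[of 0] that by (simp add: P_def)
  moreover have "res (\<Psi> (\<beta> i)) (\<alpha> i)" for i
    using \<Psi>[OF tow_mem[OF W(1), of i "Suc i"]] f(1)[of "Suc i"] by (simp add: P_def)
  ultimately show ?thesis by blast
qed

lemma frac_common_denominator:
  assumes R: "sring (R :: 'a::field set)"
  shows "polyA (frac R) p \<Longrightarrow> \<exists>d\<in>R. d \<noteq> 0 \<and> polyA R (smult d p)"
proof (induction p)
  case 0
  then show ?case using sring_1[OF R] sring_0[OF R] by (intro bexI[of _ 1]) (auto simp: polyA_def)
next
  case (pCons a p)
  then obtain d where d: "d \<in> R" "d \<noteq> 0" "polyA R (smult d p)" by (auto simp: polyA_pCons)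
  obtain x y where a: "a = x / y" "x \<in> R" "y \<in> R" "y \<noteq> 0" using pCons.prems by (auto simp: polyA_pCons frac_def)
  have "smult (d * y) (pCons a p) = pCons (d * x) (smult y (smult d p))" using a by (simp add: mult.commute)
  then show ?case using d a polyA_smult[OF R a(3) d(3)]
    by (intro bexI[of _ "d * y"]) (auto simp: polyA_pCons sring_mult[OF R])
qed

lemma poly_altdef_le: "degree p \<le> N \<Longrightarrow> poly p x = (\<Sum>i\<le>N. coeff p i * x ^ i)" for x :: "'a::comm_ring_1"
  unfolding poly_altdef by (rule sum.mono_neutral_left) (auto simp: coeff_eq_0)

subsection \<open>Differential residues\<close>

context diff_field
begin

lemma der_poly: "\<delta> (poly p y) = poly (map_poly \<delta> p) y + poly (pderiv p) y * \<delta> y"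
  by (induction p) (simp_all add: der_0 der_add der_mult map_poly_pCons pderiv_pCons algebra_simps)

text \<open>\<open>\<psi>\<close> is merely a field embedding and no derivation on Laurent series is
  used. Compatibility with \<open>\<delta>\<close> is recorded by residues instead: those of the
  derivatives of \<open>w\<close> have to be the derivatives of \<open>u\<close>, up to order
  \<open>k\<close>.\<close>

definition jet_res :: "('a \<Rightarrow> 'a fls) \<Rightarrow> nat \<Rightarrow> 'a \<Rightarrow> 'a \<Rightarrow> bool" where
  "jet_res \<psi> k w u \<longleftrightarrow> (\<forall>i\<le>k. res (\<psi> ((\<delta> ^^ i) w)) ((\<delta> ^^ i) u))"

lemma jet_res_0: "jet_res \<psi> 0 w u \<longleftrightarrow> res (\<psi> w) u" by (simp add: jet_res_def)

lemma jet_res_Suc: "jet_res \<psi> (Suc k) w u \<longleftrightarrow> res (\<psi> w) u \<and> jet_res \<psi> k (\<delta> w) (\<delta> u)"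
proof -
  have "(\<forall>i\<le>Suc k. Q i) \<longleftrightarrow> Q 0 \<and> (\<forall>i\<le>k. Q (Suc i))" for Q
    by (simp only: less_Suc_eq_le[symmetric] All_less_Suc2)
  then show ?thesis unfolding jet_res_def by (simp add: funpow_Suc_right del: funpow.simps(2))
qed

lemma jet_res_mono: "jet_res \<psi> k w u \<Longrightarrow> l \<le> k \<Longrightarrow> jet_res \<psi> l w u" by (simp add: jet_res_def)

lemma jet_res_funpow: "jet_res \<psi> k w u \<Longrightarrow> i + l \<le> k \<Longrightarrow> jet_res \<psi> l ((\<delta> ^^ i) w) ((\<delta> ^^ i) u)"
  unfolding jet_res_def
proof (intro allI impI)
  fix l' assume *: "\<forall>i\<le>k. res (\<psi> ((\<delta> ^^ i) w)) ((\<delta> ^^ i) u)" "i + l \<le> k" "l' \<le> l"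
  then have "res (\<psi> ((\<delta> ^^ (l' + i)) w)) ((\<delta> ^^ (l' + i)) u)" by simp
  then show "res (\<psi> ((\<delta> ^^ l') ((\<delta> ^^ i) w))) ((\<delta> ^^ l') ((\<delta> ^^ i) u))" by (simp add: funpow_add)
qed

lemma diff_subfield_facts:
  assumes "diff_subfield \<delta> W"
  shows "sfield W" "sring W" "\<And>x. x \<in> W \<Longrightarrow> \<delta> x \<in> W"
  using assms by (auto simp: diff_subfield_iff sfield_imp_sring)

lemma funpow_mem: "diff_subfield \<delta> W \<Longrightarrow> x \<in> W \<Longrightarrow> (\<delta> ^^ i) x \<in> W"
  by (induction i) (auto simp: diff_subfield_def)

context
  fixes W and \<psi> :: "'a \<Rightarrow> 'a fls"
  assumes W: "diff_subfield \<delta> W" and \<psi>: "hom_on W \<psi>"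
begin

lemma jet_res_add: "w \<in> W \<Longrightarrow> w' \<in> W \<Longrightarrow> jet_res \<psi> k w u \<Longrightarrow> jet_res \<psi> k w' u' \<Longrightarrow> jet_res \<psi> k (w + w') (u + u')"
  using diff_subfield_facts[OF W] \<psi>
  by (induction k arbitrary: w w' u u') (simp_all add: jet_res_0 jet_res_Suc hom_add res_add der_add)

lemma jet_res_neg: "w \<in> W \<Longrightarrow> jet_res \<psi> k w u \<Longrightarrow> jet_res \<psi> k (- w) (- u)"
  using diff_subfield_facts[OF W] \<psi>
  by (induction k arbitrary: w u) (simp_all add: jet_res_0 jet_res_Suc hom_neg res_neg der_neg)

lemma jet_res_mult: "w \<in> W \<Longrightarrow> w' \<in> W \<Longrightarrow> jet_res \<psi> k w u \<Longrightarrow> jet_res \<psi> k w' u' \<Longrightarrow> jet_res \<psi> k (w * w') (u * u')"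
proof (induction k arbitrary: w w' u u')
  case 0
  then show ?case using diff_subfield_facts[OF W] \<psi> by (simp add: jet_res_0 hom_mult res_mult)
next
  case (Suc k)
  note F = diff_subfield_facts[OF W]
  have "jet_res \<psi> k w u" "jet_res \<psi> k w' u'" using Suc.prems(3,4) by (auto intro: jet_res_mono)
  moreover have "jet_res \<psi> k (\<delta> w) (\<delta> u)" "jet_res \<psi> k (\<delta> w') (\<delta> u')" "res (\<psi> w) u" "res (\<psi> w') u'"
    using Suc.prems(3,4) by (auto simp: jet_res_Suc)
  ultimately have "jet_res \<psi> k (\<delta> w * w' + w * \<delta> w') (\<delta> u * u' + u * \<delta> u')"
    using Suc.prems(1,2) F by (intro jet_res_add Suc.IH sring_mult[OF F(2)]) auto
  moreover have "res (\<psi> (w * w')) (u * u')"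
    using Suc.prems \<open>res (\<psi> w) u\<close> \<open>res (\<psi> w') u'\<close> by (simp add: hom_mult[OF F(1) \<psi>] res_mult)
  ultimately show ?case by (simp add: jet_res_Suc der_mult)
qed

lemma jet_res_inverse: "w \<in> W \<Longrightarrow> u \<noteq> 0 \<Longrightarrow> jet_res \<psi> k w u \<Longrightarrow> jet_res \<psi> k (inverse w) (inverse u)"
proof (induction k)
  case 0
  then show ?case using diff_subfield_facts[OF W] \<psi> by (simp add: jet_res_0 hom_inverse res_inverse)
next
  case (Suc k)
  note F = diff_subfield_facts[OF W]
  have i: "inverse w \<in> W" using Suc.prems(1) F(1) by (simp add: sfield_inv)
  have "jet_res \<psi> k w u" using Suc.prems(3) by (rule jet_res_mono) simp
  then have "jet_res \<psi> k (inverse w) (inverse u)" using Suc by blast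
  moreover have "jet_res \<psi> k (\<delta> w) (\<delta> u)" "res (\<psi> w) u" using Suc.prems(3) by (auto simp: jet_res_Suc)
  ultimately have "jet_res \<psi> k (- (\<delta> w * inverse w * inverse w)) (- (\<delta> u * inverse u * inverse u))"
    using Suc.prems(1) F i by (intro jet_res_neg jet_res_mult sring_mult[OF F(2)]) auto
  moreover have "res (\<psi> (inverse w)) (inverse u)"
    using Suc.prems \<open>res (\<psi> w) u\<close> by (simp add: hom_inverse[OF F(1) \<psi>] res_inverse)
  ultimately show ?case by (simp add: jet_res_Suc der_inverse)
qed

lemma jet_res_zero: "jet_res \<psi> k 0 0"
proof -
  have "(\<delta> ^^ i) 0 = 0" for i by (induction i) (auto simp: der_0)
  then show ?thesis using hom_0[OF diff_subfield_facts(1)[OF W] \<psi>] res_const[of "0::'a"] by (simp add: jet_res_def)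
qed

lemma jet_res_one: "jet_res \<psi> k 1 1"
proof -
  have "(\<delta> ^^ i) 1 = (if i = 0 then 1 else 0)" for i by (induction i) (auto simp: der_0 der_1)
  then show ?thesis using hom_0[OF diff_subfield_facts(1)[OF W] \<psi>] hom_1[OF diff_subfield_facts(1)[OF W] \<psi>]
      res_const[of "0::'a"] res_const[of "1::'a"] by (simp add: jet_res_def)
qed

lemma jet_res_sum: "(\<And>i. i \<in> I \<Longrightarrow> f i \<in> W \<and> jet_res \<psi> k (f i) (g i)) \<Longrightarrow> jet_res \<psi> k (sum f I) (sum g I)"
  by (induction I rule: infinite_finite_induct) (auto intro!: jet_res_add sring_sum[OF diff_subfield_facts(2)[OF W]] simp: jet_res_zero)

lemma jet_res_power: "w \<in> W \<Longrightarrow> jet_res \<psi> k w u \<Longrightarrow> jet_res \<psi> k (w ^ n) (u ^ n)"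
  using sring_power[OF diff_subfield_facts(2)[OF W]]
  by (induction n) (auto intro!: jet_res_mult simp: jet_res_one)

lemma jet_res_poly:
  assumes "polyA W p" "\<And>i. jet_res \<psi> k (coeff p i) (coeff q i)" "w \<in> W" "jet_res \<psi> k w u"
  shows "jet_res \<psi> k (poly p w) (poly q u)"
proof -
  note F = diff_subfield_facts[OF W]
  define N where "N = max (degree p) (degree q)"
  have "poly p w = (\<Sum>i\<le>N. coeff p i * w ^ i)" "poly q u = (\<Sum>i\<le>N. coeff q i * u ^ i)"
    by (rule poly_altdef_le, simp add: N_def)+
  then show ?thesis using assms F(2)
    by (auto intro!: jet_res_sum jet_res_mult jet_res_power sring_mult sring_power simp: polyA_def)
qed

end

text \<open>Polynomials in all derivatives of the variables below \<open>j\<close> and in the derivatives of order less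
  than \<open>n\<close> of the variable \<open>j\<close>.\<close>

inductive_set tower_poly :: "'a set \<Rightarrow> nat \<Rightarrow> nat \<Rightarrow> ((nat \<Rightarrow> 'a) \<Rightarrow> 'a) set" for L j n where
  tower_poly_const: "l \<in> L \<Longrightarrow> (\<lambda>_. l) \<in> tower_poly L j n"
| tower_poly_old: "i < j \<Longrightarrow> (\<lambda>x. (\<delta> ^^ k) (x i)) \<in> tower_poly L j n"
| tower_poly_new: "k < n \<Longrightarrow> (\<lambda>x. (\<delta> ^^ k) (x j)) \<in> tower_poly L j n"
| tower_poly_add: "f \<in> tower_poly L j n \<Longrightarrow> g \<in> tower_poly L j n \<Longrightarrow> (\<lambda>x. f x + g x) \<in> tower_poly L j n"
| tower_poly_mult: "f \<in> tower_poly L j n \<Longrightarrow> g \<in> tower_poly L j n \<Longrightarrow> (\<lambda>x. f x * g x) \<in> tower_poly L j n"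
| tower_poly_neg: "f \<in> tower_poly L j n \<Longrightarrow> (\<lambda>x. - f x) \<in> tower_poly L j n"

lemma dpoly_funpow: "f \<in> dpoly A m \<Longrightarrow> (\<lambda>x. (\<delta> ^^ k) (f x)) \<in> dpoly A m"
  by (induction k) (auto dest: dpoly.der)

lemma tower_poly_imp_dpoly: "f \<in> tower_poly L j n \<Longrightarrow> f \<in> dpoly L (Suc j)"
  by (induction rule: tower_poly.induct) (auto intro: dpoly.intros dpoly_funpow[OF dpoly.var])

lemma tower_poly_mono: "f \<in> tower_poly L j n \<Longrightarrow> n \<le> n' \<Longrightarrow> f \<in> tower_poly L j n'"
  by (induction rule: tower_poly.induct) (auto intro: tower_poly.intros)

lemma tower_poly_der:
  assumes "diff_subfield \<delta> L"
  shows "f \<in> tower_poly L j 0 \<Longrightarrow> (\<lambda>x. \<delta> (f x)) \<in> tower_poly L j 0"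
proof (induction rule: tower_poly.induct)
  case (tower_poly_const l)
  then show ?case using diff_subfield_facts(3)[OF assms] by (intro tower_poly.tower_poly_const)
next
  case (tower_poly_old i k)
  then show ?case using tower_poly.tower_poly_old[of i j "Suc k"] by simp
next
  case (tower_poly_mult f g)
  then show ?case by (simp add: der_mult tower_poly.tower_poly_add tower_poly.tower_poly_mult)
qed (simp_all add: der_add der_neg tower_poly.tower_poly_add tower_poly.tower_poly_neg)

lemma dpoly_imp_tower_poly:
  assumes "diff_subfield \<delta> L"
  shows "f \<in> dpoly L j \<Longrightarrow> f \<in> tower_poly L j n"
proof -
  have "f \<in> dpoly L j \<Longrightarrow> f \<in> tower_poly L j 0"
  proof (induction rule: dpoly.induct)
    case (var i)
    then show ?case using tower_poly.tower_poly_old[of i j 0] by simp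
  next
    case (der f)
    then show ?case by (intro tower_poly_der[OF assms])
  qed (auto intro: tower_poly.intros)
  then show "f \<in> dpoly L j \<Longrightarrow> f \<in> tower_poly L j n" using tower_poly_mono by blast
qed

lemma sring_tower_poly_image:
  assumes "0 \<in> L" "1 \<in> L"
  shows "sring ((\<lambda>f. f x) ` tower_poly L j n)"
  unfolding sring_def
proof (intro conjI ballI)
  have I: "f x \<in> (\<lambda>f. f x) ` tower_poly L j n" if "f \<in> tower_poly L j n" for f using that by (rule imageI)
  show "0 \<in> (\<lambda>f. f x) ` tower_poly L j n" "1 \<in> (\<lambda>f. f x) ` tower_poly L j n" using I[OF tower_poly_const] assms by blast+
  fix y assume "y \<in> (\<lambda>f. f x) ` tower_poly L j n"
  then obtain f where f: "y = f x" "f \<in> tower_poly L j n" by (rule imageE)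
  show "- y \<in> (\<lambda>f. f x) ` tower_poly L j n" unfolding f(1) using I[OF tower_poly_neg[OF f(2)]] .
  fix z assume "z \<in> (\<lambda>f. f x) ` tower_poly L j n"
  then obtain g where g: "z = g x" "g \<in> tower_poly L j n" by (rule imageE)
  show "y + z \<in> (\<lambda>f. f x) ` tower_poly L j n" unfolding f(1) g(1) using I[OF tower_poly_add[OF f(2) g(2)]] .
  show "y * z \<in> (\<lambda>f. f x) ` tower_poly L j n" unfolding f(1) g(1) using I[OF tower_poly_mult[OF f(2) g(2)]] .
qed

lemma tow_subset_frac_tower_poly:
  assumes L: "diff_subfield \<delta> L"
  shows "tow (dgen L j b) (\<lambda>i. (\<delta> ^^ i) (b j)) n \<subseteq> frac ((\<lambda>f. f b) ` tower_poly L j n)"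
proof (rule tow_least)
  have L01: "0 \<in> L" "1 \<in> L" using L by (auto simp: diff_subfield_def)
  have R: "sring ((\<lambda>f. f b) ` tower_poly L j n)" by (rule sring_tower_poly_image[OF L01])
  show F: "sfield (frac ((\<lambda>f. f b) ` tower_poly L j n))" by (rule sfield_frac[OF R])
  have mem: "f b \<in> frac ((\<lambda>f. f b) ` tower_poly L j n)" if "f \<in> tower_poly L j n" for f
    by (rule subsetD[OF sring_subset_frac[OF R] imageI[OF that]])
  show "dgen L j b \<subseteq> frac ((\<lambda>f. f b) ` tower_poly L j n)"
  proof
    fix z assume "z \<in> dgen L j b"
    then obtain f g where fg: "f \<in> dpoly L j" "g \<in> dpoly L j" "z = f b / g b" by (rule dgenE[OF L01])
    show "z \<in> frac ((\<lambda>f. f b) ` tower_poly L j n)" unfolding fg(3)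
      by (rule sfield_divide[OF F mem[OF dpoly_imp_tower_poly[OF L fg(1)]] mem[OF dpoly_imp_tower_poly[OF L fg(2)]]])
  qed
  show "(\<delta> ^^ i) (b j) \<in> frac ((\<lambda>f. f b) ` tower_poly L j n)" if "i < n" for i
    using mem[OF tower_poly_new[OF that]] .
qed

lemma tower_poly_res:
  assumes T: "sfield T" "hom_on T \<psi>" "L \<subseteq> T" "\<And>l. l \<in> L \<Longrightarrow> \<psi> l = fls_const l"
    and old: "\<And>i k. i < j \<Longrightarrow> (\<delta> ^^ k) (b i) \<in> T \<and> res (\<psi> ((\<delta> ^^ k) (b i))) ((\<delta> ^^ k) (a i))"
    and new: "\<And>k. k < n \<Longrightarrow> (\<delta> ^^ k) (b j) \<in> T \<and> res (\<psi> ((\<delta> ^^ k) (b j))) ((\<delta> ^^ k) (a j))"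
  shows "f \<in> tower_poly L j n \<Longrightarrow> f b \<in> T \<and> res (\<psi> (f b)) (f a)"
proof (induction rule: tower_poly.induct)
  case (tower_poly_const l)
  then show ?case using T(3,4) res_const by auto
qed (use old new in \<open>auto simp: hom_add[OF T(1,2)] hom_mult[OF T(1,2)] hom_neg[OF T(1,2)] sring_add[OF sfield_imp_sring[OF T(1)]]
   sring_mult[OF sfield_imp_sring[OF T(1)]] sring_neg[OF sfield_imp_sring[OF T(1)]] intro: res_add res_mult res_neg\<close>)

text \<open>Derivatives of \<open>b j\<close> enter \<open>f\<close> with order below
  \<open>n\<close>. Differentiating up to \<open>Suc k\<close> times therefore reaches order
  \<open>n + k\<close> at most, one less than might be expected; this gain drives the induction in
  \<open>jet_res_step\<close>.\<close>

lemma tower_poly_jet_res: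
  assumes W: "diff_subfield \<delta> W" "hom_on W \<psi>" "L \<subseteq> W" "diff_subfield \<delta> L" "\<And>l. l \<in> L \<Longrightarrow> \<psi> l = fls_const l"
    and old: "\<And>i k. i < j \<Longrightarrow> b i \<in> W \<and> jet_res \<psi> k (b i) (a i)"
    and new: "b j \<in> W" "jet_res \<psi> (n + k) (b j) (a j)"
  shows "f \<in> tower_poly L j n \<Longrightarrow> f b \<in> W \<and> jet_res \<psi> (Suc k) (f b) (f a)"
proof (induction rule: tower_poly.induct)
  case (tower_poly_const l)
  then have "res (\<psi> ((\<delta> ^^ i) l)) ((\<delta> ^^ i) l)" for i using funpow_mem[OF W(4), of l i] W(5) res_const by simp
  then show ?case using tower_poly_const W(3) by (auto simp: jet_res_def)
next
  case (tower_poly_old i k')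
  then show ?case using old[of i "k' + Suc k"] jet_res_funpow[of \<psi> "k' + Suc k" "b i" "a i" k' "Suc k"] funpow_mem[OF W(1)] by auto
next
  case (tower_poly_new k')
  then show ?case using new jet_res_funpow[of \<psi> "n + k" "b j" "a j" k' "Suc k"] funpow_mem[OF W(1)] by auto
next
  case (tower_poly_add f g)
  then show ?case by (intro conjI jet_res_add[OF W(1,2)] sring_add[OF diff_subfield_facts(2)[OF W(1)]]) (elim conjE, assumption)+
next
  case (tower_poly_mult f g)
  then show ?case by (intro conjI jet_res_mult[OF W(1,2)] sring_mult[OF diff_subfield_facts(2)[OF W(1)]]) (elim conjE, assumption)+
next
  case (tower_poly_neg f)
  then show ?case by (intro conjI jet_res_neg[OF W(1,2)] sring_neg[OF diff_subfield_facts(2)[OF W(1)]]) (elim conjE, assumption)+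
qed

end

section \<open>Adjoining one differential variable\<close>

context diff_field
begin

text \<open>Because of this, closure of a field under \<open>\<delta>\<close> has to be checked on
  generators only.\<close>

lemma sfield_der_closed:
  assumes "sfield W" shows "sfield {w \<in> W. \<delta> w \<in> W}"
proof -
  note r = sfield_imp_sring[OF assms]
  show ?thesis unfolding sfield_def
    using sring_0[OF r] sring_1[OF r] sfield_inv[OF assms] sring_neg[OF r] sring_add[OF r] sring_mult[OF r]
    by (simp add: der_0 der_1 der_add der_mult der_neg der_inverse)
qed

lemma diff_subfield_union_tower:
  assumes W: "diff_subfield \<delta> W"
  shows "diff_subfield \<delta> (\<Union>n. tow W (\<lambda>i. (\<delta> ^^ i) y) n)" (is "diff_subfield \<delta> ?X")
proof -
  note F = diff_subfield_facts[OF W]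
  let ?T = "tow W (\<lambda>i. (\<delta> ^^ i) y)"
  have sf: "sfield (?T n)" for n by (rule sfield_tow[OF F(1)])
  have two: "\<exists>n. x \<in> ?T n \<and> z \<in> ?T n" if xz: "x \<in> ?X" "z \<in> ?X" for x z
  proof -
    obtain n m where nm: "x \<in> ?T n" "z \<in> ?T m" using xz by (elim UN_E)
    have "x \<in> ?T (max n m)" using tow_mono[OF F(1) max.cobounded1] nm(1) by (rule subsetD)
    moreover have "z \<in> ?T (max n m)" using tow_mono[OF F(1) max.cobounded2] nm(2) by (rule subsetD)
    ultimately show ?thesis by (intro exI[of _ "max n m"] conjI)
  qed
  have X: "sfield ?X" unfolding sfield_def
  proof (intro conjI ballI)
    show "0 \<in> ?X" using sring_0[OF sfield_imp_sring[OF sf[of 0]]] by (rule UN_I[OF UNIV_I])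
    show "1 \<in> ?X" using sring_1[OF sfield_imp_sring[OF sf[of 0]]] by (rule UN_I[OF UNIV_I])
    fix x assume x: "x \<in> ?X"
    then obtain n where n: "x \<in> ?T n" by (rule UN_E)
    from sring_neg[OF sfield_imp_sring[OF sf] n] show "- x \<in> ?X" by (rule UN_I[OF UNIV_I])
    from sfield_inv[OF sf n] show "inverse x \<in> ?X" by (rule UN_I[OF UNIV_I])
    fix z assume z: "z \<in> ?X"
    obtain n where n: "x \<in> ?T n" "z \<in> ?T n" using two[OF x z] by (elim exE conjE)
    from sring_add[OF sfield_imp_sring[OF sf] n] show "x + z \<in> ?X" by (rule UN_I[OF UNIV_I])
    from sring_mult[OF sfield_imp_sring[OF sf] n] show "x * z \<in> ?X" by (rule UN_I[OF UNIV_I])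
  qed
  have gen: "(\<delta> ^^ i) y \<in> ?X" for i
    using tow_mem[OF F(1) lessI, of "\<lambda>i. (\<delta> ^^ i) y" i] by (rule UN_I[OF UNIV_I])
  have WX: "W \<subseteq> ?X"
  proof
    fix w assume "w \<in> W"
    then have "w \<in> ?T 0" by simp
    then show "w \<in> ?X" by (rule UN_I[OF UNIV_I])
  qed
  have "?T n \<subseteq> {w \<in> ?X. \<delta> w \<in> ?X}" for n
  proof (rule tow_least[OF sfield_der_closed[OF X]])
    show "W \<subseteq> {w \<in> ?X. \<delta> w \<in> ?X}" using WX F(3) by blast
    show "(\<delta> ^^ i) y \<in> {w \<in> ?X. \<delta> w \<in> ?X}" for i using gen[of i] gen[of "Suc i"] by simp
  qed
  then have h: "\<delta> w \<in> ?X" if "w \<in> ?T n" for w n using that by (auto simp only: subset_iff mem_Collect_eq)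
  have "\<delta> w \<in> ?X" if w: "w \<in> ?X" for w
  proof -
    from w obtain n where "w \<in> ?T n" by (rule UN_E)
    then show ?thesis by (rule h)
  qed
  then show ?thesis unfolding diff_subfield_iff using X by (intro conjI ballI)
qed

text \<open>The polynomial is a minimal one with its denominators cleared: its coefficients are then
  values at \<open>b\<close> of polynomial functions, which can be evaluated at other tuples too.
  The derivative does not vanish at the root, since in characteristic 0 it is nonzero and of smaller
  degree.\<close>

lemma algebraic_step:
  assumes L: "diff_subfield \<delta> L"
    and nt: "\<not> transc (tow (dgen L j b) (\<lambda>i. (\<delta> ^^ i) (b j)) n) ((\<delta> ^^ n) (b j))"
  shows "\<exists>p f. polyA (tow (dgen L j b) (\<lambda>i. (\<delta> ^^ i) (b j)) n) p \<and> p \<noteq> 0 \<and> poly p ((\<delta> ^^ n) (b j)) = 0 \<and>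
    (\<forall>q. polyA (tow (dgen L j b) (\<lambda>i. (\<delta> ^^ i) (b j)) n) q \<longrightarrow> q \<noteq> 0 \<longrightarrow> poly q ((\<delta> ^^ n) (b j)) = 0 \<longrightarrow> degree p \<le> degree q) \<and>
    (\<forall>i. f i \<in> tower_poly L j n \<and> coeff p i = f i b) \<and> poly (pderiv p) ((\<delta> ^^ n) (b j)) \<noteq> 0"
proof -
  let ?T = "tow (dgen L j b) (\<lambda>i. (\<delta> ^^ i) (b j)) n" and ?y = "(\<delta> ^^ n) (b j)"
  have L01: "0 \<in> L" "1 \<in> L" using L by (auto simp: diff_subfield_def)
  have W: "sfield (dgen L j b)" using dgen_diff_subfield diff_subfield_iff by blast
  have T: "sfield ?T" by (rule sfield_tow[OF W])
  note Tr = sfield_imp_sring[OF T]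
  let ?R = "(\<lambda>f. f b) ` tower_poly L j n"
  have R: "sring ?R" by (rule sring_tower_poly_image[OF L01])
  have RT: "?R \<subseteq> ?T"
  proof -
    have old: "(\<delta> ^^ k) (b i) \<in> ?T" if "i < j" for i k
      using subsetD[OF tow_base[OF W] funpow_mem[OF dgen_diff_subfield dgen_var[OF that]]] .
    have new: "(\<delta> ^^ k) (b j) \<in> ?T" if "k < n" for k using tow_mem[OF W that, of "\<lambda>i. (\<delta> ^^ i) (b j)"] .
    have "f b \<in> ?T" if "f \<in> tower_poly L j n" for f
      using that
    proof induction
      case (tower_poly_const l)
      show ?case by (rule subsetD[OF tow_base[OF W] dgen_const[OF tower_poly_const]])
    qed (simp_all add: old new sring_add[OF Tr] sring_mult[OF Tr] sring_neg[OF Tr])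
    then show ?thesis by blast
  qed
  define Q where "Q p \<longleftrightarrow> polyA ?T p \<and> p \<noteq> 0 \<and> poly p ?y = 0" for p
  obtain p' where p': "Q p'" using nt unfolding transc_def Q_def by blast
  define p\<^sub>1 where "p\<^sub>1 = arg_min degree Q"
  have p1: "Q p\<^sub>1" unfolding p\<^sub>1_def by (rule arg_min_natI[where P = Q and k = p']) (rule p')
  have min: "degree p\<^sub>1 \<le> degree q" if "Q q" for q unfolding p\<^sub>1_def by (rule arg_min_nat_le[where P = Q]) (rule that)
  have "polyA (frac ?R) p\<^sub>1" unfolding polyA_def
  proof
    fix i
    have "coeff p\<^sub>1 i \<in> ?T" using p1 unfolding Q_def polyA_def by simp
    then show "coeff p\<^sub>1 i \<in> frac ?R" by (rule subsetD[OF tow_subset_frac_tower_poly[OF L]])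
  qed
  then obtain d where d: "d \<in> ?R" "d \<noteq> 0" "polyA ?R (smult d p\<^sub>1)" using frac_common_denominator[OF R] by blast
  define p where "p = smult d p\<^sub>1"
  have "\<forall>i. \<exists>f. f \<in> tower_poly L j n \<and> coeff p i = f b"
  proof
    fix i
    have "coeff p i \<in> ?R" using d(3) unfolding polyA_def p_def by (rule spec)
    then obtain f where "coeff p i = f b" "f \<in> tower_poly L j n" by (rule imageE)
    then show "\<exists>f. f \<in> tower_poly L j n \<and> coeff p i = f b" by (intro exI[of _ f] conjI)
  qed
  from choice[OF this] obtain f where f: "\<forall>i. f i \<in> tower_poly L j n \<and> coeff p i = f i b" by (rule exE)
  have pQ: "Q p" using p1 d subsetD[OF RT d(1)] unfolding Q_def p_def by (auto intro: polyA_smult[OF Tr])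
  have deg: "degree p = degree p\<^sub>1" using d(2) by (simp add: p_def)
  have pd: "poly (pderiv p) ?y \<noteq> 0"
  proof
    assume 0: "poly (pderiv p) ?y = 0"
    have d0: "degree p \<noteq> 0"
    proof
      assume "degree p = 0"
      then obtain c where "p = [:c:]" by (rule degree_eq_zeroE)
      then show False using pQ unfolding Q_def by simp
    qed
    then have "pderiv p \<noteq> 0" using pderiv_eq_0_iff[of p] by simp
    then have "Q (pderiv p)" using 0 pQ polyA_pderiv[OF Tr] unfolding Q_def by blast
    then have "degree p \<le> degree (pderiv p)" using min deg by simp
    then show False using d0 degree_pderiv[of p] by simp
  qed
  show ?thesis
    by (intro exI[of _ p] exI[of _ f] conjI f pd) (use pQ min deg in \<open>auto simp: Q_def\<close>)
qed

text \<open>Differentiating \<open>poly p ((\<delta> ^^ n) y) = 0\<close> expresses the next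
  derivative of \<open>y\<close> rationally by the earlier ones, because the factor
  \<open>poly (pderiv p) ((\<delta> ^^ n) y)\<close> can be divided by. So the tower is
  differentially closed at this stage.\<close>

lemma diff_subfield_algebraic_step:
  assumes W: "diff_subfield \<delta> W" and p: "polyA (tow W (\<lambda>i. (\<delta> ^^ i) y) n) p"
    "poly p ((\<delta> ^^ n) y) = 0" "poly (pderiv p) ((\<delta> ^^ n) y) \<noteq> 0"
  shows "diff_subfield \<delta> (tow W (\<lambda>i. (\<delta> ^^ i) y) (Suc n))" (is "diff_subfield \<delta> ?X")
proof -
  note F = diff_subfield_facts[OF W]
  let ?T = "tow W (\<lambda>i. (\<delta> ^^ i) y) n"
  have X: "sfield ?X" by (rule sfield_tow[OF F(1)])
  note Xr = sfield_imp_sring[OF X]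
  let ?S = "{w \<in> ?X. \<delta> w \<in> ?X}"
  have S: "sfield ?S" by (rule sfield_der_closed[OF X])
  have gen: "(\<delta> ^^ i) y \<in> ?X" if "i \<le> n" for i
    using tow_mem[OF F(1), of i "Suc n" "\<lambda>i. (\<delta> ^^ i) y"] that by simp
  have WX: "W \<subseteq> ?X" by (rule tow_base[OF F(1)])
  have WS: "W \<subseteq> ?S" using WX F(3) by blast
  have TS: "?T \<subseteq> ?S"
  proof (rule tow_least[OF S WS])
    show "(\<delta> ^^ i) y \<in> ?S" if "i < n" for i using gen[of i] gen[of "Suc i"] that by simp
  qed
  have "\<delta> (poly p ((\<delta> ^^ n) y)) = 0" using p(2) by (simp add: der_0)
  then have "poly (pderiv p) ((\<delta> ^^ n) y) * (\<delta> ^^ Suc n) y = - poly (map_poly \<delta> p) ((\<delta> ^^ n) y)"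
    by (simp add: der_poly eq_neg_iff_add_eq_0 add.commute)
  then have e: "(\<delta> ^^ Suc n) y = - poly (map_poly \<delta> p) ((\<delta> ^^ n) y) / poly (pderiv p) ((\<delta> ^^ n) y)"
    using p(3) by (simp add: field_simps)
  have pX: "polyA ?X p" "polyA ?X (map_poly \<delta> p)" using p(1) TS by (auto simp: polyA_def coeff_map_poly der_0 simp del: tow.simps)
  have "(\<delta> ^^ Suc n) y \<in> ?X" unfolding e
    by (intro sfield_divide[OF X] sring_neg[OF Xr] polyA_poly[OF Xr] pX polyA_pderiv[OF Xr] gen) simp_all
  then have "(\<delta> ^^ n) y \<in> ?S" using gen[of n] by simp
  then have "?X \<subseteq> ?S" using adj_least[OF S TS] by simp
  then show ?thesis unfolding diff_subfield_iff using X by blast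
qed

text \<open>The derivative of order \<open>Suc n\<close> is given by the same rational expression
  for \<open>b j\<close> and for \<open>a j\<close>, with coefficients of lower order. Residues
  known up to order \<open>n + k\<close> therefore give the one of order
  \<open>n + Suc k\<close>.\<close>

lemma jet_res_step:
  assumes W: "diff_subfield \<delta> W" "hom_on W \<psi>" "L \<subseteq> W" "diff_subfield \<delta> L" "\<And>l. l \<in> L \<Longrightarrow> \<psi> l = fls_const l"
    and old: "\<And>i k. i < j \<Longrightarrow> b i \<in> W \<and> jet_res \<psi> k (b i) (a i)"
    and bj: "b j \<in> W" "jet_res \<psi> n (b j) (a j)"
    and f: "\<And>i. f i \<in> tower_poly L j n" "\<And>i. coeff p i = f i b" "\<And>i. coeff q i = f i a"
    and p: "poly p ((\<delta> ^^ n) (b j)) = 0" "poly (pderiv p) ((\<delta> ^^ n) (b j)) \<noteq> 0"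
    and q: "poly q ((\<delta> ^^ n) (a j)) = 0" "poly (pderiv q) ((\<delta> ^^ n) (a j)) \<noteq> 0"
  shows "jet_res \<psi> k (b j) (a j)"
proof -
  note F = diff_subfield_facts[OF W(1)]
  have e: "(\<delta> ^^ Suc n) y = - (poly (map_poly \<delta> p) ((\<delta> ^^ n) y) * inverse (poly (pderiv p) ((\<delta> ^^ n) y)))"
    if "poly p ((\<delta> ^^ n) y) = 0" "poly (pderiv p) ((\<delta> ^^ n) y) \<noteq> 0" for y p
  proof -
    have "\<delta> (poly p ((\<delta> ^^ n) y)) = 0" using that(1) by (simp add: der_0)
    then have "poly (pderiv p) ((\<delta> ^^ n) y) * (\<delta> ^^ Suc n) y = - poly (map_poly \<delta> p) ((\<delta> ^^ n) y)"
      by (simp add: der_poly eq_neg_iff_add_eq_0 add.commute)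
    then show ?thesis using that(2) by (simp add: field_simps)
  qed
  have "jet_res \<psi> (n + k) (b j) (a j)"
  proof (induction k)
    case 0
    then show ?case using bj by simp
  next
    case (Suc k)
    have fR: "f i b \<in> W \<and> jet_res \<psi> (Suc k) (f i b) (f i a)" for i
      by (rule tower_poly_jet_res[where f = "f i" and b = b and a = a and j = j and n = n and k = k and W = W and L = L and \<psi> = \<psi>]) (rule W old bj(1) Suc f(1), assumption?)+
    have y: "(\<delta> ^^ n) (b j) \<in> W" "jet_res \<psi> k ((\<delta> ^^ n) (b j)) ((\<delta> ^^ n) (a j))"
      using funpow_mem[OF W(1) bj(1)] jet_res_funpow[OF Suc, of n k] by simp_all
    have pW: "polyA W p" "polyA W (map_poly \<delta> p)" "polyA W (pderiv p)"
      using fR F(3) polyA_pderiv[OF F(2)] by (auto simp: polyA_def coeff_map_poly der_0 f(2))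
    have 1: "jet_res \<psi> k (poly (map_poly \<delta> p) ((\<delta> ^^ n) (b j))) (poly (map_poly \<delta> q) ((\<delta> ^^ n) (a j)))"
      using fR by (intro jet_res_poly[OF W(1,2) pW(2) _ y]) (simp add: coeff_map_poly der_0 f(2,3) jet_res_Suc)
    have N: "jet_res \<psi> k (of_nat i) (of_nat i) \<and> of_nat i \<in> W" for i
      using F(2) by (induction i)
        (auto intro: jet_res_zero[OF W(1,2)] jet_res_add[OF W(1,2)] jet_res_one[OF W(1,2)] sring_0 sring_1 sring_add)
    have 2: "jet_res \<psi> k (poly (pderiv p) ((\<delta> ^^ n) (b j))) (poly (pderiv q) ((\<delta> ^^ n) (a j)))"
    proof (rule jet_res_poly[OF W(1,2) pW(3) _ y])
      fix i
      show "jet_res \<psi> k (coeff (pderiv p) i) (coeff (pderiv q) i)"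
        unfolding coeff_pderiv f(2,3) using fR[of "Suc i"] N[of "Suc i"]
        by (intro jet_res_mult[OF W(1,2)]) (auto intro: jet_res_mono)
    qed
    have m: "poly (map_poly \<delta> p) ((\<delta> ^^ n) (b j)) \<in> W" "poly (pderiv p) ((\<delta> ^^ n) (b j)) \<in> W"
      by (rule polyA_poly[OF F(2) _ y(1)], rule pW)+
    have "jet_res \<psi> k ((\<delta> ^^ Suc n) (b j)) ((\<delta> ^^ Suc n) (a j))"
      unfolding e[OF p] e[OF q]
      by (intro jet_res_neg[OF W(1,2)] jet_res_mult[OF W(1,2)] jet_res_inverse[OF W(1,2)] 1 2 m q(2) sring_mult[OF F(2)] sfield_inv[OF F(1)])
    then have "res (\<psi> ((\<delta> ^^ (k + Suc n)) (b j))) ((\<delta> ^^ (k + Suc n)) (a j))"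
      unfolding jet_res_def funpow_add comp_apply by blast
    moreover have "k + Suc n = n + Suc k" by simp
    ultimately show ?case using Suc unfolding jet_res_def by (metis add_Suc_right le_Suc_eq)
  qed
  then show ?thesis by (rule jet_res_mono) simp
qed

text \<open>The derivatives of \<open>b j\<close> are adjoined one at a time. As long as they are transcendental, they
  are sent to the derivatives of \<open>a j\<close> perturbed by a multiple of the uniformizer that keeps them
  transcendental; the first algebraic one is lifted by Hensel's lemma, and then determines the others.\<close>

theorem laurent_embedding:
  assumes L: "diff_subfield \<delta> L" and small: "|dgen L m b| <o |UNIV :: 'a set|"
  shows "j \<le> m \<Longrightarrow> \<exists>E N. finite E \<and> finite N \<and> E \<subseteq> dpoly L j \<and> N \<subseteq> dpoly L j \<and> (\<forall>f\<in>E. f b = 0) \<and> (\<forall>f\<in>N. f b \<noteq> 0) \<and>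
    (\<forall>a. (\<forall>f\<in>E. f a = 0) \<and> (\<forall>f\<in>N. f a \<noteq> 0) \<longrightarrow>
      (\<exists>\<psi>. hom_on (dgen L j b) \<psi> \<and> (\<forall>l\<in>L. \<psi> l = fls_const l) \<and> (\<forall>i<j. \<forall>k. jet_res \<psi> k (b i) (a i))))"
proof (induction j)
  case 0
  have "hom_on (dgen L 0 b) fls_const" unfolding hom_on_def by (simp add: fls_plus_const)
  then show ?case by (intro exI[of _ "{}"]) auto
next
  case (Suc j)
  let ?W = "dgen L j b" and ?\<beta> = "\<lambda>i. (\<delta> ^^ i) (b j)"
  have L01: "0 \<in> L" "1 \<in> L" using L by (auto simp: diff_subfield_def)
  obtain E N where IH: "finite E" "finite N" "E \<subseteq> dpoly L j" "N \<subseteq> dpoly L j" "\<forall>f\<in>E. f b = 0" "\<forall>f\<in>N. f b \<noteq> 0"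
    "\<forall>a. (\<forall>f\<in>E. f a = 0) \<and> (\<forall>f\<in>N. f a \<noteq> 0) \<longrightarrow>
      (\<exists>\<psi>. hom_on ?W \<psi> \<and> (\<forall>l\<in>L. \<psi> l = fls_const l) \<and> (\<forall>i<j. \<forall>k. jet_res \<psi> k (b i) (a i)))"
  proof -
    have "j \<le> m" using Suc.prems by simp
    from Suc.IH[OF this] show ?thesis using that by (elim exE conjE)
  qed
  have EN: "E \<subseteq> dpoly L (Suc j)" "N \<subseteq> dpoly L (Suc j)"
    using IH(3,4) dpoly_mono[of _ L j L "Suc j"] by (auto simp: subset_iff)
  have dW: "diff_subfield \<delta> ?W" by (rule dgen_diff_subfield)
  note F = diff_subfield_facts[OF dW]
  have bj: "b j \<in> dgen L m b" using Suc.prems by (intro dgen_var) simp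
  have WM: "?W \<subseteq> dgen L m b"
    unfolding dgen_def using Suc.prems by (intro diff_gen_mono) auto
  have smallT: "|tow ?W ?\<beta> i| <o |UNIV :: 'a set|" for i
  proof -
    have "tow ?W ?\<beta> i \<subseteq> dgen L m b"
      using WM funpow_mem[OF dgen_diff_subfield bj] diff_subfield_facts(1)[OF dgen_diff_subfield] by (intro tow_least)
    then have "|tow ?W ?\<beta> i| \<le>o |dgen L m b|" by (rule card_of_mono1)
    then show ?thesis using small by (rule ordLeq_ordLess_trans)
  qed
  have dgen_sub: "dgen L (Suc j) b \<subseteq> X" if X: "diff_subfield \<delta> X" "?W \<subseteq> X" "b j \<in> X" for X
    unfolding dgen_def
  proof (rule diff_gen_least[OF X(1)])
    show "L \<union> b ` {..<Suc j} \<subseteq> X" using X(2,3) dgen_const[of _ L j b] dgen_var[of _ j b L] by (auto simp: less_Suc_eq subset_iff)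
  qed
  have oldRR: "jet_res \<psi>' k (b i) (a i)" if "jet_res \<psi> k (b i) (a i)" "\<forall>y\<in>?W. \<psi>' y = \<psi> y" "i < j" for \<psi> \<psi>' k i a
    using that(1) funpow_mem[OF dW dgen_var[OF that(3)]] that(2) unfolding jet_res_def by simp
  show ?case
  proof (cases "\<forall>n. transc (tow ?W ?\<beta> n) (?\<beta> n)")
    case True
    \<comment> \<open>All derivatives of \<open>b j\<close> can be moved freely, so the literals for
      the earlier variables suffice.\<close>
    have "\<exists>\<psi>. hom_on (dgen L (Suc j) b) \<psi> \<and> (\<forall>l\<in>L. \<psi> l = fls_const l) \<and> (\<forall>i<Suc j. \<forall>k. jet_res \<psi> k (b i) (a i))"
      if lit\<^sub>0: "(\<forall>f\<in>E. f a = 0) \<and> (\<forall>f\<in>N. f a \<noteq> 0)" for a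
    proof -
      from IH(7)[rule_format, OF lit\<^sub>0] obtain \<psi>\<^sub>0 where p0: "hom_on ?W \<psi>\<^sub>0" "\<forall>l\<in>L. \<psi>\<^sub>0 l = fls_const l" "\<forall>i<j. \<forall>k. jet_res \<psi>\<^sub>0 k (b i) (a i)"
        by (elim exE conjE)
      obtain \<psi> where p: "hom_on (\<Union>n. tow ?W ?\<beta> n) \<psi>" "\<forall>y\<in>?W. \<psi> y = \<psi>\<^sub>0 y" "\<forall>i. res (\<psi> (?\<beta> i)) ((\<delta> ^^ i) (a j))"
        using tower_infinite[OF F(1) p0(1) smallT True[rule_format], of "\<lambda>i. (\<delta> ^^ i) (a j)"] by (elim exE conjE)
      have X: "diff_subfield \<delta> (\<Union>n. tow ?W ?\<beta> n)" by (rule diff_subfield_union_tower[OF dW])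
      have "dgen L (Suc j) b \<subseteq> (\<Union>n. tow ?W ?\<beta> n)"
      proof (rule dgen_sub[OF X])
        show "?W \<subseteq> (\<Union>n. tow ?W ?\<beta> n)" using tow_base[OF F(1), of ?\<beta> 0] by blast
        show "b j \<in> (\<Union>n. tow ?W ?\<beta> n)" using tow_mem[OF F(1), of 0 1 ?\<beta>] by (intro UN_I[of 1]) simp_all
      qed
      from hom_on_subset[OF p(1) this] show ?thesis
      proof (intro exI[of _ \<psi>] conjI ballI allI impI)
        show "\<psi> l = fls_const l" if "l \<in> L" for l using p(2) p0(2) dgen_const[OF that] that by simp
        show "jet_res \<psi> k (b i) (a i)" if "i < Suc j" for i k
        proof (cases "i = j")
          case True
          then show ?thesis using p(3) by (simp add: jet_res_def)
        next
          case False
          then have "i < j" using that by simp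
          then show ?thesis using oldRR[OF _ p(2)] p0(3) by blast
        qed
      qed
    qed
    then show ?thesis using IH(1,2,5,6) EN by (intro exI[of _ E] exI[of _ N] conjI allI impI)
  next
    case False
    define n where "n = (LEAST n. \<not> transc (tow ?W ?\<beta> n) (?\<beta> n))"
    have nt: "\<not> transc (tow ?W ?\<beta> n) (?\<beta> n)" unfolding n_def using False by (metis (mono_tags, lifting) LeastI_ex)
    have tr: "transc (tow ?W ?\<beta> i) (?\<beta> i)" if "i < n" for i using not_less_Least[OF that[unfolded n_def]] by simp
    let ?T = "tow ?W ?\<beta> n"
    obtain p f where p: "polyA ?T p" "p \<noteq> 0" "poly p (?\<beta> n) = 0"
      "\<forall>q. polyA ?T q \<longrightarrow> q \<noteq> 0 \<longrightarrow> poly q (?\<beta> n) = 0 \<longrightarrow> degree p \<le> degree q"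
      "\<forall>i. f i \<in> tower_poly L j n \<and> coeff p i = f i b" "poly (pderiv p) (?\<beta> n) \<noteq> 0"
      using algebraic_step[OF L nt] by (elim exE conjE)
    define D where "D = degree p"
    define g where "g i = (if i \<le> D then f i else (\<lambda>_. 0))" for i
    have g: "g i \<in> tower_poly L j n" "coeff p i = g i b" for i
      using p(5) tower_poly_const[OF L01(1)] coeff_eq_0[of p i] by (cases "i \<le> D"; simp add: g_def D_def)+
    \<comment> \<open>The polynomial \<open>p\<close> specialised at \<open>a\<close>. Its degree
      may drop there, which does no harm: Hensel's lemma asks for residues of coefficients and a
      simple root only.\<close>
    define q where "q a = Abs_poly (\<lambda>i. g i a)" for a
    have q: "coeff (q a) i = g i a" for a i
      unfolding q_def by (subst coeff_Abs_poly[of D]) (auto simp: g_def)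
    have degq: "degree (q a) \<le> D" for a by (rule degree_le) (auto simp: q g_def)
    have qb: "q b = p" by (rule poly_eqI) (simp add: q g(2))
    \<comment> \<open>\<open>e\<close> and \<open>s\<close> are the value of the polynomial and of
      its derivative (the separant) as differential polynomial functions; they become the new
      equation and the new inequation.\<close>
    define e where "e x = (\<Sum>i\<le>D. g i x * ((\<delta> ^^ n) (x j)) ^ i)" for x
    define s where "s x = (\<Sum>i\<le>D. (of_nat (Suc i) * g (Suc i) x) * ((\<delta> ^^ n) (x j)) ^ i)" for x
    have e: "e a = poly (q a) ((\<delta> ^^ n) (a j))" for a
      unfolding e_def by (simp add: poly_altdef_le[OF degq] q)
    have s: "s a = poly (pderiv (q a)) ((\<delta> ^^ n) (a j))" for a
    proof -
      have "degree (pderiv (q a)) \<le> D" using degq[of a] degree_pderiv[of "q a"] by simp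
      then show ?thesis unfolding s_def by (simp add: poly_altdef_le coeff_pderiv q)
    qed
    have nat_in: "of_nat i \<in> L" for i by (rule sring_of_nat[OF diff_subfield_facts(2)[OF L]])
    have var: "(\<lambda>x. (\<delta> ^^ n) (x j)) \<in> dpoly L (Suc j)" by (rule dpoly_funpow[OF dpoly.var]) simp
    have eD: "e \<in> dpoly L (Suc j)" unfolding e_def[abs_def]
      by (intro dpoly_sum L01 dpoly.mult dpoly_power var tower_poly_imp_dpoly[OF g(1)])
    have sD: "s \<in> dpoly L (Suc j)" unfolding s_def[abs_def]
      by (intro dpoly_sum L01 dpoly.mult dpoly_power var tower_poly_imp_dpoly[OF g(1)] dpoly.const nat_in)
    have eb: "e b = 0" "s b \<noteq> 0" using p(3,6) unfolding e s qb .
    have "\<exists>\<psi>. hom_on (dgen L (Suc j) b) \<psi> \<and> (\<forall>l\<in>L. \<psi> l = fls_const l) \<and> (\<forall>i<Suc j. \<forall>k. jet_res \<psi> k (b i) (a i))"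
      if lit: "(\<forall>f\<in>insert e E. f a = 0) \<and> (\<forall>f\<in>insert s N. f a \<noteq> 0)" for a
    proof -
      have "(\<forall>f\<in>E. f a = 0) \<and> (\<forall>f\<in>N. f a \<noteq> 0)" using lit by simp
      from IH(7)[rule_format, OF this]
      obtain \<psi>\<^sub>0 where p0: "hom_on ?W \<psi>\<^sub>0" "\<forall>l\<in>L. \<psi>\<^sub>0 l = fls_const l" "\<forall>i<j. \<forall>k. jet_res \<psi>\<^sub>0 k (b i) (a i)"
        by (elim exE conjE)
      have ea: "e a = 0" "s a \<noteq> 0" using lit by simp_all
      have "\<exists>\<psi>'. hom_on ?T \<psi>' \<and> (\<forall>y\<in>?W. \<psi>' y = \<psi>\<^sub>0 y) \<and> (\<forall>i<n. res (\<psi>' (?\<beta> i)) ((\<delta> ^^ i) (a j)))"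
        by (rule tower_finite[OF F(1) p0(1) smallT]) (rule tr)
      then obtain \<psi>\<^sub>1 where p1: "hom_on ?T \<psi>\<^sub>1" "\<forall>y\<in>?W. \<psi>\<^sub>1 y = \<psi>\<^sub>0 y" "\<forall>i<n. res (\<psi>\<^sub>1 (?\<beta> i)) ((\<delta> ^^ i) (a j))"
        by (elim exE conjE)
      have T: "sfield ?T" by (rule sfield_tow[OF F(1)])
      have WT: "?W \<subseteq> ?T" by (rule tow_base[OF F(1)])
      have gres: "res (\<psi>\<^sub>1 (g i b)) (g i a)" for i
      proof -
        have "g i b \<in> ?T \<and> res (\<psi>\<^sub>1 (g i b)) (g i a)"
        proof (rule tower_poly_res[where f = "g i" and b = b and a = a and j = j and n = n and L = L, OF T p1(1) _ _ _ _ g(1)])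
          show "L \<subseteq> ?T" using WT dgen_const[of _ L j b] by blast
          show "\<psi>\<^sub>1 l = fls_const l" if "l \<in> L" for l using p1(2) p0(2) dgen_const[OF that] that by simp
          show "(\<delta> ^^ k) (b i) \<in> ?T \<and> res (\<psi>\<^sub>1 ((\<delta> ^^ k) (b i))) ((\<delta> ^^ k) (a i))" if "i < j" for i k
          proof -
            have "(\<delta> ^^ k) (b i) \<in> ?W" by (rule funpow_mem[OF dW dgen_var[OF that]])
            moreover have "res (\<psi>\<^sub>0 ((\<delta> ^^ k) (b i))) ((\<delta> ^^ k) (a i))" using p0(3) that unfolding jet_res_def by blast
            ultimately show ?thesis using p1(2) WT by auto
          qed
          show "(\<delta> ^^ k) (b j) \<in> ?T \<and> res (\<psi>\<^sub>1 ((\<delta> ^^ k) (b j))) ((\<delta> ^^ k) (a j))" if "k < n" for k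
            using tow_mem[OF F(1) that, of ?\<beta>] p1(3) that by simp
        qed
        then show ?thesis ..
      qed
      \<comment> \<open>The literals \<open>e a = 0\<close> and \<open>s a \<noteq> 0\<close> say
        that the \<open>n\<close>-th derivative of \<open>a j\<close> is a simple root of the
        residue polynomial \<open>q a\<close>.\<close>
      have "\<exists>\<xi>. poly (map_poly \<psi>\<^sub>1 p) \<xi> = 0 \<and> res \<xi> ((\<delta> ^^ n) (a j))"
      proof (rule hensel_fls[where q = "q a"])
        show "res (coeff (map_poly \<psi>\<^sub>1 p) i) (coeff (q a) i)" for i
          unfolding coeff_hom[OF T p1(1)] q g(2) by (rule gres)
      qed (use ea in \<open>simp_all add: e s\<close>)
      then obtain \<xi> where \<xi>: "poly (map_poly \<psi>\<^sub>1 p) \<xi> = 0" "res \<xi> ((\<delta> ^^ n) (a j))" by blast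
      have "\<exists>\<psi>'. hom_on (adj ?T (?\<beta> n)) \<psi>' \<and> (\<forall>y\<in>?T. \<psi>' y = \<psi>\<^sub>1 y) \<and> \<psi>' (?\<beta> n) = \<xi>"
      proof (rule hom_extend[OF T p1(1)])
        fix r assume r: "polyA ?T r"
        show "poly r (?\<beta> n) = 0 \<longleftrightarrow> poly (map_poly \<psi>\<^sub>1 r) \<xi> = 0"
          by (rule algebraic_transfer[OF T p1(1) p(1-3) _ \<xi>(1) r]) (rule p(4)[rule_format])
      qed
      then obtain \<psi> where ps: "hom_on (adj ?T (?\<beta> n)) \<psi>" "\<forall>y\<in>?T. \<psi> y = \<psi>\<^sub>1 y" "\<psi> (?\<beta> n) = \<xi>"
        by (elim exE conjE)
      let ?X = "tow ?W ?\<beta> (Suc n)"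
      have hX: "hom_on ?X \<psi>" using ps(1) by simp
      have X: "diff_subfield \<delta> ?X" by (rule diff_subfield_algebraic_step[OF dW p(1,3,6)])
      have WX: "?W \<subseteq> ?X" by (rule tow_base[OF F(1)])
      have bX: "b j \<in> ?X" using tow_mem[OF F(1), of 0 "Suc n" ?\<beta>] by simp
      have agr: "\<forall>y\<in>?W. \<psi> y = \<psi>\<^sub>0 y" using ps(2) p1(2) WT by (auto simp: subset_iff)
      have cl: "\<psi> l = fls_const l" if "l \<in> L" for l using agr p0(2) dgen_const[OF that] that by simp
      have RRn: "jet_res \<psi> n (b j) (a j)" unfolding jet_res_def
      proof (intro allI impI)
        fix i assume "i \<le> n"
        show "res (\<psi> ((\<delta> ^^ i) (b j))) ((\<delta> ^^ i) (a j))"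
        proof (cases "i = n")
          case True
          then show ?thesis using ps(3) \<xi>(2) by simp
        next
          case False
          then have "i < n" using \<open>i \<le> n\<close> by simp
          then show ?thesis using ps(2) tow_mem[OF F(1), of i n ?\<beta>] p1(3) by simp
        qed
      qed
      have RRold: "jet_res \<psi> k (b i) (a i)" if "i < j" for i k using oldRR[OF _ agr that] p0(3) that by blast
      have RRj: "jet_res \<psi> k (b j) (a j)" for k
      proof (rule jet_res_step[where b = b and a = a and j = j and n = n and p = p and q = "q a" and f = g and L = L and W = ?X and \<psi> = \<psi>, OF X hX _ L _ _ bX RRn g(1) g(2) q p(3,6)])
        show "\<psi> l = fls_const l" if "l \<in> L" for l by (rule cl[OF that])
      next
        show "L \<subseteq> ?X" using WX dgen_const[of _ L j b] by blast
        show "b i \<in> ?X \<and> jet_res \<psi> k (b i) (a i)" if "i < j" for i k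
          by (intro conjI subsetD[OF WX dgen_var[OF that]] RRold[OF that])
      qed (use ea in \<open>simp_all add: e s\<close>)
      show ?thesis
      proof (intro exI[of _ \<psi>] conjI ballI allI impI)
        show "hom_on (dgen L (Suc j) b) \<psi>" by (rule hom_on_subset[OF hX dgen_sub[OF X WX bX]])
        show "jet_res \<psi> k (b i) (a i)" if "i < Suc j" for i k
          using RRj RRold that by (cases "i = j") simp_all
      qed (rule cl)
    qed
    moreover have "\<forall>f\<in>insert e E. f b = 0" "\<forall>f\<in>insert s N. f b \<noteq> 0" using IH(5,6) eb by simp_all
    ultimately show ?thesis using IH(1,2) EN eD sD
      by (intro exI[of _ "insert e E"] exI[of _ "insert s N"] conjI allI impI) simp_all
  qed
qed

end

section \<open>Strongly normal extensions\<close>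

lemma of_base_add: "of_base (x + y) = of_base x + of_base y"
  and of_base_mult: "of_base (x * y) = of_base x * of_base y"
  and of_base_neg: "of_base (- x) = - of_base x"
  and of_base_0: "of_base 0 = 0" and of_base_1: "of_base 1 = 1"
  and of_base_inj: "of_base x = of_base y \<longleftrightarrow> x = y"
  by (simp_all add: of_base_def plus_adj_i_def times_adj_i_def uminus_adj_i_def zero_adj_i_def one_adj_i_def
      inverse_adj_i_def)

lemma of_base_inverse: "of_base (inverse x) = inverse (of_base x)"
  by (cases "x = 0") (simp_all add: of_base_def inverse_adj_i_def power2_eq_square field_simps)

locale sn_ext = codf \<delta> CODF for \<delta> :: "'u::linordered_field \<Rightarrow> 'u" and CODF +
  fixes K L :: "'u set"
  assumes K: "diff_subfield \<delta> K" and Ksmall: "K \<prec> (UNIV :: 'u set)" and L: "diff_subfield \<delta> L" and KL: "K \<subseteq> L"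
    and sn: "strongly_normal \<delta> (of_base ` K) (of_base ` L)"
begin

definition C where "C = constants \<delta> UNIV"
definition F where "F = diff_gen \<delta> (L \<union> C)"
definition E where "E = diff_gen \<delta> (K \<union> C)"

lemma F_dsf: "diff_subfield \<delta> F" and E_dsf: "diff_subfield \<delta> E"
  unfolding F_def E_def by (rule diff_subfield_diff_gen)+

lemma C_sfield: "sfield C" unfolding C_def by (rule sfield_constants[OF sfield_UNIV])
lemma C_der: "c \<in> C \<longleftrightarrow> \<delta> c = 0" by (simp add: C_def constants_def)
lemma LF: "L \<subseteq> F" and CF: "C \<subseteq> F" and KE: "K \<subseteq> E" and CE: "C \<subseteq> E"
  unfolding F_def E_def using subset_diff_gen by blast+
lemma EF: "E \<subseteq> F" unfolding E_def by (rule diff_gen_least[OF F_dsf]) (use KL LF CF in blast)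

lemma diff_subfield_adj_i_set:
  assumes A: "diff_subfield \<delta> A" shows "diff_subfield (ext_deriv \<delta>) (adj_i_set A)"
proof -
  note Ar = diff_subfield_facts[OF A]
  show ?thesis unfolding diff_subfield_def
  proof (intro conjI ballI)
    show "0 \<in> adj_i_set A" "1 \<in> adj_i_set A"
      using sring_0[OF Ar(2)] sring_1[OF Ar(2)] by (auto simp: adj_i_set_def zero_adj_i_def one_adj_i_def)
    fix x assume "x \<in> adj_i_set A"
    then obtain a b where x: "x = Adj a b" "a \<in> A" "b \<in> A" by (auto simp: adj_i_set_def)
    have "a / (a\<^sup>2 + b\<^sup>2) \<in> A" "- b / (a\<^sup>2 + b\<^sup>2) \<in> A"
      using x by (auto intro!: sfield_divide[OF Ar(1)] sring_add[OF Ar(2)] sring_power[OF Ar(2)] sring_neg[OF Ar(2)])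
    then show "- x \<in> adj_i_set A" "inverse x \<in> adj_i_set A" "ext_deriv \<delta> x \<in> adj_i_set A"
      using x sring_neg[OF Ar(2)] Ar(3) by (auto simp: adj_i_set_def uminus_adj_i_def inverse_adj_i_def ext_deriv_def)
    fix y assume "y \<in> adj_i_set A"
    then obtain c d where y: "y = Adj c d" "c \<in> A" "d \<in> A" by (auto simp: adj_i_set_def)
    show "x + y \<in> adj_i_set A" "x * y \<in> adj_i_set A"
      using x y by (auto simp: adj_i_set_def plus_adj_i_def times_adj_i_def intro!: sring_add[OF Ar(2)] sring_mult[OF Ar(2)] sring_diff[OF Ar(2)])
  qed
qed

lemma diff_subfield_of_base:
  assumes A: "diff_subfield \<delta> A" shows "diff_subfield (ext_deriv \<delta>) (of_base ` A)"
proof -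
  note Ar = diff_subfield_facts[OF A]
  have d: "ext_deriv \<delta> (of_base x) = of_base (\<delta> x)" for x by (simp add: ext_deriv_def of_base_def der_0)
  show ?thesis unfolding diff_subfield_def
  proof (intro conjI ballI)
    show "0 \<in> of_base ` A" using sring_0[OF Ar(2)] of_base_0 by (metis image_eqI)
    show "1 \<in> of_base ` A" using sring_1[OF Ar(2)] of_base_1 by (metis image_eqI)
    fix x assume "x \<in> of_base ` A"
    then obtain a where x: "x = of_base a" "a \<in> A" by blast
    show "- x \<in> of_base ` A" unfolding x(1) of_base_neg[symmetric] by (intro imageI sring_neg[OF Ar(2)] x(2))
    show "inverse x \<in> of_base ` A" unfolding x(1) of_base_inverse[symmetric] by (intro imageI sfield_inv[OF Ar(1)] x(2))
    show "ext_deriv \<delta> x \<in> of_base ` A" unfolding x(1) d by (intro imageI Ar(3) x(2))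
    fix y assume "y \<in> of_base ` A"
    then obtain b where y: "y = of_base b" "b \<in> A" by blast
    show "x + y \<in> of_base ` A" unfolding x(1) y(1) of_base_add[symmetric] by (intro imageI sring_add[OF Ar(2)] x(2) y(2))
    show "x * y \<in> of_base ` A" unfolding x(1) y(1) of_base_mult[symmetric] by (intro imageI sring_mult[OF Ar(2)] x(2) y(2))
  qed
qed

text \<open>The finitely many generators given by strong normality live in \<open>U(i)\<close>, but
  belong to the image of \<open>L\<close> and hence come from \<open>U\<close>.\<close>

lemma L_generated: "\<exists>m a. L = dgen K m a"
proof -
  obtain S where S: "finite S" "of_base ` L = diff_gen (ext_deriv \<delta>) (of_base ` K \<union> S)"
    using sn unfolding strongly_normal_def Let_def by blast
  have "S \<subseteq> of_base ` L" unfolding S(2) diff_gen_def by blast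
  then obtain S' where S': "S' \<subseteq> L" "finite S'" "S = of_base ` S'" using S(1) by (meson finite_subset_image)
  obtain ls where ls: "set ls = S'" using finite_list[OF S'(2)] by blast
  have S'e: "S' = (\<lambda>i. ls ! i) ` {..<length ls}" unfolding ls[symmetric] by (auto simp: in_set_conv_nth)
  have "L = diff_gen \<delta> (K \<union> S')"
  proof
    have "diff_gen (ext_deriv \<delta>) (of_base ` K \<union> S) \<subseteq> of_base ` diff_gen \<delta> (K \<union> S')"
    proof -
      have "diff_subfield (ext_deriv \<delta>) (of_base ` diff_gen \<delta> (K \<union> S'))"
        by (rule diff_subfield_of_base[OF diff_subfield_diff_gen])
      moreover have "of_base ` K \<union> S \<subseteq> of_base ` diff_gen \<delta> (K \<union> S')"
        using subset_diff_gen[of "K \<union> S'"] S'(3) by blast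
      ultimately show ?thesis unfolding diff_gen_def[of "ext_deriv \<delta>"] by blast
    qed
    then have "of_base ` L \<subseteq> of_base ` diff_gen \<delta> (K \<union> S')" using S(2) by simp
    then show "L \<subseteq> diff_gen \<delta> (K \<union> S')" by (simp add: inj_image_subset_iff inj_def of_base_inj)
    show "diff_gen \<delta> (K \<union> S') \<subseteq> L" by (rule diff_gen_least[OF L]) (use KL S'(1) in blast)
  qed
  then show ?thesis unfolding dgen_def S'e by (intro exI[of _ "length ls"] exI[of _ "\<lambda>i. ls ! i"])
qed

text \<open>Acting on real and imaginary parts turns \<open>\<beta>\<close> into an automorphism of
  \<open>U(i)\<close> over \<open>K\<close>, to which strong normality applies. The field generated
  by \<open>L\<close> and the constants of \<open>U(i)\<close> lies in \<open>adj_i_set F\<close>,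
  so the real part of the image of an element of \<open>L\<close> lies in \<open>F\<close>.\<close>

lemma automorphism_preserves_F:
  assumes b: "bij \<beta>" "\<And>x y. \<beta> (x + y) = \<beta> x + \<beta> y" "\<And>x y. \<beta> (x * y) = \<beta> x * \<beta> y" "\<And>x. \<beta> (\<delta> x) = \<delta> (\<beta> x)"
     "\<And>x. x \<in> K \<Longrightarrow> \<beta> x = x"
  shows "x \<in> F \<Longrightarrow> \<beta> x \<in> F"
proof -
  have b0: "\<beta> 0 = 0" using b(2)[of 0 0] by simp
  have b1: "\<beta> 1 = 1" using b(5) K by (simp add: diff_subfield_def)
  have bneg: "\<beta> (- x) = - \<beta> x" for x using b(2)[of x "- x"] b0 by (simp add: eq_neg_iff_add_eq_0 add.commute)
  have bdiff: "\<beta> (x - y) = \<beta> x - \<beta> y" for x y using b(2)[of x "- y"] bneg by simp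
  have binv: "\<beta> (inverse x) = inverse (\<beta> x)" for x
  proof (cases "x = 0")
    case False
    then have "\<beta> x * \<beta> (inverse x) = 1" using b(3)[of x "inverse x"] b1 by simp
    then show ?thesis by (metis inverse_unique)
  qed (simp add: b0)
  define \<sigma> where "\<sigma> z = Adj (\<beta> (re z)) (\<beta> (im z))" for z
  have "bij \<sigma>"
  proof (rule o_bij)
    show "(\<lambda>z. Adj (inv_into UNIV \<beta> (re z)) (inv_into UNIV \<beta> (im z))) \<circ> \<sigma> = id"
      using b(1) by (auto simp: \<sigma>_def fun_eq_iff bij_def)
    show "\<sigma> \<circ> (\<lambda>z. Adj (inv_into UNIV \<beta> (re z)) (inv_into UNIV \<beta> (im z))) = id"
      using b(1) by (auto simp: \<sigma>_def fun_eq_iff bij_def surj_f_inv_f)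
  qed
  then have "\<sigma> \<in> carrier (gal (ext_deriv \<delta>) UNIV (of_base ` K))"
    by (auto simp: gal_def \<sigma>_def plus_adj_i_def times_adj_i_def ext_deriv_def of_base_def b bdiff b0)
  then have eq: "diff_gen (ext_deriv \<delta>) (of_base ` L \<union> adj_i_set C) = diff_gen (ext_deriv \<delta>) (\<sigma> ` of_base ` L \<union> adj_i_set C)"
    using sn unfolding strongly_normal_def Let_def C_def by blast
  have sub: "diff_gen (ext_deriv \<delta>) (of_base ` L \<union> adj_i_set C) \<subseteq> adj_i_set F"
  proof -
    have "of_base ` L \<union> adj_i_set C \<subseteq> adj_i_set F"
      using LF CF F_dsf by (auto simp: of_base_def adj_i_set_def diff_subfield_def)
    then show ?thesis unfolding diff_gen_def using diff_subfield_adj_i_set[OF F_dsf] by blast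
  qed
  have bL: "\<beta> l \<in> F" if "l \<in> L" for l
  proof -
    have "\<sigma> (of_base l) \<in> diff_gen (ext_deriv \<delta>) (\<sigma> ` of_base ` L \<union> adj_i_set C)"
      unfolding diff_gen_def using that by blast
    then have "\<sigma> (of_base l) \<in> adj_i_set F" using eq sub by blast
    then show ?thesis by (auto simp: \<sigma>_def of_base_def adj_i_set_def)
  qed
  have "diff_subfield \<delta> {x. \<beta> x \<in> F}"
    using F_dsf unfolding diff_subfield_def by (simp add: b0 b1 b(2,3,4) bneg binv)
  moreover have "L \<union> C \<subseteq> {x. \<beta> x \<in> F}"
  proof -
    have "\<beta> c \<in> F" if "c \<in> C" for c
    proof -
      have "\<delta> (\<beta> c) = 0" using that b(4)[of c] b0 by (simp add: C_der)
      then show ?thesis using CF C_der by blast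
    qed
    then show ?thesis using bL by blast
  qed
  ultimately have "F \<subseteq> {x. \<beta> x \<in> F}" unfolding F_def by (rule diff_gen_least)
  then show "x \<in> F \<Longrightarrow> \<beta> x \<in> F" by blast
qed

abbreviation GG where "GG \<equiv> carrier (Gal \<delta> L K)"

lemma GG_iff: "\<sigma> \<in> GG \<longleftrightarrow> \<sigma> \<in> extensional F \<and> bij_betw \<sigma> F F \<and>
   (\<forall>x\<in>F. \<forall>y\<in>F. \<sigma> (x + y) = \<sigma> x + \<sigma> y \<and> \<sigma> (x * y) = \<sigma> x * \<sigma> y) \<and> (\<forall>x\<in>F. \<sigma> (\<delta> x) = \<delta> (\<sigma> x)) \<and> (\<forall>x\<in>E. \<sigma> x = x)"
  unfolding Gal_def gal_def F_def E_def C_def by simp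

lemma GG_mem: "\<sigma> \<in> GG \<Longrightarrow> x \<in> F \<Longrightarrow> \<sigma> x \<in> F"
  unfolding GG_iff bij_betw_def by blast

lemma GG_zero_iff: "\<sigma> \<in> GG \<Longrightarrow> x \<in> F \<Longrightarrow> \<sigma> x = 0 \<longleftrightarrow> x = 0"
proof -
  assume s: "\<sigma> \<in> GG" "x \<in> F"
  have 0: "0 \<in> E" "0 \<in> F" using E_dsf F_dsf by (auto simp: diff_subfield_def)
  then have "\<sigma> 0 = 0" using s(1) unfolding GG_iff by blast
  then show ?thesis using s 0 unfolding GG_iff bij_betw_def inj_on_def by metis
qed

lemma GG_dpoly:
  assumes s: "\<sigma> \<in> GG" and x: "\<And>i. i < m \<Longrightarrow> x i \<in> F"
  shows "f \<in> dpoly E m \<Longrightarrow> \<sigma> (f x) = f (\<lambda>i. \<sigma> (x i))"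
proof -
  note S = s[unfolded GG_iff]
  note Fr = diff_subfield_facts[OF F_dsf]
  have "f \<in> dpoly E m \<Longrightarrow> f x \<in> F \<and> \<sigma> (f x) = f (\<lambda>i. \<sigma> (x i))"
  proof (induction rule: dpoly.induct)
    case (const a)
    then show ?case using S EF by blast
  next
    case (neg f)
    have "\<sigma> (f x + - f x) = \<sigma> (f x) + \<sigma> (- f x)" using S neg sring_neg[OF Fr(2)] by blast
    moreover have "\<sigma> 0 = 0" using GG_zero_iff[OF s sring_0[OF Fr(2)]] by simp
    ultimately have "\<sigma> (- f x) = - \<sigma> (f x)" by (simp add: eq_neg_iff_add_eq_0 add.commute)
    then show ?case using neg sring_neg[OF Fr(2)] by simp
  qed (use x S Fr(3) sring_add[OF Fr(2)] sring_mult[OF Fr(2)] in simp_all)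
  then show "f \<in> dpoly E m \<Longrightarrow> \<sigma> (f x) = f (\<lambda>i. \<sigma> (x i))" by blast
qed

subsection \<open>Fractions of constant combinations\<close>

text \<open>For a fixed finite \<open>V\<close> this is a definable condition on \<open>x\<close>,
  whereas membership in \<open>F\<close> is a union of such conditions over all finite
  \<open>V\<close>. Row \<open>m\<close> of \<open>c\<close> holds the common denominator.\<close>

definition const_frac :: "nat \<Rightarrow> 'u set \<Rightarrow> (nat \<Rightarrow> 'u) \<Rightarrow> bool" where
  "const_frac m V x \<longleftrightarrow> (\<exists>c. (\<forall>i. \<forall>v\<in>V. c i v \<in> C) \<and> (\<Sum>v\<in>V. c m v * v) \<noteq> 0 \<and>
     (\<forall>i<m. x i * (\<Sum>v\<in>V. c m v * v) = (\<Sum>v\<in>V. c i v * v)))"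

lemma const_frac_cong: "(\<And>i. i < m \<Longrightarrow> x i = y i) \<Longrightarrow> const_frac m V x \<longleftrightarrow> const_frac m V y"
  unfolding const_frac_def by simp

lemma const_frac_mono:
  assumes "const_frac m V x" "V \<subseteq> V'" "finite V'" shows "const_frac m V' x"
proof -
  obtain c where c: "\<forall>i. \<forall>v\<in>V. c i v \<in> C" "(\<Sum>v\<in>V. c m v * v) \<noteq> 0"
     "\<forall>i<m. x i * (\<Sum>v\<in>V. c m v * v) = (\<Sum>v\<in>V. c i v * v)" using assms(1) unfolding const_frac_def by blast
  define c' where "c' i v = (if v \<in> V then c i v else 0)" for i v
  have "(\<Sum>v\<in>V'. c' i v * v) = (\<Sum>v\<in>V. c i v * v)" for i
    using assms(2,3) by (intro sum.mono_neutral_cong_right) (auto simp: c'_def)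
  moreover have "\<forall>i. \<forall>v\<in>V'. c' i v \<in> C" using c(1) sring_0[OF sfield_imp_sring[OF C_sfield]] by (auto simp: c'_def)
  ultimately show ?thesis unfolding const_frac_def using c by (intro exI[of _ c']) simp
qed

inductive_set CL_span :: "'u set" where
  base: "c \<in> C \<Longrightarrow> l \<in> L \<Longrightarrow> c * l \<in> CL_span"
| add: "x \<in> CL_span \<Longrightarrow> y \<in> CL_span \<Longrightarrow> x + y \<in> CL_span"

lemma CL_span_expand: "x \<in> CL_span \<Longrightarrow> \<exists>V c. finite V \<and> V \<subseteq> L \<and> (\<forall>v. c v \<in> C) \<and> (\<forall>V'. finite V' \<longrightarrow> V \<subseteq> V' \<longrightarrow> x = (\<Sum>v\<in>V'. c v * v))"
proof (induction rule: CL_span.induct)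
  case (base c l)
  have "c * l = (\<Sum>v\<in>V'. (if v = l then c else 0) * v)" if "finite V'" "{l} \<subseteq> V'" for V'
    using that by (subst sum.remove[of _ l]) (auto intro!: sum.neutral)
  then show ?case using base sring_0[OF sfield_imp_sring[OF C_sfield]]
    by (intro exI[of _ "{l}"] exI[of _ "\<lambda>v. if v = l then c else 0"]) simp
next
  case (add x y)
  from add.IH(1) obtain V c where 1: "finite V" "V \<subseteq> L" "\<forall>v. c v \<in> C" "\<forall>V'. finite V' \<longrightarrow> V \<subseteq> V' \<longrightarrow> x = (\<Sum>v\<in>V'. c v * v)"
    by (elim exE conjE)
  from add.IH(2) obtain V\<^sub>2 d where 2: "finite V\<^sub>2" "V\<^sub>2 \<subseteq> L" "\<forall>v. d v \<in> C" "\<forall>V'. finite V' \<longrightarrow> V\<^sub>2 \<subseteq> V' \<longrightarrow> y = (\<Sum>v\<in>V'. d v * v)"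
    by (elim exE conjE)
  have "x + y = (\<Sum>v\<in>V'. (c v + d v) * v)" if V': "finite V'" "V \<union> V\<^sub>2 \<subseteq> V'" for V'
  proof -
    have "V \<subseteq> V'" "V\<^sub>2 \<subseteq> V'" using V'(2) by auto
    from 1(4)[rule_format, OF V'(1) this(1)] 2(4)[rule_format, OF V'(1) this(2)] show ?thesis
      by (simp only: distrib_right sum.distrib)
  qed
  moreover have "\<forall>v. c v + d v \<in> C" using 1(3) 2(3) sring_add[OF sfield_imp_sring[OF C_sfield]] by simp
  ultimately show ?case using 1(1,2) 2(1,2)
    by (intro exI[of _ "V \<union> V\<^sub>2"] exI[of _ "\<lambda>v. c v + d v"] conjI allI impI) simp_all
qed

lemma sring_CL_span: "sring CL_span"
proof -
  note Cr = sfield_imp_sring[OF C_sfield] and Lr = diff_subfield_facts[OF L]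
  have m1: "c * l * y \<in> CL_span" if "y \<in> CL_span" "c \<in> C" "l \<in> L" for c l y
    using that
  proof (induction rule: CL_span.induct)
    case (base d k)
    have "c * l * (d * k) = (c * d) * (l * k)" by (simp add: ac_simps)
    then show ?case using CL_span.base[OF sring_mult[OF Cr base(3,1)] sring_mult[OF Lr(2) base(4,2)]] by (simp only:)
  next
    case (add x y)
    then show ?case by (simp add: distrib_left CL_span.add)
  qed
  have m2: "x * y \<in> CL_span" if "x \<in> CL_span" "y \<in> CL_span" for x y
    using that by (induction rule: CL_span.induct) (auto simp: m1 distrib_right intro: CL_span.add)
  have one: "1 \<in> CL_span" "0 \<in> CL_span" "-1 \<in> CL_span"
    using CL_span.base[OF sring_1[OF Cr] sring_1[OF Lr(2)]] CL_span.base[OF sring_1[OF Cr] sring_0[OF Lr(2)]]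
      CL_span.base[OF sring_1[OF Cr] sring_neg[OF Lr(2) sring_1[OF Lr(2)]]] by simp_all
  have m3: "- x \<in> CL_span" if "x \<in> CL_span" for x using m2[OF one(3) that] by simp
  show ?thesis unfolding sring_def by (intro conjI ballI one m2 m3 CL_span.add)
qed

lemma CL_span_der: "x \<in> CL_span \<Longrightarrow> \<delta> x \<in> CL_span"
proof (induction rule: CL_span.induct)
  case (base c l)
  have "\<delta> (c * l) = c * \<delta> l" using base(1) by (simp add: der_mult C_der)
  then show ?case using CL_span.base[OF base(1) diff_subfield_facts(3)[OF L base(2)]] by simp
qed (simp add: der_add CL_span.add)

text \<open>Constants pass through the derivation, so the ring spanned by products of a constant and
  an element of \<open>L\<close> is closed under \<open>\<delta>\<close>, and its fraction field is
  already differential.\<close>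

lemma F_frac: "F \<subseteq> frac CL_span"
  unfolding F_def
proof (rule diff_gen_least[OF diff_subfield_frac[OF sring_CL_span CL_span_der]])
  note Cr = sfield_imp_sring[OF C_sfield] and Lr = diff_subfield_facts[OF L]
  have "L \<union> C \<subseteq> CL_span" using CL_span.base[OF sring_1[OF Cr]] CL_span.base[OF _ sring_1[OF Lr(2)]] by auto
  then show "L \<union> C \<subseteq> frac CL_span" using sring_subset_frac[OF sring_CL_span] by blast
qed

text \<open>Here \<open>V\<close> depends on the tuple; making it uniform is the task of
  \<open>uniform_bound\<close>.\<close>

lemma F_const_frac:
  assumes x: "\<And>i. i < m \<Longrightarrow> x i \<in> F"
  shows "\<exists>V. finite V \<and> V \<subseteq> L \<and> const_frac m V x"
proof -
  have "\<forall>i. \<exists>r. fst r \<in> CL_span \<and> snd r \<in> CL_span \<and> snd r \<noteq> 0 \<and> (i < m \<longrightarrow> x i = fst r / snd r)"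
  proof
    fix i
    show "\<exists>r. fst r \<in> CL_span \<and> snd r \<in> CL_span \<and> snd r \<noteq> 0 \<and> (i < m \<longrightarrow> x i = fst r / snd r)"
    proof (cases "i < m")
      case True
      have "x i \<in> frac CL_span" using x[OF True] F_frac by blast
      then obtain y z where "x i = y / z" "y \<in> CL_span" "z \<in> CL_span" "z \<noteq> 0" unfolding frac_def by blast
      then show ?thesis by (intro exI[of _ "(y, z)"]) simp
    next
      case False
      then show ?thesis using sring_1[OF sring_CL_span] by (intro exI[of _ "(1, 1)"]) simp
    qed
  qed
  from choice[OF this] obtain pr where pr: "\<forall>i. fst (pr i) \<in> CL_span \<and> snd (pr i) \<in> CL_span \<and> snd (pr i) \<noteq> 0 \<and> (i < m \<longrightarrow> x i = fst (pr i) / snd (pr i))" ..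
  define p where "p i = fst (pr i)" for i
  define q where "q i = snd (pr i)" for i
  have pq: "p i \<in> CL_span" "q i \<in> CL_span" "q i \<noteq> 0" "i < m \<Longrightarrow> x i = p i / q i" for i
    using pr by (simp_all add: p_def q_def)
  define Q where "Q = (\<Prod>i<m. q i)"
  define r where "r i = (if i < m then p i * (\<Prod>k\<in>{..<m} - {i}. q k) else Q)" for i
  have Q0: "Q \<noteq> 0" using pq(3) by (simp add: Q_def)
  have rQ: "x i * Q = r i" if "i < m" for i
  proof -
    have "Q = q i * (\<Prod>k\<in>{..<m} - {i}. q k)" unfolding Q_def using that by (intro prod.remove) auto
    then show ?thesis using that pq(3,4) by (simp add: r_def)
  qed
  have "r i \<in> CL_span" for i unfolding r_def Q_def
    using pq(1,2) by (auto intro!: sring_mult[OF sring_CL_span] sring_prod[OF sring_CL_span])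
  then have "\<exists>Vc. finite (fst Vc) \<and> fst Vc \<subseteq> L \<and> (\<forall>v. snd Vc v \<in> C) \<and> (\<forall>V'. finite V' \<longrightarrow> fst Vc \<subseteq> V' \<longrightarrow> r i = (\<Sum>v\<in>V'. snd Vc v * v))" for i
  proof -
    from CL_span_expand[OF \<open>r i \<in> CL_span\<close>] obtain V c where "finite V" "V \<subseteq> L" "\<forall>v. c v \<in> C" "\<forall>V'. finite V' \<longrightarrow> V \<subseteq> V' \<longrightarrow> r i = (\<Sum>v\<in>V'. c v * v)"
      by (elim exE conjE)
    then show ?thesis by (intro exI[of _ "(V, c)"]) simp
  qed
  from choice[OF allI[OF this]] obtain Vc where Vc\<^sub>0: "\<forall>i. finite (fst (Vc i)) \<and> fst (Vc i) \<subseteq> L \<and> (\<forall>v. snd (Vc i) v \<in> C) \<and>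
     (\<forall>V'. finite V' \<longrightarrow> fst (Vc i) \<subseteq> V' \<longrightarrow> r i = (\<Sum>v\<in>V'. snd (Vc i) v * v))" ..
  define V where "V i = fst (Vc i)" for i
  define c where "c i = snd (Vc i)" for i
  have Vc: "finite (V i)" "V i \<subseteq> L" "c i v \<in> C" "\<And>V'. finite V' \<Longrightarrow> V i \<subseteq> V' \<Longrightarrow> r i = (\<Sum>v\<in>V'. c i v * v)" for i v
    using Vc\<^sub>0 by (simp_all add: V_def c_def)
  define W where "W = (\<Union>i\<le>m. V i)"
  have W: "finite W" "W \<subseteq> L" "\<And>i. i \<le> m \<Longrightarrow> V i \<subseteq> W" using Vc(1,2) by (auto simp: W_def)
  have rW: "r i = (\<Sum>v\<in>W. c i v * v)" if "i \<le> m" for i using Vc(4)[OF W(1) W(3)[OF that]] .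
  have QW: "(\<Sum>v\<in>W. c m v * v) = Q" using rW[of m] by (simp add: r_def)
  have "x i * Q = (\<Sum>v\<in>W. c i v * v)" if "i < m" for i using rQ[OF that] rW[of i] that by simp
  then have "const_frac m W x" unfolding const_frac_def
    using Q0 by (intro exI[of _ c] conjI allI ballI impI Vc(3)) (simp_all add: QW)
  then show ?thesis using W by blast
qed

lemma defbl_const_frac:
  assumes V: "finite V" "V \<subseteq> L"
  shows "defbl LL UU L (const_frac m V)"
proof -
  obtain ls where ls: "set ls = V" "distinct ls" using finite_distinct_list[OF V(1)] by blast
  define N where "N = length ls"
  \<comment> \<open>The coefficients to be quantified are stored behind the tuple, as
    \<open>m + 1\<close> rows of length \<open>N\<close> in the coordinates from \<open>m\<close> to
    \<open>M - 1\<close>.\<close>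
  define M where "M = m + (m + 1) * N"
  define num where "num i y = (\<Sum>j<N. y (m + i * N + j) * ls ! j)" for i and y :: "nat \<Rightarrow> 'u"
  have idx: "m + i * N + j < M" if "i \<le> m" "j < N" for i j
  proof -
    have "i * N + j < Suc i * N" using that by simp
    also have "\<dots> \<le> (m + 1) * N" using that by (intro mult_le_mono1) simp
    finally show ?thesis by (simp add: M_def)
  qed
  have L01: "0 \<in> L" "1 \<in> L" using L by (auto simp: diff_subfield_def)
  have Lne: "L \<noteq> {}" using L01 by auto
  have numD: "num i \<in> dpoly L M" if "i \<le> m" for i
    unfolding num_def[abs_def] using idx[OF that] V(2) ls(1)
    by (intro dpoly_sum L01 dpoly.mult dpoly.var dpoly.const) (auto simp: N_def)
  have sumV: "(\<Sum>v\<in>V. f v * v) = (\<Sum>j<N. f (ls ! j) * ls ! j)" for f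
  proof -
    have "bij_betw (\<lambda>j. ls ! j) {..<N} V" unfolding N_def ls(1)[symmetric]
      using ls(2) by (metis bij_betw_nth lessThan_atLeast0 lessThan_def)
    from sum.reindex_bij_betw[OF this, of "\<lambda>v. f v * v"] show ?thesis by simp
  qed
  define P where "P y \<longleftrightarrow> (\<forall>k\<in>{m..<M}. \<delta> (y k) = 0) \<and> num m y \<noteq> 0 \<and> (\<forall>i\<in>{..<m}. y i * num m y - num i y = 0)" for y
  have "defbl LL UU L P" unfolding P_def[abs_def]
  proof (intro defbl_conj defbl_ball Lne defbl_not)
    show "defbl LL UU L (\<lambda>x. \<delta> (x k) = 0)" for k
      by (rule defbl_dpoly_eq[OF dpoly.der[OF dpoly.var[of k "Suc k"]] L01(1)]) simp
    show "defbl LL UU L (\<lambda>x. num m x = 0)" by (rule defbl_dpoly_eq[OF numD L01(1)]) simp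
    show "defbl LL UU L (\<lambda>x. x i * num m x - num i x = 0)" if "i \<in> {..<m}" for i
    proof (rule defbl_dpoly_eq[OF _ L01(1)])
      have "i < M" using that by (simp add: M_def)
      then show "(\<lambda>x. x i * num m x - num i x) \<in> dpoly L M" using that
        by (intro dpoly_diff dpoly.mult dpoly.var numD) simp_all
    qed
  qed simp_all
  from defbl_exblock[OF this, of "{m..<M}"]
  have "defbl LL UU L (\<lambda>x. \<exists>y. range y \<subseteq> dom UU \<and> (\<forall>i. i \<notin> {m..<M} \<longrightarrow> y i = x i) \<and> P y)" by simp
  then show ?thesis
  proof (rule defbl_cong)
    fix x :: "nat \<Rightarrow> 'u"
    show "(\<exists>y. range y \<subseteq> dom UU \<and> (\<forall>i. i \<notin> {m..<M} \<longrightarrow> y i = x i) \<and> P y) = const_frac m V x" (is "?l = ?r")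
    proof
      assume ?l
      then obtain y where y: "\<forall>i. i \<notin> {m..<M} \<longrightarrow> y i = x i" "P y" by blast
      define pos where "pos v = (THE j. j < N \<and> ls ! j = v)" for v
      have pos: "pos (ls ! j) = j" if "j < N" for j
        unfolding pos_def using that ls(2) by (intro the_equality) (auto simp: N_def nth_eq_iff_index_eq)
      define c where "c i v = (if i \<le> m then y (m + i * N + pos v) else 0)" for i v
      have s: "(\<Sum>v\<in>V. c i v * v) = num i y" if "i \<le> m" for i
        unfolding sumV num_def using that by (intro sum.cong) (auto simp: c_def pos)
      have "c i v \<in> C" if vV: "v \<in> V" for i v
      proof -
        obtain j where "j < N" "v = ls ! j" using vV ls(1) by (auto simp: in_set_conv_nth N_def)
        then show ?thesis using idx[of i j] y(2) by (auto simp: c_def pos C_der P_def der_0)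
      qed
      moreover have "y i = x i" if "i < m" for i using y(1) that by simp
      ultimately show ?r unfolding const_frac_def using y(2) s by (intro exI[of _ c]) (auto simp: P_def)
    next
      assume ?r
      then obtain c where c: "\<forall>i. \<forall>v\<in>V. c i v \<in> C" "(\<Sum>v\<in>V. c m v * v) \<noteq> 0"
         "\<forall>i<m. x i * (\<Sum>v\<in>V. c m v * v) = (\<Sum>v\<in>V. c i v * v)" unfolding const_frac_def by blast
      define y where "y k = (if k \<in> {m..<M} then c ((k - m) div N) (ls ! ((k - m) mod N)) else x k)" for k
      have yk: "y (m + i * N + j) = c i (ls ! j)" if "i \<le> m" "j < N" for i j
        using idx[OF that] that by (simp add: y_def)
      have s: "num i y = (\<Sum>v\<in>V. c i v * v)" if "i \<le> m" for i
        unfolding sumV num_def using that by (intro sum.cong) (auto simp: yk)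
      have "\<delta> (y k) = 0" if "k \<in> {m..<M}" for k
      proof -
        have "N \<noteq> 0" using that by (intro notI) (simp add: M_def)
        then have "ls ! ((k - m) mod N) \<in> V" using ls(1) by (auto simp: N_def intro!: nth_mem)
        then show ?thesis using c(1) that by (simp add: y_def flip: C_der)
      qed
      moreover have "y i = x i" if "i < m" for i using that by (simp add: y_def)
      ultimately have "P y" using c(2,3) s by (simp add: P_def)
      then show ?l by (intro exI[of _ y]) (auto simp: y_def)
    qed
  qed
qed

end

subsection \<open>The order of Laurent series\<close>

text \<open>The sign of the lowest coefficient: the order in which the uniformizer is a positive
  infinitesimal.\<close>

definition fls_pos :: "'a::linordered_field fls \<Rightarrow> bool" where
  "fls_pos f \<longleftrightarrow> 0 < fls_nth f (fls_subdegree f)"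

lemma fls_pos_0: "\<not> fls_pos 0" by (simp add: fls_pos_def)

lemma fls_pos_total: "fls_pos f \<or> f = 0 \<or> fls_pos (- f)"
proof (cases "f = 0")
  case False
  from nth_fls_subdegree_nonzero[OF this] show ?thesis by (auto simp: fls_pos_def)
qed simp

lemma fls_pos_nonneg: "fls_pos f \<Longrightarrow> d \<le> fls_subdegree f \<Longrightarrow> 0 \<le> fls_nth f d"
  using fls_eq0_below_subdegree[of d f] by (cases "d = fls_subdegree f") (auto simp: fls_pos_def)

lemma fls_pos_add:
  assumes f: "fls_pos f" and g: "fls_pos g" shows "fls_pos (f + g)"
proof -
  define d where "d = min (fls_subdegree f) (fls_subdegree g)"
  have le: "0 \<le> fls_nth f d" "0 \<le> fls_nth g d"
    by (rule fls_pos_nonneg[OF f], simp add: d_def, rule fls_pos_nonneg[OF g], simp add: d_def)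
  moreover have "0 < fls_nth f d \<or> 0 < fls_nth g d"
    using f g by (auto simp: fls_pos_def d_def min_def)
  ultimately have pos: "0 < fls_nth (f + g) d" by (auto intro: add_pos_nonneg add_nonneg_pos)
  have "fls_subdegree (f + g) = d"
  proof (rule fls_subdegree_eqI)
    show "fls_nth (f + g) d \<noteq> 0" using pos by simp
    show "fls_nth (f + g) k = 0" if "k < d" for k using that by (simp add: d_def)
  qed
  then show ?thesis using pos by (simp add: fls_pos_def)
qed

lemma fls_pos_mult:
  assumes f: "fls_pos f" and g: "fls_pos g" shows "fls_pos (f * g)"
proof -
  have "f \<noteq> 0" "g \<noteq> 0" using f g fls_pos_0 by auto
  then have "fls_subdegree (f * g) = fls_subdegree f + fls_subdegree g" by simp
  moreover have "fls_nth (f * g) (fls_subdegree f + fls_subdegree g) = fls_nth f (fls_subdegree f) * fls_nth g (fls_subdegree g)"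
    by (rule fls_times_base)
  ultimately show ?thesis using f g by (simp add: fls_pos_def)
qed

lemma fls_pos_const: "fls_pos (fls_const l) \<longleftrightarrow> 0 < l"
  by (simp add: fls_pos_def)

text \<open>Strict inequalities pass from the residue to the series. This is how positivity at a
  conjugate of \<open>a\<close> is carried over to \<open>b\<close>.\<close>

lemma res_pos: "res f u \<Longrightarrow> 0 < u \<Longrightarrow> fls_pos f"
  unfolding res_def
proof (elim exE conjE)
  fix g assume "0 < u" "f = fps_to_fls g" "g $ 0 = u"
  moreover from this have "subdegree g = 0" by (intro subdegree_eq_0) simp
  ultimately show ?thesis by (simp add: fls_pos_def fls_subdegree_fls_to_fps)
qed

lemma order_on_laurent:
  assumes W: "sfield W" "hom_on W \<psi>"
  shows "order_on W (\<lambda>x y. fls_pos (\<psi> (y - x)))"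
  unfolding order_on_def
proof (intro conjI ballI impI)
  note Wr = sfield_imp_sring[OF W(1)]
  note h = hom_diff[OF W] hom_add[OF W] hom_mult[OF W]
  show "\<not> fls_pos (\<psi> (x - x))" for x by (simp add: hom_0[OF W] fls_pos_0)
  show "fls_pos (\<psi> (z - x))" if "x \<in> W" "y \<in> W" "z \<in> W" "fls_pos (\<psi> (y - x))" "fls_pos (\<psi> (z - y))" for x y z
    using fls_pos_add[OF that(4,5)] that(1-3) by (simp add: h)
  show "fls_pos (\<psi> (y - x)) \<or> x = y \<or> fls_pos (\<psi> (x - y))" if "x \<in> W" "y \<in> W" for x y
    using fls_pos_total[of "\<psi> (y - x)"] that hom_eq_0[OF W sring_diff[OF Wr that(2,1)]] by (auto simp: h)
  show "fls_pos (\<psi> (y + z - (x + z)))" if "fls_pos (\<psi> (y - x))" for x y z using that by simp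
  show "fls_pos (\<psi> (x * y - 0))" if "x \<in> W" "y \<in> W" "fls_pos (\<psi> (x - 0))" "fls_pos (\<psi> (y - 0))" for x y
    using fls_pos_mult[of "\<psi> x" "\<psi> y"] that by (simp add: h)
qed

section \<open>Residues and definability of literals\<close>

context codf
begin

lemma dgen_small:
  assumes K: "diff_subfield \<delta> K" "K \<prec> (UNIV :: 'u set)"
  shows "dgen K m a \<prec> (UNIV :: 'u set)"
proof -
  have infK: "infinite K" by (rule sfield_infinite[OF diff_subfield_facts(1)[OF K(1)]])
  have KU: "K \<union> a ` {..<m} \<prec> (UNIV :: 'u set)"
    using card_of_Un_ordLess_infinite[OF infinite_UNIV_u, of K "a ` {..<m}"] K(2)
      finite_lesspoll_infinite[OF infinite_UNIV_u, of "a ` {..<m}"] by (simp add: lesspoll_iff_ordLess)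
  show ?thesis unfolding dgen_def
    by (rule diff_gen_lesspoll[OF _ KU]) (use infK in auto)
qed

lemma dpoly_jet_res:
  assumes W: "diff_subfield \<delta> W" "hom_on W \<psi>" "A \<subseteq> W" "diff_subfield \<delta> A" "\<And>l. l \<in> A \<Longrightarrow> \<psi> l = fls_const l"
    and b: "\<And>i k. i < m \<Longrightarrow> b i \<in> W \<and> jet_res \<psi> k (b i) (a i)"
  shows "f \<in> dpoly A m \<Longrightarrow> f b \<in> W \<and> (\<forall>k. jet_res \<psi> k (f b) (f a))"
proof (induction rule: dpoly.induct)
  case (const l)
  then have "res (\<psi> ((\<delta> ^^ i) l)) ((\<delta> ^^ i) l)" for i using funpow_mem[OF W(4), of l i] W(5) res_const by simp
  then show ?case using const W(3) by (auto simp: jet_res_def)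
next
  case (var i)
  then show ?case using b by simp
next
  case (add f g)
  then show ?case using jet_res_add[OF W(1,2)] sring_add[OF diff_subfield_facts(2)[OF W(1)]] by simp
next
  case (mult f g)
  then show ?case using jet_res_mult[OF W(1,2)] sring_mult[OF diff_subfield_facts(2)[OF W(1)]] by simp
next
  case (neg f)
  then show ?case using jet_res_neg[OF W(1,2)] sring_neg[OF diff_subfield_facts(2)[OF W(1)]] by simp
next
  case (der f)
  then have "jet_res \<psi> k (\<delta> (f b)) (\<delta> (f a))" for k using jet_res_Suc[of \<psi> k "f b" "f a"] by simp
  then show ?case using der diff_subfield_facts(3)[OF W(1)] by simp
qed

lemma defbl_holds:
  assumes "snd l \<in> dpoly A m" "0 \<in> A" shows "defbl LL UU A (holds (<) l)"
proof -
  consider "fst l = 0" | "fst l = 1" | "fst l \<noteq> 0" "fst l \<noteq> 1" by blast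
  then show ?thesis
  proof cases
    case 1
    then have "holds (<) l = (\<lambda>x. snd l x = 0)" by (intro ext) (simp add: holds_def)
    then show ?thesis using defbl_dpoly_eq[OF assms] by (simp only:)
  next
    case 2
    then have "holds (<) l = (\<lambda>x. \<not> snd l x = 0)" by (intro ext) (simp add: holds_def)
    then show ?thesis using defbl_not[OF defbl_dpoly_eq[OF assms]] by (simp only:)
  next
    case 3
    then have "holds (<) l = (\<lambda>x. 0 < snd l x)" by (intro ext) (simp add: holds_def)
    then show ?thesis using defbl_dpoly_pos[OF assms] by (simp only:)
  qed
qed

lemma holds_cong:
  assumes "snd l \<in> dpoly A m" "\<And>i. i < m \<Longrightarrow> x i = y i" shows "holds lt l x = holds lt l y"
  using dpoly_cong[OF assms(1), of x y] assms(2) by (simp add: holds_def)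

end

lemma finite_subset_two_images:
  assumes "finite D" "D \<subseteq> f ` A \<union> g ` B"
  obtains A' B' where "finite A'" "A' \<subseteq> A" "finite B'" "B' \<subseteq> B" "D \<subseteq> f ` A' \<union> g ` B'"
proof -
  have "finite (D \<inter> f ` A)" "finite (D \<inter> g ` B)" using assms(1) by auto
  then obtain A' B' where A': "A' \<subseteq> A" "finite A'" "D \<inter> f ` A = f ` A'" and B': "B' \<subseteq> B" "finite B'" "D \<inter> g ` B = g ` B'"
    using finite_subset_image[of "D \<inter> f ` A" f A] finite_subset_image[of "D \<inter> g ` B" g B] by (metis Int_lower2)
  have "D \<subseteq> f ` A' \<union> g ` B'" unfolding A'(3)[symmetric] B'(3)[symmetric] using assms(2) by blast
  then show ?thesis using that A' B' by blast
qed

section \<open>Uniform representation of the conjugates of the generators\<close>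

context sn_ext
begin

context
  fixes m :: nat and a :: "nat \<Rightarrow> 'u" assumes La: "L = dgen K m a"
begin

lemma Lsmall: "L \<prec> (UNIV :: 'u set)" unfolding La by (rule dgen_small[OF K Ksmall])

lemma L0: "0 \<in> L" "1 \<in> L" using L by (auto simp: diff_subfield_def)

lemma not_const_frac_Union:
  assumes "finite \<V>" "\<V> \<subseteq> {V. finite V \<and> V \<subseteq> L}" "\<not> const_frac m (\<Union>\<V>) y" "V \<in> \<V>"
  shows "\<not> const_frac m V y"
proof
  assume "const_frac m V y"
  moreover have "V \<subseteq> \<Union>\<V>" "finite (\<Union>\<V>)" using assms by auto
  ultimately have "const_frac m (\<Union>\<V>) y" by (rule const_frac_mono)
  with assms(3) show False ..
qed

text \<open>Otherwise saturation gives a tuple \<open>y\<close> with the signs of \<open>x\<close>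
  over \<open>K\<close> that is a fraction over no finite \<open>V\<close>. Equal signs yield an
  automorphism of \<open>U\<close> over \<open>K\<close> from \<open>x\<close> to \<open>y\<close>;
  it preserves \<open>F\<close>, so \<open>y\<close> lies in \<open>F\<close> and is such a fraction
  after all.\<close>

lemma type_isolated:
  assumes x: "\<And>i. i < m \<Longrightarrow> x i \<in> F"
  shows "\<exists>S V. finite S \<and> S \<subseteq> UNIV \<times> dpoly K m \<and> (\<forall>l\<in>S. holds (<) l x) \<and> finite V \<and> V \<subseteq> L \<and>
    (\<forall>y. (\<forall>l\<in>S. holds (<) l y) \<longrightarrow> const_frac m V y)"
proof (rule ccontr)
  assume neg: "\<not> ?thesis"
  define T where "T = {l \<in> UNIV \<times> dpoly K m. holds (<) l x}"
  define VV where "VV = {V. finite V \<and> V \<subseteq> L}"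
  define nI where "nI V = (\<lambda>y. \<not> const_frac m V y)" for V
  define \<P> where "\<P> = (\<lambda>l. holds (<) l) ` T \<union> nI ` VV"
  have TL: "snd l \<in> dpoly L m" if "l \<in> T" for l using that dpoly_mono[OF _ KL order_refl] by (auto simp: T_def)
  have r0: "range (\<lambda>_::nat. 0) \<subseteq> L" using L0 by auto
  have "\<exists>y. range y \<subseteq> dom UU \<and> (\<forall>i\<ge>m. y i = 0) \<and> (\<forall>P\<in>\<P>. P y)"
  proof (rule saturated_realise[OF sat _ _ r0])
    show "L \<subseteq> dom UU" "infinite (dom UU)" using infinite_UNIV_u by simp_all
    show "L \<prec> dom UU" using Lsmall by simp
  next
    fix P assume "P \<in> \<P>"
    then show "defbl LL UU L P" unfolding \<P>_def
    proof (elim UnE imageE)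
      fix l assume "P = holds (<) l" "l \<in> T"
      then show ?thesis using defbl_holds[OF TL L0(1)] by (simp only:)
    next
      fix V assume "P = nI V" "V \<in> VV"
      then show ?thesis using defbl_not[OF defbl_const_frac, of V m] unfolding nI_def VV_def by simp
    qed
  next
    fix \<D> assume D: "\<D> \<subseteq> \<P>" "finite \<D>"
    obtain S \<V> where SV: "finite S" "S \<subseteq> T" "finite \<V>" "\<V> \<subseteq> VV" "\<D> \<subseteq> (\<lambda>l. holds (<) l) ` S \<union> nI ` \<V>"
      by (rule finite_subset_two_images[OF D(2) D(1)[unfolded \<P>_def]])
    \<comment> \<open>Being a fraction is monotone in \<open>V\<close>, so finitely many sets are
      excluded at once by excluding their union.\<close>
    have "\<exists>y. (\<forall>l\<in>S. holds (<) l y) \<and> \<not> const_frac m (\<Union>\<V>) y"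
    proof (rule ccontr)
      assume "\<not> ?thesis"
      then have "\<forall>y. (\<forall>l\<in>S. holds (<) l y) \<longrightarrow> const_frac m (\<Union>\<V>) y" by blast
      moreover have "finite (\<Union>\<V>)" "\<Union>\<V> \<subseteq> L" "S \<subseteq> UNIV \<times> dpoly K m" "\<forall>l\<in>S. holds (<) l x"
        using SV(2,3,4) by (auto simp: VV_def T_def)
      ultimately show False using neg SV(1) by (elim notE, intro exI[of _ S] exI[of _ "\<Union>\<V>"] conjI)
    qed
    then obtain y where y: "\<forall>l\<in>S. holds (<) l y" "\<not> const_frac m (\<Union>\<V>) y" by (elim exE conjE)
    define y' where "y' i = (if i < m then y i else 0)" for i
    have h: "holds (<) l y'" if "l \<in> S" for l
    proof -
      have "snd l \<in> dpoly L m" using TL SV(2) that by blast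
      then have "holds (<) l y' = holds (<) l y" by (rule holds_cong) (simp add: y'_def)
      then show ?thesis using y(1) that by simp
    qed
    have "\<not> const_frac m (\<Union>\<V>) y'" using y(2) const_frac_cong[of m y y'] by (simp add: y'_def)
    then have n: "nI V y'" if "V \<in> \<V>" for V unfolding nI_def
      by (rule not_const_frac_Union[OF SV(3) SV(4)[unfolded VV_def] _ that])
    have "P y'" if "P \<in> \<D>" for P
      using subsetD[OF SV(5) that] by (elim UnE imageE) (simp_all only: h n)
    then show "\<exists>y. range y \<subseteq> dom UU \<and> (\<forall>i\<ge>m. y i = 0) \<and> (\<forall>P\<in>\<D>. P y)"
      by (intro exI[of _ y'] conjI ballI) (simp_all add: y'_def)
  qed
  then obtain y where y: "\<forall>P\<in>\<P>. P y" by (elim exE conjE)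
  have hT: "holds (<) l y" if "l \<in> T" for l
    by (rule bspec[OF y]) (unfold \<P>_def, rule UnI1, rule imageI[OF that])
  have e1: "f x = 0 \<longleftrightarrow> f y = 0" if "f \<in> dpoly K m" for f
    using hT[of "(0, f)"] hT[of "(1, f)"] that by (auto simp: T_def holds_def)
  have e2': "0 < f y" if "f \<in> dpoly K m" "0 < f x" for f
    using hT[of "(2, f)"] that by (simp add: T_def holds_def)
  have e2: "0 < f x \<longleftrightarrow> 0 < f y" if f: "f \<in> dpoly K m" for f
  proof
    assume "0 < f y"
    show "0 < f x"
    proof (rule ccontr)
      assume "\<not> 0 < f x"
      moreover have "f x \<noteq> 0" using e1[OF f] \<open>0 < f y\<close> by simp
      ultimately have "0 < - f x" by simp
      from e2'[OF dpoly.neg[OF f] this] \<open>0 < f y\<close> show False by simp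
    qed
  qed (rule e2'[OF f])
  have "\<exists>\<beta>. bij \<beta> \<and> (\<forall>x y. \<beta> (x + y) = \<beta> x + \<beta> y \<and> \<beta> (x * y) = \<beta> x * \<beta> y) \<and> (\<forall>x. \<beta> (\<delta> x) = \<delta> (\<beta> x)) \<and>
     (\<forall>x\<in>K. \<beta> x = x) \<and> (\<forall>i<m. \<beta> (x i) = y i)"
    by (rule automorphism_extension[where a = x and b = y and m = m, OF K Ksmall]) (erule e1, erule e2)
  then obtain \<beta> where \<beta>: "bij \<beta>"
    "\<forall>x y. \<beta> (x + y) = \<beta> x + \<beta> y \<and> \<beta> (x * y) = \<beta> x * \<beta> y" "\<forall>x. \<beta> (\<delta> x) = \<delta> (\<beta> x)" "\<forall>x\<in>K. \<beta> x = x" "\<forall>i<m. \<beta> (x i) = y i"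
    by (elim exE conjE)
  have yF: "y i \<in> F" if "i < m" for i
    using automorphism_preserves_F[of \<beta> "x i"] \<beta> x[OF that] that by auto
  have "\<exists>V. finite V \<and> V \<subseteq> L \<and> const_frac m V y" by (rule F_const_frac) (erule yF)
  then obtain V where V: "finite V" "V \<subseteq> L" "const_frac m V y" by (elim exE conjE)
  have "nI V \<in> \<P>" unfolding \<P>_def using V(1,2) by (intro UnI2 imageI) (simp add: VV_def)
  from bspec[OF y this] V(3) show False by (simp add: nI_def)
qed

lemma a_in_L: "i < m \<Longrightarrow> a i \<in> L" unfolding La by (rule dgen_var)

lemma GG_dpoly_L:
  assumes "\<sigma> \<in> GG" "f \<in> dpoly K m"
  shows "f (\<lambda>i. \<sigma> (a i)) = 0 \<longleftrightarrow> f a = 0"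
proof -
  have aF: "\<And>i. i < m \<Longrightarrow> a i \<in> F" using a_in_L LF by blast
  have f: "f \<in> dpoly E m" by (rule dpoly_mono[OF assms(2) KE order_refl])
  have "f a \<in> F" by (rule dpoly_in[OF f F_dsf EF aF])
  moreover have "\<sigma> (f a) = f (\<lambda>i. \<sigma> (a i))" by (rule GG_dpoly[OF assms(1) _ f]) (rule aF)
  ultimately show ?thesis using GG_zero_iff[OF assms(1), of "f a"] by simp
qed

text \<open>The coefficients solve a homogeneous linear system over
  \<open>L\<langle>b'\<rangle>\<close>, so they may be taken among the constants of that field. The
  isomorphism with \<open>L\<langle>b\<rangle>\<close> over \<open>L\<close> then moves the
  solution, and it takes constants to constants.\<close>

lemma const_frac_transfer:
  assumes V: "finite V" "V \<subseteq> L" and I: "const_frac m V b'"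
    and eq: "\<forall>f\<in>dpoly L m. f b' = 0 \<longleftrightarrow> f b = 0"
  shows "const_frac m V b"
proof -
  let ?W = "dgen L m b'"
  have W: "diff_subfield \<delta> ?W" by (rule dgen_diff_subfield)
  note Wr = diff_subfield_facts[OF W]
  obtain c where c: "\<forall>i. \<forall>v\<in>V. c i v \<in> C" "(\<Sum>v\<in>V. c m v * v) \<noteq> 0"
     "\<forall>i<m. b' i * (\<Sum>v\<in>V. c m v * v) = (\<Sum>v\<in>V. c i v * v)" using I unfolding const_frac_def by blast
  define J where "J = {..m} \<times> V"
  \<comment> \<open>The unknowns are indexed by row and element of \<open>V\<close>. Equation
    \<open>r\<close> is the cleared form of the representation of \<open>b' r\<close>; the
    functional \<open>u\<close> below is the common denominator, which has to stay nonzero.\<close>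
  define w where "w r p = (if fst p = m then b' r * snd p else 0) - (if fst p = r then snd p else 0)" for r and p :: "nat \<times> 'u"
  define u where "u p = (if fst p = m then snd p else 0)" for p :: "nat \<times> 'u"
  have VW: "v \<in> ?W" if "v \<in> V" for v using V(2) that dgen_const by blast
  have bW: "b' i \<in> ?W" if "i < m" for i using that by (rule dgen_var)
  have pick: "(\<Sum>p\<in>J. (if fst p = r then g (snd p) else 0) * d p) = (\<Sum>v\<in>V. g v * d (r, v))" if "r \<le> m" for r g and d :: "nat \<times> 'u \<Rightarrow> 'u"
  proof -
    have "(\<Sum>p\<in>J. (if fst p = r then g (snd p) else 0) * d p) = (\<Sum>i\<le>m. \<Sum>v\<in>V. (if i = r then g v else 0) * d (i, v))"
      unfolding J_def sum.cartesian_product by (simp add: case_prod_beta)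
    also have "\<dots> = (\<Sum>i\<le>m. if i = r then \<Sum>v\<in>V. g v * d (i, v) else 0)" by (intro sum.cong) auto
    also have "\<dots> = (\<Sum>v\<in>V. g v * d (r, v))" using that by simp
    finally show ?thesis .
  qed
  have wsum: "(\<Sum>p\<in>J. w r p * d p) = b' r * (\<Sum>v\<in>V. d (m, v) * v) - (\<Sum>v\<in>V. d (r, v) * v)" if "r < m" for r and d :: "nat \<times> 'u \<Rightarrow> 'u"
  proof -
    have "(\<Sum>p\<in>J. w r p * d p) = (\<Sum>p\<in>J. (if fst p = m then b' r * snd p else 0) * d p) - (\<Sum>p\<in>J. (if fst p = r then snd p else 0) * d p)"
      unfolding w_def by (simp add: left_diff_distrib sum_subtractf)
    also have "\<dots> = (\<Sum>v\<in>V. b' r * v * d (m, v)) - (\<Sum>v\<in>V. v * d (r, v))"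
      using that pick[of m "\<lambda>v. b' r * v" d] pick[of r "\<lambda>v. v" d] by simp
    finally show ?thesis by (simp add: sum_distrib_left ac_simps)
  qed
  have usum: "(\<Sum>p\<in>J. u p * d p) = (\<Sum>v\<in>V. d (m, v) * v)" for d
    unfolding u_def using pick[of m "\<lambda>v. v" d] by (simp add: ac_simps)
  have "\<exists>c'. (\<forall>p\<in>J. c' p \<in> constants \<delta> ?W) \<and> (\<forall>r\<in>{..<m}. (\<Sum>p\<in>J. w r p * c' p) = 0) \<and> (\<Sum>p\<in>J. u p * c' p) \<noteq> 0"
  proof (rule constant_solution_descends[OF W, where c = "\<lambda>p. c (fst p) (snd p)"])
    show "finite J" using V(1) by (simp add: J_def)
    show "c (fst p) (snd p) \<in> constants \<delta> UNIV" if "p \<in> J" for p using c(1) that by (auto simp: J_def C_def)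
    show "w r p \<in> ?W" if "r \<in> {..<m}" "p \<in> J" for r p
      using that VW bW sring_0[OF Wr(2)] unfolding w_def J_def by (auto intro!: sring_diff[OF Wr(2)] sring_mult[OF Wr(2)] sring_neg[OF Wr(2)])
    show "u p \<in> ?W" if "p \<in> J" for p using that VW sring_0[OF Wr(2)] unfolding u_def J_def by auto
    show "(\<Sum>p\<in>J. w r p * c (fst p) (snd p)) = 0" if "r \<in> {..<m}" for r
      using wsum[of r "\<lambda>p. c (fst p) (snd p)"] c(3) that by simp
    show "(\<Sum>p\<in>J. u p * c (fst p) (snd p)) \<noteq> 0" using usum[of "\<lambda>p. c (fst p) (snd p)"] c(2) by simp
  qed
  then obtain c' where c': "\<forall>p\<in>J. c' p \<in> constants \<delta> ?W" "\<forall>r\<in>{..<m}. (\<Sum>p\<in>J. w r p * c' p) = 0" "(\<Sum>p\<in>J. u p * c' p) \<noteq> 0"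
    by (elim exE conjE)
  from dgen_iso[OF L0 eq] obtain s where s:
    "\<forall>x\<in>?W. \<forall>y\<in>?W. s (x + y) = s x + s y \<and> s (x * y) = s x * s y"
    "\<forall>x\<in>?W. s (\<delta> x) = \<delta> (s x)" "\<forall>x\<in>L. s x = x" "\<forall>i<m. s (b' i) = b i" by (elim exE conjE)
  have hs: "hom_on ?W s" unfolding hom_on_def using s(1,3) L0(2) by simp
  have cW: "c' (i, v) \<in> ?W" "\<delta> (c' (i, v)) = 0" if "i \<le> m" "v \<in> V" for i v
    using c'(1) that by (auto simp: J_def constants_def)
  have ssum: "s (\<Sum>v\<in>V. c' (i, v) * v) = (\<Sum>v\<in>V. s (c' (i, v)) * v)" if "i \<le> m" for i
  proof -
    have "s (\<Sum>v\<in>V. c' (i, v) * v) = (\<Sum>v\<in>V. s (c' (i, v) * v))"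
      by (rule hom_sum[OF Wr(1) hs]) (use cW that VW sring_mult[OF Wr(2)] in blast)
    also have "\<dots> = (\<Sum>v\<in>V. s (c' (i, v)) * v)"
      using that cW VW V(2) s(3) by (intro sum.cong refl) (simp add: hom_mult[OF Wr(1) hs] subset_iff)
    finally show ?thesis .
  qed
  have mem: "(\<Sum>v\<in>V. c' (i, v) * v) \<in> ?W" if "i \<le> m" for i
    by (rule sring_sum[OF Wr(2)]) (use cW that VW sring_mult[OF Wr(2)] in blast)
  have "b i * (\<Sum>v\<in>V. s (c' (m, v)) * v) = (\<Sum>v\<in>V. s (c' (i, v)) * v)" if i: "i < m" for i
  proof -
    have "b' i * (\<Sum>v\<in>V. c' (m, v) * v) = (\<Sum>v\<in>V. c' (i, v) * v)" using c'(2) wsum[OF i, of c'] i by simp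
    then have "s (b' i * (\<Sum>v\<in>V. c' (m, v) * v)) = s (\<Sum>v\<in>V. c' (i, v) * v)" by simp
    moreover have "s (b' i * (\<Sum>v\<in>V. c' (m, v) * v)) = s (b' i) * s (\<Sum>v\<in>V. c' (m, v) * v)"
      by (rule hom_mult[OF Wr(1) hs bW[OF i] mem]) simp
    ultimately show ?thesis using ssum[of m] ssum[of i] s(4) i by simp
  qed
  moreover have "(\<Sum>v\<in>V. s (c' (m, v)) * v) \<noteq> 0"
    using c'(3) ssum[of m] hom_eq_0[OF Wr(1) hs mem[of m]] by (simp add: usum)
  moreover have "s (c' (i, v)) \<in> C" if "i \<le> m" "v \<in> V" for i v
  proof -
    have "s (\<delta> (c' (i, v))) = \<delta> (s (c' (i, v)))" using s(2) cW(1)[OF that] by (rule bspec)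
    then show ?thesis by (simp add: cW(2)[OF that] hom_0[OF Wr(1) hs] C_der)
  qed
  then have "\<forall>i. \<forall>v\<in>V. (if i \<le> m then s (c' (i, v)) else 0) \<in> C"
    using sring_0[OF sfield_imp_sring[OF C_sfield]] by simp
  ultimately show ?thesis unfolding const_frac_def
    by (intro exI[of _ "\<lambda>i v. if i \<le> m then s (c' (i, v)) else 0"] conjI) simp_all
qed


text \<open>Equations and inequations over \<open>L\<close> are evaluated in \<open>W\<close>
  without regard to \<open>lt\<close>, so the realised tuple has the field type of \<open>b\<close>;
  the order \<open>lt\<close> enters through the literals of \<open>S\<close> alone.\<close>

lemma realise_field_type:
  assumes W: "diff_subfield \<delta> W" "L \<subseteq> W" "order_on W lt" "\<And>x y. x \<in> L \<Longrightarrow> y \<in> L \<Longrightarrow> lt x y \<longleftrightarrow> x < y"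
    and b: "\<And>i. i < m \<Longrightarrow> b i \<in> W" and S: "S \<subseteq> UNIV \<times> dpoly L m" "\<And>l. l \<in> S \<Longrightarrow> holds lt l b"
  shows "\<exists>y. (\<forall>f\<in>dpoly L m. f y = 0 \<longleftrightarrow> f b = 0) \<and> (\<forall>l\<in>S. holds (<) l y)"
proof -
  define T where "T = {l \<in> {0, 1} \<times> dpoly L m. holds lt l b} \<union> S"
  have TL: "snd l \<in> dpoly L m" if "l \<in> T" for l using that S(1) by (auto simp: T_def)
  have TS: "T \<subseteq> UNIV \<times> dpoly L m" using S(1) by (auto simp: T_def)
  have Tb: "holds lt l b" if "l \<in> T" for l using that S(2) unfolding T_def by blast
  have r0: "range (\<lambda>_::nat. 0) \<subseteq> L" using L0 by auto
  have "\<exists>y. range y \<subseteq> dom UU \<and> (\<forall>i\<ge>m. y i = 0) \<and> (\<forall>P\<in>(\<lambda>l. holds (<) l) ` T. P y)"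
  proof (rule saturated_realise[OF sat _ _ r0])
    show "L \<subseteq> dom UU" "infinite (dom UU)" using infinite_UNIV_u by simp_all
    show "L \<prec> dom UU" using Lsmall by simp
  next
    fix P assume "P \<in> (\<lambda>l. holds (<) l) ` T"
    then show "defbl LL UU L P"
    proof (elim imageE)
      fix l assume "P = holds (<) l" "l \<in> T"
      then show ?thesis using defbl_holds[OF TL L0(1)] by (simp only:)
    qed
  next
    fix \<D> assume D: "\<D> \<subseteq> (\<lambda>l. holds (<) l) ` T" "finite \<D>"
    obtain S' where S': "S' \<subseteq> T" "finite S'" "\<D> = (\<lambda>l. holds (<) l) ` S'" using finite_subset_image[OF D(2,1)] by blast
    have "\<exists>x. (\<forall>i\<ge>m. x i = 0) \<and> (\<forall>l\<in>S'. holds (<) l x)"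
      by (rule realise_literals[where b = b, OF L W S'(2) subset_trans[OF S'(1) TS]])
        (use b Tb S'(1) in auto)
    then obtain x where x: "\<forall>i\<ge>m. x i = 0" "\<forall>l\<in>S'. holds (<) l x" by (elim exE conjE)
    have "\<forall>P\<in>\<D>. P x" unfolding S'(3) using x(2) by (simp only: ball_simps)
    then show "\<exists>y. range y \<subseteq> dom UU \<and> (\<forall>i\<ge>m. y i = 0) \<and> (\<forall>P\<in>\<D>. P y)"
      using x(1) by (intro exI[of _ x] conjI) simp_all
  qed
  then obtain y where y: "\<forall>P\<in>(\<lambda>l. holds (<) l) ` T. P y" by (elim exE conjE)
  have hT: "holds (<) l y" if "l \<in> T" for l by (rule bspec[OF y imageI[OF that]])
  have "f y = 0 \<longleftrightarrow> f b = 0" if "f \<in> dpoly L m" for f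
    using hT[of "(0, f)"] hT[of "(1, f)"] that by (auto simp: T_def holds_def)
  moreover have "holds (<) l y" if "l \<in> S" for l using hT that by (simp add: T_def)
  ultimately show ?thesis by (intro exI[of _ y] conjI ballI)
qed

text \<open>The type consists of all conditions over \<open>L\<close> shared by every conjugate,
  together with the exclusion of every finite \<open>V\<close>. If a condition held at
  \<open>b\<close> but at no conjugate, its negation would belong to the type.\<close>

lemma limit_point:
  assumes neg: "\<forall>V. finite V \<longrightarrow> V \<subseteq> L \<longrightarrow> (\<exists>\<sigma>\<in>GG. \<not> const_frac m V (\<lambda>i. \<sigma> (a i)))"
  shows "\<exists>b. (\<forall>V. finite V \<longrightarrow> V \<subseteq> L \<longrightarrow> \<not> const_frac m V b) \<and>
    (\<forall>P. defbl LL UU L P \<longrightarrow> P b \<longrightarrow> (\<exists>\<sigma>\<in>GG. P (\<lambda>i. if i < m then \<sigma> (a i) else 0)))"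
proof -
  \<comment> \<open>Conjugates are padded with 0, since assignments are infinite and the type fixes
    the coordinates from \<open>m\<close> on.\<close>
  define pt where "pt \<sigma> = (\<lambda>i. if i < m then \<sigma> (a i) else 0)" for \<sigma> :: "'u \<Rightarrow> 'u"
  define VV where "VV = {V. finite V \<and> V \<subseteq> L}"
  define nI where "nI V = (\<lambda>y. \<not> const_frac m V y)" for V
  define \<Q> where "\<Q> = {P. defbl LL UU L P \<and> (\<forall>\<sigma>\<in>GG. P (pt \<sigma>))}"
  have r0: "range (\<lambda>_::nat. 0) \<subseteq> L" using L0 by auto
  have "\<exists>y. range y \<subseteq> dom UU \<and> (\<forall>i\<ge>m. y i = 0) \<and> (\<forall>P\<in>id ` \<Q> \<union> nI ` VV. P y)"
  proof (rule saturated_realise[OF sat _ _ r0])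
    show "L \<subseteq> dom UU" "infinite (dom UU)" using infinite_UNIV_u by simp_all
    show "L \<prec> dom UU" using Lsmall by simp
  next
    fix P assume "P \<in> id ` \<Q> \<union> nI ` VV"
    then show "defbl LL UU L P"
    proof (elim UnE imageE)
      fix P' assume "P = id P'" "P' \<in> \<Q>"
      then show ?thesis by (simp add: \<Q>_def)
    next
      fix V assume "P = nI V" "V \<in> VV"
      then show ?thesis using defbl_not[OF defbl_const_frac, of V m] unfolding nI_def VV_def by simp
    qed
  next
    fix \<D> assume D: "\<D> \<subseteq> id ` \<Q> \<union> nI ` VV" "finite \<D>"
    obtain S \<V> where SV: "finite S" "S \<subseteq> \<Q>" "finite \<V>" "\<V> \<subseteq> VV" "\<D> \<subseteq> id ` S \<union> nI ` \<V>"
      by (rule finite_subset_two_images[OF D(2) D(1)])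
    have "finite (\<Union>\<V>)" "\<Union>\<V> \<subseteq> L" using SV(3,4) by (auto simp: VV_def)
    from neg[rule_format, OF this] obtain \<sigma> where s: "\<sigma> \<in> GG" "\<not> const_frac m (\<Union>\<V>) (\<lambda>i. \<sigma> (a i))" by (rule bexE)
    have "\<not> const_frac m (\<Union>\<V>) (pt \<sigma>)" using s(2) const_frac_cong[of m "\<lambda>i. \<sigma> (a i)" "pt \<sigma>"] by (simp add: pt_def)
    then have n: "nI V (pt \<sigma>)" if "V \<in> \<V>" for V unfolding nI_def
      by (rule not_const_frac_Union[OF SV(3) SV(4)[unfolded VV_def] _ that])
    have q: "P (pt \<sigma>)" if "P \<in> S" for P using subsetD[OF SV(2) that] s(1) unfolding \<Q>_def by simp
    have "P (pt \<sigma>)" if "P \<in> \<D>" for P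
      using subsetD[OF SV(5) that] by (elim UnE imageE) (simp_all only: id_apply n q)
    then show "\<exists>y. range y \<subseteq> dom UU \<and> (\<forall>i\<ge>m. y i = 0) \<and> (\<forall>P\<in>\<D>. P y)"
      by (intro exI[of _ "pt \<sigma>"] conjI ballI) (simp_all add: pt_def)
  qed
  then obtain b where b: "\<forall>P\<in>id ` \<Q> \<union> nI ` VV. P b" by (elim exE conjE)
  have "\<exists>\<sigma>\<in>GG. P (pt \<sigma>)" if P: "defbl LL UU L P" "P b" for P
  proof (rule ccontr)
    assume "\<not> ?thesis"
    then have "(\<lambda>x. \<not> P x) \<in> \<Q>" unfolding \<Q>_def using defbl_not[OF P(1)] by simp
    then have "id (\<lambda>x. \<not> P x) \<in> id ` \<Q> \<union> nI ` VV" by (intro UnI1 imageI)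
    from bspec[OF b this] P(2) show False by simp
  qed
  moreover have "\<not> const_frac m V b" if "finite V" "V \<subseteq> L" for V
  proof -
    have "nI V \<in> id ` \<Q> \<union> nI ` VV" using that by (intro UnI2 imageI) (simp add: VV_def)
    from bspec[OF b this] show ?thesis by (simp add: nI_def)
  qed
  ultimately show ?thesis unfolding pt_def by (intro exI[of _ b] conjI allI impI)
qed

theorem uniform_bound: "\<exists>V. finite V \<and> V \<subseteq> L \<and> (\<forall>\<sigma>\<in>GG. const_frac m V (\<lambda>i. \<sigma> (a i)))"
proof (rule ccontr)
  assume "\<not> ?thesis"
  then have "\<forall>V. finite V \<longrightarrow> V \<subseteq> L \<longrightarrow> (\<exists>\<sigma>\<in>GG. \<not> const_frac m V (\<lambda>i. \<sigma> (a i)))" by blast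
  from limit_point[OF this] obtain b where b: "\<forall>V. finite V \<longrightarrow> V \<subseteq> L \<longrightarrow> \<not> const_frac m V b"
    "\<forall>P. defbl LL UU L P \<longrightarrow> P b \<longrightarrow> (\<exists>\<sigma>\<in>GG. P (\<lambda>i. if i < m then \<sigma> (a i) else 0))" by (elim exE conjE)
  \<comment> \<open>Vanishing of \<open>f\<close> over \<open>K\<close> takes the same truth value
    at all conjugates of \<open>a\<close>, and a condition true at \<open>b\<close> is met at some
    conjugate.\<close>
  have Kb: "f a = 0 \<longleftrightarrow> f b = 0" if f: "f \<in> dpoly K m" for f
  proof -
    have d: "defbl LL UU L (\<lambda>x. f x = 0)" by (rule defbl_dpoly_eq[OF dpoly_mono[OF f KL order_refl] L0(1)])
    have e: "f (\<lambda>i. if i < m then \<sigma> (a i) else 0) = 0 \<longleftrightarrow> f a = 0" if "\<sigma> \<in> GG" for \<sigma>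
      using GG_dpoly_L[OF that f] dpoly_cong[OF f, of "\<lambda>i. if i < m then \<sigma> (a i) else 0" "\<lambda>i. \<sigma> (a i)"] by simp
    show ?thesis
    proof (cases "f b = 0")
      case True
      then show ?thesis using b(2)[rule_format, OF d] e by blast
    next
      case False
      then show ?thesis using b(2)[rule_format, OF defbl_not[OF d]] e by blast
    qed
  qed
  have small: "|dgen L m b| <o |UNIV :: 'u set|"
    using dgen_small[OF L Lsmall] by (simp only: lesspoll_iff_ordLess)
  from laurent_embedding[OF L small order_refl] obtain Eq Ne where EN: "finite Eq" "finite Ne" "Eq \<subseteq> dpoly L m" "Ne \<subseteq> dpoly L m"
    "\<forall>f\<in>Eq. f b = 0" "\<forall>f\<in>Ne. f b \<noteq> 0"
    "\<forall>a. (\<forall>f\<in>Eq. f a = 0) \<and> (\<forall>f\<in>Ne. f a \<noteq> 0) \<longrightarrow>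
      (\<exists>\<psi>. hom_on (dgen L m b) \<psi> \<and> (\<forall>l\<in>L. \<psi> l = fls_const l) \<and> (\<forall>i<m. \<forall>k. jet_res \<psi> k (b i) (a i)))"
    by (elim exE conjE)
  have Lne: "L \<noteq> {}" using L0 by auto
  \<comment> \<open>The literals that permit an embedding are finitely many, so together they form
    one condition over \<open>L\<close>; it holds at \<open>b\<close> and therefore at some
    conjugate.\<close>
  have "defbl LL UU L (\<lambda>x. (\<forall>f\<in>Eq. f x = 0) \<and> (\<forall>f\<in>Ne. \<not> f x = 0))"
    by (intro defbl_conj defbl_ball Lne EN(1,2) defbl_not defbl_dpoly_eq[OF _ L0(1)]) (use EN(3,4) in blast)+
  from b(2)[rule_format, OF this] EN(5,6) obtain \<sigma> where s: "\<sigma> \<in> GG"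
    "(\<forall>f\<in>Eq. f (\<lambda>i. if i < m then \<sigma> (a i) else 0) = 0) \<and> (\<forall>f\<in>Ne. f (\<lambda>i. if i < m then \<sigma> (a i) else 0) \<noteq> 0)" by blast
  define x where "x = (\<lambda>i. if i < m then \<sigma> (a i) else 0)"
  from EN(7)[rule_format, OF s(2)] obtain \<psi> where \<psi>: "hom_on (dgen L m b) \<psi>" "\<forall>l\<in>L. \<psi> l = fls_const l"
    "\<forall>i<m. \<forall>k. jet_res \<psi> k (b i) (x i)" unfolding x_def by (elim exE conjE)
  let ?W = "dgen L m b"
  have W: "diff_subfield \<delta> ?W" by (rule dgen_diff_subfield)
  note Wr = diff_subfield_facts[OF W]
  have LW: "L \<subseteq> ?W" using dgen_const by blast
  define lt where "lt = (\<lambda>x y. fls_pos (\<psi> (y - x)))"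
  have ord: "order_on ?W lt" unfolding lt_def by (rule order_on_laurent[OF Wr(1) \<psi>(1)])
  have ltL: "lt x y \<longleftrightarrow> x < y" if "x \<in> L" "y \<in> L" for x y
    using \<psi>(2) sring_diff[OF diff_subfield_facts(2)[OF L] that(2,1)] by (simp add: lt_def fls_pos_const)
  have xF: "x i \<in> F" if "i < m" for i using GG_mem[OF s(1)] a_in_L[OF that] LF that by (auto simp: x_def)
  have "\<exists>S V. finite S \<and> S \<subseteq> UNIV \<times> dpoly K m \<and> (\<forall>l\<in>S. holds (<) l x) \<and> finite V \<and> V \<subseteq> L \<and>
    (\<forall>y. (\<forall>l\<in>S. holds (<) l y) \<longrightarrow> const_frac m V y)" by (rule type_isolated) (erule xF)
  then obtain S V where SV: "finite S" "S \<subseteq> UNIV \<times> dpoly K m" "\<forall>l\<in>S. holds (<) l x" "finite V" "V \<subseteq> L"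
    "\<forall>y. (\<forall>l\<in>S. holds (<) l y) \<longrightarrow> const_frac m V y" by (elim exE conjE)
  \<comment> \<open>\<open>S\<close> describes the signs of \<open>x\<close>, not those of
    \<open>b\<close>. Equations and inequations pass to \<open>b\<close> because both tuples have
    the zeros of \<open>a\<close> over \<open>K\<close>; positivity passes because the residue of
    the value at \<open>b\<close> is the value at \<open>x\<close>.\<close>
  have hS: "holds lt l b" if l: "l \<in> S" for l
  proof -
    have f: "snd l \<in> dpoly K m" using SV(2) l by auto
    have fx: "snd l x = snd l (\<lambda>i. \<sigma> (a i))" by (rule dpoly_cong[OF f]) (simp add: x_def)
    have z: "snd l x = 0 \<longleftrightarrow> snd l b = 0" unfolding fx using GG_dpoly_L[OF s(1) f] Kb[OF f] by simp
    have "lt 0 (snd l b)" if "0 < snd l x"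
    proof -
      have "snd l b \<in> ?W \<and> (\<forall>k. jet_res \<psi> k (snd l b) (snd l x))"
        by (rule dpoly_jet_res[OF W \<psi>(1) LW L _ _ dpoly_mono[OF f KL order_refl]]) (use \<psi>(2,3) dgen_var in blast)+
      then have "res (\<psi> (snd l b)) (snd l x)" using jet_res_0[of \<psi> "snd l b" "snd l x"] by blast
      then show ?thesis using that by (simp add: lt_def res_pos)
    qed
    then show ?thesis using SV(3) l z by (auto simp: holds_def)
  qed
  have SL: "S \<subseteq> UNIV \<times> dpoly L m" using SV(2) dpoly_mono[OF _ KL order_refl] by (auto simp: subset_iff)
  have bW: "b i \<in> ?W" if "i < m" for i using that by (rule dgen_var)
  have "\<exists>y. (\<forall>f\<in>dpoly L m. f y = 0 \<longleftrightarrow> f b = 0) \<and> (\<forall>l\<in>S. holds (<) l y)"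
    by (rule realise_field_type[OF W LW ord _ _ SL]) (erule (1) ltL, erule bW, erule hS)
  then obtain y where y: "\<forall>f\<in>dpoly L m. f y = 0 \<longleftrightarrow> f b = 0" "\<forall>l\<in>S. holds (<) l y" by (elim exE conjE)
  \<comment> \<open>\<open>y\<close> satisfies \<open>S\<close> in the true order of
    \<open>U\<close>, so the isolating property applies to it; the representation then goes back to
    \<open>b\<close> by the common field type over \<open>L\<close>.\<close>
  have "const_frac m V y" using spec[OF SV(6), of y] y(2) by (rule mp)
  then have "const_frac m V b" by (rule const_frac_transfer[OF SV(4,5) _ y(1)])
  then show False using b(1) SV(4,5) by blast
qed

end

end

section \<open>Definable sets of constants\<close>

subsection \<open>Hilbert's basis theorem\<close>

text \<open>A form of dependent choice in which each step may depend on the whole set of earlier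
  values; the recursion carries the list of these values along.\<close>

lemma history_choice:
  assumes "\<And>S. finite S \<Longrightarrow> S \<subseteq> A \<Longrightarrow> \<exists>y\<in>A. Q S y"
  shows "\<exists>h. \<forall>n::nat. h n \<in> A \<and> Q (h ` {..<n}) (h n)"
proof -
  define pick where "pick S = (SOME y. y \<in> A \<and> Q S y)" for S
  have pick: "pick S \<in> A \<and> Q S (pick S)" if "finite S" "S \<subseteq> A" for S
  proof -
    have "\<exists>y. y \<in> A \<and> Q S y" using assms[OF that] by (elim bexE) (intro exI conjI)
    then show ?thesis unfolding pick_def by (rule someI_ex)
  qed
  define hs where "hs = rec_nat [] (\<lambda>_ xs. xs @ [pick (set xs)])"
  have hs0: "hs 0 = []" and hsS: "hs (Suc n) = hs n @ [pick (set (hs n))]" for n by (simp_all add: hs_def)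
  define h where "h n = pick (set (hs n))" for n
  have set: "set (hs n) = h ` {..<n}" for n
    by (induction n) (auto simp: hs0 hsS h_def lessThan_Suc)
  have "h n \<in> A \<and> Q (h ` {..<n}) (h n)" for n
  proof (induction n rule: less_induct)
    case (less n)
    have "finite (set (hs n))" "set (hs n) \<subseteq> A" using less by (auto simp: set)
    from pick[OF this] show ?case unfolding h_def[symmetric] unfolding set .
  qed
  then show ?thesis by (intro exI[of _ h] allI)
qed

text \<open>Noetherian in sequence form: some member of each sequence is a combination of earlier ones.\<close>

definition noetherian :: "'r::comm_ring_1 set \<Rightarrow> bool" where
  "noetherian R \<longleftrightarrow> (\<forall>f::nat \<Rightarrow> 'r. (\<forall>n. f n \<in> R) \<longrightarrow> (\<exists>n r. (\<forall>i<n. r i \<in> R) \<and> f n = (\<Sum>i<n. r i * f i)))"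

inductive_set gen_ideal :: "'r::comm_ring_1 set \<Rightarrow> 'r poly set \<Rightarrow> 'r poly set" for R S where
  zero: "0 \<in> gen_ideal R S"
| step: "p \<in> gen_ideal R S \<Longrightarrow> polyA R s \<Longrightarrow> g \<in> S \<Longrightarrow> p + s * g \<in> gen_ideal R S"

lemma gen_ideal_add:
  assumes q: "q \<in> gen_ideal R S" shows "p \<in> gen_ideal R S \<Longrightarrow> p + q \<in> gen_ideal R S"
proof (induction rule: gen_ideal.induct)
  case (step p s g)
  then have "(p + q) + s * g \<in> gen_ideal R S" by (intro gen_ideal.step)
  then show ?case by (simp add: ac_simps)
qed (simp add: q)

lemma gen_ideal_mult:
  assumes R: "sring R" and t: "polyA R t" shows "p \<in> gen_ideal R S \<Longrightarrow> t * p \<in> gen_ideal R S"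
proof (induction rule: gen_ideal.induct)
  case (step p s g)
  then have "t * p + (t * s) * g \<in> gen_ideal R S" by (intro gen_ideal.step polyA_mult R t)
  then show ?case by (simp add: algebra_simps)
qed (simp add: gen_ideal.zero)

lemma gen_ideal_mono: "p \<in> gen_ideal R S \<Longrightarrow> S \<subseteq> S' \<Longrightarrow> p \<in> gen_ideal R S'"
  by (induction rule: gen_ideal.induct) (auto intro: gen_ideal.intros)

lemma gen_ideal_base: "sring R \<Longrightarrow> g \<in> S \<Longrightarrow> g \<in> gen_ideal R S"
  using gen_ideal.step[OF gen_ideal.zero, of R "[:1:]" g S] polyA_const[of R 1] sring_1[of R] by simp

lemma gen_ideal_subset:
  assumes R: "sring R" "S' \<subseteq> gen_ideal R S" shows "p \<in> gen_ideal R S' \<Longrightarrow> p \<in> gen_ideal R S"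
proof (induction rule: gen_ideal.induct)
  case (step p s g)
  have "s * g \<in> gen_ideal R S" using step(2,3) R(2) by (intro gen_ideal_mult[OF R(1)]) blast+
  then show ?case using step(4) by (intro gen_ideal_add)
qed (rule gen_ideal.zero)

lemma gen_ideal_compact: "p \<in> gen_ideal R (range f) \<Longrightarrow> \<exists>n. p \<in> gen_ideal R (f ` {..<n::nat})"
proof (induction rule: gen_ideal.induct)
  case (step p s g)
  then obtain n k where n: "p \<in> gen_ideal R (f ` {..<n})" "g = f k" by auto
  have "p \<in> gen_ideal R (f ` {..<max n (Suc k)})" by (rule gen_ideal_mono[OF n(1)]) auto
  then have "p + s * g \<in> gen_ideal R (f ` {..<max n (Suc k)})" using step n(2) by (intro gen_ideal.step) auto
  then show ?case by blast
qed (auto intro: gen_ideal.zero)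

lemma gen_ideal_expand: "p \<in> gen_ideal R (f ` {..<n::nat}) \<Longrightarrow> sring R \<Longrightarrow> \<exists>s. (\<forall>i. polyA R (s i)) \<and> p = (\<Sum>i<n. s i * f i)"
proof (induction rule: gen_ideal.induct)
  case zero
  then show ?case using polyA_0 by (intro exI[of _ "\<lambda>_. 0"]) simp
next
  case (step p s g)
  then obtain t k where t: "\<forall>i. polyA R (t i)" "p = (\<Sum>i<n. t i * f i)" "k < n" "g = f k" by auto
  have "(\<Sum>i<n. (t i + (if i = k then s else 0)) * f i) = (\<Sum>i<n. t i * f i) + (\<Sum>i<n. if i = k then s * f i else 0)"
    unfolding sum.distrib[symmetric] by (intro sum.cong refl) (simp add: distrib_right)
  also have "(\<Sum>i<n. if i = k then s * f i else 0) = s * f k" using t(3) by simp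
  finally have "p + s * g = (\<Sum>i<n. (t i + (if i = k then s else 0)) * f i)" using t by simp
  moreover have "polyA R (t i + (if i = k then s else 0))" for i
    using t(1) step.hyps(2) step.prems polyA_0 by (auto intro: polyA_add)
  ultimately show ?case by (intro exI[of _ "\<lambda>i. t i + (if i = k then s else 0)"] conjI allI)
qed

lemma gen_ideal_polyA: "p \<in> gen_ideal R S \<Longrightarrow> sring R \<Longrightarrow> (\<And>g. g \<in> S \<Longrightarrow> polyA R g) \<Longrightarrow> polyA R p"
  by (induction rule: gen_ideal.induct) (auto intro: polyA_0 polyA_add polyA_mult)

text \<open>The argument by elements of least degree: each \<open>h n\<close> has least degree among
  the members of the ideal outside the ideal of its predecessors. A relation between leading
  coefficients produces a combination of predecessors that cancels the leading term of
  \<open>h n\<close>, leaving an outside element of smaller degree.\<close>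

lemma hilbert_basis:
  fixes f :: "nat \<Rightarrow> 'r::comm_ring_1 poly"
  assumes R: "sring R" "noetherian R" and f: "\<And>n. polyA R (f n)"
  shows "\<exists>n. f n \<in> gen_ideal R (f ` {..<n})"
proof (rule ccontr)
  assume "\<not> ?thesis"
  then have neg: "f n \<notin> gen_ideal R (f ` {..<n})" for n by blast
  define J where "J = gen_ideal R (range f)"
  define Q where "Q S y \<longleftrightarrow> y \<notin> gen_ideal R S \<and> (\<forall>p. p \<in> J \<longrightarrow> p \<notin> gen_ideal R S \<longrightarrow> degree y \<le> degree p)" for S y
  have "\<exists>y\<in>J. Q S y" if S: "finite S" "S \<subseteq> J" for S
  proof -
    have "\<exists>n. S \<subseteq> gen_ideal R (f ` {..<n})" using S
    proof (induction S)
      case (insert x S)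
      then obtain n where n: "S \<subseteq> gen_ideal R (f ` {..<n})" by auto
      obtain k where k: "x \<in> gen_ideal R (f ` {..<k})" using insert.prems gen_ideal_compact[of x R f] by (auto simp: J_def)
      have "insert x S \<subseteq> gen_ideal R (f ` {..<max n k})"
      proof -
        have 1: "f ` {..<n} \<subseteq> f ` {..<max n k}" "f ` {..<k} \<subseteq> f ` {..<max n k}" by auto
        have "x \<in> gen_ideal R (f ` {..<max n k})" by (rule gen_ideal_mono[OF k 1(2)])
        moreover have "S \<subseteq> gen_ideal R (f ` {..<max n k})"
        proof
          fix y assume "y \<in> S"
          then have "y \<in> gen_ideal R (f ` {..<n})" using n by (rule subsetD[rotated])
          then show "y \<in> gen_ideal R (f ` {..<max n k})" by (rule gen_ideal_mono[OF _ 1(1)])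
        qed
        ultimately show ?thesis by (rule insert_subsetI)
      qed
      then show ?case by blast
    qed simp
    \<comment> \<open>A finite part of the ideal is generated by finitely many \<open>f i\<close>,
      and \<open>f n\<close> lies outside their ideal, so the choice of \<open>h\<close> never gets
      stuck.\<close>
    then obtain n where n: "S \<subseteq> gen_ideal R (f ` {..<n})" by blast
    define P where "P p \<longleftrightarrow> p \<in> J \<and> p \<notin> gen_ideal R S" for p
    have "P (f n)" using neg[of n] gen_ideal_subset[OF R(1) n] gen_ideal_base[OF R(1)] by (auto simp: P_def J_def)
    then have "P (arg_min degree P)" by (rule arg_min_natI[where P = P])
    moreover have "degree (arg_min degree P) \<le> degree p" if "P p" for p using that by (rule arg_min_nat_le[where P = P])
    ultimately show ?thesis by (intro bexI[of _ "arg_min degree P"]) (auto simp: Q_def P_def)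
  qed
  from history_choice[of J Q, OF this] obtain h where h\<^sub>0: "\<forall>n::nat. h n \<in> J \<and> Q (h ` {..<n}) (h n)" by (rule exE)
  have h: "h n \<in> J" "Q (h ` {..<n}) (h n)" for n using h\<^sub>0 by simp_all
  have hA: "polyA R (h n)" for n using gen_ideal_polyA[OF h(1)[unfolded J_def] R(1)] f by blast
  have mono: "degree (h i) \<le> degree (h n)" if "i < n" for i n
  proof -
    have "h ` {..<i} \<subseteq> h ` {..<n}" using that by auto
    then have "h n \<notin> gen_ideal R (h ` {..<i})" using h(2)[of n] gen_ideal_mono[of "h n" R "h ` {..<i}" "h ` {..<n}"] by (auto simp: Q_def)
    then show ?thesis using h(2)[of i] h(1)[of n] by (simp add: Q_def)
  qed
  have "\<forall>n. lead_coeff (h n) \<in> R" using hA by (simp add: polyA_def)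
  from R(2)[unfolded noetherian_def, rule_format, OF this[rule_format], of id, simplified]
  obtain n r where r: "\<forall>i<n. r i \<in> R" "lead_coeff (h n) = (\<Sum>i<n. r i * lead_coeff (h i))" by blast
  define D where "D = degree (h n)"
  \<comment> \<open>The monomials raise every predecessor to the degree \<open>D\<close> of
    \<open>h n\<close>; this is possible because the degrees of the \<open>h i\<close> do not
    decrease.\<close>
  define t where "t = (\<Sum>i<n. monom (r i) (D - degree (h i)) * h i)"
  have tI: "t \<in> gen_ideal R (h ` {..<n})" unfolding t_def
  proof -
    have "(\<Sum>i<k. monom (r i) (D - degree (h i)) * h i) \<in> gen_ideal R (h ` {..<n})" if "k \<le> n" for k
      using that
    proof (induction k)
      case (Suc k)
      have "polyA R (monom (r k) (D - degree (h k)))" using r(1) Suc.prems by (intro polyA_monom[OF R(1)]) simp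
      moreover have "h k \<in> h ` {..<n}" using Suc.prems by simp
      ultimately show ?case using Suc by (auto intro: gen_ideal.step)
    qed (simp add: gen_ideal.zero)
    then show "(\<Sum>i<n. monom (r i) (D - degree (h i)) * h i) \<in> gen_ideal R (h ` {..<n})" by simp
  qed
  have hJ: "h ` {..<n} \<subseteq> gen_ideal R (range f)" using h(1) by (auto simp: J_def)
  have neg1: "- t \<in> gen_ideal R (h ` {..<n})"
    using gen_ideal_mult[OF R(1) polyA_const[OF R(1) sring_neg[OF R(1) sring_1[OF R(1)]]] tI] by simp
  define p where "p = h n + - t"
  have pJ: "p \<in> J" unfolding p_def J_def
    using h(1)[of n] gen_ideal_subset[OF R(1) hJ neg1] by (intro gen_ideal_add) (auto simp: J_def)
  have pn: "p \<notin> gen_ideal R (h ` {..<n})"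
  proof
    assume "p \<in> gen_ideal R (h ` {..<n})"
    from gen_ideal_add[OF tI this] have "h n \<in> gen_ideal R (h ` {..<n})" by (simp add: p_def)
    then show False using h(2)[of n] by (simp add: Q_def)
  qed
  have "coeff t D = (\<Sum>i<n. r i * lead_coeff (h i))" unfolding t_def coeff_sum
    using mono by (intro sum.cong refl) (auto simp: coeff_monom_mult D_def)
  then have c0: "coeff p D = 0" using r(2) by (simp add: p_def D_def)
  have "degree (monom (r i) (D - degree (h i)) * h i) \<le> D" if "i < n" for i
  proof -
    have "degree (monom (r i) (D - degree (h i)) * h i) \<le> degree (monom (r i) (D - degree (h i))) + degree (h i)"
      by (rule degree_mult_le)
    also have "\<dots> \<le> (D - degree (h i)) + degree (h i)" by (intro add_right_mono degree_monom_le)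
    also have "\<dots> = D" using mono[OF that] by (simp add: D_def)
    finally show ?thesis .
  qed
  then have "degree t \<le> D" unfolding t_def by (intro degree_sum_le) auto
  then have dp: "degree p \<le> D" unfolding p_def by (intro degree_add_le) (auto simp: D_def)
  have "degree p < D"
  proof (rule ccontr)
    assume "\<not> degree p < D"
    then have "degree p = D" using dp by simp
    then have "p = 0" using c0 by (metis leading_coeff_0_iff)
    then show False using pn gen_ideal.zero by blast
  qed
  then show False using h(2)[of n] pJ pn by (auto simp: Q_def D_def)
qed

lemma noetherian_adjoin:
  assumes R: "sring R" "noetherian R"
  shows "noetherian {poly p x | p. polyA R p}"
  unfolding noetherian_def
proof (intro allI impI)
  fix f :: "nat \<Rightarrow> 'a" assume "\<forall>n. f n \<in> {poly p x | p. polyA R p}"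
  then have "\<forall>n. \<exists>p. f n = poly p x \<and> polyA R p" by simp
  from choice[OF this] obtain g where g: "\<forall>n. f n = poly (g n) x \<and> polyA R (g n)" ..
  obtain n where "g n \<in> gen_ideal R (g ` {..<n})" using hilbert_basis[OF R, of g] g by auto
  from gen_ideal_expand[OF this R(1)] obtain s where s: "\<forall>i. polyA R (s i)" "g n = (\<Sum>i<n. s i * g i)" by (elim exE conjE)
  have "f n = (\<Sum>i<n. poly (s i) x * f i)" using g s(2) by (simp add: poly_sum)
  moreover have "\<forall>i<n. poly (s i) x \<in> {poly p x | p. polyA R p}" using s(1) by blast
  ultimately show "\<exists>n r. (\<forall>i<n. r i \<in> {poly p x | p. polyA R p}) \<and> f n = (\<Sum>i<n. r i * f i)"
    by (intro exI[of _ n] exI[of _ "\<lambda>i. poly (s i) x"] conjI)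
qed

subsection \<open>Polynomial functions\<close>

inductive_set poly_fun :: "'a::comm_ring_1 set \<Rightarrow> nat \<Rightarrow> ((nat \<Rightarrow> 'a) \<Rightarrow> 'a) set" for A M where
  poly_fun_const: "u \<in> A \<Longrightarrow> (\<lambda>_. u) \<in> poly_fun A M"
| poly_fun_var: "i < M \<Longrightarrow> (\<lambda>x. x i) \<in> poly_fun A M"
| poly_fun_add: "f \<in> poly_fun A M \<Longrightarrow> g \<in> poly_fun A M \<Longrightarrow> (\<lambda>x. f x + g x) \<in> poly_fun A M"
| poly_fun_mult: "f \<in> poly_fun A M \<Longrightarrow> g \<in> poly_fun A M \<Longrightarrow> (\<lambda>x. f x * g x) \<in> poly_fun A M"

lemma poly_fun_sum: "0 \<in> A \<Longrightarrow> (\<And>i. i \<in> I \<Longrightarrow> f i \<in> poly_fun A M) \<Longrightarrow> (\<lambda>x. \<Sum>i\<in>I. f i x) \<in> poly_fun A M"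
  by (induction I rule: infinite_finite_induct) (auto simp: poly_fun_const poly_fun_add)

lemma poly_fun_power: "1 \<in> A \<Longrightarrow> f \<in> poly_fun A M \<Longrightarrow> (\<lambda>x. f x ^ n) \<in> poly_fun A M"
  by (induction n) (auto simp: poly_fun_const poly_fun_mult)

lemma poly_fun_neg: "-1 \<in> A \<Longrightarrow> f \<in> poly_fun A M \<Longrightarrow> (\<lambda>x. - f x) \<in> poly_fun A M"
  using poly_fun_mult[OF poly_fun_const, of "-1" A f M] by simp

lemma poly_fun_diff: "-1 \<in> A \<Longrightarrow> f \<in> poly_fun A M \<Longrightarrow> g \<in> poly_fun A M \<Longrightarrow> (\<lambda>x. f x - g x) \<in> poly_fun A M"
  using poly_fun_add[OF _ poly_fun_neg, of f A M g] by simp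

lemma poly_fun_shift: "f \<in> poly_fun A M \<Longrightarrow> d + M \<le> M' \<Longrightarrow> (\<lambda>x. f (\<lambda>i. x (d + i))) \<in> poly_fun A M'"
  by (induction rule: poly_fun.induct) (auto intro: poly_fun.intros)

text \<open>Polynomials are evaluated in the ring of all functions with pointwise operations, so
  \<open>poly p (\<lambda>x. x k)\<close> adjoins one coordinate and Hilbert's theorem applies once
  per coordinate. That ring has zero divisors, which is why the preceding lemmas are stated for
  commutative rings.\<close>

primrec poly_fun_ring :: "nat \<Rightarrow> ((nat \<Rightarrow> 'a::field) \<Rightarrow> 'a) set" where
  "poly_fun_ring 0 = range (\<lambda>u _. u)"
| "poly_fun_ring (Suc k) = {poly p (\<lambda>x. x k) | p. polyA (poly_fun_ring k) p}"

lemma poly_fun_ring_sring: "sring (poly_fun_ring k)"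
proof (induction k)
  case 0
  have c: "(\<lambda>_. u) \<in> poly_fun_ring 0" for u :: 'a by simp
  show ?case unfolding sring_def
  proof (intro conjI ballI)
    show "(0 :: (nat \<Rightarrow> 'a) \<Rightarrow> 'a) \<in> poly_fun_ring 0" "(1 :: (nat \<Rightarrow> 'a) \<Rightarrow> 'a) \<in> poly_fun_ring 0"
      unfolding zero_fun_def one_fun_def by (rule c)+
    fix f :: "(nat \<Rightarrow> 'a) \<Rightarrow> 'a" assume "f \<in> poly_fun_ring 0"
    then obtain u where f: "f = (\<lambda>_. u)" by auto
    show "- f \<in> poly_fun_ring 0" unfolding f fun_Compl_def by (rule c)
    fix g :: "(nat \<Rightarrow> 'a) \<Rightarrow> 'a" assume "g \<in> poly_fun_ring 0"
    then obtain v where g: "g = (\<lambda>_. v)" by auto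
    show "f + g \<in> poly_fun_ring 0" "f * g \<in> poly_fun_ring 0" unfolding f g plus_fun_def times_fun_def by (rule c)+
  qed
next
  case (Suc k)
  then show ?case using sring_poly_image[OF Suc] by simp
qed

lemma poly_fun_ring_noetherian: "noetherian (poly_fun_ring k)"
proof (induction k)
  case 0
  show ?case unfolding noetherian_def
  proof (intro allI impI)
    fix f :: "nat \<Rightarrow> (nat \<Rightarrow> 'a) \<Rightarrow> 'a" assume "\<forall>n. f n \<in> poly_fun_ring 0"
    then have "\<forall>n. \<exists>u. f n = (\<lambda>_. u)" by (auto simp: image_iff)
    from choice[OF this] obtain u where u: "\<forall>n. f n = (\<lambda>_. u n)" ..
    show "\<exists>n r. (\<forall>i<n. r i \<in> poly_fun_ring 0) \<and> f n = (\<Sum>i<n. r i * f i)"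
    proof (cases "u 0 = 0")
      case True
      then show ?thesis using u by (intro exI[of _ 0]) (simp add: zero_fun_def)
    next
      case False
      then show ?thesis using u
        by (intro exI[of _ 1] exI[of _ "\<lambda>_ _. u 1 / u 0"]) (simp add: times_fun_def)
    qed
  qed
next
  case (Suc k)
  then show ?case using noetherian_adjoin[OF poly_fun_ring_sring Suc] by simp
qed

lemma poly_fun_ring_mono: "f \<in> poly_fun_ring k \<Longrightarrow> f \<in> poly_fun_ring (Suc k)"
  using polyA_const[OF poly_fun_ring_sring, of f k] by (simp only: poly_fun_ring.simps) (intro CollectI exI[of _ "[:f:]"], simp)

lemma poly_fun_subset_poly_fun_ring: "f \<in> poly_fun UNIV M \<Longrightarrow> f \<in> poly_fun_ring M"
proof (induction rule: poly_fun.induct)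
  case (poly_fun_const u)
  have "(\<lambda>_. u) \<in> poly_fun_ring k" for k
  proof (induction k)
    case (Suc k)
    then show ?case by (rule poly_fun_ring_mono)
  qed simp
  then show ?case .
next
  case (poly_fun_var i)
  have "(\<lambda>x::nat \<Rightarrow> 'a. x i) \<in> poly_fun_ring (Suc i)" using polyA_X[OF poly_fun_ring_sring, of i]
    by (simp only: poly_fun_ring.simps) (intro CollectI exI[of _ "[:0, 1:]"], simp)
  moreover have "(\<lambda>x::nat \<Rightarrow> 'a. x i) \<in> poly_fun_ring k \<Longrightarrow> (\<lambda>x::nat \<Rightarrow> 'a. x i) \<in> poly_fun_ring (k + d)" for k d
    by (induction d) (simp_all del: poly_fun_ring.simps add: poly_fun_ring_mono)
  ultimately have "(\<lambda>x::nat \<Rightarrow> 'a. x i) \<in> poly_fun_ring (Suc i + (M - Suc i))" by blast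
  then show ?case using poly_fun_var by (simp del: poly_fun_ring.simps)
next
  case (poly_fun_add f g)
  then show ?case using sring_add[OF poly_fun_ring_sring, of f M g] by (simp add: plus_fun_def)
next
  case (poly_fun_mult f g)
  then show ?case using sring_mult[OF poly_fun_ring_sring, of f M g] by (simp add: times_fun_def)
qed

text \<open>If no finite part had the same zeros, there would be a sequence in which each function
  is nonzero at some common zero of its predecessors. The noetherian property makes one of them a
  combination of its predecessors, a contradiction.\<close>

lemma poly_fun_zeros_noetherian:
  assumes G: "\<G> \<subseteq> poly_fun (UNIV :: 'a::field set) M"
  shows "\<exists>\<G>\<^sub>0. finite \<G>\<^sub>0 \<and> \<G>\<^sub>0 \<subseteq> \<G> \<and> (\<forall>x. (\<forall>g\<in>\<G>\<^sub>0. g x = 0) \<longrightarrow> (\<forall>g\<in>\<G>. g x = 0))"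
proof (rule ccontr)
  assume neg: "\<not> ?thesis"
  define Q where "Q S y \<longleftrightarrow> (\<exists>x. (\<forall>g\<in>S. g x = 0) \<and> y x \<noteq> 0)" for S :: "((nat \<Rightarrow> 'a) \<Rightarrow> 'a) set" and y :: "(nat \<Rightarrow> 'a) \<Rightarrow> 'a"
  have "\<exists>y\<in>\<G>. Q S y" if "finite S" "S \<subseteq> \<G>" for S
  proof (rule ccontr)
    assume "\<not> ?thesis"
    then have "\<forall>x. (\<forall>g\<in>S. g x = 0) \<longrightarrow> (\<forall>g\<in>\<G>. g x = 0)" unfolding Q_def by blast
    then show False using neg that by (elim notE, intro exI[of _ S] conjI)
  qed
  from history_choice[of \<G> Q, OF this] obtain h where h: "\<forall>n::nat. h n \<in> \<G> \<and> Q (h ` {..<n}) (h n)" by (rule exE)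
  have "\<forall>n. h n \<in> poly_fun_ring M" using h G poly_fun_subset_poly_fun_ring by blast
  then have "\<exists>n r. (\<forall>i<n. r i \<in> poly_fun_ring M) \<and> h n = (\<Sum>i<n. r i * h i)"
    by (rule poly_fun_ring_noetherian[unfolded noetherian_def, THEN spec, THEN mp])
  then obtain n r where r: "h n = (\<Sum>i<n. r i * h i)" by (elim exE conjE)
  obtain x where x: "\<forall>g\<in>h ` {..<n}. g x = 0" "h n x \<noteq> 0" using h[rule_format, of n] unfolding Q_def by (elim conjE exE)
  have "(\<Sum>i<k. r i * h i) x = (\<Sum>i<k. r i x * h i x)" for k by (induction k) (simp_all add: zero_fun_def)
  then have "h n x = (\<Sum>i<n. r i x * h i x)" using r by simp
  also have "\<dots> = 0" using x(1) by (intro sum.neutral) simp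
  finally show False using x(2) by simp
qed

text \<open>Separates the coefficients in the big field from functions with coefficients in
  \<open>A\<close>; expanding the former in a basis later brings an equation down to the
  constants.\<close>

lemma poly_fun_expand:
  assumes A: "1 \<in> (A :: 'a::field set)"
  shows "f \<in> poly_fun UNIV M \<Longrightarrow> \<exists>ps. (\<forall>p\<in>set ps. fst p \<in> poly_fun A M) \<and> (\<forall>x. f x = (\<Sum>p\<leftarrow>ps. fst p x * snd p))"
proof (induction rule: poly_fun.induct)
  case (poly_fun_const u)
  then show ?case using A by (intro exI[of _ "[(\<lambda>_. 1, u)]"]) (simp add: poly_fun.poly_fun_const)
next
  case (poly_fun_var i)
  then show ?case by (intro exI[of _ "[(\<lambda>x. x i, 1)]"]) (simp add: poly_fun.poly_fun_var)
next
  case (poly_fun_add f g)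
  then obtain ps qs where "\<forall>p\<in>set ps. fst p \<in> poly_fun A M" "\<forall>x. f x = (\<Sum>p\<leftarrow>ps. fst p x * snd p)"
    "\<forall>p\<in>set qs. fst p \<in> poly_fun A M" "\<forall>x. g x = (\<Sum>p\<leftarrow>qs. fst p x * snd p)" by (elim exE conjE)
  then show ?case by (intro exI[of _ "ps @ qs"]) auto
next
  case (poly_fun_mult f g)
  then obtain ps qs where ps: "\<forall>p\<in>set ps. fst p \<in> poly_fun A M" "\<forall>x. f x = (\<Sum>p\<leftarrow>ps. fst p x * snd p)"
    and qs: "\<forall>p\<in>set qs. fst p \<in> poly_fun A M" "\<forall>x. g x = (\<Sum>p\<leftarrow>qs. fst p x * snd p)" by (elim exE conjE)
  define pr where "pr p q = ((\<lambda>x. fst p x * fst q x), snd p * snd q)" for p q :: "((nat \<Rightarrow> 'a) \<Rightarrow> 'a) \<times> 'a"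
  define rs where "rs = concat (map (\<lambda>p. map (pr p) qs) ps)"
  have 1: "(\<Sum>r\<leftarrow>map (pr p) qs'. fst r x * snd r) = fst p x * snd p * (\<Sum>q\<leftarrow>qs'. fst q x * snd q)" for p qs' x
    by (induction qs') (simp_all add: pr_def algebra_simps)
  have "(\<Sum>r\<leftarrow>concat (map (\<lambda>p. map (pr p) qs) ps'). fst r x * snd r) = (\<Sum>p\<leftarrow>ps'. fst p x * snd p) * (\<Sum>q\<leftarrow>qs. fst q x * snd q)" for ps' x
  proof (induction ps')
    case (Cons p ps')
    then show ?case using 1[where p = p and qs' = qs and x = x] by (simp add: distrib_right)
  qed simp
  then have "\<forall>x. f x * g x = (\<Sum>r\<leftarrow>rs. fst r x * snd r)" using ps(2) qs(2) by (simp add: rs_def)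
  moreover have "\<forall>r\<in>set rs. fst r \<in> poly_fun A M" using ps(1) qs(1) by (auto simp: rs_def pr_def intro: poly_fun.poly_fun_mult)
  ultimately show ?case by (intro exI[of _ rs] conjI)
qed

section \<open>Equations at constant points\<close>

context sn_ext
begin

abbreviation "CC \<equiv> ord_diff_field_struct \<delta> C"

lemma dom_CC [simp]: "dom CC = C" by (simp add: ord_diff_field_struct_def)

lemma C01: "0 \<in> C" "1 \<in> C" "-1 \<in> C"
  using sring_0[OF sfield_imp_sring[OF C_sfield]] sring_1[OF sfield_imp_sring[OF C_sfield]]
    sring_neg[OF sfield_imp_sring[OF C_sfield]] by auto

lemma poly_fun_tfun:
  assumes "f \<in> poly_fun C M" shows "tfun ring_lang CC C f"
  using assms
proof induction
  case (poly_fun_add f g)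
  from tfun_2[OF poly_fun_add.IH, of Add] show ?case by (simp add: ord_diff_field_struct_def ring_lang_def)
next
  case (poly_fun_mult f g)
  from tfun_2[OF poly_fun_mult.IH, of Mul] show ?case by (simp add: ord_diff_field_struct_def ring_lang_def)
next
  case (poly_fun_const u)
  then show ?case by (rule tfun_const)
next
  case (poly_fun_var i)
  show ?case using C01 by (intro tfun_var) auto
qed

lemma poly_fun_C_mem: "f \<in> poly_fun C M \<Longrightarrow> range x \<subseteq> C \<Longrightarrow> f x \<in> C"
  by (induction rule: poly_fun.induct) (auto intro: sring_add[OF sfield_imp_sring[OF C_sfield]] sring_mult[OF sfield_imp_sring[OF C_sfield]])

lemma defbl_poly_fun_C: "f \<in> poly_fun C M \<Longrightarrow> defbl ring_lang CC C (\<lambda>x. f x = 0)"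
  by (rule defbl_eq[OF poly_fun_tfun tfun_const]) (use C01 in auto)

text \<open>A polynomial with coefficients in the big field vanishes at a constant point iff its finitely
  many components with respect to a basis over the constants do.\<close>

lemma defbl_poly_fun:
  assumes "f \<in> poly_fun UNIV M" shows "defbl ring_lang CC C (\<lambda>x. f x = 0)"
proof -
  obtain ps where ps: "\<forall>p\<in>set ps. fst p \<in> poly_fun C M" "\<forall>x. f x = (\<Sum>p\<leftarrow>ps. fst p x * snd p)"
    using poly_fun_expand[OF C01(2) assms] by (elim exE conjE)
  define k where "k = length ps"
  define P where "P j = fst (ps ! j)" for j
  define e where "e j = snd (ps ! j)" for j
  have P: "P j \<in> poly_fun C M" if "j < k" for j using ps(1) that by (simp add: P_def k_def)
  have fx: "f x = (\<Sum>j<k. P j x * e j)" for x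
    using ps(2) by (simp add: P_def e_def k_def sum_list_sum_nth atLeast0LessThan)
  obtain B \<kappa> where B: "finite B" "indep C B" "\<forall>j\<in>{..<k}. (\<forall>w\<in>B. \<kappa> j w \<in> C) \<and> e j = (\<Sum>w\<in>B. \<kappa> j w * w)"
    using basis_exists[OF C_sfield finite_lessThan, of e k] by (elim exE conjE)
  define g where "g w x = (\<Sum>j<k. P j x * \<kappa> j w)" for w x
  have g: "g w \<in> poly_fun C M" if "w \<in> B" for w unfolding g_def[abs_def]
    using P B(3) that by (intro poly_fun_sum C01 poly_fun_mult poly_fun_const) auto
  have fg: "f x = (\<Sum>w\<in>B. g w x * w)" for x
  proof -
    have "f x = (\<Sum>j<k. \<Sum>w\<in>B. P j x * \<kappa> j w * w)"
      unfolding fx using B(3) by (intro sum.cong refl) (simp add: sum_distrib_left mult.assoc)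
    also have "\<dots> = (\<Sum>w\<in>B. \<Sum>j<k. P j x * \<kappa> j w * w)" by (rule sum.swap)
    finally show ?thesis by (simp add: g_def sum_distrib_right)
  qed
  have "defbl ring_lang CC C (\<lambda>x. \<forall>w\<in>B. g w x = 0)"
    using C01 by (intro defbl_ball B(1) defbl_poly_fun_C[OF g]) auto
  then show ?thesis
  proof (rule defbl_cong)
    fix x :: "nat \<Rightarrow> 'u" assume x: "range x \<subseteq> dom CC"
    have gC: "g w x \<in> C" if "w \<in> B" for w using poly_fun_C_mem[OF g[OF that]] x by simp
    show "(\<forall>w\<in>B. g w x = 0) = (f x = 0)"
    proof
      assume "f x = 0"
      then have "(\<Sum>w\<in>B. g w x * w) = 0" using fg by simp
      then show "\<forall>w\<in>B. g w x = 0" using indepD[OF B(2), of "\<lambda>w. g w x"] gC by blast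
    qed (simp add: fg)
  qed
qed

lemma defbl_poly_fun_family:
  assumes G: "\<G> \<subseteq> poly_fun UNIV M" shows "defbl ring_lang CC C (\<lambda>x. \<forall>g\<in>\<G>. g x = 0)"
proof -
  obtain \<G>\<^sub>0 where G0: "finite \<G>\<^sub>0" "\<G>\<^sub>0 \<subseteq> \<G>" "\<forall>x. (\<forall>g\<in>\<G>\<^sub>0. g x = 0) \<longrightarrow> (\<forall>g\<in>\<G>. g x = 0)"
    using poly_fun_zeros_noetherian[OF G] by (elim exE conjE)
  have "defbl ring_lang CC C (\<lambda>x. \<forall>g\<in>\<G>\<^sub>0. g x = 0)"
    using C01 by (intro defbl_ball G0(1) defbl_poly_fun[of _ M]) (use G0(2) G in auto)
  then show ?thesis by (rule defbl_cong) (use G0(2,3) in blast)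
qed

text \<open>At a constant point the derivation acts on the coefficients only, so the result is again
  polynomial.\<close>

lemma poly_fun_der: "f \<in> poly_fun UNIV M \<Longrightarrow> \<exists>g\<in>poly_fun UNIV M. \<forall>x. range x \<subseteq> C \<longrightarrow> g x = \<delta> (f x)"
proof (induction rule: poly_fun.induct)
  case (poly_fun_const u)
  then show ?case by (intro bexI[of _ "\<lambda>_. \<delta> u"]) (simp_all add: poly_fun.poly_fun_const)
next
  case (poly_fun_var i)
  have "0 = \<delta> (x i)" if "range x \<subseteq> C" for x
  proof -
    have "x i \<in> C" using that by blast
    then show ?thesis by (simp add: C_der)
  qed
  then show ?case by (intro bexI[of _ "\<lambda>_. 0"]) (simp_all add: poly_fun.poly_fun_const)
next
  case (poly_fun_add f g)
  then obtain f' g' where "f' \<in> poly_fun UNIV M" "\<forall>x. range x \<subseteq> C \<longrightarrow> f' x = \<delta> (f x)" "g' \<in> poly_fun UNIV M" "\<forall>x. range x \<subseteq> C \<longrightarrow> g' x = \<delta> (g x)" by (elim bexE)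
  then show ?case by (intro bexI[of _ "\<lambda>x. f' x + g' x"]) (simp_all add: der_add poly_fun.poly_fun_add)
next
  case (poly_fun_mult f g)
  then obtain f' g' where "f' \<in> poly_fun UNIV M" "\<forall>x. range x \<subseteq> C \<longrightarrow> f' x = \<delta> (f x)" "g' \<in> poly_fun UNIV M" "\<forall>x. range x \<subseteq> C \<longrightarrow> g' x = \<delta> (g x)" by (elim bexE)
  then show ?case using poly_fun_mult.hyps by (intro bexI[of _ "\<lambda>x. f' x * g x + f x * g' x"]) (simp_all add: der_mult poly_fun.poly_fun_add poly_fun.poly_fun_mult)
qed

end

section \<open>The Galois group as a group of codes\<close>

lemma group_gal:
  fixes D :: "'a::field \<Rightarrow> 'a"
  assumes F: "diff_subfield D F" and EF: "E \<subseteq> F"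
  shows "group (gal D F E)"
proof -
  let ?G = "carrier (gal D F E)"
  have iff: "\<sigma> \<in> ?G \<longleftrightarrow> \<sigma> \<in> extensional F \<and> bij_betw \<sigma> F F \<and>
      (\<forall>x\<in>F. \<forall>y\<in>F. \<sigma> (x + y) = \<sigma> x + \<sigma> y \<and> \<sigma> (x * y) = \<sigma> x * \<sigma> y) \<and>
      (\<forall>x\<in>F. \<sigma> (D x) = D (\<sigma> x)) \<and> (\<forall>x\<in>E. \<sigma> x = x)" for \<sigma>
    by (simp add: gal_def)
  have cl: "x + y \<in> F" "x * y \<in> F" "D x \<in> F" if "x \<in> F" "y \<in> F" for x y
    using F that by (simp_all add: diff_subfield_def)
  have mem: "\<sigma> x \<in> F" if "\<sigma> \<in> ?G" "x \<in> F" for \<sigma> x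
    using that unfolding iff bij_betw_def by blast
  have mult: "\<sigma> \<otimes>\<^bsub>gal D F E\<^esub> \<tau> = compose F \<sigma> \<tau>" for \<sigma> \<tau> by (simp add: gal_def)
  have one: "\<one>\<^bsub>gal D F E\<^esub> = (\<lambda>x\<in>F. x)" by (simp add: gal_def)
  have closed: "compose F \<sigma> \<tau> \<in> ?G" if st: "\<sigma> \<in> ?G" "\<tau> \<in> ?G" for \<sigma> \<tau>
    unfolding iff
  proof (intro conjI ballI)
    show "compose F \<sigma> \<tau> \<in> extensional F" by (rule compose_extensional)
    show "bij_betw (compose F \<sigma> \<tau>) F F" using st unfolding iff by (intro bij_betw_compose) blast+
    fix x assume x: "x \<in> F"
    show "compose F \<sigma> \<tau> (D x) = D (compose F \<sigma> \<tau> x)"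
      using st x cl(3) mem[OF st(2) x] unfolding iff by (simp add: compose_eq)
    fix y assume y: "y \<in> F"
    show "compose F \<sigma> \<tau> (x + y) = compose F \<sigma> \<tau> x + compose F \<sigma> \<tau> y"
      "compose F \<sigma> \<tau> (x * y) = compose F \<sigma> \<tau> x * compose F \<sigma> \<tau> y"
      using st x y cl(1,2) mem[OF st(2) x] mem[OF st(2) y] unfolding iff by (simp_all add: compose_eq)
  next
    fix x assume "x \<in> E"
    then show "compose F \<sigma> \<tau> x = x" using st EF unfolding iff by (simp add: compose_eq subset_iff)
  qed
  have inv: "restrict (inv_into F \<sigma>) F \<in> ?G" if s: "\<sigma> \<in> ?G" for \<sigma>
  proof -
    let ?t = "restrict (inv_into F \<sigma>) F"
    note S = s[unfolded iff]
    have t: "?t (\<sigma> u) = u" if "u \<in> F" for u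
      using that S mem[OF s that] by (simp add: bij_betw_def inv_into_f_f)
    have ex: "\<exists>u\<in>F. x = \<sigma> u" if "x \<in> F" for x using S that unfolding bij_betw_def by blast
    show ?thesis unfolding iff
    proof (intro conjI ballI)
      show "?t \<in> extensional F" by (rule restrict_extensional)
      show "bij_betw ?t F F" unfolding bij_betw_restrict_eq using S by (intro bij_betw_inv_into) blast
      fix x assume "x \<in> F"
      then obtain u where u: "u \<in> F" "x = \<sigma> u" using ex by blast
      have "?t (D (\<sigma> u)) = ?t (\<sigma> (D u))" using S u by simp
      then show "?t (D x) = D (?t x)" unfolding u(2) t[OF u(1)] t[OF cl(3)[OF u(1) u(1)]] .
      fix y assume "y \<in> F"
      then obtain v where v: "v \<in> F" "y = \<sigma> v" using ex by blast
      have "?t (\<sigma> u + \<sigma> v) = ?t (\<sigma> (u + v))" "?t (\<sigma> u * \<sigma> v) = ?t (\<sigma> (u * v))" using S u v by simp_all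
      then show "?t (x + y) = ?t x + ?t y" "?t (x * y) = ?t x * ?t y"
        unfolding u(2) v(2) t[OF u(1)] t[OF v(1)] t[OF cl(1)[OF u(1) v(1)]] t[OF cl(2)[OF u(1) v(1)]] .
    next
      fix x assume x: "x \<in> E"
      then have "\<sigma> x = x" "x \<in> F" using S EF by blast+
      then show "?t x = x" using t[of x] by simp
    qed
  qed
  show ?thesis
  proof (rule groupI)
    fix \<sigma> \<tau> assume st: "\<sigma> \<in> ?G" "\<tau> \<in> ?G"
    show "\<sigma> \<otimes>\<^bsub>gal D F E\<^esub> \<tau> \<in> ?G" unfolding mult by (rule closed[OF st])
    fix \<rho> assume r: "\<rho> \<in> ?G"
    have "\<rho> \<in> F \<rightarrow> F" using mem[OF r] by blast
    from compose_assoc[OF this, of \<sigma> \<tau>] show "\<sigma> \<otimes>\<^bsub>gal D F E\<^esub> \<tau> \<otimes>\<^bsub>gal D F E\<^esub> \<rho> = \<sigma> \<otimes>\<^bsub>gal D F E\<^esub> (\<tau> \<otimes>\<^bsub>gal D F E\<^esub> \<rho>)"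
      unfolding mult by simp
  next
    show "\<one>\<^bsub>gal D F E\<^esub> \<in> ?G" unfolding one iff using cl EF by (auto simp: subset_iff bij_betw_def inj_on_def)
  next
    fix \<sigma> assume s: "\<sigma> \<in> ?G"
    have "\<sigma> \<in> F \<rightarrow> F" using mem[OF s] by blast
    moreover have "\<sigma> \<in> extensional F" using s unfolding iff by blast
    ultimately show "\<one>\<^bsub>gal D F E\<^esub> \<otimes>\<^bsub>gal D F E\<^esub> \<sigma> = \<sigma>" unfolding mult one by (rule Id_compose)
    have "compose F (restrict (inv_into F \<sigma>) F) \<sigma> = (\<lambda>x\<in>F. x)"
      using s unfolding iff by (intro compose_inv_into_id) blast
    then show "\<exists>\<tau>\<in>?G. \<tau> \<otimes>\<^bsub>gal D F E\<^esub> \<sigma> = \<one>\<^bsub>gal D F E\<^esub>" unfolding mult one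
      by (intro bexI[OF _ inv[OF s]])
  qed
qed

text \<open>By the quotient rule every operation on quotients with denominator \<open>q\<close>
  again has a power of \<open>q\<close> as denominator. The class \<open>\<R>\<close> is abstract
  because the lemma is applied both to differential polynomial functions and to polynomial functions
  of constant points; in the latter case derivatives are available on \<open>X\<close> only.\<close>

lemma (in diff_field) dpoly_rational_substitution:
  fixes \<R> :: "('x \<Rightarrow> 'a) set"
  assumes A: "sring A" and R: "\<And>u. u \<in> A \<Longrightarrow> (\<lambda>_. u) \<in> \<R>"
      "\<And>f g. f \<in> \<R> \<Longrightarrow> g \<in> \<R> \<Longrightarrow> (\<lambda>x. f x + g x) \<in> \<R>"
      "\<And>f g. f \<in> \<R> \<Longrightarrow> g \<in> \<R> \<Longrightarrow> (\<lambda>x. f x * g x) \<in> \<R>"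
    and der: "\<And>f. f \<in> \<R> \<Longrightarrow> \<exists>g\<in>\<R>. \<forall>x\<in>X. g x = \<delta> (f x)"
    and p: "\<And>i. i < m \<Longrightarrow> p i \<in> \<R>" and q: "q \<in> \<R>"
  shows "f \<in> dpoly A m \<Longrightarrow> \<exists>e. \<exists>r\<in>\<R>. \<forall>x\<in>X. q x \<noteq> 0 \<longrightarrow> f (\<lambda>i. p i x / q x) * q x ^ e = r x"
proof -
  have pow: "(\<lambda>x. q x ^ e) \<in> \<R>" for e
  proof (induction e)
    case 0
    show ?case using R(1)[OF sring_1[OF A]] by simp
  next
    case (Suc e)
    from R(3)[OF q this] show ?case by simp
  qed
  have neg: "(\<lambda>x. - f x) \<in> \<R>" if "f \<in> \<R>" for f
    using R(3)[OF R(1)[OF sring_neg[OF A sring_1[OF A]]] that] by simp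
  show "f \<in> dpoly A m \<Longrightarrow> \<exists>e. \<exists>r\<in>\<R>. \<forall>x\<in>X. q x \<noteq> 0 \<longrightarrow> f (\<lambda>i. p i x / q x) * q x ^ e = r x"
  proof (induction rule: dpoly.induct)
    case (const u)
    show ?case by (intro exI[of _ 0] bexI[OF _ R(1)[OF const]]) simp
  next
    case (var i)
    show ?case by (intro exI[of _ 1] bexI[OF _ p[OF var]]) simp
  next
    case (add f g)
    then obtain d r e s where r: "r \<in> \<R>" "\<forall>x\<in>X. q x \<noteq> 0 \<longrightarrow> f (\<lambda>i. p i x / q x) * q x ^ d = r x"
      and s: "s \<in> \<R>" "\<forall>x\<in>X. q x \<noteq> 0 \<longrightarrow> g (\<lambda>i. p i x / q x) * q x ^ e = s x" by (elim exE bexE)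
    have "(f (\<lambda>i. p i x / q x) + g (\<lambda>i. p i x / q x)) * q x ^ (d + e) = r x * q x ^ e + s x * q x ^ d"
      if "x \<in> X" "q x \<noteq> 0" for x
      unfolding r(2)[rule_format, OF that, symmetric] s(2)[rule_format, OF that, symmetric]
      by (simp add: algebra_simps power_add)
    then show ?case
      by (intro exI[of _ "d + e"] bexI[OF _ R(2)[OF R(3)[OF r(1) pow[of e]] R(3)[OF s(1) pow[of d]]]]) simp
  next
    case (mult f g)
    then obtain d r e s where r: "r \<in> \<R>" "\<forall>x\<in>X. q x \<noteq> 0 \<longrightarrow> f (\<lambda>i. p i x / q x) * q x ^ d = r x"
      and s: "s \<in> \<R>" "\<forall>x\<in>X. q x \<noteq> 0 \<longrightarrow> g (\<lambda>i. p i x / q x) * q x ^ e = s x" by (elim exE bexE)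
    have "(f (\<lambda>i. p i x / q x) * g (\<lambda>i. p i x / q x)) * q x ^ (d + e) = r x * s x"
      if "x \<in> X" "q x \<noteq> 0" for x
      unfolding r(2)[rule_format, OF that, symmetric] s(2)[rule_format, OF that, symmetric]
      by (simp add: algebra_simps power_add)
    then show ?case by (intro exI[of _ "d + e"] bexI[OF _ R(3)[OF r(1) s(1)]]) simp
  next
    case (neg f)
    then obtain d r where r: "r \<in> \<R>" "\<forall>x\<in>X. q x \<noteq> 0 \<longrightarrow> f (\<lambda>i. p i x / q x) * q x ^ d = r x" by (elim exE bexE)
    then show ?case by (intro exI[of _ d] bexI[OF _ \<open>\<And>f. f \<in> \<R> \<Longrightarrow> (\<lambda>x. - f x) \<in> \<R>\<close>[OF r(1)]]) simp
  next
    case (der f)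
    then obtain d r where r: "r \<in> \<R>" "\<forall>x\<in>X. q x \<noteq> 0 \<longrightarrow> f (\<lambda>i. p i x / q x) * q x ^ d = r x" by (elim exE bexE)
    obtain r' where r': "r' \<in> \<R>" "\<forall>x\<in>X. r' x = \<delta> (r x)"
      using \<open>\<And>f. f \<in> \<R> \<Longrightarrow> \<exists>g\<in>\<R>. \<forall>x\<in>X. g x = \<delta> (f x)\<close>[OF r(1)] by (elim bexE)
    obtain q' where q': "q' \<in> \<R>" "\<forall>x\<in>X. q' x = \<delta> (q x)"
      using \<open>\<And>f. f \<in> \<R> \<Longrightarrow> \<exists>g\<in>\<R>. \<forall>x\<in>X. g x = \<delta> (f x)\<close>[OF q] by (elim bexE)
    \<comment> \<open>The extra factor avoids the exponent \<open>d - 1\<close> and accounts for the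
      \<open>Suc d\<close> in the exponent of the derivative.\<close>
    have dq: "\<delta> (q x ^ d) * q x = of_nat d * q x ^ d * \<delta> (q x)" for x
      by (cases d) (simp_all add: der_1 der_power_Suc ac_simps del: power_Suc of_nat_Suc, simp add: ac_simps)
    have "\<delta> (f (\<lambda>i. p i x / q x)) * q x ^ Suc d = r' x * q x + - (of_nat d * (r x * q' x))"
      if x: "x \<in> X" "q x \<noteq> 0" for x
    proof -
      have eq: "f (\<lambda>i. p i x / q x) * q x ^ d = r x" using r(2) x by simp
      have "r' x = \<delta> (f (\<lambda>i. p i x / q x)) * q x ^ d + f (\<lambda>i. p i x / q x) * \<delta> (q x ^ d)"
        unfolding r'(2)[rule_format, OF x(1)] eq[symmetric] der_mult ..
      then have "r' x * q x = \<delta> (f (\<lambda>i. p i x / q x)) * q x ^ Suc d + f (\<lambda>i. p i x / q x) * (\<delta> (q x ^ d) * q x)"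
        by (simp add: algebra_simps)
      also have "f (\<lambda>i. p i x / q x) * (\<delta> (q x ^ d) * q x) = of_nat d * (r x * q' x)"
        unfolding dq eq[symmetric] using q'(2) x(1) by (simp add: ac_simps)
      finally show ?thesis by simp
    qed
    then show ?case
      by (intro exI[of _ "Suc d"] bexI[OF _ R(2)[OF R(3)[OF r'(1) q] \<open>\<And>f. f \<in> \<R> \<Longrightarrow> (\<lambda>x. - f x) \<in> \<R>\<close>[OF R(3)[OF R(1)[OF sring_of_nat[OF A, of d]] R(3)[OF r(1) q'(1)]]]]]) simp
  qed
qed

text \<open>The values \<open>n j a\<close> are linearly independent over the constants, and
  numerators and denominators of all conjugates lie in their span. The \<open>n j\<close> are
  functions, not elements, because composing automorphisms requires their values at the conjugates
  as well.\<close>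

locale coded = sn_ext \<delta> CODF K L for \<delta> :: "'u::linordered_field \<Rightarrow> 'u" and CODF and K L :: "'u set" +
  fixes m :: nat and a :: "nat \<Rightarrow> 'u" and N :: nat and n :: "nat \<Rightarrow> (nat \<Rightarrow> 'u) \<Rightarrow> 'u"
  assumes Fa: "F = dgen E m a" and n_dpoly: "\<forall>j. n j \<in> dpoly E m"
    and ind: "\<forall>\<kappa>. (\<forall>j. \<kappa> j \<in> C) \<longrightarrow> (\<Sum>j<N. \<kappa> j * n j a) = 0 \<longrightarrow> (\<forall>j<N. \<kappa> j = 0)"
    and cov: "\<forall>\<sigma>\<in>GG. \<exists>c. (\<forall>i j. c i j \<in> C) \<and> (\<Sum>j<N. c m j * n j a) \<noteq> 0 \<and>
      (\<forall>i<m. \<sigma> (a i) * (\<Sum>j<N. c m j * n j a) = (\<Sum>j<N. c i j * n j a))"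

context sn_ext
begin

lemma E01: "0 \<in> E" "1 \<in> E" using E_dsf by (auto simp: diff_subfield_def)

lemma F_eq_dgen:
  assumes La: "L = dgen K m a" shows "F = dgen E m a"
proof
  have "L \<subseteq> dgen E m a" unfolding La dgen_def by (rule diff_gen_mono) (use KE in blast)
  moreover have "C \<subseteq> dgen E m a" using CE dgen_const by blast
  ultimately show "F \<subseteq> dgen E m a" unfolding F_def by (intro diff_gen_least[OF dgen_diff_subfield]) blast
  have "a ` {..<m} \<subseteq> L" unfolding La using dgen_var by blast
  then show "dgen E m a \<subseteq> F" unfolding dgen_def using EF LF by (intro diff_gen_least[OF F_dsf]) blast
qed

text \<open>The finite set supplied by \<open>uniform_bound\<close> is replaced by a basis of its
  span over the constants. Independence will make the coefficients of a code unique up to a common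
  change of numerators and denominator.\<close>

lemma coded_exists:
  assumes La: "L = dgen K m a"
  shows "\<exists>N n. coded \<delta> CODF K L m a N n"
proof -
  note Cr = sfield_imp_sring[OF C_sfield]
  note Fa = F_eq_dgen[OF La]
  obtain V where V: "finite V" "V \<subseteq> L" "\<forall>\<sigma>\<in>GG. const_frac m V (\<lambda>i. \<sigma> (a i))" using uniform_bound[OF La] by (elim exE conjE)
  obtain B \<kappa> where B: "finite B" "B \<subseteq> (\<lambda>v. v) ` V" "indep C B"
    "\<forall>v\<in>V. (\<forall>e\<in>B. \<kappa> v e \<in> C) \<and> v = (\<Sum>e\<in>B. \<kappa> v e * e)"
    using basis_exists[OF C_sfield V(1), of "\<lambda>v. v"] by (elim exE conjE)
  define N where "N = card B"
  obtain h where h: "bij_betw h {..<N} B" using ex_bij_betw_nat_finite[OF B(1)] unfolding N_def atLeast0LessThan by blast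
  have hB: "h j \<in> B" if "j < N" for j using h that unfolding bij_betw_def by blast
  have "\<forall>j. \<exists>fg. fst fg \<in> dpoly E m \<and> snd fg \<in> dpoly E m \<and> snd fg a \<noteq> 0 \<and> (j < N \<longrightarrow> h j = fst fg a / snd fg a)"
  proof
    fix j
    show "\<exists>fg. fst fg \<in> dpoly E m \<and> snd fg \<in> dpoly E m \<and> snd fg a \<noteq> 0 \<and> (j < N \<longrightarrow> h j = fst fg a / snd fg a)"
    proof (cases "j < N")
      case True
      have "h j \<in> dgen E m a" using hB[OF True] B(2) V(2) LF Fa by blast
      then obtain f g where "f \<in> dpoly E m" "g \<in> dpoly E m" "g a \<noteq> 0" "h j = f a / g a" by (rule dgenE[OF E01])
      then show ?thesis by (intro exI[of _ "(f, g)"]) simp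
    next
      case False
      then show ?thesis using dpoly.const[OF E01(2), of m] by (intro exI[of _ "(\<lambda>_. 1, \<lambda>_. 1)"]) simp
    qed
  qed
  from choice[OF this] obtain fg where fg: "\<forall>j. fst (fg j) \<in> dpoly E m \<and> snd (fg j) \<in> dpoly E m \<and> snd (fg j) a \<noteq> 0 \<and>
    (j < N \<longrightarrow> h j = fst (fg j) a / snd (fg j) a)" ..
  define f where "f j = fst (fg j)" for j
  define g where "g j = snd (fg j)" for j
  have f: "f j \<in> dpoly E m" and g: "g j \<in> dpoly E m" "g j a \<noteq> 0" and hfg: "j < N \<Longrightarrow> h j = f j a / g j a" for j
    using fg by (simp_all add: f_def g_def)
  \<comment> \<open>Multiplying all basis elements by the common denominator \<open>G\<close> keeps
    them independent, cancels in quotients, and makes them values of differential polynomial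
    functions.\<close>
  define n where "n j y = f j y * (\<Prod>k\<in>{..<N} - {j}. g k y)" for j y
  define G where "G = (\<Prod>k<N. g k a)"
  have n: "n j \<in> dpoly E m" for j unfolding n_def[abs_def] by (intro dpoly.mult f dpoly_prod E01 g(1))
  have G0: "G \<noteq> 0" using g(2) by (simp add: G_def)
  have na: "n j a = h j * G" if "j < N" for j
  proof -
    have "G = g j a * (\<Prod>k\<in>{..<N} - {j}. g k a)" unfolding G_def using that by (intro prod.remove) auto
    then show ?thesis using g(2)[of j] hfg[OF that] by (simp add: n_def)
  qed
  have sum_n: "(\<Sum>j<N. \<gamma> j * n j a) = (\<Sum>j<N. \<gamma> j * h j) * G" for \<gamma>
    unfolding sum_distrib_right using na by (intro sum.cong refl) simp
  have "coded_axioms \<delta> K L m a N n"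
  proof (unfold_locales, rule Fa)
    show "\<forall>j. n j \<in> dpoly E m" using n by (rule allI)
    show "\<forall>\<gamma>. (\<forall>j. \<gamma> j \<in> C) \<longrightarrow> (\<Sum>j<N. \<gamma> j * n j a) = 0 \<longrightarrow> (\<forall>j<N. \<gamma> j = 0)"
    proof (intro allI impI)
      fix \<gamma> j assume c: "\<forall>j. \<gamma> j \<in> C" and 0: "(\<Sum>j<N. \<gamma> j * n j a) = 0" and j: "j < N"
      define k where "k e = \<gamma> (inv_into {..<N} h e)" for e
      have kh: "k (h j) = \<gamma> j" if "j < N" for j using h that by (simp add: k_def bij_betw_def inv_into_f_f)
      have "(\<Sum>e\<in>B. k e * e) = (\<Sum>j<N. k (h j) * h j)" by (rule sum.reindex_bij_betw[OF h, symmetric])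
      also have "\<dots> = (\<Sum>j<N. \<gamma> j * h j)" using kh by (intro sum.cong refl) simp
      also have "\<dots> = 0" using 0 G0 unfolding sum_n by simp
      finally have "k (h j) = 0" using c by (intro indepD[OF B(3), of k]) (simp_all add: k_def hB j)
      then show "\<gamma> j = 0" using kh[OF j] by simp
    qed
    show "\<forall>\<sigma>\<in>GG. \<exists>c. (\<forall>i j. c i j \<in> C) \<and> (\<Sum>j<N. c m j * n j a) \<noteq> 0 \<and>
      (\<forall>i<m. \<sigma> (a i) * (\<Sum>j<N. c m j * n j a) = (\<Sum>j<N. c i j * n j a))"
    proof
      fix \<sigma> assume "\<sigma> \<in> GG"
      then have "const_frac m V (\<lambda>i. \<sigma> (a i))" using V(3) by blast
      then obtain c where c: "\<forall>i. \<forall>v\<in>V. c i v \<in> C" "(\<Sum>v\<in>V. c m v * v) \<noteq> 0"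
         "\<forall>i<m. \<sigma> (a i) * (\<Sum>v\<in>V. c m v * v) = (\<Sum>v\<in>V. c i v * v)" unfolding const_frac_def by (elim exE conjE)
      define d where "d i j = (if j < N then \<Sum>v\<in>V. c i v * \<kappa> v (h j) else 0)" for i j
      have dC: "d i j \<in> C" for i j
        using c(1) B(4) hB by (auto simp: d_def intro!: sring_sum[OF Cr] sring_mult[OF Cr] sring_0[OF Cr])
      have dsum: "(\<Sum>j<N. d i j * n j a) = (\<Sum>v\<in>V. c i v * v) * G" for i
      proof -
        have "(\<Sum>j<N. d i j * h j) = (\<Sum>j<N. (\<Sum>v\<in>V. c i v * \<kappa> v (h j)) * h j)" by (intro sum.cong refl) (simp add: d_def)
        also have "\<dots> = (\<Sum>e\<in>B. (\<Sum>v\<in>V. c i v * \<kappa> v e) * e)"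
          by (rule sum.reindex_bij_betw[OF h, where g = "\<lambda>e. (\<Sum>v\<in>V. c i v * \<kappa> v e) * e"])
        also have "\<dots> = (\<Sum>v\<in>V. \<Sum>e\<in>B. c i v * \<kappa> v e * e)" unfolding sum_distrib_right by (rule sum.swap)
        also have "\<dots> = (\<Sum>v\<in>V. c i v * v)"
        proof (intro sum.cong refl)
          fix v assume "v \<in> V"
          then have "v = (\<Sum>e\<in>B. \<kappa> v e * e)" using B(4) by blast
          then have "c i v * v = c i v * (\<Sum>e\<in>B. \<kappa> v e * e)" by (rule arg_cong)
          then show "(\<Sum>e\<in>B. c i v * \<kappa> v e * e) = c i v * v" by (simp add: sum_distrib_left mult.assoc)
        qed
        finally show ?thesis unfolding sum_n by simp
      qed
      show "\<exists>c. (\<forall>i j. c i j \<in> C) \<and> (\<Sum>j<N. c m j * n j a) \<noteq> 0 \<and>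
        (\<forall>i<m. \<sigma> (a i) * (\<Sum>j<N. c m j * n j a) = (\<Sum>j<N. c i j * n j a))"
      proof (intro exI[of _ d] conjI allI impI dC)
        show "(\<Sum>j<N. d m j * n j a) \<noteq> 0" unfolding dsum using c(2) G0 by simp
        fix i assume "i < m"
        then show "\<sigma> (a i) * (\<Sum>j<N. d m j * n j a) = (\<Sum>j<N. d i j * n j a)"
          unfolding dsum mult.assoc[symmetric] using c(3) by simp
      qed
    qed
  qed
  from coded.intro[OF sn_ext_axioms this] show ?thesis by (intro exI)
qed

end

section \<open>Codes and the automorphisms they define\<close>

context coded
begin

text \<open>A code consists of \<open>m + 1\<close> blocks of \<open>N\<close> constants: the coefficients of \<open>m\<close> numerators, followed by
  those of their common denominator.\<close>

definition M where "M = Suc m * N"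
definition num where "num x i y = (\<Sum>j<N. x (i * N + j) * n j y)"
definition coded_tuple where "coded_tuple x i = (if i < m then num x i a else 0) / num x m a"
definition coding where "coding \<sigma> x \<longleftrightarrow> num x m a \<noteq> 0 \<and> (\<forall>i<m. \<sigma> (a i) * num x m a = num x i a)"
definition specializes where "specializes x \<longleftrightarrow> num x m a \<noteq> 0 \<and> (\<forall>f\<in>dpoly E m. f a = 0 \<longrightarrow> f (coded_tuple x) = 0)"
text \<open>Specializing \<open>a\<close> to the tuple coded by \<open>x\<close> gives a homomorphism; it is an automorphism of \<open>F\<close>
  because some other code gives its inverse.\<close>

definition inverse_codes where "inverse_codes x y \<longleftrightarrow> specializes x \<and> specializes y \<and> num y m (coded_tuple x) \<noteq> 0 \<and> num x m (coded_tuple y) \<noteq> 0 \<and>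
  (\<forall>i<m. num y i (coded_tuple x) = a i * num y m (coded_tuple x)) \<and> (\<forall>i<m. num x i (coded_tuple y) = a i * num x m (coded_tuple y))"
definition is_code where "is_code x \<longleftrightarrow> (\<exists>y. range y \<subseteq> C \<and> inverse_codes x y)"

lemma index_less: "i \<le> m \<Longrightarrow> j < N \<Longrightarrow> i * N + j < M"
proof -
  assume "i \<le> m" "j < N"
  then have "i * N + j < Suc i * N" "Suc i * N \<le> Suc m * N" by (simp, intro mult_right_mono) simp_all
  then show ?thesis unfolding M_def by (rule less_le_trans)
qed

text \<open>Codes are handled as infinite sequences of which only the first \<open>M\<close> entries
  matter. This congruence and those below justify passing between sequences, lists and blocks of a
  longer assignment.\<close>

lemma num_cong: "\<forall>k<M. x k = x' k \<Longrightarrow> i \<le> m \<Longrightarrow> num x i y = num x' i y"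
  unfolding num_def using index_less by (intro sum.cong refl) simp

lemma coded_tuple_cong: "\<forall>k<M. x k = x' k \<Longrightarrow> coded_tuple x = coded_tuple x'"
  unfolding coded_tuple_def[abs_def] using num_cong[of x x'] by (auto simp: fun_eq_iff)

lemma coding_cong: "\<forall>k<M. x k = x' k \<Longrightarrow> coding \<sigma> x = coding \<sigma> x'"
  unfolding coding_def using num_cong[of x x'] by simp

lemma specializes_cong: "\<forall>k<M. x k = x' k \<Longrightarrow> specializes x = specializes x'"
  unfolding specializes_def using num_cong[of x x'] coded_tuple_cong[of x x'] by simp

lemma inverse_codes_cong: "\<forall>k<M. x k = x' k \<Longrightarrow> \<forall>k<M. y k = y' k \<Longrightarrow> inverse_codes x y = inverse_codes x' y'"
  unfolding inverse_codes_def using num_cong[of x x'] coded_tuple_cong[of x x'] num_cong[of y y'] coded_tuple_cong[of y y'] specializes_cong[of x x'] specializes_cong[of y y'] by simp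

lemma is_code_cong: "\<forall>k<M. x k = x' k \<Longrightarrow> is_code x = is_code x'"
  unfolding is_code_def using inverse_codes_cong[of x x'] by metis

lemma num_dpoly: "range x \<subseteq> C \<Longrightarrow> num x i \<in> dpoly E m"
  unfolding num_def[abs_def] using n_dpoly CE by (intro dpoly_sum E01 dpoly.mult dpoly.const) auto

lemma dpoly_F: "f \<in> dpoly E m \<Longrightarrow> f a \<in> F" unfolding Fa by (rule dgen_dpoly)

lemma aF: "i < m \<Longrightarrow> a i \<in> F" unfolding Fa by (rule dgen_var)

lemma numF: "range x \<subseteq> C \<Longrightarrow> num x i a \<in> F" by (rule dpoly_F[OF num_dpoly])

lemma bbF: "range x \<subseteq> C \<Longrightarrow> coded_tuple x i \<in> F"
  unfolding coded_tuple_def using numF[of x] sring_0[OF diff_subfield_facts(2)[OF F_dsf]]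
  by (intro sfield_divide[OF diff_subfield_facts(1)[OF F_dsf]]) auto

lemma coding_coded_tuple: "coding \<sigma> x \<Longrightarrow> i < m \<Longrightarrow> \<sigma> (a i) = coded_tuple x i"
  unfolding coding_def coded_tuple_def by (simp add: nonzero_eq_divide_eq)

lemma coding_eval: "\<sigma> \<in> GG \<Longrightarrow> coding \<sigma> x \<Longrightarrow> f \<in> dpoly E m \<Longrightarrow> f (coded_tuple x) = \<sigma> (f a)"
  using GG_dpoly[of \<sigma> m a f] aF dpoly_cong[of f E m "coded_tuple x" "\<lambda>i. \<sigma> (a i)"] coding_coded_tuple[of \<sigma> x] by simp

lemma coding_exists:
  assumes "\<sigma> \<in> GG" shows "\<exists>x. range x \<subseteq> C \<and> coding \<sigma> x"
proof -
  obtain c where c: "\<forall>i j. c i j \<in> C" "(\<Sum>j<N. c m j * n j a) \<noteq> 0"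
    "\<forall>i<m. \<sigma> (a i) * (\<Sum>j<N. c m j * n j a) = (\<Sum>j<N. c i j * n j a)" using bspec[OF cov assms] by (elim exE conjE)
  define x where "x k = c (k div N) (k mod N)" for k
  have "num x i a = (\<Sum>j<N. c i j * n j a)" for i unfolding num_def x_def by (intro sum.cong refl) simp
  then have "coding \<sigma> x" unfolding coding_def using c(2,3) by simp
  moreover have "range x \<subseteq> C" using c(1) by (auto simp: x_def)
  ultimately show ?thesis by (intro exI[of _ x] conjI)
qed

lemma GG_group: "group (Gal \<delta> L K)"
  unfolding Gal_def by (rule group_gal) (use F_dsf EF in \<open>simp_all add: F_def E_def C_def\<close>)

lemma GG_mult: "\<sigma> \<otimes>\<^bsub>Gal \<delta> L K\<^esub> \<tau> = compose F \<sigma> \<tau>"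
  by (simp add: Gal_def gal_def F_def C_def)

lemma GG_one: "\<one>\<^bsub>Gal \<delta> L K\<^esub> = (\<lambda>x\<in>F. x)"
  by (simp add: Gal_def gal_def F_def C_def)

lemma GG_inverse:
  assumes s: "\<sigma> \<in> GG" shows "\<exists>\<tau>\<in>GG. \<forall>z\<in>F. \<sigma> (\<tau> z) = z \<and> \<tau> (\<sigma> z) = z"
proof -
  interpret group "Gal \<delta> L K" by (rule GG_group)
  let ?t = "m_inv (Gal \<delta> L K) \<sigma>"
  have c: "compose F \<sigma> ?t = (\<lambda>x\<in>F. x)" "compose F ?t \<sigma> = (\<lambda>x\<in>F. x)"
    using r_inv[OF s] l_inv[OF s] unfolding GG_mult GG_one by simp_all
  have "\<sigma> (?t z) = z \<and> ?t (\<sigma> z) = z" if "z \<in> F" for z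
    using fun_cong[OF c(1), of z] fun_cong[OF c(2), of z] that by (simp add: compose_eq)
  then show ?thesis by (intro bexI[OF _ inv_closed[OF s]] ballI)
qed

lemma coding_specializes: "\<sigma> \<in> GG \<Longrightarrow> coding \<sigma> x \<Longrightarrow> specializes x"
proof -
  assume s: "\<sigma> \<in> GG" "coding \<sigma> x"
  have "f (coded_tuple x) = 0" if "f \<in> dpoly E m" "f a = 0" for f
    unfolding coding_eval[OF s that(1)] that(2) using GG_zero_iff[OF s(1)] dpoly_F[OF that(1)] that(2) by simp
  then show "specializes x" unfolding specializes_def using s(2) by (simp add: coding_def)
qed

lemma coding_compose:
  assumes s: "\<sigma> \<in> GG" "coding \<sigma> x" and t: "\<tau> \<in> GG" "coding \<tau> y" "range y \<subseteq> C"
  shows "num y m (coded_tuple x) \<noteq> 0" "i < m \<Longrightarrow> num y i (coded_tuple x) = \<sigma> (\<tau> (a i)) * num y m (coded_tuple x)"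
proof -
  show "num y m (coded_tuple x) \<noteq> 0" unfolding coding_eval[OF s num_dpoly[OF t(3)]]
    using GG_zero_iff[OF s(1) numF[OF t(3)]] t(2) by (simp add: coding_def)
  assume i: "i < m"
  then have "\<sigma> (num y i a) = \<sigma> (\<tau> (a i) * num y m a)" using t(2) by (simp add: coding_def)
  also have "\<dots> = \<sigma> (\<tau> (a i)) * \<sigma> (num y m a)" using s(1) GG_mem[OF t(1) aF[OF i]] numF[OF t(3)] unfolding GG_iff by blast
  finally show "num y i (coded_tuple x) = \<sigma> (\<tau> (a i)) * num y m (coded_tuple x)" unfolding coding_eval[OF s num_dpoly[OF t(3)]] .
qed

text \<open>Replaces the quantifier over automorphisms by one over tuples of constants, as needed
  for definability. In the nontrivial direction the second code supplies both the injectivity and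
  the surjectivity of the specialisation.\<close>

lemma is_code_coding:
  assumes x: "range x \<subseteq> C" shows "is_code x \<longleftrightarrow> (\<exists>\<sigma>\<in>GG. coding \<sigma> x)"
proof
  assume "\<exists>\<sigma>\<in>GG. coding \<sigma> x"
  then obtain \<sigma> where s: "\<sigma> \<in> GG" "coding \<sigma> x" by (elim bexE)
  obtain \<tau> where t: "\<tau> \<in> GG" "\<forall>z\<in>F. \<sigma> (\<tau> z) = z \<and> \<tau> (\<sigma> z) = z" using GG_inverse[OF s(1)] by (elim bexE)
  obtain y where y: "range y \<subseteq> C" "coding \<tau> y" using coding_exists[OF t(1)] by (elim exE conjE)
  have "inverse_codes x y" unfolding inverse_codes_def
    using coding_specializes[OF s] coding_specializes[OF t(1) y(2)] coding_compose[OF s t(1) y(2,1)] coding_compose[OF t(1) y(2) s x] t(2) aF by simp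
  then show "is_code x" unfolding is_code_def using y(1) by (intro exI[of _ y] conjI)
next
  assume "is_code x"
  then obtain y where y: "range y \<subseteq> C" "inverse_codes x y" unfolding is_code_def by (elim exE conjE)
  have Hx: "num x m a \<noteq> 0" "\<forall>f\<in>dpoly E m. f a = 0 \<longrightarrow> f (coded_tuple x) = 0"
    and Hy: "num y m a \<noteq> 0" "\<forall>f\<in>dpoly E m. f a = 0 \<longrightarrow> f (coded_tuple y) = 0" using y(2) by (simp_all add: inverse_codes_def specializes_def)
  have yx: "num y m (coded_tuple x) \<noteq> 0" "\<And>i. i < m \<Longrightarrow> num y i (coded_tuple x) = a i * num y m (coded_tuple x)"
    and xy: "num x m (coded_tuple y) \<noteq> 0" "\<And>i. i < m \<Longrightarrow> num x i (coded_tuple y) = a i * num x m (coded_tuple y)" using y(2) by (simp_all add: inverse_codes_def)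
  have eq: "\<forall>f\<in>dpoly E m. f a = 0 \<longleftrightarrow> f (coded_tuple x) = 0"
  proof
    fix f assume f: "f \<in> dpoly E m"
    define p where "p i z = (if i < m then num x i z else 0)" for i z
    have "\<exists>e. \<exists>r\<in>dpoly E m. \<forall>z\<in>UNIV. num x m z \<noteq> 0 \<longrightarrow> f (\<lambda>i. p i z / num x m z) * num x m z ^ e = r z"
    proof (rule dpoly_rational_substitution[OF _ _ _ _ _ _ _ f])
      show "sring E" by (rule diff_subfield_facts(2)[OF E_dsf])
      show "p i \<in> dpoly E m" for i unfolding p_def[abs_def] using num_dpoly[OF x, of i] dpoly.const[OF E01(1)] by (cases "i < m") simp_all
      show "num x m \<in> dpoly E m" by (rule num_dpoly[OF x])
      show "\<exists>g\<in>dpoly E m. \<forall>z\<in>UNIV. g z = \<delta> (f z)" if "f \<in> dpoly E m" for f by (intro bexI[OF _ dpoly.der[OF that]]) simp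
    qed (rule dpoly.const dpoly.add dpoly.mult; assumption)+
    then obtain e r where r: "r \<in> dpoly E m" "\<forall>z. num x m z \<noteq> 0 \<longrightarrow> f (\<lambda>i. p i z / num x m z) * num x m z ^ e = r z"
      by (elim exE bexE) simp
    show "f a = 0 \<longleftrightarrow> f (coded_tuple x) = 0"
    proof
      \<comment> \<open>Clearing denominators turns this into \<open>r a = 0\<close>. Hence
        \<open>r\<close> also vanishes at \<open>coded_tuple y\<close>, where the quotients
        substituted into \<open>f\<close> are the \<open>a i\<close> themselves; so
        \<open>f a = 0\<close>.\<close>
      assume 0: "f (coded_tuple x) = 0"
      have "(\<lambda>i. p i a / num x m a) = coded_tuple x" by (simp add: p_def coded_tuple_def fun_eq_iff)
      then have "r a = 0" using r(2)[rule_format, OF Hx(1)] 0 by simp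
      then have "r (coded_tuple y) = 0" using Hy(2) r(1) by blast
      then have "f (\<lambda>i. p i (coded_tuple y) / num x m (coded_tuple y)) = 0" using r(2)[rule_format, OF xy(1)] xy(1) by simp
      moreover have "f (\<lambda>i. p i (coded_tuple y) / num x m (coded_tuple y)) = f a" using xy by (intro dpoly_cong[OF f]) (simp add: p_def)
      ultimately show "f a = 0" by simp
    qed (use Hx(2) f in blast)
  qed
  have Fb: "dgen E m (coded_tuple x) = F"
  proof
    show "dgen E m (coded_tuple x) \<subseteq> F" unfolding dgen_def
      by (rule diff_gen_least[OF F_dsf]) (use EF bbF[OF x] in blast)
    \<comment> \<open>The second code recovers the generators from the specialised tuple, so the
      image is all of \<open>F\<close>.\<close>
    have "a i \<in> dgen E m (coded_tuple x)" if "i < m" for i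
    proof -
      have "a i = num y i (coded_tuple x) / num y m (coded_tuple x)" using yx that by simp
      then show ?thesis using dgenI[OF num_dpoly[OF y(1), of i] num_dpoly[OF y(1), of m], where x = "coded_tuple x"] by simp
    qed
    then show "F \<subseteq> dgen E m (coded_tuple x)" unfolding Fa dgen_def[of E m a]
      by (intro diff_gen_least[OF dgen_diff_subfield]) (use dgen_const in blast)
  qed
  obtain s where s: "bij_betw s F F" "\<forall>x\<in>F. \<forall>y\<in>F. s (x + y) = s x + s y \<and> s (x * y) = s x * s y"
    "\<forall>x\<in>F. s (\<delta> x) = \<delta> (s x)" "\<forall>x\<in>E. s x = x" "\<forall>i<m. s (a i) = coded_tuple x i"
    using dgen_iso[OF E01 eq] unfolding Fb Fa[symmetric] by (elim exE conjE)
  note Fr = diff_subfield_facts[OF F_dsf]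
  have "restrict s F \<in> GG" unfolding GG_iff bij_betw_restrict_eq
    using s EF sring_add[OF Fr(2)] sring_mult[OF Fr(2)] Fr(3) by (auto simp: subset_iff)
  moreover have "coding (restrict s F) x" unfolding coding_def using s(5) Hx(1) aF by (simp add: coded_tuple_def)
  ultimately show "\<exists>\<sigma>\<in>GG. coding \<sigma> x" by (intro bexI)
qed

lemma GG_eqI:
  assumes s: "\<sigma> \<in> GG" and t: "\<tau> \<in> GG" and eq: "\<forall>i<m. \<sigma> (a i) = \<tau> (a i)"
  shows "\<sigma> = \<tau>"
proof (rule extensionalityI[of _ F])
  show "\<sigma> \<in> extensional F" "\<tau> \<in> extensional F" using s t unfolding GG_iff by blast+
  fix z assume z: "z \<in> F"
  then have "z \<in> dgen E m a" using Fa by simp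
  then obtain f g where fg: "f \<in> dpoly E m" "g \<in> dpoly E m" "g a \<noteq> 0" "z = f a / g a" by (rule dgenE[OF E01])
  have e: "\<sigma> (h a) = \<tau> (h a)" if "h \<in> dpoly E m" for h
  proof -
    have "\<sigma> (h a) = h (\<lambda>i. \<sigma> (a i))" by (rule GG_dpoly[OF s _ that]) (rule aF)
    also have "\<dots> = h (\<lambda>i. \<tau> (a i))" using eq by (intro dpoly_cong[OF that]) simp
    also have "\<dots> = \<tau> (h a)" by (rule GG_dpoly[OF t _ that, symmetric]) (rule aF)
    finally show ?thesis .
  qed
  have zg: "z * g a = f a" using fg by simp
  have "\<sigma> z * \<sigma> (g a) = \<sigma> (f a)" "\<tau> z * \<tau> (g a) = \<tau> (f a)"
    using s t z dpoly_F[OF fg(2)] unfolding GG_iff zg[symmetric] by simp_all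
  then have "\<sigma> z * \<tau> (g a) = \<tau> z * \<tau> (g a)" using e[OF fg(1)] e[OF fg(2)] by simp
  moreover have "\<tau> (g a) \<noteq> 0" using GG_zero_iff[OF t dpoly_F[OF fg(2)]] fg(3) by simp
  ultimately show "\<sigma> z = \<tau> z" by simp
qed

text \<open>Equality of the coded tuples in cross-multiplied form, polynomial in both codes; the
  first code is meant to have a nonzero denominator already.\<close>

definition same where "same x y \<longleftrightarrow> num y m a \<noteq> 0 \<and> (\<forall>i<m. num x i a * num y m a = num y i a * num x m a)"

text \<open>Among all codes of an automorphism, the canonical one has the longest possible block of
  leading zeros, followed by a 1; it is unique because the difference of two such codes would
  have more leading zeros.\<close>

definition canonical where "canonical x \<longleftrightarrow> is_code x \<and> (\<exists>l<M. (\<forall>i<l. x i = 0) \<and> x l = 1 \<and> \<not> (\<exists>y. range y \<subseteq> C \<and> same x y \<and> (\<forall>i<Suc l. y i = 0)))"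

lemma same_cong: "\<forall>k<M. x k = x' k \<Longrightarrow> \<forall>k<M. y k = y' k \<Longrightarrow> same x y = same x' y'"
  unfolding same_def using num_cong[of x x'] num_cong[of y y'] by simp

lemma canonical_cong:
  assumes "\<forall>k<M. x k = x' k" shows "canonical x = canonical x'"
proof -
  have "same x y = same x' y" for y using same_cong[OF assms] by simp
  then show ?thesis unfolding canonical_def is_code_cong[OF assms] using assms by (intro conj_cong refl ex_cong1) auto
qed

lemma coding_same: "coding \<sigma> x \<Longrightarrow> coding \<sigma> y \<longleftrightarrow> same x y"
proof -
  assume x: "coding \<sigma> x"
  have "\<sigma> (a i) * num y m a = num y i a \<longleftrightarrow> num x i a * num y m a = num y i a * num x m a" if "i < m" for i
  proof -
    have "num x m a \<noteq> 0" "num x i a = \<sigma> (a i) * num x m a" using x that unfolding coding_def by simp_all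
    then show ?thesis unfolding mult.assoc mult.commute[of "num x m a"] unfolding mult.assoc[symmetric] by simp
  qed
  then show ?thesis unfolding coding_def same_def by simp
qed

lemma num_scale: "num (\<lambda>k. c * x k) i y = c * num x i y"
  unfolding num_def sum_distrib_left by (simp add: mult.assoc)

lemma num_diff: "num (\<lambda>k. x k - x' k) i y = num x i y - num x' i y"
  unfolding num_def sum_subtractf[symmetric] by (simp add: left_diff_distrib)

text \<open>This is where independence of the \<open>n j a\<close> over the constants enters: a
  block of constants is determined by its combination.\<close>

lemma num_zero:
  assumes x: "range x \<subseteq> C" and 0: "\<forall>i\<le>m. num x i a = 0" shows "\<forall>k<M. x k = 0"
proof (intro allI impI)
  fix k assume k: "k < M"
  then have N: "0 < N" unfolding M_def by (cases "N = 0") simp_all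
  have "k div N < Suc m" using k by (simp add: M_def less_mult_imp_div_less)
  then have 1: "num x (k div N) a = 0" using 0 by simp
  have 2: "\<forall>j. x (k div N * N + j) \<in> C" using x by blast
  have "\<forall>j<N. x (k div N * N + j) = 0"
    by (rule mp[OF mp[OF spec[OF ind, of "\<lambda>j. x (k div N * N + j)"] 2] 1[unfolded num_def]])
  then have "x (k div N * N + k mod N) = 0" using mod_less_divisor[OF N] by blast
  then show "x k = 0" by simp
qed

lemma canonical_unique:
  assumes x: "range x \<subseteq> C" "coding \<sigma> x" "canonical x" and y: "range y \<subseteq> C" "coding \<sigma> y" "canonical y"
  shows "\<forall>k<M. x k = y k"
proof -
  obtain l where l: "l < M" "\<forall>i<l. x i = 0" "x l = 1" "\<not> (\<exists>z. range z \<subseteq> C \<and> same x z \<and> (\<forall>i<Suc l. z i = 0))"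
    using x(3) unfolding canonical_def by (elim exE conjE)
  obtain l' where l': "l' < M" "\<forall>i<l'. y i = 0" "y l' = 1" "\<not> (\<exists>z. range z \<subseteq> C \<and> same y z \<and> (\<forall>i<Suc l'. z i = 0))"
    using y(3) unfolding canonical_def by (elim exE conjE)
  have xy: "same x y" "same y x" using coding_same[OF x(2)] coding_same[OF y(2)] x(2) y(2) by simp_all
  have "\<not> l < l'"
  proof
    assume "l < l'"
    then have "\<forall>i<Suc l. y i = 0" using l'(2) by simp
    then show False using l(4) y(1) xy(1) by (elim notE, intro exI[of _ y] conjI)
  qed
  moreover have "\<not> l' < l"
  proof
    assume "l' < l"
    then have "\<forall>i<Suc l'. x i = 0" using l(2) by simp
    then show False using l'(4) x(1) xy(2) by (elim notE, intro exI[of _ x] conjI)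
  qed
  ultimately have ll: "l = l'" by simp
  define z where "z k = x k - y k" for k
  have zC: "range z \<subseteq> C" using x(1) y(1) by (auto simp: z_def intro!: sring_diff[OF sfield_imp_sring[OF C_sfield]])
  have zl: "\<forall>i<Suc l. z i = 0" using l(2,3) l'(2,3) ll by (simp add: z_def less_Suc_eq)
  have nz: "num z i a = num x i a - num y i a" for i unfolding z_def by (rule num_diff)
  have za: "\<forall>i<m. \<sigma> (a i) * num z m a = num z i a" using x(2) y(2) unfolding nz coding_def by (simp add: right_diff_distrib)
  \<comment> \<open>The conditions on a code are linear apart from the nonvanishing denominator. A
    difference of two codes with nonzero denominator would thus be a code of the same automorphism
    with one more leading zero. So its denominator vanishes, then its numerators do, and the
    difference is zero.\<close>
  have z0: "num z m a = 0"
  proof (rule ccontr)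
    assume "num z m a \<noteq> 0"
    then have "coding \<sigma> z" unfolding coding_def using za by simp
    then have "same x z" using coding_same[OF x(2)] by simp
    then show False using l(4) zC zl by (elim notE, intro exI[of _ z] conjI)
  qed
  have "\<forall>i\<le>m. num z i a = 0"
  proof (intro allI impI)
    fix i assume "i \<le> m"
    then show "num z i a = 0" using z0 za by (cases "i = m") auto
  qed
  from num_zero[OF zC this] show ?thesis by (simp add: z_def)
qed

lemma canonical_exists:
  assumes s: "\<sigma> \<in> GG" shows "\<exists>x. range x \<subseteq> C \<and> coding \<sigma> x \<and> canonical x"
proof -
  \<comment> \<open>The number of leading zeros is bounded by \<open>M\<close>, because a code whose
    first \<open>M\<close> entries vanish would have denominator 0; a maximal number therefore
    exists.\<close>
  define Q where "Q l \<longleftrightarrow> (\<exists>x. range x \<subseteq> C \<and> coding \<sigma> x \<and> (\<forall>i<l. x i = 0))" for l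
  have "Q 0" unfolding Q_def using coding_exists[OF s] by simp
  have bound: "l \<le> M" if "Q l" for l
  proof (rule ccontr)
    assume "\<not> l \<le> M"
    with that have "Q l" "\<not> l \<le> M" .
    then obtain x where x: "coding \<sigma> x" "\<forall>i<l. x i = 0" unfolding Q_def by (elim exE conjE)
    have "num x m a = num (\<lambda>_. 0) m a" using x(2) \<open>\<not> l \<le> M\<close> by (intro num_cong) auto
    then show False using x(1) by (simp add: coding_def num_def)
  qed
  define l where "l = (GREATEST l. Q l)"
  have Ql: "Q l" unfolding l_def by (rule GreatestI_nat[where P = Q, OF \<open>Q 0\<close>]) (rule bound)
  have nQ: "\<not> Q (Suc l)"
  proof
    assume "Q (Suc l)"
    then have "Suc l \<le> (GREATEST l. Q l)" by (rule Greatest_le_nat[where P = Q]) (rule bound)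
    then show False unfolding l_def by simp
  qed
  obtain x where x: "range x \<subseteq> C" "coding \<sigma> x" "\<forall>i<l. x i = 0" using Ql unfolding Q_def by (elim exE conjE)
  have xl: "x l \<noteq> 0"
  proof
    assume "x l = 0"
    then have "\<forall>i<Suc l. x i = 0" using x(3) by (simp add: less_Suc_eq)
    then show False using nQ x(1,2) unfolding Q_def by (elim notE, intro exI[of _ x] conjI)
  qed
  have lM: "l < M"
  proof (rule ccontr)
    assume "\<not> l < M"
    then have "num x m a = num (\<lambda>_. 0) m a" using x(3) by (intro num_cong) auto
    then show False using x(2) by (simp add: coding_def num_def)
  qed
  \<comment> \<open>Scaling numerators and denominator together does not change the coded tuple, so
    the first nonzero entry can be made 1.\<close>
  define y where "y k = inverse (x l) * x k" for k
  have nz: "num y i a = inverse (x l) * num x i a" for i unfolding y_def by (rule num_scale)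
  have yC: "range y \<subseteq> C" using x(1) by (auto simp: y_def intro!: sring_mult[OF sfield_imp_sring[OF C_sfield]] sfield_inv[OF C_sfield])
  have cy: "coding \<sigma> y" unfolding coding_def nz using x(2) xl by (simp add: coding_def)
  have "\<not> (\<exists>z. range z \<subseteq> C \<and> same y z \<and> (\<forall>i<Suc l. z i = 0))"
    using nQ unfolding Q_def coding_same[OF cy, symmetric] .
  moreover have "is_code y" using is_code_coding[OF yC] s cy by blast
  ultimately have "canonical y" unfolding canonical_def using lM x(3) xl by (intro conjI exI[of _ l]) (simp_all add: y_def)
  then show ?thesis using yC cy by (intro exI[of _ y] conjI)
qed

end

section \<open>Definability of codes and of their composition\<close>

context coded
begin

lemma num_poly_fun:
  assumes "i \<le> m" "d + M \<le> M'" shows "(\<lambda>w. num (\<lambda>k. w (d + k)) i y) \<in> poly_fun UNIV M'"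
proof -
  have "(\<lambda>x. num x i y) \<in> poly_fun UNIV M" unfolding num_def
    using index_less[OF assms(1)] by (intro poly_fun_sum poly_fun.poly_fun_mult poly_fun.poly_fun_var poly_fun.poly_fun_const) simp_all
  from poly_fun_shift[OF this assms(2)] show ?thesis .
qed

lemma poly_fun_substitution:
  assumes f: "f \<in> dpoly E m"
  shows "\<exists>e. \<exists>r\<in>poly_fun UNIV M. \<forall>x. range x \<subseteq> C \<longrightarrow> num x m a \<noteq> 0 \<longrightarrow> f (coded_tuple x) * num x m a ^ e = r x"
proof -
  define p where "p i x = (if i < m then num x i a else 0)" for i x
  have "\<exists>e. \<exists>r\<in>poly_fun UNIV M. \<forall>x\<in>{x. range x \<subseteq> C}. num x m a \<noteq> 0 \<longrightarrow> f (\<lambda>i. p i x / num x m a) * num x m a ^ e = r x"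
  proof (rule dpoly_rational_substitution[OF _ _ _ _ _ _ _ f, where q = "\<lambda>x. num x m a"])
    show "sring E" by (rule diff_subfield_facts(2)[OF E_dsf])
    show "p i \<in> poly_fun UNIV M" for i
      unfolding p_def[abs_def] using num_poly_fun[of i 0 M a] poly_fun.poly_fun_const[of 0 UNIV M] by (cases "i < m") simp_all
    show "(\<lambda>x. num x m a) \<in> poly_fun UNIV M" using num_poly_fun[of m 0 M a] by simp
    show "\<exists>g\<in>poly_fun UNIV M. \<forall>x\<in>{x. range x \<subseteq> C}. g x = \<delta> (f x)" if "f \<in> poly_fun UNIV M" for f
      using poly_fun_der[OF that] by simp
  qed (rule poly_fun.poly_fun_const poly_fun.poly_fun_add poly_fun.poly_fun_mult, simp_all)+
  moreover have "(\<lambda>i. p i x / num x m a) = coded_tuple x" for x by (simp add: p_def coded_tuple_def fun_eq_iff)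
  ultimately show ?thesis by simp
qed

text \<open>The value is linear in \<open>y\<close> and rational in \<open>x\<close>, with a power
  of \<open>num x m a\<close> as denominator. The exponent is the sum of those needed for the single
  \<open>n j\<close>, hence common to all blocks \<open>i\<close>, so that equations between two
  such values can be cleared uniformly. The offsets place both codes in one assignment.\<close>

lemma composition_poly_fun:
  "\<exists>e NN. (\<forall>i x y. range x \<subseteq> C \<longrightarrow> num x m a \<noteq> 0 \<longrightarrow> num y i (coded_tuple x) * num x m a ^ e = NN i x y) \<and>
     (\<forall>i d d' M'. i \<le> m \<longrightarrow> d + M \<le> M' \<longrightarrow> d' + M \<le> M' \<longrightarrow> (\<lambda>w. NN i (\<lambda>k. w (d + k)) (\<lambda>k. w (d' + k))) \<in> poly_fun UNIV M')"
proof -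
  have "\<forall>j. \<exists>er. snd er \<in> poly_fun UNIV M \<and> (\<forall>x. range x \<subseteq> C \<longrightarrow> num x m a \<noteq> 0 \<longrightarrow> n j (coded_tuple x) * num x m a ^ fst er = snd er x)"
  proof
    fix j
    obtain e r where "r \<in> poly_fun UNIV M" "\<forall>x. range x \<subseteq> C \<longrightarrow> num x m a \<noteq> 0 \<longrightarrow> n j (coded_tuple x) * num x m a ^ e = r x"
      using poly_fun_substitution[OF spec[OF n_dpoly, of j]] by (elim exE bexE)
    then show "\<exists>er. snd er \<in> poly_fun UNIV M \<and> (\<forall>x. range x \<subseteq> C \<longrightarrow> num x m a \<noteq> 0 \<longrightarrow> n j (coded_tuple x) * num x m a ^ fst er = snd er x)"
      by (intro exI[of _ "(e, r)"]) simp
  qed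
  from choice[OF this] obtain er where er: "\<forall>j. snd (er j) \<in> poly_fun UNIV M \<and>
     (\<forall>x. range x \<subseteq> C \<longrightarrow> num x m a \<noteq> 0 \<longrightarrow> n j (coded_tuple x) * num x m a ^ fst (er j) = snd (er j) x)" ..
  define e where "e = (\<Sum>j<N. fst (er j))"
  define r where "r j x = snd (er j) x * num x m a ^ (e - fst (er j))" for j x
  define NN where "NN i x y = (\<Sum>j<N. y (i * N + j) * r j x)" for i x y
  have r: "n j (coded_tuple x) * num x m a ^ e = r j x" if "range x \<subseteq> C" "num x m a \<noteq> 0" "j < N" for j x
  proof -
    have "fst (er j) \<le> e" unfolding e_def using that(3) by (intro member_le_sum) simp_all
    then have "num x m a ^ e = num x m a ^ fst (er j) * num x m a ^ (e - fst (er j))" by (simp flip: power_add)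
    moreover have "n j (coded_tuple x) * num x m a ^ fst (er j) = snd (er j) x" using er that by simp
    ultimately show ?thesis unfolding r_def by (simp add: mult.assoc[symmetric])
  qed
  have rPF: "(\<lambda>w. r j (\<lambda>k. w (d + k))) \<in> poly_fun UNIV M'" if "d + M \<le> M'" for j d M'
    unfolding r_def using er that by (intro poly_fun.poly_fun_mult poly_fun_power poly_fun_shift[of _ UNIV M] num_poly_fun) simp_all
  show ?thesis
  proof (intro exI[of _ e] exI[of _ NN] conjI allI impI)
    fix i and x y :: "nat \<Rightarrow> 'u" assume x: "range x \<subseteq> C" "num x m a \<noteq> 0"
    show "num y i (coded_tuple x) * num x m a ^ e = NN i x y"
      unfolding num_def[of y] NN_def sum_distrib_right using r[OF x]
      by (intro sum.cong refl) (simp add: mult.assoc)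
  next
    fix i d d' M' assume "i \<le> m" "d + M \<le> M'" "d' + M \<le> M'"
    then show "(\<lambda>w. NN i (\<lambda>k. w (d + k)) (\<lambda>k. w (d' + k))) \<in> poly_fun UNIV M'"
      unfolding NN_def using index_less[of i]
      by (intro poly_fun_sum poly_fun.poly_fun_mult rPF poly_fun.poly_fun_var) (simp, force simp: less_le_trans[of _ "d' + M"], simp)
  qed
qed

text \<open>The factors \<open>p\<close> and \<open>q\<close> let one shape of equation serve for
  inverse codes, for nonvanishing, and for products. The condition on the denominator belongs to the
  statement because clearing it is an equivalence only where it is nonzero.\<close>

lemma defbl_composition:
  assumes ik: "i \<le> m" "k \<le> m" and d: "d + M \<le> M'" "d' + M \<le> M'" and pq: "p \<in> poly_fun UNIV M'" "q \<in> poly_fun UNIV M'"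
  shows "defbl ring_lang CC C (\<lambda>w. num (\<lambda>k. w (d + k)) m a \<noteq> 0 \<and>
    num (\<lambda>k. w (d' + k)) i (coded_tuple (\<lambda>k. w (d + k))) * p w = q w * num (\<lambda>k. w (d' + k)) k (coded_tuple (\<lambda>k. w (d + k))))"
proof -
  obtain e NN where NN: "\<forall>i x y. range x \<subseteq> C \<longrightarrow> num x m a \<noteq> 0 \<longrightarrow> num y i (coded_tuple x) * num x m a ^ e = NN i x y"
    "\<forall>i d d' M'. i \<le> m \<longrightarrow> d + M \<le> M' \<longrightarrow> d' + M \<le> M' \<longrightarrow> (\<lambda>w. NN i (\<lambda>k. w (d + k)) (\<lambda>k. w (d' + k))) \<in> poly_fun UNIV M'"
    using composition_poly_fun by (elim exE conjE)
  let ?x = "\<lambda>w k. w (d + k)" and ?y = "\<lambda>w k. w (d' + k)"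
  have 1: "(\<lambda>w. NN i (?x w) (?y w) * p w - q w * NN k (?x w) (?y w)) \<in> poly_fun UNIV M'"
    using NN(2) ik d by (intro poly_fun_diff poly_fun.poly_fun_mult pq) simp_all
  have 2: "(\<lambda>w. num (?x w) m a) \<in> poly_fun UNIV M'" by (rule num_poly_fun[OF le_refl d(1)])
  show ?thesis
  proof (rule defbl_cong[OF defbl_conj[OF defbl_not[OF defbl_poly_fun[OF 2]] defbl_poly_fun[OF 1]]])
    fix w :: "nat \<Rightarrow> 'u" assume "range w \<subseteq> dom CC"
    then have x: "range (?x w) \<subseteq> C" by auto
    have "NN i (?x w) (?y w) * p w - q w * NN k (?x w) (?y w) = 0 \<longleftrightarrow>
       num (?y w) i (coded_tuple (?x w)) * p w = q w * num (?y w) k (coded_tuple (?x w))" if nz: "num (?x w) m a \<noteq> 0"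
    proof -
      let ?t = "num (?x w) m a ^ e"
      have e: "NN l (?x w) (?y w) = num (?y w) l (coded_tuple (?x w)) * ?t" for l using NN(1) x nz by simp
      have "NN i (?x w) (?y w) * p w - q w * NN k (?x w) (?y w) =
         (num (?y w) i (coded_tuple (?x w)) * p w - q w * num (?y w) k (coded_tuple (?x w))) * ?t"
        unfolding e by (simp add: algebra_simps)
      then show ?thesis using nz by simp
    qed
    then show "(num (?x w) m a \<noteq> 0 \<and> NN i (?x w) (?y w) * p w - q w * NN k (?x w) (?y w) = 0) \<longleftrightarrow>
      (num (?x w) m a \<noteq> 0 \<and> num (?y w) i (coded_tuple (?x w)) * p w = q w * num (?y w) k (coded_tuple (?x w)))" by (rule conj_cong[OF refl])
  qed
qed

lemma C_ne: "C \<noteq> {}" using C01 by auto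

lemma defbl_specializes: "defbl ring_lang CC C specializes"
proof -
  define \<G> where "\<G> = {r \<in> poly_fun UNIV M. \<exists>f\<in>dpoly E m. \<exists>e. f a = 0 \<and>
    (\<forall>x. range x \<subseteq> C \<longrightarrow> num x m a \<noteq> 0 \<longrightarrow> f (coded_tuple x) * num x m a ^ e = r x)}"
  have "\<G> \<subseteq> poly_fun UNIV M" by (simp add: \<G>_def)
  note G = defbl_poly_fun_family[OF this]
  have den: "(\<lambda>x. num x m a) \<in> poly_fun UNIV M" using num_poly_fun[of m 0 M a] by simp
  show ?thesis
  proof (rule defbl_cong[OF defbl_conj[OF defbl_not[OF defbl_poly_fun[OF den]] G]])
    fix x :: "nat \<Rightarrow> 'u" assume "range x \<subseteq> dom CC"
    then have x: "range x \<subseteq> C" by simp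
    show "(num x m a \<noteq> 0 \<and> (\<forall>g\<in>\<G>. g x = 0)) = specializes x"
    proof
      assume A: "num x m a \<noteq> 0 \<and> (\<forall>g\<in>\<G>. g x = 0)"
      have "f (coded_tuple x) = 0" if f: "f \<in> dpoly E m" "f a = 0" for f
      proof -
        obtain e r where r: "r \<in> poly_fun UNIV M" "\<forall>x. range x \<subseteq> C \<longrightarrow> num x m a \<noteq> 0 \<longrightarrow> f (coded_tuple x) * num x m a ^ e = r x"
          using poly_fun_substitution[OF f(1)] by (elim exE bexE)
        have "r \<in> \<G>" unfolding \<G>_def by (intro CollectI conjI r(1) bexI[OF _ f(1)] exI[of _ e] f(2) r(2))
        then have "r x = 0" using A by blast
        then show ?thesis using r(2)[rule_format, OF x conjunct1[OF A]] A by simp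
      qed
      then show "specializes x" unfolding specializes_def using A by simp
    next
      assume specializes: "specializes x"
      have "g x = 0" if g: "g \<in> \<G>" for g
      proof -
        obtain f e where f: "f \<in> dpoly E m" "f a = 0" "\<forall>x. range x \<subseteq> C \<longrightarrow> num x m a \<noteq> 0 \<longrightarrow> f (coded_tuple x) * num x m a ^ e = g x"
          using g unfolding \<G>_def by (elim CollectE bexE exE conjE)
        have "f (coded_tuple x) = 0" "num x m a \<noteq> 0" using specializes f(1,2) unfolding specializes_def by simp_all
        then show ?thesis using f(3)[rule_format, OF x] by simp
      qed
      then show "num x m a \<noteq> 0 \<and> (\<forall>g\<in>\<G>. g x = 0)" using specializes by (simp add: specializes_def)
    qed
  qed
qed

lemma defbl_shift: "defbl ring_lang CC C P \<Longrightarrow> defbl ring_lang CC C (\<lambda>w. P (\<lambda>k. w (d + k)))"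
  by (erule defbl_reindex) (simp add: inj_def)

text \<open>The quantified code is stored in the coordinates from \<open>M\<close> to
  \<open>M + M - 1\<close> of the same assignment; by \<open>cong\<close> the first argument of
  \<open>P\<close> does not see what is written there.\<close>

lemma defbl_ex_code:
  assumes P: "defbl ring_lang CC C (\<lambda>w. P w (\<lambda>k. w (M + k)))"
    and cong: "\<forall>x x' y y'. (\<forall>i<M. x i = x' i) \<longrightarrow> (\<forall>i<M. y i = y' i) \<longrightarrow> P x y \<longrightarrow> P x' y'"
  shows "defbl ring_lang CC C (\<lambda>x. \<exists>y. range y \<subseteq> C \<and> P x y)"
proof (rule defbl_cong[OF defbl_exblock[OF P, of "{M..<M + M}"]])
  show "finite {M..<M + M}" by simp
  fix x :: "nat \<Rightarrow> 'u" assume "range x \<subseteq> dom CC"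
  then have x: "x i \<in> C" for i by auto
  show "(\<exists>w. range w \<subseteq> dom CC \<and> (\<forall>i. i \<notin> {M..<M + M} \<longrightarrow> w i = x i) \<and> P w (\<lambda>k. w (M + k))) = (\<exists>y. range y \<subseteq> C \<and> P x y)"
  proof
    assume "\<exists>w. range w \<subseteq> dom CC \<and> (\<forall>i. i \<notin> {M..<M + M} \<longrightarrow> w i = x i) \<and> P w (\<lambda>k. w (M + k))"
    then obtain w where w: "range w \<subseteq> dom CC" "\<forall>i. i \<notin> {M..<M + M} \<longrightarrow> w i = x i" "P w (\<lambda>k. w (M + k))" by (elim exE conjE)
    have "\<forall>i<M. w i = x i" using w(2) by simp
    then have "P x (\<lambda>k. w (M + k))" using cong[rule_format, of w x "\<lambda>k. w (M + k)" "\<lambda>k. w (M + k)"] w(3) by simp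
    moreover have "range (\<lambda>k. w (M + k)) \<subseteq> C" using w(1) by auto
    ultimately show "\<exists>y. range y \<subseteq> C \<and> P x y" by (intro exI[of _ "\<lambda>k. w (M + k)"] conjI)
  next
    assume "\<exists>y. range y \<subseteq> C \<and> P x y"
    then obtain y where y: "range y \<subseteq> C" "P x y" by (elim exE conjE)
    define w where "w i = (if i \<in> {M..<M + M} then y (i - M) else x i)" for i
    have "\<forall>i<M. x i = w i" "\<forall>i<M. y i = w (M + i)" by (simp_all add: w_def)
    then have "P w (\<lambda>k. w (M + k))" using cong[rule_format, of x w y "\<lambda>k. w (M + k)"] y(2) by simp
    moreover have "w i \<in> C" for i using x y(1) unfolding w_def by auto
    then have "range w \<subseteq> dom CC" by auto
    moreover have "\<forall>i. i \<notin> {M..<M + M} \<longrightarrow> w i = x i" by (simp add: w_def)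
    ultimately show "\<exists>w. range w \<subseteq> dom CC \<and> (\<forall>i. i \<notin> {M..<M + M} \<longrightarrow> w i = x i) \<and> P w (\<lambda>k. w (M + k))"
      by (intro exI[of _ w] conjI)
  qed
qed

lemma defbl_is_code: "defbl ring_lang CC C is_code"
proof -
  have "defbl ring_lang CC C (\<lambda>w. inverse_codes w (\<lambda>k. w (M + k)))"
  proof (rule defbl_cong)
    have k: "(\<lambda>_. u) \<in> poly_fun UNIV (M + M)" for u :: 'u by (simp add: poly_fun.poly_fun_const)
    let ?y = "\<lambda>w k. w (M + k)"
    note 1 = defbl_composition[where d = 0 and d' = M and M' = "M + M" and p = "\<lambda>_. 1" and k = m, OF _ le_refl _ _ k, simplified]
      and 2 = defbl_composition[where d = M and d' = 0 and M' = "M + M" and p = "\<lambda>_. 1" and k = m, OF _ le_refl _ _ k, simplified]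
    \<comment> \<open>The factor \<open>0 *\<close> brings nonvanishing into the shape of
      \<open>defbl_composition\<close>, with \<open>q = 0\<close> and \<open>p = 1\<close>.\<close>
    show "defbl ring_lang CC C (\<lambda>w. specializes w \<and> specializes (?y w) \<and>
        \<not> (num w m a \<noteq> 0 \<and> num (?y w) m (coded_tuple w) = 0 * num (?y w) m (coded_tuple w)) \<and>
        \<not> (num (?y w) m a \<noteq> 0 \<and> num w m (coded_tuple (?y w)) = 0 * num w m (coded_tuple (?y w))) \<and>
        (\<forall>i\<in>{..<m}. num w m a \<noteq> 0 \<and> num (?y w) i (coded_tuple w) = a i * num (?y w) m (coded_tuple w)) \<and>
        (\<forall>i\<in>{..<m}. num (?y w) m a \<noteq> 0 \<and> num w i (coded_tuple (?y w)) = a i * num w m (coded_tuple (?y w))))"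
      by (intro defbl_conj defbl_not defbl_ball C_ne finite_lessThan defbl_specializes defbl_shift[OF defbl_specializes] 1 2 k) simp_all
    fix w :: "nat \<Rightarrow> 'u"
    have "specializes x \<Longrightarrow> num x m a \<noteq> 0" for x by (simp add: specializes_def)
    then show "(specializes w \<and> specializes (?y w) \<and>
        \<not> (num w m a \<noteq> 0 \<and> num (?y w) m (coded_tuple w) = 0 * num (?y w) m (coded_tuple w)) \<and>
        \<not> (num (?y w) m a \<noteq> 0 \<and> num w m (coded_tuple (?y w)) = 0 * num w m (coded_tuple (?y w))) \<and>
        (\<forall>i\<in>{..<m}. num w m a \<noteq> 0 \<and> num (?y w) i (coded_tuple w) = a i * num (?y w) m (coded_tuple w)) \<and>
        (\<forall>i\<in>{..<m}. num (?y w) m a \<noteq> 0 \<and> num w i (coded_tuple (?y w)) = a i * num w m (coded_tuple (?y w)))) = inverse_codes w (?y w)"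
      unfolding inverse_codes_def by auto
  qed
  then show ?thesis unfolding is_code_def[abs_def] by (rule defbl_ex_code) (use inverse_codes_cong in blast)
qed

lemma defbl_same: "defbl ring_lang CC C (\<lambda>w. same w (\<lambda>k. w (M + k)))"
proof -
  have "defbl ring_lang CC C (\<lambda>w. num (\<lambda>k. w (M + k)) m a \<noteq> 0 \<and>
    (\<forall>i\<in>{..<m}. num w i a * num (\<lambda>k. w (M + k)) m a - num (\<lambda>k. w (M + k)) i a * num w m a = 0))"
    using num_poly_fun[of _ 0 "M + M" a] num_poly_fun[of _ M "M + M" a]
    by (intro defbl_conj defbl_not defbl_ball C_ne finite_lessThan defbl_poly_fun[of _ "M + M"] poly_fun_diff poly_fun.poly_fun_mult) simp_all
  then show ?thesis by (rule defbl_cong) (auto simp: same_def)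
qed

lemma defbl_canonical: "defbl ring_lang CC C canonical"
proof -
  have var: "defbl ring_lang CC C (\<lambda>w. w i = u)" if "u \<in> C" for i u
    by (rule defbl_eq[OF tfun_var[OF C_ne] tfun_const[OF that]])
  have ex: "defbl ring_lang CC C (\<lambda>x. \<exists>y. range y \<subseteq> C \<and> (same x y \<and> (\<forall>i\<in>{..<Suc l}. y i = 0)))" if "l < M" for l
  proof (rule defbl_ex_code)
    show "defbl ring_lang CC C (\<lambda>w. same w (\<lambda>k. w (M + k)) \<and> (\<forall>i\<in>{..<Suc l}. w (M + i) = 0))"
      by (intro defbl_conj defbl_same defbl_ball C_ne finite_lessThan var C01)
    show "\<forall>x x' y y'. (\<forall>i<M. x i = x' i) \<longrightarrow> (\<forall>i<M. y i = y' i) \<longrightarrow>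
       same x y \<and> (\<forall>i\<in>{..<Suc l}. y i = 0) \<longrightarrow> same x' y' \<and> (\<forall>i\<in>{..<Suc l}. y' i = 0)"
    proof (intro allI impI conjI ballI; elim conjE)
      fix x x' y y' :: "nat \<Rightarrow> 'u" assume c: "\<forall>i<M. x i = x' i" "\<forall>i<M. y i = y' i" and s: "same x y" "\<forall>i\<in>{..<Suc l}. y i = 0"
      show "same x' y'" using same_cong[OF c] s(1) by simp
      fix i assume "i \<in> {..<Suc l}"
      then show "y' i = 0" using c(2) s(2) that by auto
    qed
  qed
  have "defbl ring_lang CC C (\<lambda>x. is_code x \<and> (\<exists>l\<in>{..<M}. (\<forall>i\<in>{..<l}. x i = 0) \<and> x l = 1 \<and>
     \<not> (\<exists>y. range y \<subseteq> C \<and> (same x y \<and> (\<forall>i\<in>{..<Suc l}. y i = 0)))))"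
    by (intro defbl_conj defbl_is_code defbl_bex defbl_ball defbl_not ex C_ne finite_lessThan var C01) simp
  then show ?thesis by (rule defbl_cong) (simp add: canonical_def lessThan_def)
qed

text \<open>Since automorphisms fix the constants, \<open>\<sigma>(\<tau>(a i))\<close> is computed
  by evaluating the code \<open>y\<close> of \<open>\<tau>\<close> at the tuple coded by
  \<open>x\<close>; the result is compared with the tuple of \<open>z\<close> by cross
  multiplication.\<close>

definition product_rel where "product_rel x y z \<longleftrightarrow> (\<forall>i<m. num y i (coded_tuple x) * num z m a = num z i a * num y m (coded_tuple x))"

lemma product_rel_cong: "\<forall>k<M. x k = x' k \<Longrightarrow> \<forall>k<M. y k = y' k \<Longrightarrow> \<forall>k<M. z k = z' k \<Longrightarrow> product_rel x y z = product_rel x' y' z'"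
  unfolding product_rel_def using num_cong[of y y'] num_cong[of z z'] coded_tuple_cong[of x x'] by simp

lemma product_rel_iff:
  assumes s: "\<sigma> \<in> GG" "coding \<sigma> x" and t: "\<tau> \<in> GG" "coding \<tau> y" "range y \<subseteq> C" and r: "\<rho> \<in> GG" "coding \<rho> z"
  shows "product_rel x y z \<longleftrightarrow> \<sigma> \<otimes>\<^bsub>Gal \<delta> L K\<^esub> \<tau> = \<rho>"
proof -
  interpret group "Gal \<delta> L K" by (rule GG_group)
  note st = coding_compose[OF s t]
  have z: "num z m a \<noteq> 0" "i < m \<Longrightarrow> num z i a = \<rho> (a i) * num z m a" for i using r(2) by (simp_all add: coding_def)
  have "product_rel x y z \<longleftrightarrow> (\<forall>i<m. \<sigma> (\<tau> (a i)) = \<rho> (a i))"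
    unfolding product_rel_def
  proof (intro all_cong)
    fix i assume i: "i < m"
    show "num y i (coded_tuple x) * num z m a = num z i a * num y m (coded_tuple x) \<longleftrightarrow> \<sigma> (\<tau> (a i)) = \<rho> (a i)"
      unfolding st(2)[OF i] z(2)[OF i] mult.assoc mult.commute[of "num y m (coded_tuple x)"] using st(1) z(1) by simp
  qed
  also have "\<dots> \<longleftrightarrow> (\<forall>i<m. (\<sigma> \<otimes>\<^bsub>Gal \<delta> L K\<^esub> \<tau>) (a i) = \<rho> (a i))"
    using aF by (simp add: GG_mult compose_eq)
  also have "\<dots> \<longleftrightarrow> \<sigma> \<otimes>\<^bsub>Gal \<delta> L K\<^esub> \<tau> = \<rho>" using GG_eqI[OF m_closed[OF s(1) t(1)] r(1)] by blast
  finally show ?thesis .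
qed

section \<open>The group of canonical codes\<close>

definition seq_of where "seq_of xs = (\<lambda>i. if i < M then xs ! i else 0)"
definition codes where "codes = {xs. length xs = M \<and> set xs \<subseteq> C \<and> canonical (seq_of xs)}"
definition code where "code \<sigma> = (SOME xs. xs \<in> codes \<and> coding \<sigma> (seq_of xs))"

lemma seq_of_C: "length xs = M \<Longrightarrow> set xs \<subseteq> C \<Longrightarrow> range (seq_of xs) \<subseteq> C"
  using C01(1) by (auto simp: seq_of_def subset_iff)

lemma code:
  assumes "\<sigma> \<in> GG" shows "code \<sigma> \<in> codes" "coding \<sigma> (seq_of (code \<sigma>))"
proof -
  obtain x where x: "range x \<subseteq> C" "coding \<sigma> x" "canonical x" using canonical_exists[OF assms] by (elim exE conjE)
  define xs where "xs = map x [0..<M]"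
  have e: "\<forall>k<M. x k = seq_of xs k" by (simp add: seq_of_def xs_def)
  have "xs \<in> codes \<and> coding \<sigma> (seq_of xs)"
    using x coding_cong[OF e] canonical_cong[OF e] by (auto simp: codes_def xs_def)
  then have "code \<sigma> \<in> codes \<and> coding \<sigma> (seq_of (code \<sigma>))" unfolding code_def by (rule someI)
  then show "code \<sigma> \<in> codes" "coding \<sigma> (seq_of (code \<sigma>))" by simp_all
qed

lemma codes_unique:
  assumes "xs \<in> codes" "ys \<in> codes" "coding \<sigma> (seq_of xs)" "coding \<sigma> (seq_of ys)" shows "xs = ys"
proof (rule nth_equalityI)
  show "length xs = length ys" using assms(1,2) by (simp add: codes_def)
  fix i assume "i < length xs"
  then have i: "i < M" using assms(1) by (simp add: codes_def)
  have "seq_of xs i = seq_of ys i"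
    using canonical_unique[of "seq_of xs" \<sigma> "seq_of ys"] assms i seq_of_C[of xs] seq_of_C[of ys] by (simp add: codes_def)
  then show "xs ! i = ys ! i" using i by (simp add: seq_of_def)
qed

lemma code_bij: "bij_betw code GG codes"
  unfolding bij_betw_def
proof
  show "inj_on code GG"
  proof (rule inj_onI)
    fix \<sigma> \<tau> assume st: "\<sigma> \<in> GG" "\<tau> \<in> GG" "code \<sigma> = code \<tau>"
    show "\<sigma> = \<tau>"
      using coding_coded_tuple[OF code(2)[OF st(1)]] coding_coded_tuple[OF code(2)[OF st(2)]] st(3) by (intro GG_eqI st(1,2)) simp
  qed
  show "code ` GG = codes"
  proof
    show "code ` GG \<subseteq> codes" using code(1) by blast
    show "codes \<subseteq> code ` GG"
    proof
      fix xs assume xs: "xs \<in> codes"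
      then have "is_code (seq_of xs)" "range (seq_of xs) \<subseteq> C" using seq_of_C[of xs] by (simp_all add: codes_def canonical_def)
      then obtain \<sigma> where s: "\<sigma> \<in> GG" "coding \<sigma> (seq_of xs)" using is_code_coding[of "seq_of xs"] by blast
      have "xs = code \<sigma>" by (rule codes_unique[OF xs code(1)[OF s(1)] s(2) code(2)[OF s(1)]])
      then show "xs \<in> code ` GG" using s(1) by blast
    qed
  qed
qed

text \<open>The multiplication is transported from the Galois group along the bijection
  \<open>code\<close>, so the group axioms need no computation with codes; only the definability of
  the graph does.\<close>

definition G where "G = \<lparr>carrier = codes,
  monoid.mult = (\<lambda>xs ys. code (inv_into GG code xs \<otimes>\<^bsub>Gal \<delta> L K\<^esub> inv_into GG code ys)),
  one = code \<one>\<^bsub>Gal \<delta> L K\<^esub>\<rparr>"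

lemma code_iso: "code \<in> iso (Gal \<delta> L K) G"
proof (rule isoI)
  interpret group "Gal \<delta> L K" by (rule GG_group)
  have inv: "inv_into GG code (code \<sigma>) = \<sigma>" if "\<sigma> \<in> GG" for \<sigma>
    using code_bij that unfolding bij_betw_def by (simp add: inv_into_f_f)
  show "code \<in> hom (Gal \<delta> L K) G" by (rule homI) (simp_all add: G_def code(1) inv)
  show "bij_betw code GG (carrier G)" using code_bij by (simp add: G_def)
qed

lemma group_G: "group G"
proof -
  interpret group "Gal \<delta> L K" by (rule GG_group)
  from iso_imp_img_group[OF code_iso] show ?thesis by (simp add: G_def)
qed

lemma defbl_product_rel:
  "defbl ring_lang CC C (\<lambda>w. num w m a \<noteq> 0 \<and> product_rel w (\<lambda>k. w (M + k)) (\<lambda>k. w (2 * M + k)))"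
proof -
  let ?y = "\<lambda>w k. w (M + k)" and ?z = "\<lambda>w k. w (2 * M + k)"
  have 0: "(\<lambda>w. num w m a) \<in> poly_fun UNIV (3 * M)" using num_poly_fun[of m 0 "3 * M" a] by simp
  have z: "(\<lambda>w. num (?z w) i a) \<in> poly_fun UNIV (3 * M)" if "i \<le> m" for i by (rule num_poly_fun[OF that]) simp
  have "defbl ring_lang CC C (\<lambda>w. num w m a \<noteq> 0 \<and>
    (\<forall>i\<in>{..<m}. num w m a \<noteq> 0 \<and> num (?y w) i (coded_tuple w) * num (?z w) m a = num (?z w) i a * num (?y w) m (coded_tuple w)))"
    by (rule defbl_conj[OF defbl_not[OF defbl_poly_fun[OF 0]] defbl_ball[OF C_ne finite_lessThan]])
      (rule defbl_composition[where d = 0 and d' = M and M' = "3 * M" and k = m and p = "\<lambda>w. num (?z w) m a", OF _ le_refl _ _ z[OF le_refl], simplified],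
        simp, rule z, simp)
  then show ?thesis by (rule defbl_cong) (auto simp: product_rel_def)
qed

lemma definable_G: "definable_group ring_lang CC M G"
  unfolding definable_group_def
proof (intro conjI group_G)
  have def1: "defbl ring_lang CC (dom CC) canonical" using defbl_canonical by simp
  show "definable_set ring_lang CC M (carrier G)"
    using defbl_definable_set[OF def1, of 0 M] C01(1) by (simp add: G_def codes_def seq_of_def)
  \<comment> \<open>The condition \<open>num w m a \<noteq> 0\<close> is carried along because
    \<open>product_rel\<close> is shown to be definable in conjunction with it.\<close>
  define Q where "Q w \<longleftrightarrow> canonical w \<and> canonical (\<lambda>k. w (M + k)) \<and> canonical (\<lambda>k. w (2 * M + k)) \<and>
    num w m a \<noteq> 0 \<and> product_rel w (\<lambda>k. w (M + k)) (\<lambda>k. w (2 * M + k))" for w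
  have "defbl ring_lang CC (dom CC) Q" unfolding Q_def[abs_def]
    using defbl_conj[OF defbl_canonical defbl_conj[OF defbl_shift[OF defbl_canonical] defbl_conj[OF defbl_shift[OF defbl_canonical] defbl_product_rel]]] by simp
  note def2 = defbl_definable_set[OF this, of 0 "3 * M", simplified, OF C01(1)]
  have Q_iff: "Q (\<lambda>i. if i < 3 * M then (xs @ ys @ zs) ! i else 0) \<longleftrightarrow> xs \<in> codes \<and> ys \<in> codes \<and> zs = xs \<otimes>\<^bsub>G\<^esub> ys"
    if l: "length xs = M" "length ys = M" "length zs = M" and c: "set xs \<subseteq> C" "set ys \<subseteq> C" "set zs \<subseteq> C" for xs ys zs
  proof -
    interpret Gal: group "Gal \<delta> L K" by (rule GG_group)
    let ?w = "\<lambda>i. if i < 3 * M then (xs @ ys @ zs) ! i else 0"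
    have e: "\<forall>k<M. ?w k = seq_of xs k" "\<forall>k<M. ?w (M + k) = seq_of ys k" "\<forall>k<M. ?w (2 * M + k) = seq_of zs k"
      using l by (simp_all add: seq_of_def nth_append)
    have "Q ?w \<longleftrightarrow> canonical (seq_of xs) \<and> canonical (seq_of ys) \<and> canonical (seq_of zs) \<and> num (seq_of xs) m a \<noteq> 0 \<and> product_rel (seq_of xs) (seq_of ys) (seq_of zs)"
      unfolding Q_def canonical_cong[OF e(1)] canonical_cong[OF e(2)] canonical_cong[OF e(3)] num_cong[OF e(1) le_refl] product_rel_cong[OF e] ..
    also have "\<dots> \<longleftrightarrow> xs \<in> codes \<and> ys \<in> codes \<and> zs \<in> codes \<and> num (seq_of xs) m a \<noteq> 0 \<and> product_rel (seq_of xs) (seq_of ys) (seq_of zs)"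
      using l c by (simp add: codes_def)
    also have "\<dots> \<longleftrightarrow> xs \<in> codes \<and> ys \<in> codes \<and> zs = xs \<otimes>\<^bsub>G\<^esub> ys"
    proof (cases "xs \<in> codes \<and> ys \<in> codes")
      case True
      then obtain \<sigma> \<tau> where st: "\<sigma> \<in> GG" "xs = code \<sigma>" "\<tau> \<in> GG" "ys = code \<tau>"
        using code_bij unfolding bij_betw_def by blast
      have m: "xs \<otimes>\<^bsub>G\<^esub> ys = code (\<sigma> \<otimes>\<^bsub>Gal \<delta> L K\<^esub> \<tau>)"
        using code_iso st unfolding iso_def hom_def by simp
      have nz: "num (seq_of xs) m a \<noteq> 0" using code(2)[OF st(1)] st(2) by (simp add: coding_def)
      have "zs \<in> codes \<and> product_rel (seq_of xs) (seq_of ys) (seq_of zs) \<longleftrightarrow> zs = code (\<sigma> \<otimes>\<^bsub>Gal \<delta> L K\<^esub> \<tau>)"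
      proof
        assume A: "zs \<in> codes \<and> product_rel (seq_of xs) (seq_of ys) (seq_of zs)"
        then obtain \<rho> where r: "\<rho> \<in> GG" "zs = code \<rho>" using code_bij unfolding bij_betw_def by blast
        have "\<sigma> \<otimes>\<^bsub>Gal \<delta> L K\<^esub> \<tau> = \<rho>"
          using product_rel_iff[OF st(1) code(2)[OF st(1)] st(3) code(2)[OF st(3)] _ r(1) code(2)[OF r(1)]] A seq_of_C[OF l(2) c(2)] st r by simp
        then show "zs = code (\<sigma> \<otimes>\<^bsub>Gal \<delta> L K\<^esub> \<tau>)" using r(2) by simp
      next
        assume A: "zs = code (\<sigma> \<otimes>\<^bsub>Gal \<delta> L K\<^esub> \<tau>)"
        have r: "\<sigma> \<otimes>\<^bsub>Gal \<delta> L K\<^esub> \<tau> \<in> GG" using st by simp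
        show "zs \<in> codes \<and> product_rel (seq_of xs) (seq_of ys) (seq_of zs)"
          using product_rel_iff[OF st(1) code(2)[OF st(1)] st(3) code(2)[OF st(3)] _ r code(2)[OF r]] A code(1)[OF r] seq_of_C[OF l(2) c(2)] st by simp
      qed
      then show ?thesis using True nz m by simp
    qed auto
    finally show ?thesis .
  qed
  have "{xs @ ys @ (xs \<otimes>\<^bsub>G\<^esub> ys) | xs ys. xs \<in> carrier G \<and> ys \<in> carrier G} =
    {ws. length ws = 3 * M \<and> set ws \<subseteq> C \<and> Q (\<lambda>i. if i < 3 * M then ws ! i else 0)}" (is "?l = ?r")
  proof (rule subset_antisym; rule subsetI)
    interpret G: group G by (rule group_G)
    fix ws assume "ws \<in> ?l"
    then obtain xs ys where ws: "ws = xs @ ys @ (xs \<otimes>\<^bsub>G\<^esub> ys)" "xs \<in> carrier G" "ys \<in> carrier G" by (elim CollectE exE conjE)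
    have codes: "xs \<in> codes" "ys \<in> codes" "xs \<otimes>\<^bsub>G\<^esub> ys \<in> codes" using ws(2,3) G.m_closed[OF ws(2,3)] by (simp_all add: G_def)
    then have "length xs = M" "length ys = M" "length (xs \<otimes>\<^bsub>G\<^esub> ys) = M" "set xs \<subseteq> C" "set ys \<subseteq> C" "set (xs \<otimes>\<^bsub>G\<^esub> ys) \<subseteq> C"
      by (simp_all add: codes_def)
    then show "ws \<in> ?r" unfolding ws(1) using Q_iff[of xs ys "xs \<otimes>\<^bsub>G\<^esub> ys"] codes by simp
  next
    fix ws assume "ws \<in> ?r"
    then have ws: "length ws = 3 * M" "set ws \<subseteq> C" "Q (\<lambda>i. if i < 3 * M then ws ! i else 0)" by simp_all
    define xs where "xs = take M ws"
    define ys where "ys = take M (drop M ws)"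
    define zs where "zs = drop M (drop M ws)"
    have e: "ws = xs @ ys @ zs" by (simp add: xs_def ys_def zs_def del: drop_drop)
    have l: "length xs = M" "length ys = M" "length zs = M" using ws(1) by (simp_all add: xs_def ys_def zs_def)
    have c: "set xs \<subseteq> C" "set ys \<subseteq> C" "set zs \<subseteq> C" using ws(2) unfolding e by simp_all
    have "xs \<in> codes \<and> ys \<in> codes \<and> zs = xs \<otimes>\<^bsub>G\<^esub> ys" using Q_iff[OF l c] ws(3) unfolding e by blast
    then show "ws \<in> ?l" unfolding e by (simp add: G_def) blast
  qed
  then show "definable_set ring_lang CC (3 * M) {xs @ ys @ (xs \<otimes>\<^bsub>G\<^esub> ys) | xs ys. xs \<in> carrier G \<and> ys \<in> carrier G}"
    using def2 by simp
qed

end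

theorem mainTheorem2:
  fixes \<delta> :: "'u::linordered_field \<Rightarrow> 'u"
    and CODF :: "(fsym, rsym) form set"
    and K L :: "'u set"
  assumes "derivation \<delta>"
    and "model_completion TYPE('u) ord_diff_ring_lang CODF ODF"
    and "is_model ord_diff_ring_lang (ord_diff_field_struct \<delta> UNIV) CODF"
    and "saturated ord_diff_ring_lang (ord_diff_field_struct \<delta> UNIV)"
    and "diff_subfield \<delta> K" and "formally_real K" and "K \<prec> (UNIV :: 'u set)"
    and "diff_subfield \<delta> L" and "K \<subseteq> L"
    and "strongly_normal \<delta> (of_base ` K) (of_base ` L)"
  shows "\<exists>n (G :: 'u list monoid).
    definable_group ring_lang (ord_diff_field_struct \<delta> (constants \<delta> UNIV)) n G \<and>
    Gal \<delta> L K \<cong> G"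
proof -
  interpret sn_ext \<delta> CODF K L using assms by unfold_locales
  obtain m a where "L = dgen K m a" using L_generated by (elim exE)
  from coded_exists[OF this] obtain N n where "coded \<delta> CODF K L m a N n" by (elim exE)
  then interpret coded \<delta> CODF K L m a N n .
  show ?thesis using definable_G is_isoI[OF code_iso] unfolding C_def by (intro exI[of _ M] exI[of _ G] conjI)
qed

end
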